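(* Let $\Omega=\{x\in\mathbb{R}^2: 1/2<|x|<1\}$, let $x_0\in\mathbb{R}^2$ with $|x_0|=1/2$ (so $x_0\in\partial\Omega$), let $\beta\in(-1/2,+\infty)$, and let $a,b,c,d$ be positive real numbers. Then there exist constants $C=C(a,b,c,d,\beta,x_0,\Omega)$ and $C'=C'(a,b,c,d,\beta,x_0,\Omega)$, depending only on the indicated quantities, such that the following holds. Let $V,W:\Omega\to\mathbb{R}$ be Lipschitz functions with $$0<a\le V\le b,\qquad \|\nabla V\|_{L^\infty(\Omega)}\le A=\frac{(\beta+1)a}{2},$$ $$0<c\le W\le d,\qquad \|\nabla W\|_{L^\infty(\Omega)}\le B=\frac{(\beta+1)c}{2}.$$ Let $u,v\in W_0^{1,1}(\Omega)$ be such that $|x-x_0|^{2\beta}e^u\in L^1(\Omega)$, $|x-x_0|^{2\beta}e^v\in L^1(\Omega)$, and $(u,v)$ is a solution, in the sense of distributions, of $$-\Delta u=|x-x_0|^{2\beta}\,V e^{v}\ \text{ in }\Omega,\qquad -\Delta v=|x-x_0|^{2\beta}\,W e^{u}\ \text{ in }\Omega,\qquad u=v=0\ \text{ on }\partial\Omega.$$ Then $$\int_\Omega |x-x_0|^{2\beta}e^u\,dx\le C\qquad\text{and}\qquad \int_\Omega |x-x_0|^{2\beta}e^v\,dx\le C'.$$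
   Context: $\Delta=\partial_{11}+\partial_{22}$ is the Laplacian on $\mathbb{R}^2$, with $\Omega$ the open annulus of radii $1$ and $1/2$ centered at the origin. The functions $u,v$ are real-valued. The equations are understood in the sense of distributions on $\Omega$ (the right-hand sides are in $L^1(\Omega)$), and the Dirichlet boundary condition is encoded by $u,v\in W_0^{1,1}(\Omega)$. *)

theory Defs
  imports "HOL-Analysis.Analysis" "HOL-Probability.Essential_Supremum"
begin

definition partial_deriv ::
    "'a::euclidean_space \<Rightarrow> ('a \<Rightarrow> real) \<Rightarrow> 'a \<Rightarrow> real" where
  "partial_deriv b f x = frechet_derivative f (at x) b"

definition grad :: "('a::euclidean_space \<Rightarrow> real) \<Rightarrow> 'a \<Rightarrow> 'a" where
  "grad f x = (\<Sum>b\<in>Basis. partial_deriv b f x *\<^sub>R b)"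

definition laplacian :: "('a::euclidean_space \<Rightarrow> real) \<Rightarrow> 'a \<Rightarrow> real" where
  "laplacian f x = (\<Sum>b\<in>Basis. partial_deriv b (partial_deriv b f) x)"

text \<open>A function is \<open>C\<^sup>\<infinity>\<close> iff all its iterated partial derivatives, of every order, exist and
  are everywhere (Frechet) differentiable; \<open>foldr\<close> forms the iterated partial derivative along
  the list of basis directions \<open>bs\<close>.\<close>

definition smooth :: "('a::euclidean_space \<Rightarrow> real) \<Rightarrow> bool" where
  "smooth f \<longleftrightarrow> (\<forall>bs x. set bs \<subseteq> Basis \<longrightarrow> foldr partial_deriv bs f differentiable (at x))"

text \<open>Elements of \<open>C\<^sub>c\<^sup>\<infinity>(S)\<close>, regarded as functions on the whole space by extension by zero.\<close>

definition test_function :: "'a::euclidean_space set \<Rightarrow> ('a \<Rightarrow> real) \<Rightarrow> bool" where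
  "test_function S \<phi> \<longleftrightarrow>
     smooth \<phi> \<and> compact (closure {x. \<phi> x \<noteq> 0}) \<and> closure {x. \<phi> x \<noteq> 0} \<subseteq> S"

definition loc_integrable ::
    "'a::euclidean_space set \<Rightarrow> ('a \<Rightarrow> 'b::euclidean_space) \<Rightarrow> bool" where
  "loc_integrable S f \<longleftrightarrow> (\<forall>K. compact K \<and> K \<subseteq> S \<longrightarrow> f absolutely_integrable_on K)"

definition has_weak_gradient ::
    "'a::euclidean_space set \<Rightarrow> ('a \<Rightarrow> real) \<Rightarrow> ('a \<Rightarrow> 'a) \<Rightarrow> bool" where
  "has_weak_gradient S f G \<longleftrightarrow> loc_integrable S f \<and> loc_integrable S G \<and>
     (\<forall>\<phi>. test_function S \<phi> \<longrightarrow> (\<forall>b\<in>Basis.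
        (LINT x:S|lebesgue. f x * partial_deriv b \<phi> x) = - (LINT x:S|lebesgue. (G x \<bullet> b) * \<phi> x)))"

text \<open>\<open>W\<^sub>0\<^sup>1\<^sup>,\<^sup>1(S)\<close>: the closure of \<open>C\<^sub>c\<^sup>\<infinity>(S)\<close> in \<open>W\<^sup>1\<^sup>,\<^sup>1(S)\<close>. Elements are represented by functions on
  the whole space, of which only the values almost everywhere on \<open>S\<close> matter.\<close>

definition W11_0 :: "'a::euclidean_space set \<Rightarrow> ('a \<Rightarrow> real) set" where
  "W11_0 S = {f. \<exists>G. has_weak_gradient S f G \<and>
      f absolutely_integrable_on S \<and> G absolutely_integrable_on S \<and>
      (\<forall>\<epsilon>>0. \<exists>\<phi>. test_function S \<phi> \<and>
         (LINT x:S|lebesgue. \<bar>f x - \<phi> x\<bar>) + (LINT x:S|lebesgue. norm (G x - grad \<phi> x)) < \<epsilon>)}"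

definition neg_laplacian_distr ::
    "'a::euclidean_space set \<Rightarrow> ('a \<Rightarrow> real) \<Rightarrow> ('a \<Rightarrow> real) \<Rightarrow> bool" where
  "neg_laplacian_distr S u F \<longleftrightarrow> loc_integrable S u \<and> loc_integrable S F \<and>
     (\<forall>\<phi>. test_function S \<phi> \<longrightarrow>
        - (LINT x:S|lebesgue. u x * laplacian \<phi> x) = (LINT x:S|lebesgue. F x * \<phi> x))"

text \<open>\<open>\<parallel>\<nabla>f\<parallel>\<close> in \<open>L\<^sup>\<infinity>(S)\<close> is at most \<open>A\<close>. For a Lipschitz function the weak gradient exists
  and agrees almost everywhere with the classical one (Rademacher); it is unique up to null sets,
  so the existential quantifier only names it.\<close>

definition grad_Linf_le :: "'a::euclidean_space set \<Rightarrow> ('a \<Rightarrow> real) \<Rightarrow> real \<Rightarrow> bool" where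
  "grad_Linf_le S f A \<longleftrightarrow>
     (\<exists>G. has_weak_gradient S f G \<and> esssup (lebesgue_on S) (\<lambda>x. ereal (norm (G x))) \<le> ereal A)"

definition annulus :: "(real^2) set" where
  "annulus = {x. 1/2 < norm x \<and> norm x < 1}"

end

(* Moving planes are not needed.  Solutions are represented by the explicit parametrix
  G(x,y) = ln (1 + p(x) p(y) / |x-y|^2), where p vanishes on the boundary of the annulus.
  The maximum principle shows u, v >= 0 and bounds |u - v|, and testing the equations with
  a positive superharmonic function that vanishes on the boundary bounds the mass away from
  the boundary.  Near a boundary component, a Pohozaev (virial) identity is applied with the
  radial field X(x) = x - x0 (inner circle) or X(x) = -x (outer circle), cut off to a collar.
  The weight |x-x0|^(2 beta) is homogeneous with respect to x - x0, so that the gradient bounds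
  A and B give the weight term near the inner circle a favourable sign; the interaction term,
  after symmetrisation in x and y, has a positive definite kernel (a geometric series in
  x0/z, respectively z, in complex notation).  The quadratic self-interaction thus has
  a sign, which leaves an inequality bounding the mass in the collar. *)
theory Submission
 imports Defs
begin

section \<open>Smooth test functions\<close>

text \<open>The profile \<open>p\<close> is chosen so that near each boundary circle the parametrix
  is the exact Green function of the unit disc or of the exterior of the inner disc. Its error
  kernel vanishes when both points lie in the same collar, so the singular part of the interaction
  is explicit there. The obstacle is that the virial sum pairs \<open>G\<close> with
  \<open>F\<close>, while positivity is available only for \<open>G\<close> against
  \<open>G\<close>; the bounds on \<open>u - v\<close> and \<open>v - u\<close>, which make
  \<open>F\<close> and \<open>G\<close> comparable, close this gap. Off the cores of the collars the
  symmetrised kernel is bounded below by a multiple of - \<open>collar x * collar y\<close>, a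
  product controlled by the interior estimate. What is left is at most linear in the integral
  \<open>J\<close> whose square has the good sign. Near the outer circle \<open>J\<close> is the
  mass itself. Near the inner circle its density degenerates at \<open>x0\<close>, and the mass is
  read off the weight term: of \<open>2 * (\<beta> + 1)\<close> the gradient bound consumes 3/5 of
  \<open>\<beta> + 1\<close>, and 7/5 remain. Regularity constants such as \<open>Cu\<close> or
  \<open>Cp\<close> serve integrability only and never enter \<open>mass_bound\<close>.\<close>

definition flat_exp :: "nat => real => real" where
 "flat_exp n t = (if t > 0 then exp (- 1 / t) / t ^ n else 0)"

lemma flat_exp_nonneg: "flat_exp n t >= 0"
 by (simp add: flat_exp_def)

text \<open>The single term of index \<open>n + m\<close> of the exponential series at
  \<open>1/t\<close> bounds \<open>exp (1/t)\<close> from below. With \<open>m = 2\<close> this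
  yields the derivative at the origin.\<close>

lemma flat_exp_le_power:
 assumes "t >= 0"
 shows "flat_exp n t <= fact (n + m) * t ^ m"
proof (cases "t > 0")
 case True
 have "(1/t) ^ (n + m) / fact (n + m) <= exp (1/t)"
  using True sum_le_suminf[OF summable_exp_generic, of "{n + m}" "1/t"]
  by (simp add: exp_def divide_inverse mult.commute)
 then have "exp (- 1 / t) / t ^ n <= (fact (n + m) * t ^ (n + m)) / t ^ n"
  using True by (intro divide_right_mono) (auto simp: exp_minus field_simps power_divide)
 with True show ?thesis by (simp add: flat_exp_def power_add)
qed (use assms in \<open>auto simp: flat_exp_def\<close>)

text \<open>The power in the denominator is carried along so that the family is closed under
  differentiation up to linear combinations.\<close>

lemma flat_exp_deriv:
 "(flat_exp n has_real_derivative flat_exp (n + 2) t - real n * flat_exp (n + 1) t) (at t)"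
proof -
 consider "t > 0" | "t < 0" | "t = 0" by linarith
 then show ?thesis
 proof cases
  case 1
  have "((\<lambda>t. exp (- 1 / t) / t ^ n) has_real_derivative
      flat_exp (n + 2) t - real n * flat_exp (n + 1) t) (at t)"
  proof -
   have 1: "((\<lambda>t. exp (- 1 / t)) has_real_derivative exp (- 1 / t) * (1 / t^2)) (at t)"
    using \<open>t > 0\<close> by (auto intro!: derivative_eq_intros simp: power2_eq_square)
   have 2: "((\<lambda>t. inverse t ^ n) has_real_derivative real n * (- (inverse t ^ Suc (Suc 0)) * inverse t ^ (n - Suc 0))) (at t)"
    using \<open>t > 0\<close> by (intro DERIV_power DERIV_inverse) auto
   have "((\<lambda>t. exp (- 1 / t) * inverse t ^ n) has_real_derivative
     exp (- 1 / t) * (1 / t^2) * inverse t ^ n + real n * (- (inverse t ^ Suc (Suc 0)) * inverse t ^ (n - Suc 0)) * exp (- 1 / t)) (at t)"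
    by (rule DERIV_mult[OF 1 2])
   moreover have "exp (- 1 / t) * (1 / t^2) * inverse t ^ n + real n * (- (inverse t ^ Suc (Suc 0)) * inverse t ^ (n - Suc 0)) * exp (- 1 / t)
     = flat_exp (n + 2) t - real n * flat_exp (n + 1) t"
    using \<open>t > 0\<close> by (cases n) (auto simp: flat_exp_def power2_eq_square field_simps)
   ultimately show ?thesis by (simp add: divide_inverse power_inverse)
  qed
  moreover have "\<forall>\<^sub>F s in nhds t. exp (- 1 / s) / s ^ n = flat_exp n s"
   using eventually_nhds_in_open[of "{0<..}" t] 1
   by (auto elim!: eventually_mono simp: flat_exp_def)
  ultimately show ?thesis
   using DERIV_cong_ev[OF refl _ refl] by fast
 next
  case 2
  have "((\<lambda>t. 0) has_real_derivative 0) (at t)" by simp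
  moreover have "\<forall>\<^sub>F s in nhds t. 0 = flat_exp n s"
   using eventually_nhds_in_open[of "{..<0}" t] 2
   by (auto elim!: eventually_mono simp: flat_exp_def)
  ultimately have "(flat_exp n has_real_derivative 0) (at t)"
   using DERIV_cong_ev[OF refl _ refl] by fast
  with 2 show ?thesis by (simp add: flat_exp_def)
 next
  case 3
  have "(\<lambda>h. flat_exp n h / h) \<midarrow>0\<rightarrow> 0"
  proof (rule Lim_null_comparison)
   show "\<forall>\<^sub>F h in at 0. norm (flat_exp n h / h) <= fact (n + 2) * \<bar>h\<bar>"
   proof (intro always_eventually allI)
    fix h :: real
    show "norm (flat_exp n h / h) <= fact (n + 2) * \<bar>h\<bar>"
    proof (cases "h > 0")
     case True
     then show ?thesis
      using flat_exp_le_power[of h n 2] flat_exp_nonneg[of n h]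
      by (simp add: pos_divide_le_eq power2_eq_square mult.assoc)
    next
     case False
     have "0 <= fact (n + 2) * \<bar>h\<bar>" by (intro mult_nonneg_nonneg) auto
     with False show ?thesis by (simp add: flat_exp_def del: fact_Suc)
    qed
   qed
   show "(\<lambda>h::real. fact (n + 2) * \<bar>h\<bar>) \<midarrow>0\<rightarrow> 0"
    by (auto intro!: tendsto_eq_intros)
  qed
  with 3 show ?thesis by (auto simp: DERIV_def flat_exp_def)
 qed
qed

text \<open>An algebra that contains the standard bump and is closed under every partial derivative.
  Since \<open>smooth\<close> quantifies over lists of directions, closure gives smoothness by
  induction on the list, with no formula for higher derivatives.\<close>

inductive_set bump_alg :: "'a::euclidean_space => real => ('a => real) set" for y r where
 const: "(\<lambda>x. c) \<in> bump_alg y r"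
| coord: "(\<lambda>x. (x - y) \<bullet> b) \<in> bump_alg y r"
| flat: "(\<lambda>x. flat_exp n (r - (x - y) \<bullet> (x - y))) \<in> bump_alg y r"
| add: "f \<in> bump_alg y r ==> g \<in> bump_alg y r ==> (\<lambda>x. f x + g x) \<in> bump_alg y r"
| mult: "f \<in> bump_alg y r ==> g \<in> bump_alg y r ==> (\<lambda>x. f x * g x) \<in> bump_alg y r"

lemma partial_deriv_eq:
 assumes "(f has_derivative f') (at x)"
 shows "partial_deriv b f x = f' b"
 unfolding partial_deriv_def using frechet_derivative_at[OF assms] by simp

lemma flat_has_derivative:
 fixes x y :: "'a::euclidean_space"
 shows "((\<lambda>x. flat_exp n (r - (x - y) \<bullet> (x - y))) has_derivative
  (\<lambda>h. (flat_exp (n + 2) (r - (x - y) \<bullet> (x - y)) - real n * flat_exp (n + 1) (r - (x - y) \<bullet> (x - y)))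
     * (- 2 * ((x - y) \<bullet> h)))) (at x)"
proof -
 have 1: "((\<lambda>x. r - (x - y) \<bullet> (x - y)) has_derivative (\<lambda>h. - 2 * ((x - y) \<bullet> h))) (at x)"
  by (auto intro!: derivative_eq_intros simp: inner_commute)
 show ?thesis
  by (rule has_derivative_compose[OF 1 flat_exp_deriv[unfolded has_field_derivative_def]])
qed

lemma bump_alg_deriv:
 assumes "f \<in> bump_alg y r"
 shows "(\<forall>x. f differentiable (at x)) \<and> (\<forall>b. partial_deriv b f \<in> bump_alg y r)"
 using assms
proof induction
 case (const c)
 have "partial_deriv b (\<lambda>x. c) = (\<lambda>x. 0)" for b :: 'a
  by (rule ext, rule partial_deriv_eq, rule has_derivative_const)
 then show ?case by (auto intro: bump_alg.const)
next
 case (coord c)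
 have d: "((\<lambda>x. (x - y) \<bullet> c) has_derivative (\<lambda>h. h \<bullet> c)) (at x)" for x
  by (auto intro!: derivative_eq_intros)
 have "partial_deriv b (\<lambda>x. (x - y) \<bullet> c) = (\<lambda>x. b \<bullet> c)" for b :: 'a
  by (rule ext, rule partial_deriv_eq, rule d)
 then show ?case using d by (auto intro: bump_alg.const simp: differentiable_def)
next
 case (flat n)
 have "partial_deriv b (\<lambda>x. flat_exp n (r - (x - y) \<bullet> (x - y))) =
   (\<lambda>x. (flat_exp (n + 2) (r - (x - y) \<bullet> (x - y)) + (- real n) * flat_exp (n + 1) (r - (x - y) \<bullet> (x - y)))
     * (- 2 * ((x - y) \<bullet> b)))" for b
  by (rule ext) (subst partial_deriv_eq[OF flat_has_derivative], simp)
 moreover have "(\<lambda>x. (flat_exp (n + 2) (r - (x - y) \<bullet> (x - y)) + (- real n) * flat_exp (n + 1) (r - (x - y) \<bullet> (x - y)))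
     * (- 2 * ((x - y) \<bullet> b))) \<in> bump_alg y r" for b
  by (intro bump_alg.intros)
 moreover have "(\<lambda>x. flat_exp n (r - (x - y) \<bullet> (x - y))) differentiable (at x)" for x
  using flat_has_derivative by (rule differentiableI)
 ultimately show ?case by simp
next
 case (add f g)
 have "partial_deriv b (\<lambda>x. f x + g x) = (\<lambda>x. partial_deriv b f x + partial_deriv b g x)" for b
  using add.IH unfolding frechet_derivative_works
  by (intro ext, subst partial_deriv_eq[OF has_derivative_add]) (auto simp: partial_deriv_def)
 moreover have "(\<lambda>x. partial_deriv b f x + partial_deriv b g x) \<in> bump_alg y r" for b
  using add.IH by (intro bump_alg.add) auto
 moreover have "(\<lambda>x. f x + g x) differentiable (at x)" for x
  using add.IH by (intro differentiable_add) auto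
 ultimately show ?case by simp
next
 case (mult f g)
 have "partial_deriv b (\<lambda>x. f x * g x) = (\<lambda>x. f x * partial_deriv b g x + partial_deriv b f x * g x)" for b
 proof
  fix x
  have "(f has_derivative frechet_derivative f (at x)) (at x)" "(g has_derivative frechet_derivative g (at x)) (at x)"
   using mult.IH frechet_derivative_works by blast+
  from partial_deriv_eq[OF has_derivative_mult[OF this]]
  show "partial_deriv b (\<lambda>x. f x * g x) x = f x * partial_deriv b g x + partial_deriv b f x * g x"
   by (simp add: partial_deriv_def)
 qed
 moreover have "(\<lambda>x. f x * partial_deriv b g x + partial_deriv b f x * g x) \<in> bump_alg y r" for b
  using mult.IH mult.hyps by (intro bump_alg.add bump_alg.mult) auto
 moreover have "(\<lambda>x. f x * g x) differentiable (at x)" for x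
  using mult.IH by (intro differentiable_mult) auto
 ultimately show ?case by simp
qed

lemma bump_alg_smooth:
 assumes "f \<in> bump_alg y r"
 shows "smooth f"
proof -
 have "foldr partial_deriv bs f \<in> bump_alg y r" for bs
 proof (induction bs)
  case (Cons b bs)
  from bump_alg_deriv[OF Cons.IH] show ?case by simp
 qed (simp add: assms)
 from bump_alg_deriv[OF this] show ?thesis by (simp add: smooth_def)
qed

definition bump :: "real => 'a::euclidean_space => real" where
 "bump r z = flat_exp 0 (r\<^sup>2 - z \<bullet> z)"

definition bump_grad :: "real => 'a::euclidean_space => 'a" where
 "bump_grad r z = (- 2 * flat_exp 2 (r\<^sup>2 - z \<bullet> z)) *\<^sub>R z"

lemma bump_nonzero_iff:
 assumes "r > 0" shows "bump r z \<noteq> 0 \<longleftrightarrow> norm z < r"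
proof -
 have "norm z < r \<longleftrightarrow> z \<bullet> z < r\<^sup>2"
  using assms power_mono_iff[of r "norm z" 2]
  by (metis norm_ge_zero not_le order_less_imp_le power2_norm_eq_inner zero_less_numeral)
 then show ?thesis by (simp add: bump_def flat_exp_def)
qed

lemma bump_zero:
 assumes "r > 0" "norm z >= r" shows "bump r z = 0" "bump_grad r z = 0"
proof -
 have "r\<^sup>2 <= z \<bullet> z"
  using assms power_mono[of r "norm z" 2] by (simp add: power2_norm_eq_inner)
 then show "bump r z = 0" "bump_grad r z = 0"
  by (simp_all add: bump_def bump_grad_def flat_exp_def)
qed

lemma bump_nonneg: "bump r z >= 0"
 by (simp add: bump_def flat_exp_nonneg)

lemma bump_gderiv: "GDERIV (bump r) z :> bump_grad r z"
 using flat_has_derivative[of 0 "r\<^sup>2" 0 z]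
 by (simp add: gderiv_def bump_def[abs_def] bump_grad_def inner_commute mult_ac numeral_2_eq_2)

lemma continuous_flat_exp: "continuous_on A (flat_exp n)"
 by (rule continuous_at_imp_continuous_on) (auto intro!: DERIV_isCont flat_exp_deriv)

lemma continuous_bump: "continuous_on A (bump r)" "continuous_on A (bump_grad r)"
 unfolding bump_def[abs_def] bump_grad_def[abs_def]
 by (intro continuous_intros continuous_on_compose2[OF continuous_flat_exp[of UNIV]]; simp)+

lemma bump_test_function:
 assumes "r > 0" "cball y r \<subseteq> S"
 shows "test_function S (\<lambda>x. bump r (x - y))"
proof -
 have "(\<lambda>x. bump r (x - y)) \<in> bump_alg y (r\<^sup>2)"
  unfolding bump_def by (rule bump_alg.flat)
 moreover have "{x. bump r (x - y) \<noteq> 0} = ball y r"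
  using assms by (auto simp: bump_nonzero_iff dist_norm norm_minus_commute)
 ultimately show ?thesis
  using assms by (simp add: test_function_def bump_alg_smooth)
qed

lemma gderiv_partial_deriv:
 assumes "GDERIV f x :> D"
 shows "partial_deriv b f x = D \<bullet> b"
 using partial_deriv_eq[of f "\<lambda>h. h \<bullet> D" x b] assms by (simp add: gderiv_def inner_commute)

lemma gderiv_grad:
 assumes "GDERIV f x :> D"
 shows "grad f x = D"
 unfolding grad_def gderiv_partial_deriv[OF assms] by (rule euclidean_representation)

lemma bounded_gderiv_lipschitz:
 fixes \<Phi> :: "'a::real_inner => real"
 assumes "convex S" "\<And>x. x \<in> S ==> GDERIV \<Phi> x :> D x" "\<And>x. x \<in> S ==> norm (D x) <= C" "x \<in> S" "y \<in> S"
 shows "\<bar>\<Phi> x - \<Phi> y\<bar> <= C * norm (x - y)"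
proof -
 have "norm (\<Phi> x - \<Phi> y) <= C * norm (x - y)"
 proof (rule differentiable_bound[OF assms(1)])
  fix x assume x: "x \<in> S"
  show "(\<Phi> has_derivative (\<lambda>h. h \<bullet> D x)) (at x within S)"
   using assms(2)[OF x] has_derivative_at_withinI by (auto simp: gderiv_def)
  show "onorm (\<lambda>h. h \<bullet> D x) <= C"
  proof (rule onorm_bound)
   show "0 <= C" using assms(3)[OF x] norm_ge_zero order_trans by blast
   fix h
   have "\<bar>h \<bullet> D x\<bar> <= norm h * norm (D x)" by (rule Cauchy_Schwarz_ineq2)
   also have "... <= norm h * C" using assms(3)[OF x] by (rule mult_left_mono) simp
   finally show "norm (h \<bullet> D x) <= C * norm h" by (simp add: mult.commute)
  qed
 qed (use assms in auto)
 then show ?thesis by simp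
qed

lemma gderiv_continuous_on:
 assumes "\<And>x. x \<in> S ==> GDERIV \<Phi> x :> D x"
 shows "continuous_on S \<Phi>"
 using assms by (meson continuous_at_imp_continuous_on gderiv_def has_derivative_continuous)

lemma integrable_continuous_bounded_support:
 fixes \<Phi> :: "'a::euclidean_space => real"
 assumes "continuous_on UNIV \<Phi>" "\<And>x. norm x > R ==> \<Phi> x = 0"
 shows "integrable lborel \<Phi>"
proof -
 have "integrable lborel (\<lambda>x. indicator (cball 0 R) x *\<^sub>R \<Phi> x)"
  using assms by (intro borel_integrable_compact) (auto intro: continuous_on_subset)
 moreover have "(\<lambda>x. indicator (cball 0 R) x *\<^sub>R \<Phi> x) = \<Phi>"
  using assms(2) by (force simp: indicator_def)
 ultimately show ?thesis by simp
qed

text \<open>Difference quotients in direction \<open>b\<close> integrate to zero by translation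
  invariance, are bounded through the Lipschitz constant \<open>C\<close>, and converge pointwise to
  the derivative. The same limit gives measurability of the derivative.\<close>

lemma integral_gderiv_zero:
 fixes \<Phi> :: "'a::euclidean_space => real"
 assumes D: "\<And>x. GDERIV \<Phi> x :> D x" and C: "\<And>x. norm (D x) <= C"
  and supp: "\<And>x. norm x > R ==> \<Phi> x = 0"
 shows "integrable lborel (\<lambda>x. D x \<bullet> b)" "(LINT x|lborel. D x \<bullet> b) = 0"
proof -
 define t where "t n = inverse (real (Suc n))" for n
 have t: "t n > 0" "t n <= 1" for n by (auto simp: t_def field_simps)
 have t0: "t \<longlonglongrightarrow> 0" unfolding t_def by (rule LIMSEQ_inverse_real_of_nat)
 define q where "q n x = (\<Phi> (x + t n *\<^sub>R b) - \<Phi> x) / t n" for n x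
 have cont: "continuous_on UNIV \<Phi>" using D by (rule gderiv_continuous_on)
 have int0: "integrable lborel \<Phi>" using integrable_continuous_bounded_support[OF cont supp] .
 have cont': "continuous_on UNIV (\<lambda>x. \<Phi> (x + c))" for c
  by (intro continuous_on_compose2[OF cont] continuous_intros) auto
 have supp': "norm x > R + norm c ==> \<Phi> (x + c) = 0" for x c
  using norm_triangle_ineq4[of "x + c" c] by (intro supp) auto
 have int1: "integrable lborel (\<lambda>x. \<Phi> (x + c))" for c
  using integrable_continuous_bounded_support[OF cont' supp'] .
 have eq1: "(LINT x|lborel. \<Phi> (x + c)) = (LINT x|lborel. \<Phi> x)" for c
 proof -
  have "(LINT x|lborel. \<Phi> x) = (\<integral>x. \<Phi> x \<partial>distr lborel borel ((+) c))"
   by (simp add: lborel_distr_plus)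
  also have "... = (LINT x|lborel. \<Phi> (c + x))"
   using cont by (intro integral_distr) (auto intro: borel_measurable_continuous_onI)
  finally show ?thesis by (simp add: add.commute)
 qed
 have q_meas: "q n \<in> borel_measurable lborel" for n
  unfolding q_def using int0 int1 by (intro borel_measurable_divide borel_measurable_diff) auto
 have q_int: "(LINT x|lborel. q n x) = 0" for n
  unfolding q_def using int0 int1 eq1 by simp
 have lim: "(\<lambda>n. q n x) \<longlonglongrightarrow> D x \<bullet> b" for x
 proof -
  have "((\<lambda>s. \<Phi> (x + s *\<^sub>R b)) has_real_derivative D x \<bullet> b) (at 0)"
  proof -
   have 1: "((\<lambda>s. x + s *\<^sub>R b) has_derivative (\<lambda>s. s *\<^sub>R b)) (at (0::real))"
    by (auto intro!: derivative_eq_intros)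
   have "((\<lambda>s. \<Phi> (x + s *\<^sub>R b)) has_derivative (\<lambda>s. (s *\<^sub>R b) \<bullet> D x)) (at 0)"
    by (rule has_derivative_compose[OF 1]) (use D[of x] in \<open>simp add: gderiv_def\<close>)
   then show ?thesis
    by (simp add: has_field_derivative_def inner_commute mult_commute_abs)
  qed
  then have "(\<lambda>s. (\<Phi> (x + s *\<^sub>R b) - \<Phi> x) / s) \<midarrow>0\<rightarrow> D x \<bullet> b"
   by (simp add: DERIV_def)
  moreover have "filterlim t (at 0) sequentially"
   using t0 t(1) by (auto simp: filterlim_at less_imp_neq[symmetric] intro!: always_eventually)
  ultimately show ?thesis
   unfolding q_def by (rule filterlim_compose)
 qed
 have bound: "norm (q n x) <= C * norm b * indicator (cball 0 (R + norm b)) x" for n x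
 proof (cases "norm x <= R + norm b")
  case True
  have "\<bar>\<Phi> (x + t n *\<^sub>R b) - \<Phi> x\<bar> <= C * norm (x + t n *\<^sub>R b - x)"
   using D C by (intro bounded_gderiv_lipschitz[of UNIV]) auto
  then show ?thesis
   using True t(1)[of n] by (simp add: q_def divide_simps mult_ac)
 next
  case False
  have "norm (t n *\<^sub>R b) <= norm b"
   using t[of n] by (simp add: mult_left_le_one_le)
  then have "norm x > R + norm (t n *\<^sub>R b)" "norm x > R"
   using False norm_ge_zero[of b] by linarith+
  then have "\<Phi> (x + t n *\<^sub>R b) = 0" "\<Phi> x = 0"
   by (blast intro: supp' supp)+
  then show ?thesis by (simp add: q_def False)
 qed
 have w: "integrable lborel (\<lambda>x::'a. C * norm b * indicator (cball 0 (R + norm b)) x)"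
  using emeasure_bounded_finite[OF bounded_cball, of "0::'a"]
  by (intro integrable_mult_right integrable_real_indicator) auto
 have meas: "(\<lambda>x. D x \<bullet> b) \<in> borel_measurable lborel"
  by (rule borel_measurable_LIMSEQ_real[OF lim q_meas])
 show "integrable lborel (\<lambda>x. D x \<bullet> b)"
  by (rule integrable_dominated_convergence[OF meas q_meas w AE_I2[OF lim] AE_I2[OF bound]])
 have "(\<lambda>n. LINT x|lborel. q n x) \<longlonglongrightarrow> (LINT x|lborel. D x \<bullet> b)"
  by (rule integral_dominated_convergence[OF meas q_meas w AE_I2[OF lim] AE_I2[OF bound]])
 then show "(LINT x|lborel. D x \<bullet> b) = 0"
  unfolding q_int by (simp add: LIMSEQ_const_iff)
qed

section \<open>Integrability of kernels on product spaces\<close>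

lemma borel_imp_pair_measurable:
 assumes k: "k \<in> borel_measurable (borel \<Otimes>\<^sub>M borel)"
  and M: "(\<lambda>x. x) \<in> M \<rightarrow>\<^sub>M borel" and N: "(\<lambda>x. x) \<in> N \<rightarrow>\<^sub>M borel"
 shows "k \<in> borel_measurable (M \<Otimes>\<^sub>M N)"
proof -
 have "(\<lambda>z. (fst z, snd z)) \<in> M \<Otimes>\<^sub>M N \<rightarrow>\<^sub>M borel \<Otimes>\<^sub>M borel"
  using measurable_compose[OF measurable_fst M] measurable_compose[OF measurable_snd N]
  by (intro measurable_Pair) auto
 from measurable_compose[OF this k] show ?thesis by simp
qed

lemma id_measurable_lebesgue_on: "(\<lambda>x. x) \<in> lebesgue_on S \<rightarrow>\<^sub>M borel"
 by (intro measurable_restrict_space1 measurable_completion) simp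

text \<open>Tonelli with inner integrals bounded uniformly in the outer variable. This form admits
  kernels that are singular on the diagonal, such as the gradient of the parametrix.\<close>

lemma integrable_pair_kernel:
 fixes k :: "'a \<times> 'b => real"
 assumes M: "sigma_finite_measure M" and N: "sigma_finite_measure N"
  and k: "k \<in> borel_measurable (M \<Otimes>\<^sub>M N)"
  and a: "integrable M a" and b: "b \<in> borel_measurable N"
  and int: "\<And>x. x \<in> space M ==> integrable N (\<lambda>y. k (x, y) * b y)"
  and bd: "\<And>x. x \<in> space M ==> (LINT y|N. \<bar>k (x, y) * b y\<bar>) <= C"
 shows "integrable (M \<Otimes>\<^sub>M N) (\<lambda>(x, y). a x * (k (x, y) * b y))"
proof -
 interpret pair_sigma_finite M N using M N by (rule pair_sigma_finite.intro)
 have meas[measurable]: "(\<lambda>z. a (fst z) * (k z * b (snd z))) \<in> borel_measurable (M \<Otimes>\<^sub>M N)"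
  using k a b by measurable
 have m1: "(\<lambda>x. LINT y|N. norm (a x * (k (x, y) * b y))) \<in> borel_measurable M"
  using measurable_compose[OF meas borel_measurable_norm]
  by (intro M2.borel_measurable_lebesgue_integral) (simp add: case_prod_unfold)
 have "integrable (M \<Otimes>\<^sub>M N) (\<lambda>z. a (fst z) * (k z * b (snd z)))"
 proof (rule Fubini_integrable[OF meas])
  have "integrable M (\<lambda>x. LINT y|N. norm (a x * (k (x, y) * b y)))"
  proof (rule Bochner_Integration.integrable_bound[OF integrable_mult_right[OF a, of C] m1])
   show "AE x in M. norm (LINT y|N. norm (a x * (k (x, y) * b y))) <= norm (C * a x)"
   proof (rule AE_I2)
    fix x assume x: "x \<in> space M"
    have "norm (LINT y|N. norm (a x * (k (x, y) * b y))) = \<bar>a x\<bar> * (LINT y|N. \<bar>k (x, y) * b y\<bar>)"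
     by (simp add: abs_mult integral_nonneg_AE)
    also have "... <= \<bar>a x\<bar> * \<bar>C\<bar>"
     using bd[OF x] by (intro mult_left_mono) auto
    finally show "norm (LINT y|N. norm (a x * (k (x, y) * b y))) <= norm (C * a x)"
     by (simp add: abs_mult mult.commute)
   qed
  qed
  then show "integrable M (\<lambda>x. LINT y|N. norm (a (fst (x, y)) * (k (x, y) * b (snd (x, y)))))" by simp
  show "AE x in M. integrable N (\<lambda>y. a (fst (x, y)) * (k (x, y) * b (snd (x, y))))"
   using int by (intro AE_I2) simp
 qed
 then show ?thesis by (simp add: case_prod_unfold)
qed

lemma integrable_pair_bounded_kernel:
 fixes k :: "'a \<times> 'b => real"
 assumes M: "sigma_finite_measure M" and N: "sigma_finite_measure N"
  and k: "k \<in> borel_measurable (M \<Otimes>\<^sub>M N)"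
  and a: "integrable M a" and b: "integrable N b"
  and bd: "\<And>x y. x \<in> space M ==> y \<in> space N ==> \<bar>k (x, y)\<bar> <= C"
 shows "integrable (M \<Otimes>\<^sub>M N) (\<lambda>(x, y). a x * (k (x, y) * b y))"
proof (rule integrable_pair_kernel[OF M N k a])
 show "b \<in> borel_measurable N" using b by simp
 fix x assume x: "x \<in> space M"
 have meas: "(\<lambda>y. k (x, y) * b y) \<in> borel_measurable N"
  using k b x measurable_Pair2 by (intro borel_measurable_times) auto
 have le: "\<bar>k (x, y) * b y\<bar> <= C * \<bar>b y\<bar>" if "y \<in> space N" for y
  using bd[OF x that] by (simp add: abs_mult mult_right_mono)
 show int: "integrable N (\<lambda>y. k (x, y) * b y)"
  by (rule Bochner_Integration.integrable_bound[OF integrable_mult_right[OF integrable_abs[OF b], of C] meas])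
    (use le in \<open>auto intro!: AE_I2 order_trans[OF le]\<close>)
 show "(LINT y|N. \<bar>k (x, y) * b y\<bar>) <= (LINT y|N. C * \<bar>b y\<bar>)"
  using int b le by (intro integral_mono) auto
qed

lemma bump_bounds:
 assumes "r > 0"
 obtains C where "\<And>z::'a::euclidean_space. bump r z <= C" "\<And>z::'a. norm (bump_grad r z) <= C"
proof -
 have "compact (bump r ` cball (0::'a) r)" "compact (bump_grad r ` cball (0::'a) r)"
  by (intro compact_continuous_image continuous_bump compact_cball)+
 then obtain C1 C2 where C: "\<And>z::'a. norm z <= r ==> norm (bump r z) <= C1" "\<And>z::'a. norm z <= r ==> norm (bump_grad r z) <= C2"
  by (force dest!: compact_imp_bounded simp: bounded_iff)
 have "C1 >= 0" "C2 >= 0" using C[of 0] assms norm_ge_zero order_trans by (metis norm_zero less_imp_le)+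
 then have "bump r z <= max C1 C2" "norm (bump_grad r z) <= max C1 C2" for z :: 'a
  using C[of z] bump_zero[OF assms, of z] by (cases "norm z <= r"; force)+
 then show ?thesis using that by blast
qed

text \<open>Mollification without normalisation; the mass of the bump is divided out only when the
  radius tends to zero, which keeps the Fubini computations free of constants.\<close>

definition smear :: "real => ('a::euclidean_space => real) => 'a => real" where
 "smear r h x = (LINT y|lborel. bump r (x - y) * h y)"

lemma bump_mass_pos:
 assumes "r > 0"
 shows "(LINT z|lborel. bump r (z::'a::euclidean_space)) > 0" "integrable lborel (bump r :: 'a => real)"
proof -
 show int: "integrable lborel (bump r :: 'a => real)"
  by (rule integrable_continuous_bounded_support[OF continuous_bump(1), of r]) (simp add: bump_zero(1)[OF assms])
 have "(LINT z|lborel. bump r (z::'a)) \<noteq> 0"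
 proof
  assume "(LINT z|lborel. bump r (z::'a)) = 0"
  then have "AE z in lborel. bump r (z::'a) = 0"
   using int bump_nonneg by (subst (asm) integral_nonneg_eq_0_iff_AE) auto
  then have "emeasure lborel (ball (0::'a) r) = 0"
   using assms by (subst (asm) AE_iff_measurable[of "ball 0 r"]) (auto simp: bump_nonzero_iff)
  then show False
   using assms content_ball_pos[of r "0::'a"] by (simp add: measure_def)
 qed
 moreover have "(LINT z|lborel. bump r (z::'a)) >= 0"
  by (intro integral_nonneg_AE) (simp add: bump_nonneg)
 ultimately show "(LINT z|lborel. bump r (z::'a)) > 0" by simp
qed

lemma bump_integral_translate:
 fixes x :: "'a::euclidean_space"
 shows "(LINT y|lborel. bump r (x - y)) = (LINT z|lborel. bump r (z::'a::euclidean_space))"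
proof -
 have "(LINT z|lborel. bump r (z::'a)) = (\<integral>z. bump r z \<partial>distr lborel borel ((+) (- x)))"
  by (simp add: lborel_distr_plus)
 also have "... = (LINT y|lborel. bump r (- x + y))"
  by (intro integral_distr) (auto intro: borel_measurable_continuous_onI continuous_bump)
 also have "... = (LINT y|lborel. bump r (x - y))"
  by (simp add: bump_def inner_diff algebra_simps)
 finally show ?thesis ..
qed

lemma integrable_bump_mult:
 fixes h :: "'a::euclidean_space => real"
 assumes "r > 0" "continuous_on UNIV h"
 shows "integrable lborel (\<lambda>y. bump r (x - y) * h y)" "integrable lborel (\<lambda>y. bump_grad r (x - y) \<bullet> b * h y)"
proof -
 have far: "norm y > norm x + r ==> norm (x - y) >= r" for y
  using norm_triangle_ineq2[of y x] by (simp add: norm_minus_commute)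
 have c: "continuous_on UNIV (\<lambda>y. bump r (x - y))" "continuous_on UNIV (\<lambda>y. bump_grad r (x - y))"
  by (intro continuous_on_compose2[OF continuous_bump(1)[of UNIV]]
     continuous_on_compose2[OF continuous_bump(2)[of UNIV]] continuous_intros; simp)+
 show "integrable lborel (\<lambda>y. bump r (x - y) * h y)" "integrable lborel (\<lambda>y. bump_grad r (x - y) \<bullet> b * h y)"
  by (rule integrable_continuous_bounded_support[where R="norm x + r"],
    intro continuous_intros c assms, simp add: bump_zero[OF assms(1) far])+
qed

lemma smear_tendsto:
 fixes h :: "'a::euclidean_space => real"
 assumes h: "continuous_on UNIV h" and r: "\<And>n. r n > 0" "r \<longlonglongrightarrow> 0"
 shows "(\<lambda>n. smear (r n) h x / (LINT z|lborel. bump (r n) (z::'a))) \<longlonglongrightarrow> h x"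
proof (rule LIMSEQ_I)
 fix e :: real assume e: "e > 0"
 have "isCont h x" using h continuous_on_eq_continuous_at by auto
 then obtain d where d: "d > 0" "\<And>y. norm (y - x) < d ==> norm (h y - h x) < e / 2"
  using e unfolding continuous_at_eps_delta by (metis dist_norm half_gt_zero)
 from r(2) d(1) obtain N where N: "\<And>n. n >= N ==> r n < d"
  by (metis LIMSEQ_D abs_less_iff diff_zero real_norm_def)
 show "\<exists>N. \<forall>n\<ge>N. norm (smear (r n) h x / (LINT z|lborel. bump (r n) (z::'a)) - h x) < e"
 proof (intro exI allI impI)
  fix n assume n: "n >= N"
  let ?m = "LINT z|lborel. bump (r n) (z::'a)"
  have m: "?m > 0" by (rule bump_mass_pos[OF r(1)])
  note i = integrable_bump_mult[OF r(1)[of n]]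
  have ib: "integrable lborel (\<lambda>y. bump (r n) (x - y))" using i(1)[of "\<lambda>_. 1" x] by simp
  have "smear (r n) h x - h x * ?m = (LINT y|lborel. bump (r n) (x - y) * (h y - h x))"
   using i(1)[OF h, of x] ib by (simp add: smear_def right_diff_distrib bump_integral_translate)
  also have "\<bar>...\<bar> <= (LINT y|lborel. \<bar>bump (r n) (x - y) * (h y - h x)\<bar>)"
   by (rule integral_abs_bound)
  also have "... <= (LINT y|lborel. bump (r n) (x - y) * (e / 2))"
  proof (rule integral_mono)
   show "integrable lborel (\<lambda>y. \<bar>bump (r n) (x - y) * (h y - h x)\<bar>)"
    using h by (intro integrable_abs i continuous_intros)
   show "integrable lborel (\<lambda>y. bump (r n) (x - y) * (e / 2))" using ib by simp
   fix y
   show "\<bar>bump (r n) (x - y) * (h y - h x)\<bar> <= bump (r n) (x - y) * (e / 2)"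
   proof (cases "norm (x - y) < r n")
    case True
    with N[OF n] have "norm (y - x) < d" by (simp add: norm_minus_commute)
    from d(2)[OF this] show ?thesis
     using bump_nonneg[of "r n" "x - y"]
     by (auto simp only: abs_mult abs_of_nonneg real_norm_def intro!: mult_left_mono)
   qed (simp add: bump_zero[OF r(1)])
  qed
  also have "... = ?m * (e / 2)" by (simp add: bump_integral_translate)
  finally have "\<bar>smear (r n) h x - h x * ?m\<bar> <= ?m * (e / 2)" by simp
  moreover have "smear (r n) h x / ?m - h x = (smear (r n) h x - h x * ?m) / ?m"
   using m by (simp add: field_simps)
  ultimately have "\<bar>smear (r n) h x / ?m - h x\<bar> <= e / 2"
   using m by (simp add: abs_divide pos_divide_le_eq mult.commute)
  then show "norm (smear (r n) h x / ?m - h x) < e" using e by simp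
 qed
qed

lemma gderiv_zero_off_compact:
 fixes \<Phi> :: "'a::euclidean_space => real"
 assumes "compact K" "\<And>x. x \<notin> K ==> \<Phi> x = 0" "GDERIV \<Phi> x :> D" "x \<notin> K"
 shows "D = 0"
proof -
 have "open (- K)" using assms by (simp add: compact_imp_closed open_Compl)
 moreover have "((\<lambda>x. 0) has_derivative (\<lambda>h. 0)) (at x)" by simp
 ultimately have "(\<Phi> has_derivative (\<lambda>h. 0)) (at x)"
  using assms(2,4) by (rule_tac has_derivative_transform_within_open[of _ _ _ _ "- K"]) auto
 with assms(3) have "(\<lambda>h. h \<bullet> D) = (\<lambda>h. 0)"
  unfolding gderiv_def by (rule has_derivative_unique)
 then show ?thesis by (metis inner_eq_zero_iff)
qed

text \<open>Integration by parts inside the convolution. The bump depends on \<open>x - y\<close>,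
  so differentiating it in \<open>x\<close> already carries the sign that the integration by parts
  in \<open>y\<close> produces.\<close>

lemma smear_gderiv:
 fixes \<Phi> :: "'a::euclidean_space => real"
 assumes K: "compact K" "\<And>x. x \<notin> K ==> \<Phi> x = 0"
  and D: "\<And>x. GDERIV \<Phi> x :> D x" "continuous_on UNIV D" and r: "r > 0"
 shows "(LINT y|lborel. bump_grad r (x - y) \<bullet> b * \<Phi> y) = smear r (\<lambda>y. D y \<bullet> b) x"
proof -
 have cont: "continuous_on UNIV \<Phi>" using D(1) by (rule gderiv_continuous_on)
 have D0: "y \<notin> K ==> D y = 0" for y using gderiv_zero_off_compact[OF K D(1)] .
 obtain R where R: "\<And>y. y \<in> K ==> norm y <= R"
  using compact_imp_bounded[OF K(1)] unfolding bounded_iff by blast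
 have gd: "GDERIV (\<lambda>y. bump r (x - y) * \<Phi> y) y :> bump r (x - y) *\<^sub>R D y + \<Phi> y *\<^sub>R (- bump_grad r (x - y))" for y
 proof (rule GDERIV_mult)
  have "((\<lambda>y. x - y) has_derivative (\<lambda>h. - h)) (at y)" by (auto intro!: derivative_eq_intros)
  from has_derivative_compose[OF this bump_gderiv[unfolded gderiv_def]]
  show "GDERIV (\<lambda>y. bump r (x - y)) y :> - bump_grad r (x - y)"
   by (simp add: gderiv_def)
  show "GDERIV \<Phi> y :> D y" by (rule D)
 qed
 let ?E = "\<lambda>y. bump r (x - y) *\<^sub>R D y + \<Phi> y *\<^sub>R (- bump_grad r (x - y))"
 have c: "continuous_on A (\<lambda>y. bump r (x - y))" "continuous_on A (\<lambda>y. bump_grad r (x - y))" for A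
  by (intro continuous_on_compose2[OF continuous_bump(1)[of UNIV]]
     continuous_on_compose2[OF continuous_bump(2)[of UNIV]] continuous_intros; simp)+
 have "continuous_on K ?E"
  by (intro continuous_intros c continuous_on_subset[OF cont] continuous_on_subset[OF D(2)]) auto
 then have "bounded (?E ` K)" using K(1) by (intro compact_imp_bounded compact_continuous_image)
 then obtain C where C: "\<And>y. y \<in> K ==> norm (?E y) <= C"
  unfolding bounded_iff by blast
 have "norm (?E y) <= max C 0" for y
  using C[of y] D0[of y] K(2)[of y] by (cases "y \<in> K") auto
 moreover have "bump r (x - y) * \<Phi> y = 0" if "norm y > R" for y
  using K(2)[of y] R[of y] that by fastforce
 ultimately have "(LINT y|lborel. ?E y \<bullet> b) = 0"
  using integral_gderiv_zero(2)[OF gd] by blast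
 moreover have "integrable lborel (\<lambda>y. bump r (x - y) * (D y \<bullet> b))"
  by (rule integrable_bump_mult(1)[OF r]) (intro continuous_intros D)
 moreover have "integrable lborel (\<lambda>y. bump_grad r (x - y) \<bullet> b * \<Phi> y)"
  by (rule integrable_bump_mult(2)[OF r cont])
 ultimately show ?thesis
  by (simp add: inner_add_left inner_diff_left smear_def mult.commute)
qed

lemma smear_bound:
 fixes h :: "'a::euclidean_space => real"
 assumes h: "continuous_on UNIV h" "\<And>y. \<bar>h y\<bar> <= C" and r: "r > 0"
 shows "\<bar>smear r h x / (LINT z|lborel. bump r (z::'a))\<bar> <= C"
proof -
 let ?m = "LINT z|lborel. bump r (z::'a)"
 have m: "?m > 0" by (rule bump_mass_pos[OF r])
 note i = integrable_bump_mult[OF r]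
 have "\<bar>smear r h x\<bar> <= (LINT y|lborel. \<bar>bump r (x - y) * h y\<bar>)"
  unfolding smear_def by (rule integral_abs_bound)
 also have "... <= (LINT y|lborel. bump r (x - y) * C)"
  using h(2) by (intro integral_mono integrable_abs i h(1) continuous_on_const)
   (simp add: abs_mult bump_nonneg mult_left_mono)
 also have "... = ?m * C" by (simp add: bump_integral_translate)
 finally show ?thesis using m by (simp add: abs_divide pos_divide_le_eq mult.commute)
qed

section \<open>Test functions that vanish on the boundary\<close>

text \<open>Translated bumps centred in \<open>K\<close> are themselves test functions. Integrating
  their identities against \<open>\<Phi> y\<close> and exchanging the integrals gives the identity
  for the mollified \<open>\<Phi>\<close>, so smoothness of a convolution never has to be proved.
  Then the radius tends to zero.\<close>

lemma weak_identity_compact_support: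
 fixes a :: "'a::euclidean_space => real" and b :: "'a => 'a"
 assumes S: "open S" "S \<in> lmeasurable"
  and a: "integrable (lebesgue_on S) a" and b: "integrable (lebesgue_on S) b"
  and test: "\<And>\<phi>. test_function S \<phi> ==> (LINT x|(lebesgue_on S). a x * \<phi> x + b x \<bullet> grad \<phi> x) = 0"
  and K: "compact K" "K \<subseteq> S" "\<And>x. x \<notin> K ==> \<Phi> x = 0"
  and D: "\<And>x. GDERIV \<Phi> x :> D x" "continuous_on UNIV D"
 shows "(LINT x|(lebesgue_on S). a x * \<Phi> x + b x \<bullet> D x) = 0"
proof -
 let ?M = "lebesgue_on S"
 have sM: "sigma_finite_measure ?M"
  using finite_measure_lebesgue_on[OF S(2)] finite_measure_def by blast
 have sN: "sigma_finite_measure (lborel :: 'a measure)" by (rule lborel.sigma_finite_measure_axioms)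
 interpret pair_sigma_finite ?M "lborel :: 'a measure" using sM sN by (rule pair_sigma_finite.intro)
 have cont: "continuous_on UNIV \<Phi>" using D(1) by (rule gderiv_continuous_on)
 obtain R where R: "\<And>y. y \<in> K ==> norm y <= R"
  using compact_imp_bounded[OF K(1)] unfolding bounded_iff by blast
 have int\<Phi>: "integrable lborel \<Phi>"
  using K(3) R by (intro integrable_continuous_bounded_support[OF cont, of R]) force
 have D0: "y \<notin> K ==> D y = 0" for y by (rule gderiv_zero_off_compact[OF K(1,3) D(1)])
 have bdd: "bounded (range \<Phi>)" "bounded (range D)"
 proof -
  have "bounded (\<Phi> ` K)" "bounded (D ` K)"
   using cont D(2) by (auto intro!: compact_imp_bounded compact_continuous_image K(1) intro: continuous_on_subset)
  then have "bounded (insert 0 (\<Phi> ` K))" "bounded (insert 0 (D ` K))" by simp_all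
  moreover have "range \<Phi> \<subseteq> insert 0 (\<Phi> ` K)" "range D \<subseteq> insert 0 (D ` K)"
   using K(3) D0 by blast+
  ultimately show "bounded (range \<Phi>)" "bounded (range D)" using bounded_subset by blast+
 qed
 then obtain C1 C2 where "\<And>x. norm (\<Phi> x) <= C1" "\<And>x. norm (D x) <= C2"
  unfolding bounded_iff by blast
 then obtain C where C: "\<And>x. \<bar>\<Phi> x\<bar> <= C" "\<And>x. norm (D x) <= C" "C >= 0"
  by (metis max.coboundedI1 max.coboundedI2 norm_ge_zero order_trans real_norm_def)
 have CD: "\<bar>D x \<bullet> i\<bar> <= C" if "i \<in> Basis" for x i
  using C(2)[of x] Basis_le_norm[OF that, of "D x"] by linarith
 obtain e where e0: "e > 0" "(\<Union>y\<in>K. ball y e) \<subseteq> S"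
  using compact_subset_open_imp_ball_epsilon_subset[OF K(1) S(1) K(2)] .
 then have e: "e > 0" "\<And>y. y \<in> K ==> ball y e \<subseteq> S" by (simp_all add: UN_subset_iff)
 \<comment> \<open>The factor \<open>e / 2\<close> keeps every bump centred in \<open>K\<close>
   supported inside \<open>S\<close>.\<close>
 define r where "r n = e / 2 * inverse (real (Suc n))" for n
 have r: "r n > 0" "r n < e" for n
 proof -
  have "inverse (real (Suc n)) > 0" "inverse (real (Suc n)) <= 1" by (auto simp: inverse_le_1_iff)
  then show "r n > 0" "r n < e"
   using e(1) mult_left_mono[of "inverse (real (Suc n))" 1 "e / 2"] unfolding r_def by auto
 qed
 have r0: "r \<longlonglongrightarrow> 0"
  unfolding r_def using tendsto_mult_right_zero[OF LIMSEQ_inverse_real_of_nat] by blast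
 define m where "m n = (LINT z|lborel. bump (r n) (z::'a))" for n
 have m: "m n > 0" for n unfolding m_def by (rule bump_mass_pos[OF r(1)])
 have bi: "integrable ?M (\<lambda>x. b x \<bullet> i)" for i using b by auto
 let ?T = "\<lambda>n x. a x * smear (r n) \<Phi> x + (\<Sum>i\<in>Basis. (b x \<bullet> i) * smear (r n) (\<lambda>y. D y \<bullet> i) x)"
 have T: "integrable ?M (?T n) \<and> integral\<^sup>L ?M (?T n) = 0" for n
 proof -
  obtain CB where CB: "\<And>z::'a. bump (r n) z <= CB" "\<And>z::'a. norm (bump_grad (r n) z) <= CB"
   using bump_bounds[OF r(1)] by blast
  have m1: "(\<lambda>z. bump (r n) (fst z - snd z)) \<in> borel_measurable (?M \<Otimes>\<^sub>M lborel)"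
   by (rule borel_imp_pair_measurable[OF _ id_measurable_lebesgue_on])
    (auto simp: borel_prod intro!: borel_measurable_continuous_onI continuous_on_compose2[OF continuous_bump(1)[of UNIV]] continuous_intros)
  have m2: "(\<lambda>z. bump_grad (r n) (fst z - snd z) \<bullet> i) \<in> borel_measurable (?M \<Otimes>\<^sub>M lborel)" for i
   by (rule borel_imp_pair_measurable[OF _ id_measurable_lebesgue_on])
    (auto simp: borel_prod intro!: borel_measurable_continuous_onI continuous_on_compose2[OF continuous_bump(2)[of UNIV]] continuous_intros)
  define F where "F x y = a x * (bump (r n) (x - y) * \<Phi> y) +
    (\<Sum>i\<in>Basis. (b x \<bullet> i) * (bump_grad (r n) (x - y) \<bullet> i * \<Phi> y))" for x y
  have i1: "integrable (?M \<Otimes>\<^sub>M lborel) (\<lambda>(x, y). a x * (bump (r n) (x - y) * \<Phi> y))"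
  proof -
   have "\<bar>bump (r n) (x - y)\<bar> <= CB" for x y :: 'a
    using CB(1)[of "x - y"] bump_nonneg[of "r n" "x - y"] by simp
   then show ?thesis
    using integrable_pair_bounded_kernel[OF sM sN m1 a int\<Phi>, of CB] by simp
  qed
  have i2: "integrable (?M \<Otimes>\<^sub>M lborel) (\<lambda>(x, y). (b x \<bullet> i) * (bump_grad (r n) (x - y) \<bullet> i * \<Phi> y))" if "i \<in> Basis" for i
  proof -
   have "\<bar>bump_grad (r n) (x - y) \<bullet> i\<bar> <= CB" for x y :: 'a
    using CB(2)[of "x - y"] Basis_le_norm[OF that] order_trans by blast
   then show ?thesis
    using integrable_pair_bounded_kernel[OF sM sN m2[of i] bi[of i] int\<Phi>, of CB] by simp
  qed
  have iF: "integrable (?M \<Otimes>\<^sub>M lborel) (\<lambda>(x, y). F x y)"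
   unfolding F_def case_prod_unfold
   using i1 i2 by (intro Bochner_Integration.integrable_add Bochner_Integration.integrable_sum) (auto simp: case_prod_unfold)
  have Fy: "(LINT x|?M. F x y) = 0" for y
  proof (cases "y \<in> K")
   case True
   then have "cball y (r n) \<subseteq> S" using e(2)[OF True] r(2)[of n] by force
   from test[OF bump_test_function[OF r(1) this]]
   have 0: "(LINT x|?M. a x * bump (r n) (x - y) + b x \<bullet> grad (\<lambda>x. bump (r n) (x - y)) x) = 0" .
   have g: "grad (\<lambda>x. bump (r n) (x - y)) x = bump_grad (r n) (x - y)" for x
   proof (rule gderiv_grad)
    have "((\<lambda>x. x - y) has_derivative (\<lambda>h. h)) (at x)" by (auto intro!: derivative_eq_intros)
    from has_derivative_compose[OF this bump_gderiv[unfolded gderiv_def]]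
    show "GDERIV (\<lambda>x. bump (r n) (x - y)) x :> bump_grad (r n) (x - y)"
     by (simp add: gderiv_def)
   qed
   have "F x y = \<Phi> y * (a x * bump (r n) (x - y) + b x \<bullet> bump_grad (r n) (x - y))" for x
    unfolding F_def euclidean_inner[of "b x" "bump_grad (r n) (x - y)"]
    by (simp add: distrib_left sum_distrib_left mult_ac)
   then show ?thesis using 0 by (simp add: g)
  next
   case False
   then show ?thesis using K(3) by (simp add: F_def)
  qed
  have Fx: "(LINT y|lborel. F x y) = ?T n x" for x
  proof -
   have j1: "integrable lborel (\<lambda>y. bump (r n) (x - y) * \<Phi> y)"
    by (rule integrable_bump_mult(1)[OF r(1) cont])
   have j2: "integrable lborel (\<lambda>y. bump_grad (r n) (x - y) \<bullet> i * \<Phi> y)" for i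
    by (rule integrable_bump_mult(2)[OF r(1) cont])
   have "(LINT y|lborel. F x y) = a x * smear (r n) \<Phi> x +
     (\<Sum>i\<in>Basis. (b x \<bullet> i) * (LINT y|lborel. bump_grad (r n) (x - y) \<bullet> i * \<Phi> y))"
    unfolding F_def smear_def using j1 j2
    by (subst Bochner_Integration.integral_add) auto
   also have "... = ?T n x"
    using smear_gderiv[OF K(1,3) D r(1)] by simp
   finally show ?thesis .
  qed
  have "integrable ?M (\<lambda>x. LINT y|lborel. F x y)" by (rule integrable_fst[OF iF])
  moreover have "(LINT x|?M. (LINT y|lborel. F x y)) = (LINT y|lborel. (LINT x|?M. F x y))"
   using Fubini_integral[OF iF] by simp
  ultimately show ?thesis by (simp add: Fx Fy)
 qed
 let ?s = "\<lambda>n x. ?T n x / m n"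
 have s_eq: "?s n x = a x * (smear (r n) \<Phi> x / m n) + (\<Sum>i\<in>Basis. (b x \<bullet> i) * (smear (r n) (\<lambda>y. D y \<bullet> i) x / m n))" for n x
  by (simp add: add_divide_distrib sum_divide_distrib)
 have cD: "continuous_on UNIV (\<lambda>y. D y \<bullet> i)" for i by (intro continuous_intros D)
 have lim: "(\<lambda>n. ?s n x) \<longlonglongrightarrow> a x * \<Phi> x + b x \<bullet> D x" for x
  unfolding s_eq unfolding euclidean_inner[of "b x" "D x"] m_def
  by (intro tendsto_add tendsto_mult tendsto_sum tendsto_const smear_tendsto cont cD r r0)
 have bound: "norm (?s n x) <= C * \<bar>a x\<bar> + (\<Sum>i\<in>Basis. C * \<bar>b x \<bullet> i\<bar>)" for n x
 proof -
  have "\<bar>a x * (smear (r n) \<Phi> x / m n)\<bar> <= C * \<bar>a x\<bar>"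
   using smear_bound[OF cont C(1) r(1)[of n], of x] unfolding abs_mult m_def
   by (subst mult.commute) (rule mult_right_mono, auto)
  moreover have "\<bar>\<Sum>i\<in>Basis. (b x \<bullet> i) * (smear (r n) (\<lambda>y. D y \<bullet> i) x / m n)\<bar> <= (\<Sum>i\<in>Basis. C * \<bar>b x \<bullet> i\<bar>)"
  proof (rule order_trans[OF sum_abs], rule sum_mono)
   fix i :: 'a assume i: "i \<in> Basis"
   show "\<bar>(b x \<bullet> i) * (smear (r n) (\<lambda>y. D y \<bullet> i) x / m n)\<bar> <= C * \<bar>b x \<bullet> i\<bar>"
    using smear_bound[OF cD CD[OF i] r(1)[of n], of x] unfolding abs_mult m_def
    by (subst mult.commute) (rule mult_right_mono, auto)
  qed
  ultimately show ?thesis unfolding s_eq real_norm_def by linarith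
 qed
 have w: "integrable ?M (\<lambda>x. C * \<bar>a x\<bar> + (\<Sum>i\<in>Basis. C * \<bar>b x \<bullet> i\<bar>))"
  using a bi by auto
 have ms: "(\<lambda>x. ?s n x) \<in> borel_measurable ?M" for n using T[of n] by auto
 have ml: "(\<lambda>x. a x * \<Phi> x + b x \<bullet> D x) \<in> borel_measurable ?M"
  by (rule borel_measurable_LIMSEQ_real[OF lim ms])
 have "(\<lambda>n. LINT x|?M. ?s n x) \<longlonglongrightarrow> (LINT x|?M. a x * \<Phi> x + b x \<bullet> D x)"
  by (rule integral_dominated_convergence[OF ml ms w AE_I2[OF lim] AE_I2[OF bound]])
 moreover have "(\<lambda>n. LINT x|?M. ?s n x) = (\<lambda>n. 0)" using T by simp
 ultimately show ?thesis by (simp only: LIMSEQ_const_iff)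
qed

section \<open>A twice differentiable step built from truncated powers\<close>

definition trunc_pow :: "nat => real => real" where
 "trunc_pow n t = max 0 t ^ n"

lemma trunc_pow_deriv:
 "(trunc_pow (Suc (Suc n)) has_real_derivative real (n + 2) * trunc_pow (Suc n) t) (at t)"
proof -
 consider "t > 0" | "t < 0" | "t = 0" by linarith
 then show ?thesis
 proof cases
  case 1
  have "((\<lambda>t. t ^ Suc (Suc n)) has_real_derivative real (n + 2) * trunc_pow (Suc n) t) (at t)"
   using 1 DERIV_pow[of "Suc (Suc n)" t] by (simp add: trunc_pow_def)
  moreover have "\<forall>\<^sub>F s in nhds t. s ^ Suc (Suc n) = trunc_pow (Suc (Suc n)) s"
   using eventually_nhds_in_open[of "{0<..}" t] 1
   by (auto elim!: eventually_mono simp: trunc_pow_def)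
  ultimately show ?thesis
   using DERIV_cong_ev[OF refl _ refl] by fast
 next
  case 2
  have "((\<lambda>t. 0) has_real_derivative 0) (at t)" by simp
  moreover have "\<forall>\<^sub>F s in nhds t. 0 = trunc_pow (Suc (Suc n)) s"
   using eventually_nhds_in_open[of "{..<0}" t] 2
   by (auto elim!: eventually_mono simp: trunc_pow_def)
  ultimately have "(trunc_pow (Suc (Suc n)) has_real_derivative 0) (at t)"
   using DERIV_cong_ev[OF refl _ refl] by fast
  with 2 show ?thesis by (simp add: trunc_pow_def)
 next
  case 3
  have "(\<lambda>h. trunc_pow (Suc (Suc n)) h / h) \<midarrow>0\<rightarrow> 0"
  proof (rule Lim_null_comparison)
   show "\<forall>\<^sub>F h in at 0. norm (trunc_pow (Suc (Suc n)) h / h) <= \<bar>h\<bar> ^ Suc n"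
   proof (intro always_eventually allI)
    fix h :: real
    have "0 <= \<bar>h\<bar> ^ Suc n" by (rule zero_le_power) simp
    then show "norm (trunc_pow (Suc (Suc n)) h / h) <= \<bar>h\<bar> ^ Suc n"
     by (cases "h >= 0") (simp_all add: trunc_pow_def max_def del: power_Suc, simp)
   qed
   show "(\<lambda>h::real. \<bar>h\<bar> ^ Suc n) \<midarrow>0\<rightarrow> 0"
    by (auto intro!: tendsto_eq_intros)
  qed
  with 3 show ?thesis by (simp add: DERIV_def trunc_pow_def)
 qed
qed

definition sstep :: "real => real" where
 "sstep t = 10 * trunc_pow 3 t - 15 * trunc_pow 4 t + 6 * trunc_pow 5 t
   - 10 * trunc_pow 3 (t - 1) - 15 * trunc_pow 4 (t - 1) - 6 * trunc_pow 5 (t - 1)"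
definition sstep' :: "real => real" where
 "sstep' t = 30 * trunc_pow 2 t - 60 * trunc_pow 3 t + 30 * trunc_pow 4 t
   - 30 * trunc_pow 2 (t - 1) - 60 * trunc_pow 3 (t - 1) - 30 * trunc_pow 4 (t - 1)"
definition sstep'' :: "real => real" where
 "sstep'' t = 60 * trunc_pow 1 t - 180 * trunc_pow 2 t + 120 * trunc_pow 3 t
   - 60 * trunc_pow 1 (t - 1) - 180 * trunc_pow 2 (t - 1) - 120 * trunc_pow 3 (t - 1)"

lemmas trunc_pow_derivs = trunc_pow_deriv[of 0] trunc_pow_deriv[of 1] trunc_pow_deriv[of 2] trunc_pow_deriv[of 3]

lemma trunc_pow_shift_deriv:
 "((\<lambda>t. trunc_pow (Suc (Suc n)) (t - 1)) has_real_derivative real (n + 2) * trunc_pow (Suc n) (t - 1)) (at t)"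
 using DERIV_shift[of "trunc_pow (Suc (Suc n))" "real (n + 2) * trunc_pow (Suc n) (t - 1)" t "-1"] trunc_pow_deriv[of n "t - 1"]
 by simp

lemma sstep_deriv: "(sstep has_real_derivative sstep' t) (at t)"
 using trunc_pow_derivs(2-4)[of t] trunc_pow_shift_deriv[of 1 t] trunc_pow_shift_deriv[of 2 t] trunc_pow_shift_deriv[of 3 t]
 unfolding sstep_def[abs_def] sstep'_def
 by (auto simp: eval_nat_numeral intro!: derivative_eq_intros)

lemma sstep'_deriv: "(sstep' has_real_derivative sstep'' t) (at t)"
 using trunc_pow_derivs(1-3)[of t] trunc_pow_shift_deriv[of 0 t] trunc_pow_shift_deriv[of 1 t] trunc_pow_shift_deriv[of 2 t]
 unfolding sstep'_def[abs_def] sstep''_def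
 by (auto simp: eval_nat_numeral intro!: derivative_eq_intros)

lemma sstep_low: assumes "t <= 0" shows "sstep t = 0" "sstep' t = 0" "sstep'' t = 0"
 using assms by (auto simp: sstep_def sstep'_def sstep''_def trunc_pow_def)

lemma sstep_high: assumes "t >= 1" shows "sstep t = 1" "sstep' t = 0" "sstep'' t = 0"
 using assms by (simp_all add: sstep_def sstep'_def sstep''_def trunc_pow_def max_def) algebra+

lemma sstep_range: "0 <= sstep t" "sstep t <= 1"
proof -
 have p: "0 <= s ^ 3 * (10 - 15 * s + 6 * s\<^sup>2)" if "0 <= s" for s :: real
 proof -
  have "10 - 15 * s + 6 * s\<^sup>2 = 6 * (s - 5/4)\<^sup>2 + 5/8" by (simp add: power2_eq_square algebra_simps)
  then show ?thesis using that by (intro mult_nonneg_nonneg) auto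
 qed
 consider "t <= 0" | "t >= 1" | "0 < t" "t < 1" by linarith
 then have "0 <= sstep t \<and> sstep t <= 1"
 proof cases
  case 3
  then have "sstep t = t ^ 3 * (10 - 15 * t + 6 * t\<^sup>2)" "1 - sstep t = (1 - t) ^ 3 * (10 - 15 * (1 - t) + 6 * (1 - t)\<^sup>2)"
   by (simp_all add: sstep_def trunc_pow_def max_def) algebra+
  with p[of t] p[of "1 - t"] 3 show ?thesis by simp
 qed (auto simp: sstep_low sstep_high)
 then show "0 <= sstep t" "sstep t <= 1" by auto
qed

lemma sstep'_range: "0 <= sstep' t" "sstep' t <= 2"
proof -
 consider "t <= 0" | "t >= 1" | "0 < t" "t < 1" by linarith
 then have "0 <= sstep' t \<and> sstep' t <= 2"
 proof cases
  case 3
  then have e: "sstep' t = 30 * (t * (1 - t))\<^sup>2"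
   by (simp add: sstep'_def trunc_pow_def max_def) algebra
  have "t * (1 - t) <= 1 / 4"
   using zero_le_power2[of "t - 1/2"] by (simp add: power2_eq_square algebra_simps)
  then have "(t * (1 - t))\<^sup>2 <= (1/4)\<^sup>2" using 3 by (intro power_mono) auto
  moreover have "(1/4::real)\<^sup>2 = 1/16" by (simp add: power2_eq_square)
  ultimately have "30 * (t * (1 - t))\<^sup>2 <= 2" by linarith
  then show ?thesis unfolding e by simp
 qed (auto simp: sstep_low sstep_high)
 then show "0 <= sstep' t" "sstep' t <= 2" by auto
qed

lemma continuous_trunc_pow [continuous_intros]:
 "continuous_on A f ==> continuous_on A (\<lambda>x. trunc_pow n (f x))"
 unfolding trunc_pow_def by (intro continuous_intros)

lemma continuous_sstep [continuous_intros]: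
 "continuous_on A f ==> continuous_on A (\<lambda>x. sstep (f x))"
 "continuous_on A f ==> continuous_on A (\<lambda>x. sstep' (f x))"
 "continuous_on A f ==> continuous_on A (\<lambda>x. sstep'' (f x))"
 unfolding sstep_def sstep'_def sstep''_def by (intro continuous_intros; assumption)+

section \<open>Functions that vanish linearly at the boundary of the annulus\<close>

abbreviation annM :: "(real^2) measure" where "annM \<equiv> lebesgue_on annulus"

text \<open>A polynomial defining function of the annulus, comparable with the distance to the
  boundary; it depends on \<open>x \<bullet> x\<close> alone, which keeps its derivatives
  polynomial.\<close>

definition collar :: "real^2 => real" where
 "collar x = (1 - x \<bullet> x) * (x \<bullet> x - 1/4)"

lemma annulus_iff: "x \<in> annulus \<longleftrightarrow> 1/4 < x \<bullet> x \<and> x \<bullet> x < 1"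
 by (simp add: annulus_def norm_lt_square norm_gt_square power2_eq_square)

lemma annulus_collar: "x \<in> annulus \<longleftrightarrow> collar x > 0"
 by (auto simp: annulus_iff collar_def zero_less_mult_iff)

lemma open_annulus: "open annulus"
proof -
 have "annulus = {x. 1/4 < x \<bullet> x} \<inter> {x::real^2. x \<bullet> x < 1}" by (auto simp: annulus_iff)
 moreover have "open ({x. 1/4 < x \<bullet> x} \<inter> {x::real^2. x \<bullet> x < 1})"
  by (intro open_Int open_Collect_less continuous_intros)
 ultimately show ?thesis by metis
qed

lemma annulus_norm: "x \<in> annulus ==> norm x < 1"
 by (simp add: annulus_def)

lemma annulus_lmeasurable: "annulus \<in> lmeasurable"
proof (rule bounded_set_imp_lmeasurable)
 show "bounded annulus" by (rule bounded_subset[OF bounded_ball[of 0 1]]) (auto simp: annulus_def)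
 show "annulus \<in> sets lebesgue" using open_annulus by (simp add: borel_open)
qed

lemma finite_annM: "finite_measure annM"
 by (rule finite_measure_lebesgue_on[OF annulus_lmeasurable])

lemma sigma_finite_annM: "sigma_finite_measure annM"
 using finite_annM finite_measure_def by blast

lemma space_annM [simp]: "space annM = annulus" by simp

lemma integrable_annM_bounded:
 fixes f :: "real^2 => 'a::{banach, second_countable_topology}"
 assumes "f \<in> borel_measurable annM" "\<And>x. x \<in> annulus ==> norm (f x) <= C"
 shows "integrable annM f"
 by (rule finite_measure.integrable_const_bound[OF finite_annM AE_I2 assms(1)]) (use assms(2) in auto)

lemma continuous_on_annM_measurable:
 fixes f :: "real^2 => 'a::euclidean_space"
 assumes "continuous_on annulus f"
 shows "f \<in> borel_measurable annM"
 using assms annulus_lmeasurable by (intro continuous_imp_measurable_on_sets_lebesgue) auto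

lemma GDERIV_inner_self: "GDERIV (\<lambda>x. x \<bullet> x) x :> 2 *\<^sub>R x"
 by (auto simp: gderiv_def inner_commute intro!: derivative_eq_intros)

lemma GDERIV_radial:
 assumes "(f has_real_derivative d) (at (x \<bullet> x))"
 shows "GDERIV (\<lambda>x. f (x \<bullet> x)) x :> (2 * d) *\<^sub>R x"
 using GDERIV_DERIV_compose[OF GDERIV_inner_self assms] by (simp add: mult.commute)

lemma collar_gderiv: "GDERIV collar x :> (5/2 - 4 * (x \<bullet> x)) *\<^sub>R x"
proof -
 have "((\<lambda>t::real. (1 - t) * (t - 1/4)) has_real_derivative (5/4 - 2 * (x \<bullet> x))) (at (x \<bullet> x))"
  by (auto intro!: derivative_eq_intros simp: algebra_simps)
 from GDERIV_radial[OF this] show ?thesis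
  unfolding collar_def[abs_def] by (simp add: algebra_simps)
qed

lemma collar_grad_bound: "x \<in> annulus ==> norm ((5/2 - 4 * (x \<bullet> x)) *\<^sub>R x) <= 2"
proof -
 assume x: "x \<in> annulus"
 then have "\<bar>5/2 - 4 * (x \<bullet> x)\<bar> <= 2" "norm x <= 1"
  using annulus_iff[of x] annulus_norm[of x] by auto
 then show ?thesis using mult_mono[of "\<bar>5/2 - 4 * (x \<bullet> x)\<bar>" 2 "norm x" 1] by simp
qed

lemma collar_le: "x \<in> annulus ==> collar x <= 1"
 unfolding collar_def annulus_iff by (rule mult_le_one) auto

text \<open>Linear vanishing at the boundary is the exact price of a cutoff whose gradient grows
  like the inverse distance.\<close>

definition C1_collar :: "(real^2 => real) => (real^2 => real^2) => real => bool" where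
 "C1_collar \<Phi> D C \<longleftrightarrow> (\<forall>x\<in>annulus. (GDERIV \<Phi> x :> D x) \<and> \<bar>\<Phi> x\<bar> <= C * collar x \<and> norm (D x) <= C)
   \<and> continuous_on annulus D"

text \<open>The cutoff \<open>\<theta> n\<close> rises where \<open>collar\<close> lies between
  \<open>1 / k n\<close> and \<open>2 / k n\<close>. Its gradient is of order \<open>k n\<close>
  there, while \<open>\<Phi>\<close> is at most \<open>2 * C / k n\<close>, so the truncated
  gradients stay below \<open>9 * C\<close> and dominated convergence applies.\<close>

lemma weak_identity_C1_collar:
 assumes a: "integrable annM a" and b: "integrable annM b"
  and test: "\<And>\<phi>. test_function annulus \<phi> ==> (LINT x|annM. a x * \<phi> x + b x \<bullet> grad \<phi> x) = 0"
  and \<Phi>: "C1_collar \<Phi> D C"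
 shows "(LINT x|annM. a x * \<Phi> x + b x \<bullet> D x) = 0"
proof -
 have D: "\<And>x. x \<in> annulus ==> GDERIV \<Phi> x :> D x" "continuous_on annulus D"
  and C: "\<And>x. x \<in> annulus ==> \<bar>\<Phi> x\<bar> <= C * collar x" "\<And>x. x \<in> annulus ==> norm (D x) <= C"
  using \<Phi> by (auto simp: C1_collar_def)
 define e :: "real^2" where "e = (3/4) *\<^sub>R axis 1 1"
 have "C >= 0"
 proof -
  have "e \<in> annulus" by (simp add: e_def annulus_iff inner_axis_axis)
  from C(2)[OF this] norm_ge_zero[of "D e"] show ?thesis by linarith
 qed
 let ?g = "\<lambda>x::real^2. (5/2 - 4 * (x \<bullet> x)) *\<^sub>R x"
 define k where "k n = real (Suc n)" for n
 define \<theta> where "\<theta> n x = sstep (k n * collar x - 1)" for n x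
 define P where "P n x = (if x \<in> annulus then \<theta> n x * \<Phi> x else 0)" for n x
 define Q where "Q n x = (if x \<in> annulus then \<theta> n x *\<^sub>R D x + (\<Phi> x * (sstep' (k n * collar x - 1) * k n)) *\<^sub>R ?g x else 0)" for n x
 have cc: "continuous_on A collar" for A unfolding collar_def[abs_def] by (intro continuous_intros)
 have c\<Phi>: "continuous_on annulus \<Phi>" using D(1) by (rule gderiv_continuous_on)
 have key: "(LINT x|annM. a x * P n x + b x \<bullet> Q n x) = 0" for n
 proof (rule weak_identity_compact_support[OF open_annulus annulus_lmeasurable a b test])
  let ?K = "{x. collar x >= 1 / k n}"
  let ?U = "{x. collar x < 1 / k n}"
  have kn: "k n > 0" by (simp add: k_def)
  have "1 / k n > 0" using kn by simp
  then have sub: "?K \<subseteq> annulus" by (auto simp: annulus_collar simp del: zero_less_divide_1_iff)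
  show "?K \<subseteq> annulus" by (rule sub)
  have "bounded ?K" by (rule bounded_subset[OF bounded_ball[of 0 1]]) (use sub annulus_norm in auto)
  moreover have "closed ?K" by (intro closed_Collect_le cc continuous_intros)
  ultimately show "compact ?K" by (simp add: compact_eq_bounded_closed)
  have low: "k n * collar x - 1 <= 0" if "x \<in> ?U" for x
   using that kn by (simp add: field_simps)
  have PU: "P n x = 0" "Q n x = 0" if "x \<in> ?U" for x
   using low[OF that] by (auto simp: P_def Q_def \<theta>_def sstep_low)
  show "P n x = 0" if "x \<notin> ?K" for x using that PU by auto
  have oU: "open ?U" by (intro open_Collect_less cc continuous_intros)
  have cov: "x \<in> annulus \<or> x \<in> ?U" for x using sub by force
  show "GDERIV (P n) x :> Q n x" for x
   using cov[of x]
  proof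
   assume x: "x \<in> annulus"
   have "GDERIV (\<lambda>x. k n * collar x - 1) x :> k n *\<^sub>R ?g x"
    using collar_gderiv[of x] by (auto simp: gderiv_def intro!: derivative_eq_intros)
   from GDERIV_DERIV_compose[OF this sstep_deriv]
   have "GDERIV (\<theta> n) x :> (sstep' (k n * collar x - 1) * k n) *\<^sub>R ?g x"
    by (simp add: \<theta>_def[abs_def] mult.assoc)
   from GDERIV_mult[OF this D(1)[OF x]]
   have "GDERIV (\<lambda>x. \<theta> n x * \<Phi> x) x :> Q n x" using x by (simp add: Q_def mult_ac)
   then show ?thesis
    using x unfolding gderiv_def
    by (rule has_derivative_transform_within_open[OF _ open_annulus]) (auto simp: P_def)
  next
   assume x: "x \<in> ?U"
   have "((\<lambda>x. 0) has_derivative (\<lambda>h. 0)) (at x)" by simp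
   then have "(P n has_derivative (\<lambda>h. 0)) (at x)"
    using x by (rule has_derivative_transform_within_open[OF _ oU]) (auto simp: PU)
   then show ?thesis by (simp add: gderiv_def PU[OF x])
  qed
  have "continuous_on annulus (\<lambda>x. \<theta> n x *\<^sub>R D x + (\<Phi> x * (sstep' (k n * collar x - 1) * k n)) *\<^sub>R ?g x)"
   unfolding \<theta>_def by (intro continuous_intros cc D c\<Phi>)
  then have "continuous_on annulus (Q n)" by (rule continuous_on_eq) (simp add: Q_def)
  moreover have "continuous_on ?U (Q n)"
   using continuous_on_const[of _ 0] by (rule continuous_on_eq) (simp add: PU)
  ultimately have "continuous_on (annulus \<union> ?U) (Q n)"
   using open_annulus oU by (intro continuous_on_open_Un)
  moreover have "annulus \<union> ?U = UNIV" using cov by auto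
  ultimately show "continuous_on UNIV (Q n)" by simp
 qed
 have ev: "\<exists>N. \<forall>n\<ge>N. k n * collar x - 1 >= 1" if "x \<in> annulus" for x
 proof -
  obtain N where "real N > 2 / collar x" using reals_Archimedean2 by blast
  then have "real N * collar x > 2" using that by (simp add: annulus_collar field_simps)
  moreover have "real N * collar x <= k n * collar x" if "n >= N" for n
   using that \<open>x \<in> annulus\<close> by (intro mult_right_mono) (auto simp: k_def annulus_collar)
  ultimately show ?thesis by (intro exI[of _ N]) force
 qed
 have limP: "(\<lambda>n. P n x) \<longlonglongrightarrow> \<Phi> x" and limQ: "(\<lambda>n. Q n x) \<longlonglongrightarrow> D x" if x: "x \<in> annulus" for x
 proof -
  obtain N where N: "\<And>n. n >= N ==> k n * collar x - 1 >= 1" using ev[OF x] by blast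
  show "(\<lambda>n. P n x) \<longlonglongrightarrow> \<Phi> x"
   by (rule tendsto_eventually, rule eventually_sequentiallyI[of N])
    (use x N in \<open>simp add: P_def \<theta>_def sstep_high\<close>)
  show "(\<lambda>n. Q n x) \<longlonglongrightarrow> D x"
   by (rule tendsto_eventually, rule eventually_sequentiallyI[of N])
    (use x N in \<open>simp add: Q_def \<theta>_def sstep_high\<close>)
 qed
 have bdP: "\<bar>P n x\<bar> <= C" and bdQ: "norm (Q n x) <= 9 * C" if x: "x \<in> annulus" for n x
 proof -
  have th: "0 <= \<theta> n x" "\<theta> n x <= 1" by (auto simp: \<theta>_def sstep_range)
  have c: "0 < collar x" "collar x <= 1" using x collar_le annulus_collar by auto
  have "\<bar>\<Phi> x\<bar> <= C"
   using C(1)[OF x] mult_left_mono[OF c(2) \<open>C >= 0\<close>] by linarith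
  then show "\<bar>P n x\<bar> <= C"
   using x th mult_left_le_one_le[of "\<bar>\<Phi> x\<bar>" "\<theta> n x"] by (simp add: P_def abs_mult)
  let ?s = "k n * collar x - 1"
  have s4: "\<bar>\<Phi> x * (sstep' ?s * k n)\<bar> <= 4 * C"
  proof (cases "?s <= 1")
   case True
   have "\<bar>\<Phi> x * (sstep' ?s * k n)\<bar> = \<bar>\<Phi> x\<bar> * (sstep' ?s * k n)"
    using sstep'_range[of ?s] by (simp add: abs_mult k_def)
   also have "... <= (C * collar x) * (2 * k n)"
    using C(1)[OF x] sstep'_range[of ?s] \<open>C >= 0\<close> c
    by (intro mult_mono mult_right_mono) (auto simp: k_def)
   also have "... = 2 * C * (k n * collar x)" by simp
   also have "... <= 2 * C * 2" using True \<open>C >= 0\<close> by (intro mult_left_mono) auto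
   finally show ?thesis by simp
  qed (use sstep_high \<open>C >= 0\<close> in auto)
  have "norm (Q n x) <= norm (\<theta> n x *\<^sub>R D x) + norm ((\<Phi> x * (sstep' ?s * k n)) *\<^sub>R ?g x)"
   using x by (simp add: Q_def norm_triangle_ineq del: norm_scaleR)
  also have "norm (\<theta> n x *\<^sub>R D x) <= C"
   using C(2)[OF x] th mult_left_le_one_le[of "norm (D x)" "\<theta> n x"] by simp
  also have "norm ((\<Phi> x * (sstep' ?s * k n)) *\<^sub>R ?g x) <= (4 * C) * 2"
   unfolding norm_scaleR[of "\<Phi> x * (sstep' ?s * k n)"] using s4 collar_grad_bound[OF x] \<open>C >= 0\<close>
   by (intro mult_mono) auto
  finally show "norm (Q n x) <= 9 * C" by simp
 qed
 let ?w = "\<lambda>x. C * \<bar>a x\<bar> + 9 * C * norm (b x)"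
 have cP: "P n \<in> borel_measurable annM" "Q n \<in> borel_measurable annM" for n
 proof -
  have "continuous_on annulus (\<lambda>x. \<theta> n x * \<Phi> x)"
   "continuous_on annulus (\<lambda>x. \<theta> n x *\<^sub>R D x + (\<Phi> x * (sstep' (k n * collar x - 1) * k n)) *\<^sub>R ?g x)"
   unfolding \<theta>_def by (intro continuous_intros cc D c\<Phi>)+
  then have "continuous_on annulus (P n)" "continuous_on annulus (Q n)"
   by (auto elim!: continuous_on_eq simp: P_def Q_def)
  then show "P n \<in> borel_measurable annM" "Q n \<in> borel_measurable annM"
   by (auto intro: continuous_on_annM_measurable)
 qed
 have "(\<lambda>n. LINT x|annM. a x * P n x + b x \<bullet> Q n x) \<longlonglongrightarrow> (LINT x|annM. a x * \<Phi> x + b x \<bullet> D x)"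
 proof (rule integral_dominated_convergence[where w="?w"])
  have "\<Phi> \<in> borel_measurable annM" "D \<in> borel_measurable annM"
   using c\<Phi> D(2) by (auto intro: continuous_on_annM_measurable)
  then show "(\<lambda>x. a x * \<Phi> x + b x \<bullet> D x) \<in> borel_measurable annM" using a b by measurable
  show "(\<lambda>x. a x * P n x + b x \<bullet> Q n x) \<in> borel_measurable annM" for n using a b cP by measurable
  show "integrable annM ?w" using a b by auto
  show "AE x in annM. (\<lambda>n. a x * P n x + b x \<bullet> Q n x) \<longlonglongrightarrow> a x * \<Phi> x + b x \<bullet> D x"
   using limP limQ by (intro AE_I2 tendsto_intros) auto
  show "AE x in annM. norm (a x * P n x + b x \<bullet> Q n x) <= ?w x" for n
  proof (rule AE_I2)
   fix x assume "x \<in> space annM"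
   then have x: "x \<in> annulus" by simp
   have "\<bar>a x * P n x\<bar> <= C * \<bar>a x\<bar>"
    using mult_right_mono[OF bdP[OF x, of n] abs_ge_zero[of "a x"]] by (simp add: abs_mult mult.commute)
   moreover have "\<bar>b x \<bullet> Q n x\<bar> <= 9 * C * norm (b x)"
    using Cauchy_Schwarz_ineq2[of "b x" "Q n x"] mult_left_mono[OF bdQ[OF x, of n], of "norm (b x)"]
    by (simp add: mult.commute)
   ultimately show "norm (a x * P n x + b x \<bullet> Q n x) <= ?w x" by simp
  qed
 qed
 moreover have "(\<lambda>n. LINT x|annM. a x * P n x + b x \<bullet> Q n x) = (\<lambda>n. 0)" using key by simp
 ultimately show ?thesis by (simp only: LIMSEQ_const_iff)
qed

lemma set_integral_annM: "(LINT x:annulus|lebesgue. f x) = integral\<^sup>L annM (f :: real^2 => 'a::euclidean_space)"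
 using annulus_lmeasurable by (simp add: set_lebesgue_integral_def integral_restrict_space)

lemma absolutely_integrable_annM: "(f :: real^2 => 'a::euclidean_space) absolutely_integrable_on annulus \<longleftrightarrow> integrable annM f"
 using annulus_lmeasurable by (simp add: set_integrable_def integrable_restrict_space)

lemma integrable_annM_bounded_mult:
 fixes f g :: "real^2 => real"
 assumes f: "integrable annM f" and g: "g \<in> borel_measurable annM" "\<And>x. x \<in> annulus ==> \<bar>g x\<bar> <= C"
 shows "integrable annM (\<lambda>x. f x * g x)"
proof (rule Bochner_Integration.integrable_bound[OF integrable_mult_right[OF integrable_abs[OF f], of C]])
 show "(\<lambda>x. f x * g x) \<in> borel_measurable annM" using f g by measurable
 show "AE x in annM. norm (f x * g x) <= norm (C * \<bar>f x\<bar>)"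
 proof (rule AE_I2)
  fix x assume "x \<in> space annM"
  then have "\<bar>g x\<bar> <= \<bar>C\<bar>" using g(2)[of x] by simp
  then show "norm (f x * g x) <= norm (C * \<bar>f x\<bar>)"
   using mult_left_mono[of "\<bar>g x\<bar>" "\<bar>C\<bar>" "\<bar>f x\<bar>"] by (simp add: abs_mult mult.commute)
 qed
qed

lemma test_function_gderiv:
 assumes "test_function S \<phi>"
 shows "GDERIV \<phi> x :> grad \<phi> x"
proof -
 have "\<forall>bs x. set bs \<subseteq> Basis \<longrightarrow> foldr partial_deriv bs \<phi> differentiable (at x)"
  using assms by (simp add: test_function_def smooth_def)
 from this[rule_format, of "[]" x] have "\<phi> differentiable (at x)" by simp
 then have d: "(\<phi> has_derivative frechet_derivative \<phi> (at x)) (at x)" by (simp add: frechet_derivative_works)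
 interpret bounded_linear "frechet_derivative \<phi> (at x)" using d by (rule has_derivative_bounded_linear)
 have "frechet_derivative \<phi> (at x) h = h \<bullet> grad \<phi> x" for h
 proof -
  have "frechet_derivative \<phi> (at x) h = frechet_derivative \<phi> (at x) (\<Sum>b\<in>Basis. (h \<bullet> b) *\<^sub>R b)"
   by (simp add: euclidean_representation)
  also have "... = h \<bullet> grad \<phi> x"
   by (simp add: sum scaleR grad_def partial_deriv_def inner_sum_right mult.commute)
  finally show ?thesis .
 qed
 then have "frechet_derivative \<phi> (at x) = (\<lambda>h. h \<bullet> grad \<phi> x)" by (rule ext)
 with d show ?thesis by (simp add: gderiv_def)
qed

lemma test_function_support:
 assumes "test_function S \<phi>"
 shows "compact (closure {x. \<phi> x \<noteq> 0})" "closure {x. \<phi> x \<noteq> 0} \<subseteq> S" "\<And>x. x \<notin> closure {x. \<phi> x \<noteq> 0} ==> \<phi> x = 0"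
proof -
 show "compact (closure {x. \<phi> x \<noteq> 0})" "closure {x. \<phi> x \<noteq> 0} \<subseteq> S"
  using assms unfolding test_function_def by blast+
 show "\<phi> x = 0" if "x \<notin> closure {x. \<phi> x \<noteq> 0}" for x
  using that closure_subset[of "{x. \<phi> x \<noteq> 0}"] by blast
qed

lemma test_function_partial:
 assumes "test_function S \<phi>" "b \<in> Basis"
 shows "test_function S (partial_deriv b \<phi>)"
proof -
 let ?K = "closure {x. \<phi> x \<noteq> 0}"
 note K = test_function_support[OF assms(1)]
 have "partial_deriv b \<phi> x = 0" if "x \<notin> ?K" for x
  using gderiv_zero_off_compact[OF K(1,3) test_function_gderiv[OF assms(1)] that]
   gderiv_partial_deriv[OF test_function_gderiv[OF assms(1)], of b x] by simp
 then have sub: "closure {x. partial_deriv b \<phi> x \<noteq> 0} \<subseteq> ?K"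
  by (intro closure_minimal) auto
 have "smooth (partial_deriv b \<phi>)"
  unfolding smooth_def
 proof (intro allI impI)
  fix bs :: "'a list" and x assume "set bs \<subseteq> Basis"
  then have "set (bs @ [b]) \<subseteq> Basis" using assms(2) by auto
  then have "foldr partial_deriv (bs @ [b]) \<phi> differentiable (at x)"
   using assms(1) unfolding test_function_def smooth_def by blast
  then show "foldr partial_deriv bs (partial_deriv b \<phi>) differentiable (at x)" by simp
 qed
 then show ?thesis
  using sub K(1,2) unfolding test_function_def
  by (meson bounded_subset closed_closure compact_eq_bounded_closed order_trans)
qed

lemma test_function_continuous:
 assumes "test_function S \<phi>"
 shows "continuous_on A \<phi>" "continuous_on A (grad \<phi>)"
proof -
 show c: "continuous_on A \<phi>" for A
  using test_function_gderiv[OF assms] by (rule gderiv_continuous_on)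
 have "continuous_on A (partial_deriv b \<phi>)" if "b \<in> Basis" for b
  using test_function_gderiv[OF test_function_partial[OF assms that]] by (rule gderiv_continuous_on)
 then show "continuous_on A (grad \<phi>)"
  unfolding grad_def[abs_def] by (intro continuous_intros) auto
qed

lemma test_function_bounded:
 assumes "test_function S \<phi>"
 obtains C where "\<And>x. \<bar>\<phi> x\<bar> <= C" "\<And>x. norm (grad \<phi> x) <= C"
proof -
 let ?K = "closure {x. \<phi> x \<noteq> 0}"
 note K = test_function_support(1,3)[OF assms]
 have D0: "grad \<phi> x = 0" if "x \<notin> ?K" for x
  by (rule gderiv_zero_off_compact[OF K test_function_gderiv[OF assms] that])
 have "bounded (\<phi> ` ?K)" "bounded (grad \<phi> ` ?K)"
  by (intro compact_imp_bounded compact_continuous_image K test_function_continuous[OF assms])+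
 then obtain C1 C2 where C: "\<And>x. x \<in> ?K ==> norm (\<phi> x) <= C1" "\<And>x. x \<in> ?K ==> norm (grad \<phi> x) <= C2"
  unfolding bounded_iff by blast
 have "\<bar>\<phi> x\<bar> <= max 0 (max C1 C2)" "norm (grad \<phi> x) <= max 0 (max C1 C2)" for x
  using C[of x] K(2)[of x] D0[of x] by (cases "x \<in> ?K"; force)+
 then show ?thesis using that by blast
qed

lemma test_times_field_integral:
 assumes \<phi>: "test_function annulus \<phi>"
  and Y: "\<And>x. x \<in> annulus ==> GDERIV Y x :> Z x" "\<And>x. x \<in> annulus ==> \<bar>Y x\<bar> <= C" "\<And>x. x \<in> annulus ==> norm (Z x) <= C"
 shows "(LINT x|annM. \<phi> x * (Z x \<bullet> b) + Y x * (grad \<phi> x \<bullet> b)) = 0"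
proof -
 let ?K = "closure {x. \<phi> x \<noteq> 0}"
 note K = test_function_support[OF \<phi>]
 have D0: "grad \<phi> x = 0" if "x \<notin> ?K" for x
  by (rule gderiv_zero_off_compact[OF K(1,3) test_function_gderiv[OF \<phi>] that])
 obtain B where B: "\<And>x. \<bar>\<phi> x\<bar> <= B" "\<And>x. norm (grad \<phi> x) <= B" using test_function_bounded[OF \<phi>] by blast
 have B0: "B >= 0" using B(1)[of 0] by linarith
 have C0: "C >= 0" if "x \<in> annulus" for x using Y(2)[OF that] by linarith
 define Q where "Q x = (if x \<in> annulus then \<phi> x *\<^sub>R Z x + Y x *\<^sub>R grad \<phi> x else 0)" for x
 have g: "GDERIV (\<lambda>x. \<phi> x * Y x) x :> Q x" for x
 proof (cases "x \<in> annulus")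
  case True
  then show ?thesis
   using GDERIV_mult[OF test_function_gderiv[OF \<phi>] Y(1)[OF True]] by (simp add: Q_def)
 next
  case False
  then have xK: "x \<in> - ?K" using K(2) by auto
  have o: "open (- ?K)" by (intro open_Compl closed_closure)
  have z: "((\<lambda>x. 0) has_derivative (\<lambda>h. 0)) (at x)" by simp
  have "((\<lambda>x. \<phi> x * Y x) has_derivative (\<lambda>h. 0)) (at x)"
   by (rule has_derivative_transform_within_open[OF z o xK]) (metis ComplD K(3) mult_zero_left)
  then show ?thesis using False by (simp add: gderiv_def Q_def)
 qed
 have bd: "norm (Q x) <= B * \<bar>C\<bar> + \<bar>C\<bar> * B" for x
 proof (cases "x \<in> annulus")
  case True
  have "norm (\<phi> x *\<^sub>R Z x) <= B * \<bar>C\<bar>" "norm (Y x *\<^sub>R grad \<phi> x) <= \<bar>C\<bar> * B"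
   using B[of x] B0 Y(2,3)[OF True] by (auto intro!: mult_mono)
  then show ?thesis using True norm_triangle_ineq[of "\<phi> x *\<^sub>R Z x" "Y x *\<^sub>R grad \<phi> x"]
   unfolding Q_def if_P[OF True] by linarith
 qed (simp add: Q_def B0)
 have far: "\<phi> x * Y x = 0" if "norm x > 1" for x
 proof -
  have "x \<notin> annulus" using annulus_norm[of x] that by auto
  then have "x \<notin> ?K" using K(2) by blast
  from K(3)[OF this] show ?thesis by simp
 qed
 have 0: "(LINT x|lborel. Q x \<bullet> b) = 0"
  by (rule integral_gderiv_zero(2)[OF g bd far])
 have "integrable lborel (\<lambda>x. Q x \<bullet> b)"
  by (rule integral_gderiv_zero(1)[OF g bd far])
 then have "(LINT x|lebesgue. Q x \<bullet> b) = 0" using 0 by (subst integral_completion) auto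
 moreover have "(LINT x|annM. \<phi> x * (Z x \<bullet> b) + Y x * (grad \<phi> x \<bullet> b)) = (LINT x|lebesgue. Q x \<bullet> b)"
  using annulus_lmeasurable
  by (subst integral_restrict_space) (auto simp: Q_def inner_add_left intro!: Bochner_Integration.integral_cong)
 ultimately show ?thesis by simp
qed

text \<open>Closing the class under pointwise limits with a common constant admits singular
  potentials as limits of regularised ones. Continuity of the limit gradient is replaced by
  measurability and the uniform bound, which is all that dominated convergence asks for.\<close>

definition C1_limit :: "(real^2 => real) => (real^2 => real^2) => real => bool" where
 "C1_limit \<Phi> D C \<longleftrightarrow> (\<exists>\<Phi>n Dn. (\<forall>n. C1_collar (\<Phi>n n) (Dn n) C) \<and>
   (\<forall>x\<in>annulus. (\<lambda>n. \<Phi>n n x) \<longlonglongrightarrow> \<Phi> x \<and> (\<lambda>n. Dn n x) \<longlonglongrightarrow> D x))"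

lemma C1_collar_imp_limit: "C1_collar \<Phi> D C ==> C1_limit \<Phi> D C"
 unfolding C1_limit_def by (intro exI[of _ "\<lambda>_. \<Phi>"] exI[of _ "\<lambda>_. D"]) auto

lemma annulus_nonempty: "(3/4) *\<^sub>R axis 1 1 \<in> annulus"
 by (simp add: annulus_iff inner_axis_axis)

lemma C1_collar_measurable:
 assumes "C1_collar \<Phi> D C"
 shows "\<Phi> \<in> borel_measurable annM" "D \<in> borel_measurable annM"
 using assms gderiv_continuous_on[of annulus \<Phi> D]
 by (auto simp: C1_collar_def intro!: continuous_on_annM_measurable)

lemma C1_collar_bound:
 assumes "C1_collar \<Phi> D C"
 shows "C >= 0" "\<And>x. x \<in> annulus ==> \<bar>\<Phi> x\<bar> <= C"
proof -
 show "C >= 0"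
  using assms annulus_nonempty norm_ge_zero order_trans unfolding C1_collar_def by blast
 then show "\<bar>\<Phi> x\<bar> <= C" if "x \<in> annulus" for x
  using assms that collar_le[OF that] mult_left_mono[of "collar x" 1 C] unfolding C1_collar_def by force
qed

lemma C1_limit_facts:
 assumes "C1_limit \<Phi> D C"
 shows "C >= 0" "\<And>x. x \<in> annulus ==> \<bar>\<Phi> x\<bar> <= C * collar x" "\<And>x. x \<in> annulus ==> \<bar>\<Phi> x\<bar> <= C"
  "\<And>x. x \<in> annulus ==> norm (D x) <= C"
  "\<Phi> \<in> borel_measurable annM" "D \<in> borel_measurable annM"
proof -
 obtain \<Phi>n Dn where n: "\<And>n. C1_collar (\<Phi>n n) (Dn n) C"
  and lim: "\<And>x. x \<in> annulus ==> (\<lambda>n. \<Phi>n n x) \<longlonglongrightarrow> \<Phi> x" "\<And>x. x \<in> annulus ==> (\<lambda>n. Dn n x) \<longlonglongrightarrow> D x"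
  using assms unfolding C1_limit_def by blast
 show "C >= 0" using C1_collar_bound(1)[OF n] .
 show "\<bar>\<Phi> x\<bar> <= C * collar x" if "x \<in> annulus" for x
  by (rule LIMSEQ_le_const2[OF tendsto_rabs[OF lim(1)[OF that]]]) (use n that in \<open>auto simp: C1_collar_def\<close>)
 show "\<bar>\<Phi> x\<bar> <= C" if "x \<in> annulus" for x
  by (rule LIMSEQ_le_const2[OF tendsto_rabs[OF lim(1)[OF that]]]) (use C1_collar_bound(2)[OF n that] in auto)
 show "norm (D x) <= C" if "x \<in> annulus" for x
  by (rule LIMSEQ_le_const2[OF tendsto_norm[OF lim(2)[OF that]]]) (use n that in \<open>auto simp: C1_collar_def\<close>)
 show "\<Phi> \<in> borel_measurable annM"
  by (rule borel_measurable_LIMSEQ_metric[OF C1_collar_measurable(1)[OF n]]) (use lim in auto)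
 show "D \<in> borel_measurable annM"
  by (rule borel_measurable_LIMSEQ_metric[OF C1_collar_measurable(2)[OF n]]) (use lim in auto)
qed

lemma weak_identity_C1_limit:
 assumes a: "integrable annM a" and b: "integrable annM b"
  and test: "\<And>\<phi>. test_function annulus \<phi> ==> (LINT x|annM. a x * \<phi> x + b x \<bullet> grad \<phi> x) = 0"
  and \<Phi>: "C1_limit \<Phi> D C"
 shows "(LINT x|annM. a x * \<Phi> x + b x \<bullet> D x) = 0"
proof -
 obtain \<Phi>n Dn where n: "\<And>n. C1_collar (\<Phi>n n) (Dn n) C"
  and lim: "\<And>x. x \<in> annulus ==> (\<lambda>n. \<Phi>n n x) \<longlonglongrightarrow> \<Phi> x" "\<And>x. x \<in> annulus ==> (\<lambda>n. Dn n x) \<longlonglongrightarrow> D x"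
  using \<Phi> unfolding C1_limit_def by blast
 note m = C1_limit_facts(5,6)[OF \<Phi>] C1_collar_measurable[OF n]
 have "(\<lambda>n. LINT x|annM. a x * \<Phi>n n x + b x \<bullet> Dn n x) \<longlonglongrightarrow> (LINT x|annM. a x * \<Phi> x + b x \<bullet> D x)"
 proof (rule integral_dominated_convergence[where w="\<lambda>x. C * \<bar>a x\<bar> + C * norm (b x)"])
  show "(\<lambda>x. a x * \<Phi> x + b x \<bullet> D x) \<in> borel_measurable annM" using a b m by measurable
  show "(\<lambda>x. a x * \<Phi>n n x + b x \<bullet> Dn n x) \<in> borel_measurable annM" for n using a b m(3,4)[of n] by measurable
  show "integrable annM (\<lambda>x. C * \<bar>a x\<bar> + C * norm (b x))" using a b by auto
  show "AE x in annM. (\<lambda>n. a x * \<Phi>n n x + b x \<bullet> Dn n x) \<longlonglongrightarrow> a x * \<Phi> x + b x \<bullet> D x"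
   using lim by (intro AE_I2 tendsto_intros) auto
  show "AE x in annM. norm (a x * \<Phi>n n x + b x \<bullet> Dn n x) <= C * \<bar>a x\<bar> + C * norm (b x)" for n
  proof (rule AE_I2)
   fix x assume "x \<in> space annM"
   then have x: "x \<in> annulus" by simp
   have "\<bar>a x * \<Phi>n n x\<bar> <= C * \<bar>a x\<bar>"
    using mult_right_mono[OF C1_collar_bound(2)[OF n x, of n] abs_ge_zero[of "a x"]] by (simp add: abs_mult mult.commute)
   moreover have "\<bar>b x \<bullet> Dn n x\<bar> <= C * norm (b x)"
   proof -
    have "norm (Dn n x) <= C" using n[of n] x by (simp add: C1_collar_def)
    then show ?thesis
     using Cauchy_Schwarz_ineq2[of "b x" "Dn n x"] mult_left_mono[of "norm (Dn n x)" C "norm (b x)"]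
     by (simp add: mult.commute)
   qed
   ultimately show "norm (a x * \<Phi>n n x + b x \<bullet> Dn n x) <= C * \<bar>a x\<bar> + C * norm (b x)" by simp
  qed
 qed
 moreover have "(\<lambda>n. LINT x|annM. a x * \<Phi>n n x + b x \<bullet> Dn n x) = (\<lambda>n. 0)"
  using weak_identity_C1_collar[OF a b test n] by simp
 ultimately show ?thesis by (simp only: LIMSEQ_const_iff)
qed

lemma C1_limit_diff:
 assumes "C1_limit \<Phi> D C" "C1_limit \<Psi> E C'"
 shows "C1_limit (\<lambda>x. \<Phi> x - \<Psi> x) (\<lambda>x. D x - E x) (C + C')"
proof -
 obtain \<Phi>n Dn where 1: "\<And>n. C1_collar (\<Phi>n n) (Dn n) C"
  "\<And>x. x \<in> annulus ==> (\<lambda>n. \<Phi>n n x) \<longlonglongrightarrow> \<Phi> x" "\<And>x. x \<in> annulus ==> (\<lambda>n. Dn n x) \<longlonglongrightarrow> D x"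
  using assms(1) unfolding C1_limit_def by blast
 obtain \<Psi>n En where 2: "\<And>n. C1_collar (\<Psi>n n) (En n) C'"
  "\<And>x. x \<in> annulus ==> (\<lambda>n. \<Psi>n n x) \<longlonglongrightarrow> \<Psi> x" "\<And>x. x \<in> annulus ==> (\<lambda>n. En n x) \<longlonglongrightarrow> E x"
  using assms(2) unfolding C1_limit_def by blast
 have "C1_collar (\<lambda>x. \<Phi>n n x - \<Psi>n n x) (\<lambda>x. Dn n x - En n x) (C + C')" for n
  unfolding C1_collar_def
 proof (intro conjI ballI)
  show "continuous_on annulus (\<lambda>x. Dn n x - En n x)"
   using 1(1)[of n] 2(1)[of n] by (auto simp: C1_collar_def intro!: continuous_intros)
  fix x assume x: "x \<in> annulus"
  show "GDERIV (\<lambda>x. \<Phi>n n x - \<Psi>n n x) x :> Dn n x - En n x"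
   using 1(1)[of n] 2(1)[of n] x by (intro GDERIV_diff) (auto simp: C1_collar_def)
  show "\<bar>\<Phi>n n x - \<Psi>n n x\<bar> <= (C + C') * collar x"
   using 1(1)[of n] 2(1)[of n] x abs_triangle_ineq4[of "\<Phi>n n x" "\<Psi>n n x"] by (force simp: C1_collar_def distrib_right)
  show "norm (Dn n x - En n x) <= C + C'"
   using 1(1)[of n] 2(1)[of n] x norm_triangle_ineq4[of "Dn n x" "En n x"] by (force simp: C1_collar_def)
 qed
 then show ?thesis unfolding C1_limit_def
  using 1(2,3) 2(2,3)
  by (intro exI[of _ "\<lambda>n x. \<Phi>n n x - \<Psi>n n x"] exI[of _ "\<lambda>n x. Dn n x - En n x"]) (auto intro!: tendsto_diff)
qed

text \<open>From \<open>F 0 = 0\<close> and the bound on \<open>F'\<close> over the range of the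
  function, \<open>F\<close> is at most \<open>B\<close> times its argument, so linear vanishing at
  the boundary survives.\<close>

lemma C1_limit_compose:
 assumes \<Phi>: "C1_limit \<Phi> D C"
  and F: "F 0 = 0" "\<And>s. (F has_real_derivative F' s) (at s)" "continuous_on UNIV F'" "\<And>s. \<bar>s\<bar> <= C ==> \<bar>F' s\<bar> <= B"
 shows "C1_limit (\<lambda>x. F (\<Phi> x)) (\<lambda>x. F' (\<Phi> x) *\<^sub>R D x) (B * C)"
proof -
 obtain \<Phi>n Dn where 1: "\<And>n. C1_collar (\<Phi>n n) (Dn n) C"
  "\<And>x. x \<in> annulus ==> (\<lambda>n. \<Phi>n n x) \<longlonglongrightarrow> \<Phi> x" "\<And>x. x \<in> annulus ==> (\<lambda>n. Dn n x) \<longlonglongrightarrow> D x"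
  using \<Phi> unfolding C1_limit_def by blast
 have C0: "C >= 0" by (rule C1_limit_facts(1)[OF \<Phi>])
 have B0: "B >= 0" using F(4)[of 0] C0 by linarith
 have Fb: "\<bar>F s\<bar> <= B * \<bar>s\<bar>" if "\<bar>s\<bar> <= C" for s
 proof -
  have "norm (F s - F 0) <= B * norm (s - 0)"
  proof (rule field_differentiable_bound[of "{-C..C}"])
   show "(F has_field_derivative F' z) (at z within {-C..C})" for z using F(2) by (rule DERIV_subset) simp
   show "norm (F' z) <= B" if "z \<in> {-C..C}" for z using F(4)[of z] that by auto
  qed (use that C0 in auto)
  then show ?thesis using F(1) by simp
 qed
 have "C1_collar (\<lambda>x. F (\<Phi>n n x)) (\<lambda>x. F' (\<Phi>n n x) *\<^sub>R Dn n x) (B * C)" for n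
  unfolding C1_collar_def
 proof (intro conjI ballI)
  have "continuous_on annulus (\<Phi>n n)" using 1(1)[of n] by (intro gderiv_continuous_on) (auto simp: C1_collar_def)
  then show "continuous_on annulus (\<lambda>x. F' (\<Phi>n n x) *\<^sub>R Dn n x)"
   using 1(1)[of n] by (auto simp: C1_collar_def intro!: continuous_intros continuous_on_compose2[OF F(3)])
  fix x assume x: "x \<in> annulus"
  have b: "\<bar>\<Phi>n n x\<bar> <= C" by (rule C1_collar_bound(2)[OF 1(1) x])
  show "GDERIV (\<lambda>x. F (\<Phi>n n x)) x :> F' (\<Phi>n n x) *\<^sub>R Dn n x"
   using 1(1)[of n] x by (intro GDERIV_DERIV_compose F(2)) (auto simp: C1_collar_def)
  have "\<bar>F (\<Phi>n n x)\<bar> <= B * \<bar>\<Phi>n n x\<bar>" using Fb[OF b] .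
  also have "... <= B * (C * collar x)" using 1(1)[of n] x B0 by (intro mult_left_mono) (auto simp: C1_collar_def)
  finally show "\<bar>F (\<Phi>n n x)\<bar> <= B * C * collar x" by (simp add: mult.assoc)
  show "norm (F' (\<Phi>n n x) *\<^sub>R Dn n x) <= B * C"
   using 1(1)[of n] x B0 F(4)[OF b] by (auto simp: C1_collar_def intro!: mult_mono)
 qed
 moreover have "(\<lambda>n. F (\<Phi>n n x)) \<longlonglongrightarrow> F (\<Phi> x)" "(\<lambda>n. F' (\<Phi>n n x) *\<^sub>R Dn n x) \<longlonglongrightarrow> F' (\<Phi> x) *\<^sub>R D x" if x: "x \<in> annulus" for x
 proof -
  have "isCont F (\<Phi> x)" using F(2) by (rule DERIV_isCont)
  then show "(\<lambda>n. F (\<Phi>n n x)) \<longlonglongrightarrow> F (\<Phi> x)" using 1(2)[OF x] by (rule isCont_tendsto_compose)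
  have "isCont F' (\<Phi> x)" using F(3) by (simp add: continuous_on_eq_continuous_at)
  then show "(\<lambda>n. F' (\<Phi>n n x) *\<^sub>R Dn n x) \<longlonglongrightarrow> F' (\<Phi> x) *\<^sub>R D x"
   by (rule tendsto_scaleR[OF isCont_tendsto_compose[OF _ 1(2)[OF x]] 1(3)[OF x]])
 qed
 ultimately show ?thesis unfolding C1_limit_def
  by (intro exI[of _ "\<lambda>n x. F (\<Phi>n n x)"] exI[of _ "\<lambda>n x. F' (\<Phi>n n x) *\<^sub>R Dn n x"]) auto
qed

text \<open>The gradient \<open>Z\<close> may blow up like the inverse of \<open>collar\<close>,
  because it is multiplied by a function of order \<open>collar\<close>. This admits the weighted
  virial field, whose derivatives may be singular at \<open>x0\<close>.\<close>

lemma C1_limit_mult: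
 assumes \<Phi>: "C1_limit \<Phi> D C"
  and Y: "\<And>x. x \<in> annulus ==> GDERIV Y x :> Z x" "continuous_on annulus Z"
   "\<And>x. x \<in> annulus ==> \<bar>Y x\<bar> <= B" "\<And>x. x \<in> annulus ==> collar x * norm (Z x) <= B"
 shows "C1_limit (\<lambda>x. Y x * \<Phi> x) (\<lambda>x. Y x *\<^sub>R D x + \<Phi> x *\<^sub>R Z x) (2 * B * C)"
proof -
 obtain \<Phi>n Dn where 1: "\<And>n. C1_collar (\<Phi>n n) (Dn n) C"
  "\<And>x. x \<in> annulus ==> (\<lambda>n. \<Phi>n n x) \<longlonglongrightarrow> \<Phi> x" "\<And>x. x \<in> annulus ==> (\<lambda>n. Dn n x) \<longlonglongrightarrow> D x"
  using \<Phi> unfolding C1_limit_def by blast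
 have C0: "C >= 0" by (rule C1_limit_facts(1)[OF \<Phi>])
 have B0: "B >= 0" using Y(3)[OF annulus_nonempty] by linarith
 have "C1_collar (\<lambda>x. Y x * \<Phi>n n x) (\<lambda>x. Y x *\<^sub>R Dn n x + \<Phi>n n x *\<^sub>R Z x) (2 * B * C)" for n
  unfolding C1_collar_def
 proof (intro conjI ballI)
  have "continuous_on annulus (\<Phi>n n)" using 1(1)[of n] by (intro gderiv_continuous_on) (auto simp: C1_collar_def)
  then show "continuous_on annulus (\<lambda>x. Y x *\<^sub>R Dn n x + \<Phi>n n x *\<^sub>R Z x)"
   using 1(1)[of n] Y(2) gderiv_continuous_on[OF Y(1)] by (auto simp: C1_collar_def intro!: continuous_intros)
  fix x assume x: "x \<in> annulus"
  have h: "\<bar>\<Phi>n n x\<bar> <= C * collar x" "norm (Dn n x) <= C" "collar x > 0"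
   using 1(1)[of n] x by (auto simp: C1_collar_def annulus_collar)
  show "GDERIV (\<lambda>x. Y x * \<Phi>n n x) x :> Y x *\<^sub>R Dn n x + \<Phi>n n x *\<^sub>R Z x"
   using 1(1)[of n] x by (intro GDERIV_mult Y) (auto simp: C1_collar_def)
  have "\<bar>Y x * \<Phi>n n x\<bar> <= B * (C * collar x)"
   unfolding abs_mult using Y(3)[OF x] h B0 by (intro mult_mono) auto
  also have "... <= 2 * (B * (C * collar x))"
   using B0 C0 h by simp
  finally show "\<bar>Y x * \<Phi>n n x\<bar> <= 2 * B * C * collar x" by (simp add: mult_ac)
  have "norm (Y x *\<^sub>R Dn n x) <= B * C" using Y(3)[OF x] h B0 by (auto intro!: mult_mono)
  moreover have "norm (\<Phi>n n x *\<^sub>R Z x) <= (C * collar x) * norm (Z x)" using h by (simp add: mult_right_mono)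
  moreover have "C * (collar x * norm (Z x)) <= C * B" using Y(4)[OF x] C0 by (rule mult_left_mono)
  ultimately show "norm (Y x *\<^sub>R Dn n x + \<Phi>n n x *\<^sub>R Z x) <= 2 * B * C"
   using norm_triangle_ineq[of "Y x *\<^sub>R Dn n x" "\<Phi>n n x *\<^sub>R Z x"] by (simp add: mult_ac)
 qed
 then show ?thesis unfolding C1_limit_def
  using 1(2,3)
  by (intro exI[of _ "\<lambda>n x. Y x * \<Phi>n n x"] exI[of _ "\<lambda>n x. Y x *\<^sub>R Dn n x + \<Phi>n n x *\<^sub>R Z x"])
    (auto intro!: tendsto_intros)
qed

lemma C1_limit_parts:
 assumes \<Phi>: "C1_limit \<Phi> D C"
  and Y: "\<And>x. x \<in> annulus ==> GDERIV Y x :> Z x" "Z \<in> borel_measurable annM"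
   "\<And>x. x \<in> annulus ==> \<bar>Y x\<bar> <= B" "\<And>x. x \<in> annulus ==> norm (Z x) <= B"
 shows "(LINT x|annM. (Z x \<bullet> b) * \<Phi> x + Y x * (D x \<bullet> b)) = 0"
proof -
 have Ym: "Y \<in> borel_measurable annM" using gderiv_continuous_on[OF Y(1)] by (rule continuous_on_annM_measurable)
 have "integrable annM Z" by (rule integrable_annM_bounded[OF Y(2,4)])
 then have i1: "integrable annM (\<lambda>x. Z x \<bullet> b)" by auto
 have "integrable annM Y" by (rule integrable_annM_bounded[OF Ym]) (use Y(3) in auto)
 then have i2: "integrable annM (\<lambda>x. Y x *\<^sub>R b)" by auto
 have cb: "(Y x *\<^sub>R b) \<bullet> z = Y x * (z \<bullet> b)" for x z by (simp add: inner_commute)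
 have t: "(LINT x|annM. (Z x \<bullet> b) * \<phi> x + (Y x *\<^sub>R b) \<bullet> grad \<phi> x) = 0" if "test_function annulus \<phi>" for \<phi>
  using test_times_field_integral[OF that Y(1,3,4), of b] unfolding cb by (simp add: mult.commute)
 have "(LINT x|annM. (Z x \<bullet> b) * \<Phi> x + (Y x *\<^sub>R b) \<bullet> D x) = 0"
  by (rule weak_identity_C1_limit[OF i1 i2 t \<Phi>])
 then show ?thesis unfolding cb .
qed

text \<open>Integration by parts against all bounded \<open>C\<^sup>1\<close> functions, without boundary term: the common
 property of test functions, of \<open>W\<^sub>0\<^sup>1\<^sup>,\<^sup>1\<close> functions and of \<open>C1_limit\<close> functions.\<close>

definition zero_trace :: "(real^2 => real) => (real^2 => real^2) => bool" where
 "zero_trace w D \<longleftrightarrow> integrable annM w \<and> integrable annM D \<and>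
   (\<forall>Y Z B b. (\<forall>x\<in>annulus. (GDERIV Y x :> Z x) \<and> \<bar>Y x\<bar> <= B \<and> norm (Z x) <= B) \<and> Z \<in> borel_measurable annM \<longrightarrow>
    (LINT x|annM. (Z x \<bullet> b) * w x + Y x * (D x \<bullet> b)) = 0)"

lemma test_function_integrable:
 assumes "test_function annulus \<phi>"
 shows "integrable annM \<phi>" "integrable annM (grad \<phi>)"
proof -
 obtain C where "\<And>x. \<bar>\<phi> x\<bar> <= C" "\<And>x. norm (grad \<phi> x) <= C" using test_function_bounded[OF assms] by blast
 then show "integrable annM \<phi>" "integrable annM (grad \<phi>)"
  by (auto intro!: integrable_annM_bounded[where C=C] continuous_on_annM_measurable test_function_continuous[OF assms])
qed

lemma integrable_mult_test:
 assumes "integrable annM f" "test_function annulus \<phi>"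
 shows "integrable annM (\<lambda>x. f x * \<phi> x)"
 using test_function_bounded[OF assms(2)]
  integrable_annM_bounded_mult[OF assms(1) borel_measurable_integrable[OF test_function_integrable(1)[OF assms(2)]]] by metis

lemma zero_trace_test:
 assumes \<phi>: "test_function annulus \<phi>"
 shows "zero_trace \<phi> (grad \<phi>)"
 unfolding zero_trace_def
proof (intro conjI allI impI test_function_integrable[OF \<phi>])
 fix Y Z B b
 assume h: "(\<forall>x\<in>annulus. (GDERIV Y x :> Z x) \<and> \<bar>Y x\<bar> <= B \<and> norm (Z x) <= B) \<and> Z \<in> borel_measurable annM"
 have "(LINT x|annM. \<phi> x * (Z x \<bullet> b) + Y x * (grad \<phi> x \<bullet> b)) = 0"
  by (rule test_times_field_integral[OF \<phi>]) (use h in auto)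
 then show "(LINT x|annM. (Z x \<bullet> b) * \<phi> x + Y x * (grad \<phi> x \<bullet> b)) = 0" by (simp only: mult.commute)
qed

lemma C1_limit_zero_trace:
 assumes "C1_limit \<Phi> D C"
 shows "zero_trace \<Phi> D"
proof -
 note f = C1_limit_facts[OF assms]
 have "integrable annM \<Phi>" by (rule integrable_annM_bounded[OF f(5)]) (use f(3) in auto)
 moreover have "integrable annM D" by (rule integrable_annM_bounded[OF f(6,4)])
 ultimately show ?thesis unfolding zero_trace_def using C1_limit_parts[OF assms] by blast
qed

lemma zero_trace_divergence:
 assumes w: "zero_trace w D"
  and H: "\<And>i x. i \<in> Basis ==> x \<in> annulus ==> GDERIV (\<lambda>x. Z x \<bullet> i) x :> H i x"
   "\<And>i. i \<in> Basis ==> H i \<in> borel_measurable annM"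
   "\<And>i x. i \<in> Basis ==> x \<in> annulus ==> \<bar>Z x \<bullet> i\<bar> <= B" "\<And>i x. i \<in> Basis ==> x \<in> annulus ==> norm (H i x) <= B"
 shows "integrable annM (\<lambda>x. w x * (\<Sum>i\<in>Basis. H i x \<bullet> i))" "integrable annM (\<lambda>x. Z x \<bullet> D x)"
  "(LINT x|annM. Z x \<bullet> D x) = - (LINT x|annM. w x * (\<Sum>i\<in>Basis. H i x \<bullet> i))"
proof -
 have iw: "integrable annM w" and iD: "integrable annM (\<lambda>x. D x \<bullet> i)" for i using w unfolding zero_trace_def by auto
 have i1: "integrable annM (\<lambda>x. w x * (H i x \<bullet> i))" and i2: "integrable annM (\<lambda>x. (D x \<bullet> i) * (Z x \<bullet> i))"
  if i: "i \<in> Basis" for i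
 proof -
  have "\<bar>H i x \<bullet> i\<bar> <= B" if "x \<in> annulus" for x using Basis_le_norm[OF i] H(4)[OF i that] by (rule order_trans)
  then show "integrable annM (\<lambda>x. w x * (H i x \<bullet> i))"
   using H(2)[OF i] by (intro integrable_annM_bounded_mult[OF iw]) auto
  show "integrable annM (\<lambda>x. (D x \<bullet> i) * (Z x \<bullet> i))"
   by (rule integrable_annM_bounded_mult[OF iD continuous_on_annM_measurable[OF gderiv_continuous_on[OF H(1)[OF i]]] H(3)[OF i]])
 qed
 have 0: "(LINT x|annM. w x * (H i x \<bullet> i) + (D x \<bullet> i) * (Z x \<bullet> i)) = 0" if i: "i \<in> Basis" for i
 proof -
  have "(\<forall>x\<in>annulus. (GDERIV (\<lambda>x. Z x \<bullet> i) x :> H i x) \<and> \<bar>Z x \<bullet> i\<bar> <= B \<and> norm (H i x) <= B) \<and> H i \<in> borel_measurable annM"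
   using H i by blast
  then have "(LINT x|annM. (H i x \<bullet> i) * w x + (Z x \<bullet> i) * (D x \<bullet> i)) = 0"
   using w unfolding zero_trace_def by blast
  then show ?thesis by (simp only: mult.commute)
 qed
 have e: "Z x \<bullet> D x = (\<Sum>i\<in>Basis. (D x \<bullet> i) * (Z x \<bullet> i))" for x
  by (subst inner_commute) (rule euclidean_inner)
 show "integrable annM (\<lambda>x. w x * (\<Sum>i\<in>Basis. H i x \<bullet> i))" "integrable annM (\<lambda>x. Z x \<bullet> D x)"
  unfolding sum_distrib_left e by (intro Bochner_Integration.integrable_sum i1 i2; assumption)+
 have "(LINT x|annM. Z x \<bullet> D x) = (\<Sum>i\<in>Basis. LINT x|annM. (D x \<bullet> i) * (Z x \<bullet> i))"
  unfolding e by (rule Bochner_Integration.integral_sum) (rule i2)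
 also have "... = (\<Sum>i\<in>Basis. - (LINT x|annM. w x * (H i x \<bullet> i)))"
 proof (rule sum.cong[OF refl])
  fix i :: "real^2" assume i: "i \<in> Basis"
  show "(LINT x|annM. (D x \<bullet> i) * (Z x \<bullet> i)) = - (LINT x|annM. w x * (H i x \<bullet> i))"
   using 0[OF i] unfolding Bochner_Integration.integral_add[OF i1[OF i] i2[OF i]] by linarith
 qed
 also have "... = - (\<Sum>i\<in>Basis. LINT x|annM. w x * (H i x \<bullet> i))" by (rule sum_negf)
 also have "(\<Sum>i\<in>Basis. LINT x|annM. w x * (H i x \<bullet> i)) = (LINT x|annM. w x * (\<Sum>i\<in>Basis. H i x \<bullet> i))"
  unfolding sum_distrib_left by (rule Bochner_Integration.integral_sum[symmetric]) (rule i1)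
 finally show "(LINT x|annM. Z x \<bullet> D x) = - (LINT x|annM. w x * (\<Sum>i\<in>Basis. H i x \<bullet> i))" .
qed

text \<open>The identity holds for the approximating test functions, and its left side is continuous
  in the function and its gradient for the \<open>L^1\<close> norms, with modulus
  \<open>k\<close>.\<close>

lemma W11_0_zero_trace:
 assumes "u \<in> W11_0 annulus"
 shows "\<exists>G. zero_trace u G"
proof -
 obtain G where G: "integrable annM u" "integrable annM G"
  and approx: "\<And>\<epsilon>. \<epsilon> > 0 ==> \<exists>\<phi>. test_function annulus \<phi> \<and>
     (LINT x|annM. \<bar>u x - \<phi> x\<bar>) + (LINT x|annM. norm (G x - grad \<phi> x)) < \<epsilon>"
  using assms unfolding W11_0_def set_integral_annM absolutely_integrable_annM by blast
 have "(LINT x|annM. (Z x \<bullet> b) * u x + Y x * (G x \<bullet> b)) = 0"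
  if Y: "\<forall>x\<in>annulus. (GDERIV Y x :> Z x) \<and> \<bar>Y x\<bar> <= B \<and> norm (Z x) <= B" and Z: "Z \<in> borel_measurable annM" for Y Z B b
 proof -
  \<comment> \<open>The summand 1 makes \<open>k\<close> positive, so that \<open>e / k\<close> is a
    legitimate accuracy even when \<open>B\<close> or \<open>b\<close> vanishes.\<close>
  define k where "k = B * norm b + 1"
  have B0: "B >= 0" using Y annulus_nonempty by (meson abs_ge_zero order_trans)
  have k: "k > 0" using mult_nonneg_nonneg[OF B0 norm_ge_zero[of b]] by (simp add: k_def)
  have tri: "\<bar>p + q\<bar> <= l + k * t" if "\<bar>p\<bar> <= l" "\<bar>q\<bar> <= B * (t * norm b)" "0 <= t" for p q l t
  proof -
   have "k * t = B * (t * norm b) + t" by (simp add: k_def algebra_simps)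
   then show ?thesis using that abs_triangle_ineq[of p q] by linarith
  qed
  have Ym: "Y \<in> borel_measurable annM"
   by (rule continuous_on_annM_measurable[OF gderiv_continuous_on]) (use Y in auto)
  have Zb: "\<bar>Z x \<bullet> b\<bar> <= k" if "x \<in> annulus" for x
   using Cauchy_Schwarz_ineq2[of "Z x" b] mult_right_mono[of "norm (Z x)" B "norm b"] Y that by (force simp: k_def)
  have int: "integrable annM (\<lambda>x. (Z x \<bullet> b) * w x + Y x * (E x \<bullet> b))"
   if "integrable annM w" "integrable annM E" for w and E :: "real^2 => real^2"
  proof -
   have "integrable annM (\<lambda>x. w x * (Z x \<bullet> b))"
    by (rule integrable_annM_bounded_mult[OF that(1) _ Zb]) (use Z in auto)
   moreover have "integrable annM (\<lambda>x. (E x \<bullet> b) * Y x)"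
    by (rule integrable_annM_bounded_mult[OF _ Ym, of _ B]) (use that Y in auto)
   ultimately show ?thesis by (simp add: mult.commute)
  qed
  have "\<bar>LINT x|annM. (Z x \<bullet> b) * u x + Y x * (G x \<bullet> b)\<bar> <= e" if e: "e > 0" for e
  proof -
   obtain \<phi> where \<phi>: "test_function annulus \<phi>"
    "(LINT x|annM. \<bar>u x - \<phi> x\<bar>) + (LINT x|annM. norm (G x - grad \<phi> x)) < e / k"
    using approx[of "e / k"] e k by auto
   note i\<phi> = test_function_integrable[OF \<phi>(1)]
   have iG: "integrable annM (\<lambda>x. G x - grad \<phi> x)" and iu: "integrable annM (\<lambda>x. u x - \<phi> x)" using G i\<phi> by auto
   have "(LINT x|annM. (Z x \<bullet> b) * \<phi> x + Y x * (grad \<phi> x \<bullet> b)) = 0"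
    using zero_trace_test[OF \<phi>(1)] Y Z unfolding zero_trace_def by blast
   then have "(LINT x|annM. (Z x \<bullet> b) * u x + Y x * (G x \<bullet> b))
     = (LINT x|annM. ((Z x \<bullet> b) * u x + Y x * (G x \<bullet> b)) - ((Z x \<bullet> b) * \<phi> x + Y x * (grad \<phi> x \<bullet> b)))"
    unfolding Bochner_Integration.integral_diff[OF int[OF G] int[OF i\<phi>]] by simp
   also have "... = (LINT x|annM. (Z x \<bullet> b) * (u x - \<phi> x) + Y x * ((G x - grad \<phi> x) \<bullet> b))"
    by (simp add: inner_diff_left algebra_simps)
   finally have "\<bar>LINT x|annM. (Z x \<bullet> b) * u x + Y x * (G x \<bullet> b)\<bar> <= (LINT x|annM. \<bar>(Z x \<bullet> b) * (u x - \<phi> x) + Y x * ((G x - grad \<phi> x) \<bullet> b)\<bar>)"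
    by (simp only: integral_abs_bound)
   also have "... <= (LINT x|annM. k * \<bar>u x - \<phi> x\<bar> + k * norm (G x - grad \<phi> x))"
   proof (rule integral_mono[OF integrable_abs[OF int[OF iu iG]]])
    show "integrable annM (\<lambda>x. k * \<bar>u x - \<phi> x\<bar> + k * norm (G x - grad \<phi> x))" using iG iu by auto
    fix x assume "x \<in> space annM"
    then have x: "x \<in> annulus" by simp
    have a1: "\<bar>(Z x \<bullet> b) * (u x - \<phi> x)\<bar> <= k * \<bar>u x - \<phi> x\<bar>" unfolding abs_mult by (rule mult_right_mono[OF Zb[OF x]]) simp
    have a2: "\<bar>Y x * ((G x - grad \<phi> x) \<bullet> b)\<bar> <= B * (norm (G x - grad \<phi> x) * norm b)"
     unfolding abs_mult using Y x B0 by (intro mult_mono Cauchy_Schwarz_ineq2) auto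
    show "\<bar>(Z x \<bullet> b) * (u x - \<phi> x) + Y x * ((G x - grad \<phi> x) \<bullet> b)\<bar> <= k * \<bar>u x - \<phi> x\<bar> + k * norm (G x - grad \<phi> x)"
     by (rule tri[OF a1 a2 norm_ge_zero])
   qed
   also have "... = k * ((LINT x|annM. \<bar>u x - \<phi> x\<bar>) + (LINT x|annM. norm (G x - grad \<phi> x)))"
    using iG iu by (simp add: distrib_left)
   also have "... <= k * (e / k)" using \<phi>(2) k by (intro mult_left_mono) auto
   finally show ?thesis using k by simp
  qed
  then have "\<bar>LINT x|annM. (Z x \<bullet> b) * u x + Y x * (G x \<bullet> b)\<bar> <= 0" by (rule field_le_epsilon) simp
  then show ?thesis by simp
 qed
 then show ?thesis unfolding zero_trace_def using G by blast
qed

text \<open>The weak equation with test functions from \<open>C1_limit\<close>: nonlinear functions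
  of the solution itself then qualify as test functions.\<close>

definition weak_sol :: "(real^2 => real^2) => (real^2 => real) => bool" where
 "weak_sol D F \<longleftrightarrow> (\<forall>\<Phi> E C. C1_limit \<Phi> E C \<longrightarrow> (LINT x|annM. F x * \<Phi> x) = (LINT x|annM. D x \<bullet> E x))"

lemma C1_limit_mult_integrable:
 assumes "C1_limit \<Phi> D C" "integrable annM F"
 shows "integrable annM (\<lambda>x. F x * \<Phi> x)"
 by (rule integrable_annM_bounded_mult[OF assms(2) C1_limit_facts(5,3)[OF assms(1)]])

lemma C1_limit_inner_integrable:
 assumes \<Phi>: "C1_limit \<Phi> E C" and D: "integrable annM D"
 shows "integrable annM (\<lambda>x. D x \<bullet> E x)"
proof (rule Bochner_Integration.integrable_bound[OF integrable_mult_right[OF integrable_norm[OF D], of C]])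
 show "(\<lambda>x. D x \<bullet> E x) \<in> borel_measurable annM" using D C1_limit_facts(6)[OF \<Phi>] by measurable
 show "AE x in annM. norm (D x \<bullet> E x) <= norm (C * norm (D x))"
 proof (rule AE_I2)
  fix x assume "x \<in> space annM"
  then have "norm (E x) <= C" using C1_limit_facts(4)[OF \<Phi>] by simp
  from mult_left_mono[OF this norm_ge_zero[of "D x"]]
  show "norm (D x \<bullet> E x) <= norm (C * norm (D x))"
   using Cauchy_Schwarz_ineq2[of "D x" "E x"] C1_limit_facts(1)[OF \<Phi>] by (simp add: mult.commute)
 qed
qed

lemma zero_trace_weak_sol:
 assumes w: "zero_trace w D" and F: "integrable annM F"
  and eq: "\<And>\<phi>. test_function annulus \<phi> ==> - (LINT x|annM. w x * laplacian \<phi> x) = (LINT x|annM. F x * \<phi> x)"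
 shows "weak_sol D F"
 unfolding weak_sol_def
proof (intro allI impI)
 fix \<Phi> E C assume \<Phi>: "C1_limit \<Phi> E C"
 have D: "integrable annM D" using w by (simp add: zero_trace_def)
 have t: "(LINT x|annM. F x * \<phi> x + (- D x) \<bullet> grad \<phi> x) = 0" if \<phi>: "test_function annulus \<phi>" for \<phi>
 proof -
  note p = test_function_partial[OF \<phi>]
  have gi: "grad \<phi> x \<bullet> i = partial_deriv i \<phi> x" for i x
   using gderiv_partial_deriv[OF test_function_gderiv[OF \<phi>]] by simp
  have lap: "(\<Sum>i\<in>Basis. grad (partial_deriv i \<phi>) x \<bullet> i) = laplacian \<phi> x" for x
   unfolding laplacian_def by (rule sum.cong[OF refl]) (rule gderiv_partial_deriv[OF test_function_gderiv[OF p], symmetric])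
  have "\<exists>C. \<forall>x. \<bar>partial_deriv i \<phi> x\<bar> <= C \<and> norm (grad (partial_deriv i \<phi>) x) <= C" if "i \<in> Basis" for i
   using test_function_bounded[OF p[OF that]] by metis
  then obtain C2 where C2: "\<And>i x. i \<in> Basis ==> \<bar>partial_deriv i \<phi> x\<bar> <= C2 i"
   "\<And>i x. i \<in> Basis ==> norm (grad (partial_deriv i \<phi>) x) <= C2 i" by metis
  have m: "C2 i <= Max (C2 ` Basis)" if "i \<in> Basis" for i using that by (intro Max_ge) auto
  have h: "GDERIV (\<lambda>x. grad \<phi> x \<bullet> i) x :> grad (partial_deriv i \<phi>) x" "grad (partial_deriv i \<phi>) \<in> borel_measurable annM"
   "\<bar>grad \<phi> x \<bullet> i\<bar> <= Max (C2 ` Basis)" "norm (grad (partial_deriv i \<phi>) x) <= Max (C2 ` Basis)" if i: "i \<in> Basis" for i x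
   unfolding gi using test_function_gderiv[OF p[OF i]] borel_measurable_integrable[OF test_function_integrable(2)[OF p[OF i]]]
    order_trans[OF C2(1)[OF i] m[OF i]] order_trans[OF C2(2)[OF i] m[OF i]] by auto
  note d = zero_trace_divergence(2,3)[OF w h(1) h(2) h(3) h(4), unfolded lap]
  show ?thesis
   using d(2) eq[OF \<phi>] integrable_mult_test[OF F \<phi>] d(1) by (simp add: inner_commute)
 qed
 have "(LINT x|annM. F x * \<Phi> x + (- D x) \<bullet> E x) = 0"
  by (rule weak_identity_C1_limit[OF F _ t \<Phi>]) (use D in simp)
 then show "(LINT x|annM. F x * \<Phi> x) = (LINT x|annM. D x \<bullet> E x)"
  using C1_limit_mult_integrable[OF \<Phi> F] C1_limit_inner_integrable[OF \<Phi> D] by simp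
qed

text \<open>Both derivatives are moved onto \<open>\<psi>\<close>, which vanishes on the boundary
  but has no compact support. The zero boundary values of \<open>u\<close> enter through
  \<open>zero_trace\<close>: they remove the boundary term with the normal derivative of
  \<open>\<psi>\<close>.\<close>

lemma very_weak_solution:
 assumes u: "u \<in> W11_0 annulus" and eq: "neg_laplacian_distr annulus u F" and F: "integrable annM F"
  and \<psi>: "C1_collar \<psi> D C"
  and H: "\<And>i x. i \<in> Basis ==> x \<in> annulus ==> GDERIV (\<lambda>x. D x \<bullet> i) x :> H i x"
   "\<And>i. i \<in> Basis ==> continuous_on annulus (H i)"
   "\<And>i x. i \<in> Basis ==> x \<in> annulus ==> norm (H i x) <= B"
  and L: "\<And>x. x \<in> annulus ==> L x = (\<Sum>i\<in>Basis. H i x \<bullet> i)"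
 shows "integrable annM (\<lambda>x. u x * L x)" "(LINT x|annM. u x * L x) = - (LINT x|annM. F x * \<psi> x)"
proof -
 obtain G where G: "zero_trace u G" using W11_0_zero_trace[OF u] by blast
 have Db: "\<bar>D x \<bullet> i\<bar> <= max B C" if "i \<in> Basis" "x \<in> annulus" for i x
  using \<psi> that Basis_le_norm[OF that(1), of "D x"] by (force simp: C1_collar_def)
 have Hb: "norm (H i x) <= max B C" if "i \<in> Basis" "x \<in> annulus" for i x using H(3)[OF that] by simp
 note z = zero_trace_divergence[OF G H(1) continuous_on_annM_measurable[OF H(2)] Db Hb]
 have e: "x \<in> space annM ==> u x * L x = u x * (\<Sum>i\<in>Basis. H i x \<bullet> i)" for x using L by simp
 show "integrable annM (\<lambda>x. u x * L x)"
  by (rule iffD2[OF Bochner_Integration.integrable_cong[OF refl e] z(1)])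
 have "weak_sol G F"
  by (rule zero_trace_weak_sol[OF G F]) (use eq in \<open>simp add: neg_laplacian_distr_def set_integral_annM\<close>)
 then have "(LINT x|annM. F x * \<psi> x) = (LINT x|annM. G x \<bullet> D x)"
  using C1_collar_imp_limit[OF \<psi>] unfolding weak_sol_def by blast
 also have "... = (LINT x|annM. D x \<bullet> G x)" by (simp add: inner_commute)
 also have "... = - (LINT x|annM. u x * (\<Sum>i\<in>Basis. H i x \<bullet> i))" by (rule z(3))
 also have "(LINT x|annM. u x * (\<Sum>i\<in>Basis. H i x \<bullet> i)) = (LINT x|annM. u x * L x)"
  by (rule Bochner_Integration.integral_cong[OF refl e[symmetric]])
 finally show "(LINT x|annM. u x * L x) = - (LINT x|annM. F x * \<psi> x)" by simp
qed

section \<open>The parametrix\<close>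

text \<open>The two affine branches are forced. With \<open>2 t - 1/2\<close> near
  \<open>t = 1/4\<close> and \<open>1 - t\<close> near \<open>t = 1\<close>, where \<open>t\<close>
  is the squared radius, the sum of the squared distance of x and y and \<open>p(x) p(y)\<close>
  equals, in complex notation, \<open>4 |x conj(y) - 1/4|^2\<close> near the inner circle and
  \<open>|1 - x conj(y)|^2\<close> near the outer one. These are the reflected factors in the Green
  functions of the exterior of the disc of radius 1/2 and of the unit disc.\<close>

definition prof :: "real => real" where
 "prof t = (2 * t - 1/2) + (3/2 - 3 * t) * sstep (4 * t - 2)"
definition prof' :: "real => real" where
 "prof' t = 2 - 3 * sstep (4 * t - 2) + (6 - 12 * t) * sstep' (4 * t - 2)"
definition prof'' :: "real => real" where
 "prof'' t = - 24 * sstep' (4 * t - 2) + (24 - 48 * t) * sstep'' (4 * t - 2)"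

lemma prof_deriv: "(prof has_real_derivative prof' t) (at t)" "(prof' has_real_derivative prof'' t) (at t)"
proof -
 have l: "((\<lambda>t. 4 * t - 2) has_real_derivative 4) (at t)" by (auto intro!: derivative_eq_intros)
 note s = DERIV_chain2[OF sstep_deriv l] DERIV_chain2[OF sstep'_deriv l]
 show "(prof has_real_derivative prof' t) (at t)"
  unfolding prof_def[abs_def] prof'_def
  by (rule derivative_eq_intros s refl)+ (simp add: algebra_simps)
 show "(prof' has_real_derivative prof'' t) (at t)"
  unfolding prof'_def[abs_def] prof''_def
  by (rule derivative_eq_intros s refl)+ (simp add: algebra_simps)
qed

lemma prof_low: assumes "t <= 1/2" shows "prof t = 2 * t - 1/2" "prof' t = 2" "prof'' t = 0"
 using assms by (simp_all add: prof_def prof'_def prof''_def sstep_low)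

lemma prof_high: assumes "t >= 3/4" shows "prof t = 1 - t" "prof' t = -1" "prof'' t = 0"
 using assms by (simp_all add: prof_def prof'_def prof''_def sstep_high)

lemma continuous_prof [continuous_intros]:
 "continuous_on A f ==> continuous_on A (\<lambda>x. prof (f x))"
 "continuous_on A f ==> continuous_on A (\<lambda>x. prof' (f x))"
 "continuous_on A f ==> continuous_on A (\<lambda>x. prof'' (f x))"
 unfolding prof_def prof'_def prof''_def by (intro continuous_intros; assumption)+

lemma prof_convex: "prof t = (1 - sstep (4 * t - 2)) * (2 * t - 1/2) + sstep (4 * t - 2) * (1 - t)"
 by (simp add: prof_def algebra_simps)

lemma prof_ge: assumes "1/4 <= t" "t <= 1" shows "(1 - t) * (t - 1/4) <= prof t"
proof -
 let ?s = "sstep (4 * t - 2)"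
 have s: "0 <= ?s" "?s <= 1" by (rule sstep_range)+
 have "(1 - t) * (t - 1/4) <= 1 * (t - 1/4)" using assms by (intro mult_right_mono) auto
 also have "... <= 2 * t - 1/2" using assms by simp
 finally have 1: "(1 - t) * (t - 1/4) <= 2 * t - 1/2" .
 have "(1 - t) * (t - 1/4) <= (1 - t) * 1" using assms by (intro mult_left_mono) auto
 then have 2: "(1 - t) * (t - 1/4) <= 1 - t" by simp
 have "(1 - t) * (t - 1/4) = (1 - ?s) * ((1 - t) * (t - 1/4)) + ?s * ((1 - t) * (t - 1/4))"
  by (simp add: algebra_simps)
 also have "... <= prof t" unfolding prof_convex
  using s 1 2 by (intro add_mono mult_left_mono) auto
 finally show ?thesis .
qed

text \<open>Each branch of the convex combination is dominated by the collar function only where its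
  coefficient is nonzero, that is for \<open>t \<le> 3/4\<close> and for \<open>t \<ge> 1/2\<close>;
  the step vanishes or equals 1 elsewhere.\<close>

lemma prof_le: assumes "1/4 <= t" "t <= 1" shows "prof t <= 8 * ((1 - t) * (t - 1/4))"
proof -
 let ?s = "sstep (4 * t - 2)"
 have s: "0 <= ?s" "?s <= 1" by (rule sstep_range)+
 have 1: "(1 - ?s) * (2 * t - 1/2) <= (1 - ?s) * (8 * ((1 - t) * (t - 1/4)))"
 proof (cases "t <= 3/4")
  case True
  have "2 * t - 1/2 = 2 * (t - 1/4)" by simp
  also have "... <= (8 * (1 - t)) * (t - 1/4)" using True assms by (intro mult_right_mono) auto
  finally have "2 * t - 1/2 <= 8 * ((1 - t) * (t - 1/4))" by (simp only: mult.assoc)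
  then show ?thesis using s by (intro mult_left_mono) auto
 qed (simp add: sstep_high)
 have 2: "?s * (1 - t) <= ?s * (8 * ((1 - t) * (t - 1/4)))"
 proof (cases "t >= 1/2")
  case True
  have "1 - t = (1 - t) * 1" by simp
  also have "... <= (1 - t) * (8 * (t - 1/4))" using True assms by (intro mult_left_mono) auto
  finally have "1 - t <= 8 * ((1 - t) * (t - 1/4))" by (simp only: mult.left_commute)
  then show ?thesis using s by (intro mult_left_mono) auto
 qed (simp add: sstep_low)
 have "prof t <= (1 - ?s) * (8 * ((1 - t) * (t - 1/4))) + ?s * (8 * ((1 - t) * (t - 1/4)))"
  unfolding prof_convex using 1 2 by linarith
 also have "... = 8 * ((1 - t) * (t - 1/4))" by (simp only: distrib_right[symmetric]) simp
 finally show ?thesis .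
qed

definition pw :: "real^2 => real" where "pw x = prof (x \<bullet> x)"
definition pwg :: "real^2 => real^2" where "pwg x = (2 * prof' (x \<bullet> x)) *\<^sub>R x"
text \<open>The Laplacian of \<open>pw\<close>: a function f of \<open>t = x \<bullet> x\<close> in
  the plane has Laplacian \<open>4 f'(t) + 4 t f''(t)\<close>.\<close>

definition pwl :: "real^2 => real" where "pwl x = 4 * prof' (x \<bullet> x) + 4 * (x \<bullet> x) * prof'' (x \<bullet> x)"

lemma pw_gderiv: "GDERIV pw x :> pwg x"
 unfolding pw_def[abs_def] pwg_def by (rule GDERIV_radial[OF prof_deriv(1)])

definition closed_annulus :: "(real^2) set" where
 "closed_annulus = {x. 1/4 <= x \<bullet> x \<and> x \<bullet> x <= 1}"

lemma annulus_subset_closed: "annulus \<subseteq> closed_annulus"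
 by (auto simp: annulus_iff closed_annulus_def)

lemma compact_closed_annulus: "compact closed_annulus"
proof -
 have "closed_annulus = {x. 1/4 <= x \<bullet> x} \<inter> {x. x \<bullet> x <= 1}" by (auto simp: closed_annulus_def)
 moreover have "closed ({x. 1/4 <= x \<bullet> x} \<inter> {x::real^2. x \<bullet> x <= 1})"
  by (intro closed_Int closed_Collect_le continuous_intros)
 moreover have "closed_annulus \<subseteq> cball 0 1"
  by (auto simp: closed_annulus_def norm_le_square)
 ultimately show ?thesis using compact_eq_bounded_closed bounded_subset bounded_cball by metis
qed

lemma pw_nonneg: "x \<in> closed_annulus ==> pw x >= 0"
 using prof_ge[of "x \<bullet> x"] by (auto simp: pw_def closed_annulus_def elim!: order_trans[rotated])

lemma pw_collar: assumes "x \<in> annulus" shows "collar x <= pw x" "pw x <= 8 * collar x" "pw x > 0" "pw x <= 8"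
proof -
 have t: "1/4 <= x \<bullet> x" "x \<bullet> x <= 1" using assms by (auto simp: annulus_iff)
 show 1: "collar x <= pw x" "pw x <= 8 * collar x"
  using prof_ge[OF t] prof_le[OF t] by (simp_all add: pw_def collar_def)
 show "pw x > 0" "pw x <= 8" using 1 annulus_collar[of x] collar_le[OF assms] assms by auto
qed

lemma continuous_pw [continuous_intros]:
 "continuous_on A f ==> continuous_on A (\<lambda>x. pw (f x))"
 "continuous_on A f ==> continuous_on A (\<lambda>x. pwg (f x))"
 "continuous_on A f ==> continuous_on A (\<lambda>x. pwl (f x))"
 unfolding pw_def pwg_def pwl_def by (intro continuous_intros; assumption)+

lemma closed_annulus_bounded:
 fixes f :: "real^2 => 'a::real_normed_vector"
 assumes "continuous_on closed_annulus f"
 shows "\<exists>C. \<forall>x\<in>annulus. norm (f x) <= C"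
proof -
 have "bounded (f ` closed_annulus)"
  by (intro compact_imp_bounded compact_continuous_image assms compact_closed_annulus)
 then obtain C where "\<forall>y\<in>f ` closed_annulus. norm y <= C" unfolding bounded_iff by blast
 then show ?thesis using annulus_subset_closed by blast
qed

text \<open>One computation for both logarithms in the parametrix: \<open>c = pw x\<close> is the
  reflected term and \<open>c = 0\<close> the free one. The parameter \<open>e > 0\<close> keeps
  both smooth up to the diagonal.\<close>

lemma log_potential_facts:
 fixes x y :: "real^2" and c e :: real
 assumes e: "e > 0" and c: "c >= 0" and y: "y \<in> closed_annulus"
 defines "N \<equiv> \<lambda>y. (y - x) \<bullet> (y - x) + e + c * pw y"
 defines "Ng \<equiv> \<lambda>y. 2 *\<^sub>R (y - x) + c *\<^sub>R pwg y"
 shows "N y >= e" "GDERIV (\<lambda>y. ln (N y)) y :> (1 / N y) *\<^sub>R Ng y"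
  "GDERIV (\<lambda>y. ((1 / N y) *\<^sub>R Ng y) \<bullet> i) y :>
    (1 / N y) *\<^sub>R (2 *\<^sub>R i + c *\<^sub>R ((2 * prof' (y \<bullet> y)) *\<^sub>R i + (4 * prof'' (y \<bullet> y) * (y \<bullet> i)) *\<^sub>R y)) - ((Ng y \<bullet> i) / (N y)\<^sup>2) *\<^sub>R Ng y"
proof -
 show Ne: "N y >= e" unfolding N_def using c pw_nonneg[OF y] by simp
 have gN: "GDERIV N y :> Ng y"
  unfolding N_def Ng_def
  using pw_gderiv[of y, unfolded gderiv_def]
  by (auto simp: gderiv_def inner_commute inner_add_right intro!: derivative_eq_intros)
 have N0: "N y > 0" using Ne e by linarith
 show "GDERIV (\<lambda>y. ln (N y)) y :> (1 / N y) *\<^sub>R Ng y"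
  by (rule GDERIV_DERIV_compose[OF gN]) (use N0 in \<open>auto intro!: derivative_eq_intros\<close>)
 have gp: "GDERIV (\<lambda>y. pwg y \<bullet> i) y :> (2 * prof' (y \<bullet> y)) *\<^sub>R i + (4 * prof'' (y \<bullet> y) * (y \<bullet> i)) *\<^sub>R y"
 proof -
  have a: "GDERIV (\<lambda>y. 2 * prof' (y \<bullet> y)) y :> (4 * prof'' (y \<bullet> y)) *\<^sub>R y"
   using GDERIV_radial[OF DERIV_cmult[OF prof_deriv(2), of 2]] by simp
  have b: "GDERIV (\<lambda>y. y \<bullet> i) y :> i" by (auto simp: gderiv_def intro!: derivative_eq_intros)
  show ?thesis using GDERIV_mult[OF a b] by (simp add: pwg_def mult_ac)
 qed
 have gNg: "GDERIV (\<lambda>y. Ng y \<bullet> i) y :> 2 *\<^sub>R i + c *\<^sub>R ((2 * prof' (y \<bullet> y)) *\<^sub>R i + (4 * prof'' (y \<bullet> y) * (y \<bullet> i)) *\<^sub>R y)"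
 proof -
  have "GDERIV (\<lambda>y. 2 * ((y - x) \<bullet> i)) y :> 2 *\<^sub>R i"
   by (auto simp: gderiv_def intro!: derivative_eq_intros)
  from GDERIV_add[OF this GDERIV_mult[OF GDERIV_const[of c] gp]] show ?thesis
   by (simp add: Ng_def inner_add_left)
 qed
 have inv: "GDERIV (\<lambda>y. 1 / N y) y :> (- 1 / (N y)\<^sup>2) *\<^sub>R Ng y"
  by (rule GDERIV_DERIV_compose[OF gN]) (use N0 in \<open>auto intro!: derivative_eq_intros simp: power2_eq_square divide_inverse\<close>)
 show "GDERIV (\<lambda>y. ((1 / N y) *\<^sub>R Ng y) \<bullet> i) y :>
    (1 / N y) *\<^sub>R (2 *\<^sub>R i + c *\<^sub>R ((2 * prof' (y \<bullet> y)) *\<^sub>R i + (4 * prof'' (y \<bullet> y) * (y \<bullet> i)) *\<^sub>R y)) - ((Ng y \<bullet> i) / (N y)\<^sup>2) *\<^sub>R Ng y"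
  unfolding inner_scaleR_left
  using GDERIV_mult[OF inv gNg] by simp
qed

section \<open>The regularised parametrix and its Laplacian\<close>

definition NN :: "real => real^2 => real^2 => real" where
 "NN e x y = (y - x) \<bullet> (y - x) + e + pw x * pw y"

text \<open>Equal to \<open>ln (NN e x y)\<close> minus the logarithm of the regularised squared
  distance. The quotient form makes the sign and the vanishing at the boundary visible.\<close>

definition GG :: "real => real^2 => real^2 => real" where
 "GG e x y = ln (1 + pw x * pw y / ((norm (y - x))\<^sup>2 + e))"

text \<open>The remainder in the Laplacian of \<open>ln (NN e x y)\<close> with respect to
  \<open>y\<close>, which is \<open>(4 * e + pw x * kn e x y) / (NN e x y)\<^sup>2\<close>.\<close>

definition kn :: "real => real^2 => real^2 => real" where
 "kn e x y = 4 * pw y + pwl y * NN e x y - 4 * ((y - x) \<bullet> pwg y) - pw x * (pwg y \<bullet> pwg y)"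

lemma sum_Basis_inner_self: "(\<Sum>i\<in>(Basis::(real^2) set). i \<bullet> i) = 2"
 by simp

text \<open>The equation is tested with the difference of the two logarithms of
  \<open>log_potential_facts\<close>. It vanishes linearly at the boundary because the arguments
  differ by \<open>pw x * pw y\<close>, and both are at least \<open>e\<close>. The first kernel on
  the left concentrates at \<open>x\<close> as \<open>e\<close> tends to zero.\<close>

lemma representation_eps:
 assumes u: "u \<in> W11_0 annulus" and eq: "neg_laplacian_distr annulus u F" and F: "integrable annM F"
  and x: "x \<in> annulus" and e: "e > 0"
 shows "(LINT y|annM. u y * (4 * e / ((y - x) \<bullet> (y - x) + e)\<^sup>2 - 4 * e / (NN e x y)\<^sup>2 - pw x * kn e x y / (NN e x y)\<^sup>2))
   = (LINT y|annM. F y * GG e x y)"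
proof -
 define c where "c = pw x"
 have c: "c >= 0" using pw_collar(3)[OF x] by (simp add: c_def)
 define N where "N c y = (y - x) \<bullet> (y - x) + e + c * pw y" for c y
 define Ng where "Ng c y = 2 *\<^sub>R (y - x) + c *\<^sub>R pwg y" for c y
 define D where "D c y = (1 / N c y) *\<^sub>R Ng c y" for c y
 define M where "M c i y = 2 *\<^sub>R i + c *\<^sub>R ((2 * prof' (y \<bullet> y)) *\<^sub>R i + (4 * prof'' (y \<bullet> y) * (y \<bullet> i)) *\<^sub>R y)" for c and i y :: "real^2"
 define H where "H c i y = (1 / N c y) *\<^sub>R M c i y - ((Ng c y \<bullet> i) / (N c y)\<^sup>2) *\<^sub>R Ng c y" for c and i y :: "real^2"
 note lf = log_potential_facts[OF e, where x=x, folded N_def Ng_def, folded D_def M_def, folded H_def]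
 have N0: "y \<in> closed_annulus ==> N c y > 0" "y \<in> closed_annulus ==> N 0 y > 0" for y
  using lf(1)[OF c, of y] lf(1)[of 0 y] e by linarith+
 have contN: "continuous_on A (N c)" "continuous_on A (Ng c)" for c A
  unfolding N_def[abs_def] Ng_def[abs_def] by (intro continuous_intros)+
 have contD: "continuous_on closed_annulus (D c)" "continuous_on closed_annulus (D 0)"
  "continuous_on closed_annulus (H c i)" "continuous_on closed_annulus (H 0 i)" for i
  unfolding D_def[abs_def] H_def[abs_def] M_def
  using N0 by (auto intro!: continuous_intros contN simp: less_le)
 let ?\<psi> = "\<lambda>y. ln (N c y) - ln (N 0 y)"
 have psi_eq: "ln (N c y) - ln (N 0 y) = GG e x y" if "y \<in> annulus" for y
 proof -
  have yc: "y \<in> closed_annulus" using that annulus_subset_closed by auto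
  have "N c y = N 0 y * (1 + pw x * pw y / ((norm (y - x))\<^sup>2 + e))"
   using N0(2)[OF yc] by (simp add: N_def c_def power2_norm_eq_inner distrib_left)
  moreover have "1 + pw x * pw y / ((norm (y - x))\<^sup>2 + e) > 0"
   using pw_collar(3)[OF x] pw_collar(3)[OF that] e by (intro add_pos_nonneg) auto
  ultimately show ?thesis using N0(2)[OF yc] by (simp add: GG_def ln_mult)
 qed
 obtain C1 where C1: "\<And>y. y \<in> annulus ==> norm (D c y - D 0 y) <= C1"
  using closed_annulus_bounded[OF continuous_on_diff[OF contD(1,2)]] by blast
 have "\<forall>i. \<exists>B. \<forall>y\<in>annulus. norm (H c i y - H 0 i y) <= B"
  using closed_annulus_bounded[OF continuous_on_diff[OF contD(3,4)]] by blast
 \<comment> \<open>The bound for the second derivatives depends on the direction; a maximum over the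
   finite basis makes it uniform.\<close>
 then obtain Bi where Bi: "\<And>i y. y \<in> annulus ==> norm (H c i y - H 0 i y) <= Bi i" by metis
 define B where "B = Max (Bi ` Basis)"
 have B: "norm (H c i y - H 0 i y) <= B" if "i \<in> Basis" "y \<in> annulus" for i y
  using Bi[OF that(2), of i] that(1) by (auto simp: B_def intro: order_trans)
 have psi_bd: "\<bar>?\<psi> y\<bar> <= (8 * c / e) * collar y" if y: "y \<in> annulus" for y
 proof -
  have yc: "y \<in> closed_annulus" using y annulus_subset_closed by auto
  have n: "N c y > 0" "N 0 y >= e" "N c y = N 0 y + c * pw y" "c * pw y >= 0"
   using N0[OF yc] lf(1)[of 0 y] yc c pw_nonneg[OF yc] by (auto simp: N_def)
  have "ln (N c y) - ln (N 0 y) = ln (1 + c * pw y / N 0 y)"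
  proof -
   have "1 + c * pw y / N 0 y = N c y / N 0 y" using n e by (simp add: add_divide_distrib)
   then show ?thesis using n e by (simp add: ln_div)
  qed
  also have "... <= c * pw y / N 0 y" using n e by (intro ln_add_one_self_le_self divide_nonneg_pos) auto
  also have "... <= c * pw y / e" using n e by (intro divide_left_mono mult_pos_pos) auto
  also have "... <= c * (8 * collar y) / e"
   using pw_collar(2)[OF y] c e by (intro divide_right_mono mult_left_mono) auto
  finally have "?\<psi> y <= (8 * c / e) * collar y" by (simp add: mult_ac)
  moreover have "?\<psi> y >= 0" using n e by simp
  ultimately show ?thesis by simp
 qed
 have C: "C1_collar ?\<psi> (\<lambda>y. D c y - D 0 y) (max C1 (8 * c / e))"
  unfolding C1_collar_def
 proof (intro conjI ballI)
  show "continuous_on annulus (\<lambda>y. D c y - D 0 y)"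
   using contD annulus_subset_closed by (intro continuous_intros) (auto intro: continuous_on_subset)
  fix y assume y: "y \<in> annulus"
  then have yc: "y \<in> closed_annulus" using annulus_subset_closed by auto
  show "GDERIV ?\<psi> y :> D c y - D 0 y"
   using lf(2)[OF c yc] lf(2)[OF _ yc, of 0] by (intro GDERIV_diff) auto
  show "\<bar>?\<psi> y\<bar> <= max C1 (8 * c / e) * collar y"
   using psi_bd[OF y] y annulus_collar
   by (meson less_imp_le max.cobounded2 mult_right_mono order_trans)
  show "norm (D c y - D 0 y) <= max C1 (8 * c / e)" using C1[OF y] by simp
 qed
 define L where "L y = (\<Sum>i\<in>Basis. (H c i y - H 0 i y) \<bullet> i)" for y
 have vw: "(LINT y|annM. u y * L y) = - (LINT y|annM. F y * ?\<psi> y)"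
 proof (rule very_weak_solution(2)[OF u eq F C, where H="\<lambda>i y. H c i y - H 0 i y" and B=B])
  fix i y :: "real^2" assume i: "i \<in> Basis" and y: "y \<in> annulus"
  then have yc: "y \<in> closed_annulus" using annulus_subset_closed by auto
  show "GDERIV (\<lambda>y. (D c y - D 0 y) \<bullet> i) y :> H c i y - H 0 i y"
   unfolding inner_diff_left
   using lf(3)[OF c yc, of i] lf(3)[OF _ yc, of 0 i] by (intro GDERIV_diff) auto
  show "norm (H c i y - H 0 i y) <= B" by (rule B[OF i y])
 next
  fix i :: "real^2"
  show "continuous_on annulus (\<lambda>y. H c i y - H 0 i y)"
   using contD annulus_subset_closed by (intro continuous_intros) (auto intro: continuous_on_subset)
 qed (simp add: L_def)
 have sumH: "(\<Sum>i\<in>Basis. H c i y \<bullet> i) = (1 / N c y) * (4 + c * pwl y) - (Ng c y \<bullet> Ng c y) / (N c y)\<^sup>2" for c y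
 proof -
  have "(\<Sum>i\<in>Basis. H c i y \<bullet> i) = (\<Sum>i\<in>Basis. (1 / N c y) * ((2 + 2 * c * prof' (y \<bullet> y)) * (i \<bullet> i) + 4 * c * prof'' (y \<bullet> y) * ((y \<bullet> i) * (y \<bullet> i)))
     - (1 / (N c y)\<^sup>2) * ((Ng c y \<bullet> i) * (Ng c y \<bullet> i)))"
   by (intro sum.cong) (auto simp: H_def M_def inner_diff_left inner_add_left algebra_simps)
  also have "... = (1 / N c y) * ((2 + 2 * c * prof' (y \<bullet> y)) * (\<Sum>i\<in>(Basis::(real^2) set). i \<bullet> i) + 4 * c * prof'' (y \<bullet> y) * (\<Sum>i\<in>Basis. (y \<bullet> i) * (y \<bullet> i)))
     - (1 / (N c y)\<^sup>2) * (\<Sum>i\<in>Basis. (Ng c y \<bullet> i) * (Ng c y \<bullet> i))"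
   by (simp only: sum_subtractf sum_distrib_left[symmetric] sum.distrib)
  also have "... = (1 / N c y) * ((2 + 2 * c * prof' (y \<bullet> y)) * 2 + 4 * c * prof'' (y \<bullet> y) * (y \<bullet> y))
     - (1 / (N c y)\<^sup>2) * (Ng c y \<bullet> Ng c y)"
   by (simp only: sum_Basis_inner_self euclidean_inner[symmetric])
  finally show ?thesis by (simp add: pwl_def algebra_simps)
 qed
 have Leq: "L y = - (4 * e / ((y - x) \<bullet> (y - x) + e)\<^sup>2 - 4 * e / (NN e x y)\<^sup>2 - pw x * kn e x y / (NN e x y)\<^sup>2)" if y: "y \<in> annulus" for y
 proof -
  have yc: "y \<in> closed_annulus" using y annulus_subset_closed by auto
  let ?d = "(y - x) \<bullet> (y - x)"
  have NNe: "N c y = NN e x y" "N 0 y = ?d + e" by (auto simp: N_def NN_def c_def)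
  have pos: "NN e x y > 0" "?d + e > 0" using N0[OF yc] unfolding NNe by auto
  have q: "Ng c y \<bullet> Ng c y = 4 * ?d + 4 * c * ((y - x) \<bullet> pwg y) + c\<^sup>2 * (pwg y \<bullet> pwg y)" for c
   by (simp add: Ng_def inner_add_left inner_add_right inner_commute power2_eq_square algebra_simps)
  have A: "(1 / NN e x y) * (4 + c * pwl y) - (Ng c y \<bullet> Ng c y) / (NN e x y)\<^sup>2 = (4 * e + c * kn e x y) / (NN e x y)\<^sup>2"
  proof -
   have "(4 + c * pwl y) * NN e x y - Ng c y \<bullet> Ng c y = 4 * e + c * kn e x y"
    unfolding q kn_def by (simp add: c_def NN_def power2_eq_square algebra_simps)
   then show ?thesis using pos by (simp add: field_simps power2_eq_square)
  qed
  have Bq: "(1 / (?d + e)) * 4 - 4 * ?d / (?d + e)\<^sup>2 = 4 * e / (?d + e)\<^sup>2"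
  proof -
   have "(1 / z) * 4 - 4 * (z - e) / z\<^sup>2 = 4 * e / z\<^sup>2" if "z > 0" for z
    using that by (simp add: field_simps power2_eq_square)
   from this[OF pos(2)] show ?thesis by simp
  qed
  have "L y = ((1 / NN e x y) * (4 + c * pwl y) - (Ng c y \<bullet> Ng c y) / (NN e x y)\<^sup>2) - ((1 / (?d + e)) * 4 - 4 * ?d / (?d + e)\<^sup>2)"
   unfolding L_def inner_diff_left sum_subtractf sumH NNe q[of 0] by simp
  also have "... = (4 * e + c * kn e x y) / (NN e x y)\<^sup>2 - 4 * e / (?d + e)\<^sup>2" unfolding A Bq ..
  finally show ?thesis by (simp add: c_def add_divide_distrib)
 qed
 have "(LINT y|annM. u y * L y) = (LINT y|annM. - (u y * (4 * e / ((y - x) \<bullet> (y - x) + e)\<^sup>2 - 4 * e / (NN e x y)\<^sup>2 - pw x * kn e x y / (NN e x y)\<^sup>2)))"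
  by (rule Bochner_Integration.integral_cong) (simp_all only: space_annM Leq mult_minus_right)
 moreover have "(LINT y|annM. F y * ?\<psi> y) = (LINT y|annM. F y * GG e x y)"
  by (rule Bochner_Integration.integral_cong) (simp_all add: psi_eq)
 ultimately show ?thesis using vw by simp
qed

section \<open>Singular and concentrating kernels in the plane\<close>

lemma integrable_dominated_balls:
 fixes h :: "'a::euclidean_space => real"
 assumes h: "h \<in> borel_measurable borel" "\<And>z. h z >= 0"
  and c: "\<And>j. c j >= 0" "\<And>j. R j >= 0" "summable (\<lambda>j. c j * R j ^ DIM('a))"
  and dom: "\<And>z. h z = 0 \<or> (\<exists>j::nat. norm z < R j \<and> h z <= c j)"
 shows "integrable lborel h"
proof (rule integrableI_bounded)
 let ?v = "unit_ball_vol (DIM('a))"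
 have v: "?v >= 0" by simp
 have "ennreal (norm (h z)) <= (\<Sum>j. ennreal (c j) * indicator (ball 0 (R j)) z)" for z
 proof (cases "h z = 0")
  case False
  then obtain j where j: "norm z < R j" "h z <= c j" using dom by blast
  define f where "f i = ennreal (c i) * indicator (ball 0 (R i)) z" for i
  have "ennreal (norm (h z)) <= f j"
   using j h(2)[of z] by (simp add: ennreal_leI f_def)
  also have "... = (\<Sum>i\<in>{j}. f i)" by simp
  also have "... <= (\<Sum>i. f i)" by (rule sum_le_suminf) auto
  finally show ?thesis by (simp add: f_def)
 qed simp
 then have "(\<integral>\<^sup>+z. ennreal (norm (h z)) \<partial>lborel) <= (\<integral>\<^sup>+z. (\<Sum>j. ennreal (c j) * indicator (ball 0 (R j)) (z::'a)) \<partial>lborel)"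
  by (rule nn_integral_mono)
 also have "... = (\<Sum>j. \<integral>\<^sup>+z. ennreal (c j) * indicator (ball 0 (R j)) (z::'a) \<partial>lborel)"
  by (rule nn_integral_suminf)
   (intro borel_measurable_times_ennreal borel_measurable_const borel_measurable_indicator, simp)
 also have "... = (\<Sum>j. ennreal (?v * (c j * R j ^ DIM('a))))"
 proof (rule suminf_cong)
  fix j
  have "(\<integral>\<^sup>+z. ennreal (c j) * indicator (ball 0 (R j)) (z::'a) \<partial>lborel) = ennreal (c j) * ennreal (?v * R j ^ DIM('a))"
   using c(2)[of j] by (simp add: nn_integral_cmult_indicator emeasure_ball)
  also have "... = ennreal (c j * (?v * R j ^ DIM('a)))"
   using c(1,2)[of j] by (intro ennreal_mult[symmetric] mult_nonneg_nonneg zero_le_power v)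
  finally show "(\<integral>\<^sup>+z. ennreal (c j) * indicator (ball 0 (R j)) (z::'a) \<partial>lborel) = ennreal (?v * (c j * R j ^ DIM('a)))"
   by (simp only: mult.left_commute)
 qed
 also have "... < \<infinity>"
 proof -
  have "(\<Sum>j. ennreal (?v * (c j * R j ^ DIM('a)))) \<noteq> top"
   by (rule ennreal_suminf_neq_top[OF summable_mult[OF c(3)]])
    (intro mult_nonneg_nonneg zero_le_power v c)
  then show ?thesis by (simp only: less_top infinity_ennreal_def)
 qed
 finally show "(\<integral>\<^sup>+z. ennreal (norm (h z)) \<partial>lborel) < \<infinity>" .
qed (use h in simp_all)

lemma dyadic_below:
 fixes a :: real
 assumes "a > 0"
 obtains j where "(1/2) ^ j <= a" "j = 0 \<or> a < 2 * (1/2) ^ j"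
proof -
 obtain j where "(1/2::real) ^ j < a" using real_arch_pow_inv[of a "1/2"] assms by auto
 then have ex: "\<exists>j. (1/2::real) ^ j <= a" by (meson less_imp_le)
 define k where "k = (LEAST j. (1/2::real) ^ j <= a)"
 have "(1/2) ^ k <= a" unfolding k_def using ex by (rule LeastI_ex)
 moreover have "k = 0 \<or> a < 2 * (1/2) ^ k"
 proof (cases k)
  case (Suc i)
  then have "\<not> (1/2::real) ^ i <= a" unfolding k_def by (metis lessI not_less_Least)
  then show ?thesis using Suc by simp
 qed simp
 ultimately show ?thesis using that by blast
qed

lemma dyadic_above:
 fixes a :: real
 obtains j where "a < 2 ^ j" "j = 0 \<or> 2 ^ j <= 2 * a"
proof -
 obtain j where "a < 2 ^ j" using real_arch_pow[of 2 a] by auto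
 then have ex: "\<exists>j. a < 2 ^ j" by blast
 define k where "k = (LEAST j. a < 2 ^ j)"
 have "a < 2 ^ k" unfolding k_def using ex by (rule LeastI_ex)
 moreover have "k = 0 \<or> 2 ^ k <= 2 * a"
 proof (cases k)
  case (Suc i)
  then have "\<not> a < 2 ^ i" unfolding k_def by (metis lessI not_less_Least)
  then show ?thesis using Suc by simp
 qed simp
 ultimately show ?thesis using that by blast
qed

text \<open>Dyadic balls replace polar coordinates: on the shell of radius about \<open>2^-j\<close>
  the power is of order \<open>2^(s j)\<close> and the area of order \<open>4^-j\<close>, which sums
  for \<open>s < 2\<close>. The same device with growing radii treats the decay at infinity of the
  concentrating kernel.\<close>

lemma integrable_norm_powr:
 assumes s: "0 <= s" "s < 2"
 shows "integrable lborel (\<lambda>z::real^2. indicator (ball 0 2) z * norm z powr (- s))"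
proof (rule integrable_dominated_balls[where c="\<lambda>j. (2 powr s) ^ j" and R="\<lambda>j. 2 * (1/2) ^ j"])
 show "(\<lambda>z::real^2. indicator (ball 0 2) z * norm z powr (- s)) \<in> borel_measurable borel"
  by (intro borel_measurable_times borel_measurable_indicator powr_real_measurable borel_measurable_norm borel_measurable_const) simp_all
 have "(\<lambda>j. (2 powr s) ^ j * (2 * (1/2) ^ j) ^ DIM(real^2)) = (\<lambda>j. 4 * (2 powr s / 4) ^ j)"
 proof
  fix j :: nat
  have "((1/2::real) ^ j)\<^sup>2 = (1/4) ^ j" by (simp add: power_even_eq power2_eq_square flip: power_mult_distrib)
  then show "(2 powr s) ^ j * (2 * (1/2) ^ j) ^ DIM(real^2) = 4 * (2 powr s / 4) ^ j"
   by (simp add: power_mult_distrib power_divide)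
 qed
 moreover have "2 powr s < 2 powr 2" using s by (intro powr_less_mono) auto
 then have "\<bar>2 powr s / 4\<bar> < 1" by simp
 then have "summable (\<lambda>j. 4 * (2 powr s / 4) ^ j)" by (intro summable_mult summable_geometric) simp
 ultimately show "summable (\<lambda>j. (2 powr s) ^ j * (2 * (1/2) ^ j) ^ DIM(real^2))" by simp
 fix z :: "real^2"
 show "indicator (ball 0 2) z * norm z powr (- s) = 0 \<or>
   (\<exists>j. norm z < 2 * (1/2) ^ j \<and> indicator (ball 0 2) z * norm z powr (- s) <= (2 powr s) ^ j)"
 proof (cases "z \<in> ball 0 2 \<and> z \<noteq> 0")
  case True
  then obtain j where j: "(1/2) ^ j <= norm z" "j = 0 \<or> norm z < 2 * (1/2) ^ j"
   using dyadic_below[of "norm z"] by auto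
  have "norm z powr (- s) <= ((1/2) ^ j) powr (- s)" using j(1) s by (intro powr_mono2') auto
  also have "((1/2::real) ^ j) powr (- s) = (2 powr s) ^ j"
   by (simp add: powr_realpow[symmetric] powr_powr powr_minus_divide powr_divide mult.commute)
  finally have "norm z powr (- s) <= (2 powr s) ^ j" .
  then show ?thesis using True j(2) by (intro disjI2 exI[of _ j]) auto
 qed auto
qed auto

text \<open>This is 4 pi, the factor in the identity that the Laplacian of \<open>ln |z|^2\<close>
  is \<open>4 pi\<close> times the Dirac mass. Its positivity suffices, so it stays an
  integral.\<close>

definition delta_mass :: real where
 "delta_mass = (LINT z|lborel. 4 / ((z::real^2) \<bullet> z + 1)\<^sup>2)"

lemma delta_kernel_integrable: "integrable lborel (\<lambda>z::real^2. 4 / (z \<bullet> z + 1)\<^sup>2)"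
proof (rule integrable_dominated_balls[where c="\<lambda>j. 64 * (1/16) ^ j" and R="\<lambda>j. 2 ^ j"])
 have "(\<lambda>j. 64 * (1/16) ^ j * (2 ^ j) ^ DIM(real^2)) = (\<lambda>j. 64 * (1/4::real) ^ j)"
 proof
  fix j :: nat
  have "((2::real) ^ j)\<^sup>2 = 4 ^ j" by (simp add: power_even_eq power2_eq_square flip: power_mult_distrib)
  moreover have "(16::real) ^ j = 4 ^ j * 4 ^ j" by (simp flip: power_mult_distrib)
  ultimately show "64 * (1/16) ^ j * (2 ^ j) ^ DIM(real^2) = 64 * (1/4::real) ^ j"
   by (simp add: power_divide)
 qed
 then show "summable (\<lambda>j. 64 * (1/16) ^ j * (2 ^ j) ^ DIM(real^2) :: real)"
  by (simp add: summable_mult summable_geometric)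
 fix z :: "real^2"
 obtain j where j: "norm z < 2 ^ j" "j = 0 \<or> 2 ^ j <= 2 * norm z" using dyadic_above by blast
 have p: "z \<bullet> z + 1 > 0" using inner_ge_zero[of z] by linarith
 have "4 / (z \<bullet> z + 1)\<^sup>2 <= 64 * (1/16) ^ j"
 proof (cases "j = 0")
  case True
  have "1\<^sup>2 <= (z \<bullet> z + 1)\<^sup>2" by (intro power_mono) auto
  then have "4 / (z \<bullet> z + 1)\<^sup>2 <= 4 / 1" using p by (intro divide_left_mono) auto
  then show ?thesis using True by simp
 next
  case False
  then have a: "2 ^ j <= 2 * norm z" using j by simp
  have "(16::real) ^ j = (2 ^ j) ^ 4" by (simp add: power_even_eq flip: power_mult_distrib power_mult) (simp add: power_mult mult.commute[of j])
  also have "... <= (2 * norm z) ^ 4" using a by (intro power_mono) auto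
  also have "... = 16 * (z \<bullet> z)\<^sup>2"
   by (simp add: power_mult_distrib power2_norm_eq_inner[symmetric] flip: power_mult)
  also have "... <= 16 * (z \<bullet> z + 1)\<^sup>2" by (intro mult_left_mono power_mono) auto
  finally have b: "16 ^ j <= 16 * (z \<bullet> z + 1)\<^sup>2" .
  have "(z \<bullet> z + 1)\<^sup>2 > 0" using inner_ge_zero[of z] by (intro zero_less_power) linarith
  then show ?thesis using b by (simp add: power_divide field_simps)
 qed
 then show "4 / (z \<bullet> z + 1)\<^sup>2 = 0 \<or> (\<exists>j. norm z < 2 ^ j \<and> 4 / (z \<bullet> z + 1)\<^sup>2 <= 64 * (1/16) ^ j)"
  using j by blast
qed auto

lemma delta_mass_pos: "delta_mass > 0"
proof -
 have "(LINT z|lborel. 4 / ((z::real^2) \<bullet> z + 1)\<^sup>2) \<noteq> 0"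
 proof
  assume "(LINT z|lborel. 4 / ((z::real^2) \<bullet> z + 1)\<^sup>2) = 0"
  then have "AE z::real^2 in lborel. 4 / (z \<bullet> z + 1)\<^sup>2 = 0"
   by (subst (asm) integral_nonneg_eq_0_iff_AE[OF delta_kernel_integrable]) auto
  moreover have "4 / (z \<bullet> z + 1)\<^sup>2 \<noteq> 0" for z :: "real^2"
   using add_nonneg_pos[OF inner_ge_zero[of z] zero_less_one] by simp
  ultimately have "AE z::real^2 in lborel. False" by simp
  then show False by (simp add: AE_iff_measurable[of UNIV])
 qed
 moreover have "delta_mass >= 0" unfolding delta_mass_def by (intro integral_nonneg_AE) auto
 ultimately show ?thesis by (simp add: delta_mass_def less_le)
qed

lemma delta_kernel_scale:
 fixes \<xi> :: "real^2 => real"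
 assumes r: "r > 0" and \<xi>: "continuous_on UNIV \<xi>"
 shows "(LINT x|lborel. 4 * r\<^sup>2 / ((y - x) \<bullet> (y - x) + r\<^sup>2)\<^sup>2 * \<xi> x) = (LINT z|lborel. 4 / (z \<bullet> z + 1)\<^sup>2 * \<xi> (y + r *\<^sub>R z))"
proof -
 let ?f = "\<lambda>x. 4 * r\<^sup>2 / ((y - x) \<bullet> (y - x) + r\<^sup>2)\<^sup>2 * \<xi> x"
 let ?T = "\<lambda>x::real^2. y + r *\<^sub>R x"
 have pos: "(y - x) \<bullet> (y - x) + r\<^sup>2 \<noteq> 0" for x using r inner_ge_zero[of "y - x"] zero_less_power[OF r, of 2] by linarith
 have c: "continuous_on UNIV ?f" using pos by (intro continuous_intros \<xi>) auto
 then have m: "?f \<in> borel_measurable borel" by (rule borel_measurable_continuous_onI)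
 have "(LINT x|lborel. ?f x) = (\<integral>x. ?f x \<partial>density (distr lborel borel ?T) (\<lambda>_. \<bar>r\<bar>^DIM(real^2)))"
  using lborel_affine[of r y] r by simp
 also have "... = (\<integral>x. r\<^sup>2 * ?f x \<partial>distr lborel borel ?T)"
 proof -
  have "?f \<in> borel_measurable (distr lborel borel ?T)" using m by simp
  then show ?thesis by (subst integral_density) simp_all
 qed
 also have "... = (LINT z|lborel. r\<^sup>2 * ?f (?T z))"
  using borel_measurable_times[OF borel_measurable_const[of "r\<^sup>2"] m] by (subst integral_distr) auto
 also have "... = (LINT z|lborel. 4 / (z \<bullet> z + 1)\<^sup>2 * \<xi> (y + r *\<^sub>R z))"
 proof (rule Bochner_Integration.integral_cong)
  fix z :: "real^2"
  have e: "(y - ?T z) \<bullet> (y - ?T z) + r\<^sup>2 = r\<^sup>2 * (z \<bullet> z + 1)" by (simp add: power2_eq_square algebra_simps)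
  have "r\<^sup>2 * (4 * r\<^sup>2 / (r\<^sup>2 * (z \<bullet> z + 1))\<^sup>2) = 4 / (z \<bullet> z + 1)\<^sup>2"
   using r by (simp add: power_mult_distrib power2_eq_square)
  moreover have "r\<^sup>2 * ?f (?T z) = (r\<^sup>2 * (4 * r\<^sup>2 / (r\<^sup>2 * (z \<bullet> z + 1))\<^sup>2)) * \<xi> (y + r *\<^sub>R z)"
   unfolding e by (simp only: mult.assoc)
  ultimately show "r\<^sup>2 * ?f (?T z) = 4 / (z \<bullet> z + 1)\<^sup>2 * \<xi> (y + r *\<^sub>R z)" by (simp only:)
 qed simp
 finally show ?thesis .
qed

text \<open>The kernel is the Laplacian of \<open>ln (|z|^2 + r^2)\<close>. After the substitution
  \<open>x = y + r z\<close> it no longer depends on \<open>r\<close>, so dominated convergence only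
  involves the continuous bounded factor.\<close>

lemma delta_kernel_tendsto:
 fixes \<xi> :: "real^2 => real"
 assumes r: "\<And>n. r n > 0" "r \<longlonglongrightarrow> 0" and \<xi>: "continuous_on UNIV \<xi>" "\<And>x. \<bar>\<xi> x\<bar> <= C"
 shows "(\<lambda>n. LINT x|lborel. 4 * (r n)\<^sup>2 / ((y - x) \<bullet> (y - x) + (r n)\<^sup>2)\<^sup>2 * \<xi> x) \<longlonglongrightarrow> delta_mass * \<xi> y"
  "\<bar>LINT x|lborel. 4 * (r n)\<^sup>2 / ((y - x) \<bullet> (y - x) + (r n)\<^sup>2)\<^sup>2 * \<xi> x\<bar> <= delta_mass * C"
proof -
 note K = delta_kernel_integrable
 have c: "continuous_on UNIV (\<lambda>z. \<xi> (y + s *\<^sub>R z))" for s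
  by (intro continuous_on_compose2[OF \<xi>(1)] continuous_intros) auto
 have m: "(\<lambda>z. 4 / (z \<bullet> z + 1)\<^sup>2 * \<xi> (y + s *\<^sub>R z)) \<in> borel_measurable lborel" for s
  using borel_measurable_continuous_onI[OF c[of s]] borel_measurable_integrable[OF K] by simp
 have w: "integrable lborel (\<lambda>z::real^2. 4 / (z \<bullet> z + 1)\<^sup>2 * C)" using K by (rule integrable_mult_left)
 have b: "\<bar>4 / (z \<bullet> z + 1)\<^sup>2 * \<xi> (y + s *\<^sub>R z)\<bar> <= 4 / (z \<bullet> z + 1)\<^sup>2 * C" for z s
  unfolding abs_mult using \<xi>(2)[of "y + s *\<^sub>R z"] by (intro mult_mono) auto
 have "(\<lambda>n. LINT z|lborel. 4 / (z \<bullet> z + 1)\<^sup>2 * \<xi> (y + r n *\<^sub>R z)) \<longlonglongrightarrow> (LINT z|lborel. 4 / (z \<bullet> z + 1)\<^sup>2 * \<xi> (y + 0 *\<^sub>R z))"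
 proof (rule integral_dominated_convergence[OF m m w])
  have "isCont \<xi> (y + 0 *\<^sub>R z)" for z using \<xi>(1) by (simp add: continuous_on_eq_continuous_at)
  then show "AE z in lborel. (\<lambda>n. 4 / (z \<bullet> z + 1)\<^sup>2 * \<xi> (y + r n *\<^sub>R z)) \<longlonglongrightarrow> 4 / (z \<bullet> z + 1)\<^sup>2 * \<xi> (y + 0 *\<^sub>R z)"
   using r(2) by (intro AE_I2 tendsto_mult tendsto_const isCont_tendsto_compose[of "y + 0 *\<^sub>R _" \<xi>] tendsto_intros)
  show "AE z in lborel. norm (4 / (z \<bullet> z + 1)\<^sup>2 * \<xi> (y + r n *\<^sub>R z)) <= 4 / (z \<bullet> z + 1)\<^sup>2 * C" for n
   using b by (intro AE_I2) simp
 qed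
 moreover have "(LINT z|lborel. 4 / ((z::real^2) \<bullet> z + 1)\<^sup>2 * \<xi> (y + 0 *\<^sub>R z)) = delta_mass * \<xi> y"
  unfolding delta_mass_def integral_mult_left_zero[symmetric] by simp
 ultimately show "(\<lambda>n. LINT x|lborel. 4 * (r n)\<^sup>2 / ((y - x) \<bullet> (y - x) + (r n)\<^sup>2)\<^sup>2 * \<xi> x) \<longlonglongrightarrow> delta_mass * \<xi> y"
  unfolding delta_kernel_scale[OF r(1) \<xi>(1)] by simp
 have "\<bar>LINT z|lborel. 4 / (z \<bullet> z + 1)\<^sup>2 * \<xi> (y + r n *\<^sub>R z)\<bar> <= (LINT z|lborel. 4 / ((z::real^2) \<bullet> z + 1)\<^sup>2 * C)"
 proof (rule order_trans[OF integral_abs_bound integral_mono])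
  show "integrable lborel (\<lambda>z. \<bar>4 / (z \<bullet> z + 1)\<^sup>2 * \<xi> (y + r n *\<^sub>R z)\<bar>)"
  proof (rule Bochner_Integration.integrable_bound[OF w borel_measurable_abs[OF m] AE_I2])
   show "norm \<bar>4 / (z \<bullet> z + 1)\<^sup>2 * \<xi> (y + r n *\<^sub>R z)\<bar> <= norm (4 / (z \<bullet> z + 1)\<^sup>2 * C)" for z
    using b[of z "r n"] unfolding real_norm_def by linarith
  qed
 qed (use w b in auto)
 then show "\<bar>LINT x|lborel. 4 * (r n)\<^sup>2 / ((y - x) \<bullet> (y - x) + (r n)\<^sup>2)\<^sup>2 * \<xi> x\<bar> <= delta_mass * C"
  unfolding delta_kernel_scale[OF r(1) \<xi>(1)] delta_mass_def integral_mult_left_zero[symmetric] .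
qed

lemma integrable_annM_lborel:
 fixes g :: "real^2 => real"
 assumes g: "integrable lborel g"
 shows "integrable annM g" "(LINT x|annM. g x) = (LINT x|lborel. indicator annulus x * g x)"
proof -
 have i: "integrable lborel (\<lambda>x. indicator annulus x * g x)"
  using integrable_mult_indicator[OF _ g, of annulus] open_annulus by (simp add: borel_open)
 then have "integrable lebesgue (\<lambda>x. indicator annulus x * g x)" by (subst integrable_completion) auto
 then show "integrable annM g" using annulus_lmeasurable by (simp add: integrable_restrict_space)
 show "(LINT x|annM. g x) = (LINT x|lborel. indicator annulus x * g x)"
  using annulus_lmeasurable i by (simp add: integral_restrict_space integral_completion)
qed

text \<open>Stated on the closed unit ball in order to cover the pole \<open>x0\<close> of the
  weight, which lies on the boundary of the annulus. The ball of radius 2 absorbs every translate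
  that occurs.\<close>

lemma singular_integral_ball:
 assumes s: "0 <= s" "s < 2"
 shows "\<exists>C. \<forall>x. norm x <= 1 \<longrightarrow> integrable annM (\<lambda>y. norm (y - x) powr (- s)) \<and> (LINT y|annM. norm (y - x) powr (- s)) <= C"
proof (intro exI allI impI)
 fix x :: "real^2" assume x: "norm x <= 1"
 let ?h = "\<lambda>z::real^2. indicator (ball 0 2) z * norm z powr (- s)"
 note h = integrable_norm_powr[OF s]
 have tr: "integrable lborel (\<lambda>y. ?h (y - x))" "(LINT y|lborel. ?h (y - x)) = integral\<^sup>L lborel ?h"
 proof -
  have m: "?h \<in> borel_measurable borel" using h by simp
  have "integrable (distr lborel borel ((+) (- x))) ?h" using h by (simp add: lborel_distr_plus)
  then show "integrable lborel (\<lambda>y. ?h (y - x))" using m by (subst (asm) integrable_distr_eq) auto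
  have "integral\<^sup>L lborel ?h = integral\<^sup>L (distr lborel borel ((+) (- x))) ?h" by (simp add: lborel_distr_plus)
  also have "... = (LINT y|lborel. ?h (y - x))" using m by (subst integral_distr) auto
  finally show "(LINT y|lborel. ?h (y - x)) = integral\<^sup>L lborel ?h" ..
 qed
 have eq: "?h (y - x) = norm (y - x) powr (- s)" if "y \<in> annulus" for y
  using annulus_norm[OF that] x norm_triangle_ineq4[of y x] by (simp add: indicator_def)
 have a: "integrable annM (\<lambda>y. norm (y - x) powr (- s)) \<longleftrightarrow> integrable annM (\<lambda>y. ?h (y - x))"
  by (rule Bochner_Integration.integrable_cong) (simp_all add: eq)
 have b: "(LINT y|annM. norm (y - x) powr (- s)) = (LINT y|annM. ?h (y - x))"
  by (rule Bochner_Integration.integral_cong) (simp_all add: eq)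
 have "(LINT y|annM. ?h (y - x)) <= (LINT y|lborel. ?h (y - x))"
  unfolding integrable_annM_lborel(2)[OF tr(1)]
  using tr(1) integrable_mult_indicator[OF _ tr(1), of annulus] open_annulus
  by (intro integral_mono) (auto simp: borel_open indicator_def)
 then show "integrable annM (\<lambda>y. norm (y - x) powr (- s)) \<and> (LINT y|annM. norm (y - x) powr (- s)) <= integral\<^sup>L lborel ?h"
  unfolding a b using integrable_annM_lborel(1)[OF tr(1)] tr(2) by simp
qed

lemma singular_integral:
 assumes s: "0 <= s" "s < 2"
 shows "\<exists>C. \<forall>x\<in>annulus. integrable annM (\<lambda>y. norm (y - x) powr (- s)) \<and> (LINT y|annM. norm (y - x) powr (- s)) <= C"
 using singular_integral_ball[OF s] annulus_norm by (meson less_imp_le)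

section \<open>Pointwise bounds for the parametrix and its error kernel\<close>

lemma pw_constants_exist:
 "\<exists>C\<ge>1. (\<forall>x\<in>annulus. norm (pwg x) <= C \<and> \<bar>pwl x\<bar> <= C) \<and>
   (\<forall>x\<in>annulus. \<forall>y\<in>annulus. \<bar>pw x - pw y\<bar> <= C * norm (y - x))"
proof -
 obtain C1 where C1: "\<And>x. x \<in> cball 0 1 ==> norm (pwg x) <= C1"
 proof -
  have "bounded (pwg ` cball 0 1)"
   by (intro compact_imp_bounded compact_continuous_image continuous_pw continuous_on_id compact_cball)
  then show ?thesis using that unfolding bounded_iff by blast
 qed
 obtain C2 where C2: "\<And>x. x \<in> annulus ==> norm (pwl x) <= C2"
  using closed_annulus_bounded[OF continuous_pw(3)[OF continuous_on_id]] by blast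
 define C where "C = max 1 (max C1 C2)"
 have "\<bar>pw x - pw y\<bar> <= C * norm (y - x)" if "x \<in> annulus" "y \<in> annulus" for x y
 proof -
  have "\<bar>pw x - pw y\<bar> <= C1 * norm (x - y)"
   by (rule bounded_gderiv_lipschitz[of "cball 0 1"])
    (use that annulus_norm pw_gderiv C1 in \<open>auto simp: less_imp_le\<close>)
  also have "... <= C * norm (x - y)" by (intro mult_right_mono) (auto simp: C_def)
  finally show ?thesis by (simp add: norm_minus_commute)
 qed
 moreover have "norm (pwg x) <= C \<and> \<bar>pwl x\<bar> <= C" if "x \<in> annulus" for x
  using C1[of x] C2[OF that] annulus_norm[OF that] by (auto simp: C_def)
 ultimately show ?thesis by (intro exI[of _ C]) (auto simp: C_def)
qed

definition pwC :: real where
 "pwC = (SOME C. C >= 1 \<and> (\<forall>x\<in>annulus. norm (pwg x) <= C \<and> \<bar>pwl x\<bar> <= C) \<and>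
   (\<forall>x\<in>annulus. \<forall>y\<in>annulus. \<bar>pw x - pw y\<bar> <= C * norm (y - x)))"

lemma pwC: "pwC >= 1" "x \<in> annulus ==> norm (pwg x) <= pwC" "x \<in> annulus ==> \<bar>pwl x\<bar> <= pwC"
 "x \<in> annulus ==> y \<in> annulus ==> \<bar>pw x - pw y\<bar> <= pwC * norm (y - x)"
 using someI_ex[OF pw_constants_exist, folded pwC_def] by blast+

lemma NN_facts:
 assumes "x \<in> annulus" "y \<in> annulus" "e >= 0"
 shows "NN e x y >= pw x * pw y" "NN e x y > 0" "NN e x y >= (norm (y - x))\<^sup>2" "NN e x y >= e"
  "NN e x y = (norm (y - x))\<^sup>2 + e + pw x * pw y"
proof -
 have p: "pw x * pw y > 0" using assms pw_collar(3) by simp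
 show "NN e x y = (norm (y - x))\<^sup>2 + e + pw x * pw y" by (simp add: NN_def power2_norm_eq_inner)
 then show "NN e x y >= pw x * pw y" "NN e x y > 0" "NN e x y >= (norm (y - x))\<^sup>2" "NN e x y >= e"
  using p assms(3) zero_le_power2[of "norm (y - x)"] by linarith+
qed

text \<open>If \<open>y\<close> is far from \<open>x\<close> on the scale of \<open>pw x\<close>,
  the squared distance is large enough. Otherwise the Lipschitz bound gives
  \<open>pw y \<ge> pw x / 2\<close>, and the product term is.\<close>

lemma NN_ge_pw_sq:
 assumes x: "x \<in> annulus" and y: "y \<in> annulus" and e: "e >= 0"
 shows "NN e x y >= (pw x)\<^sup>2 / (4 * pwC\<^sup>2)"
proof (cases "norm (y - x) >= pw x / (2 * pwC)")
 case True
 have "(pw x)\<^sup>2 / (4 * pwC\<^sup>2) = (pw x / (2 * pwC))\<^sup>2" by (simp add: power_divide power_mult_distrib)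
 also have "... <= (norm (y - x))\<^sup>2"
  using True pw_collar(3)[OF x] pwC(1) by (intro power_mono) auto
 finally show ?thesis using NN_facts(3)[OF x y e] by linarith
next
 case False
 have "pwC * norm (y - x) <= pw x / 2" using False pwC(1) by (simp add: field_simps)
 then have "pw y >= pw x / 2" using pwC(4)[OF x y] by linarith
 then have "pw x * (pw x / 2) <= pw x * pw y" using pw_collar(3)[OF x] by (intro mult_left_mono) auto
 also have "... <= NN e x y" by (rule NN_facts(1)[OF x y e])
 finally have 1: "(pw x)\<^sup>2 / 2 <= NN e x y" by (simp add: power2_eq_square)
 have "1 <= pwC\<^sup>2" using pwC(1) by (simp add: one_le_power)
 then have "(pw x)\<^sup>2 / (4 * pwC\<^sup>2) <= (pw x)\<^sup>2 / 2" by (intro divide_left_mono) auto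
 with 1 show ?thesis by linarith
qed

lemma GG_nonneg:
 assumes "x \<in> annulus" "y \<in> annulus" "e >= 0"
 shows "GG e x y >= 0"
 using assms pw_collar(3)[OF assms(1)] pw_collar(3)[OF assms(2)] by (simp add: GG_def)

lemma GG_antimono:
 assumes "x \<in> annulus" "y \<in> annulus" "e >= 0" "y \<noteq> x"
 shows "GG e x y <= GG 0 x y"
proof -
 have p: "pw x * pw y > 0" using assms pw_collar(3) by simp
 have d: "(norm (y - x))\<^sup>2 > 0" using assms(4) by simp
 have "pw x * pw y / ((norm (y - x))\<^sup>2 + e) <= pw x * pw y / ((norm (y - x))\<^sup>2 + 0)"
  using p d assms(3) by (intro divide_left_mono mult_pos_pos add_pos_nonneg) auto
 moreover have "pw x * pw y / ((norm (y - x))\<^sup>2 + e) >= 0" using p assms(3) by simp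
 ultimately show ?thesis unfolding GG_def by simp
qed

text \<open>Put \<open>s = pw x / norm (y - x)\<close>. The argument of the logarithm is at most
  \<open>1 + s^2 + pwC * s\<close>, which the exponential series bounds by
  \<open>exp ((pwC + 2) * s)\<close>. Linear vanishing in \<open>x\<close> thus costs one power of
  the distance.\<close>

lemma GG_bound:
 assumes x: "x \<in> annulus" and y: "y \<in> annulus" and e: "e >= 0" and ne: "y \<noteq> x"
 shows "GG e x y <= (pwC + 2) * pw x / norm (y - x)"
proof -
 let ?r = "norm (y - x)"
 define s where "s = pw x / ?r"
 have r: "?r > 0" using ne by simp
 have px: "pw x > 0" "pw y > 0" using x y pw_collar(3) by auto
 have s0: "s > 0" using px r by (simp add: s_def)
 have "pw y <= pw x + pwC * ?r" using pwC(4)[OF x y] by linarith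
 then have "pw x * pw y / ?r\<^sup>2 <= pw x * (pw x + pwC * ?r) / ?r\<^sup>2"
  using px by (intro divide_right_mono mult_left_mono) auto
 also have "... = s\<^sup>2 + pwC * s" using r by (simp add: s_def field_simps power2_eq_square)
 finally have 1: "pw x * pw y / ?r\<^sup>2 <= s\<^sup>2 + pwC * s" .
 have "GG e x y <= GG 0 x y" by (rule GG_antimono[OF x y e ne])
 also have "GG 0 x y = ln (1 + pw x * pw y / ?r\<^sup>2)" by (simp add: GG_def)
 also have "... <= ln (1 + (s\<^sup>2 + pwC * s))"
 proof (rule ln_mono)
  have "pw x * pw y / ?r\<^sup>2 > 0" using px r by simp
  then show "0 < 1 + pw x * pw y / ?r\<^sup>2" by linarith
 qed (use 1 in simp)
 also have "... <= ln (exp ((pwC + 2) * s))"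
 proof (subst ln_le_cancel_iff)
  have a: "(pwC + 2) * s >= 0" using s0 pwC(1) by simp
  have "1 + (pwC + 2) * s + ((pwC + 2) * s)\<^sup>2 / 2 <= exp ((pwC + 2) * s)"
   by (rule exp_lower_Taylor_quadratic[OF a])
  moreover have "pwC * s <= (pwC + 2) * s" using s0 by simp
  moreover have "s\<^sup>2 <= ((pwC + 2) * s)\<^sup>2 / 2"
  proof -
   have "2\<^sup>2 <= (pwC + 2)\<^sup>2" using pwC(1) by (intro power_mono) auto
   then have "2 * s\<^sup>2 <= (pwC + 2)\<^sup>2 * s\<^sup>2" by (intro mult_right_mono) auto
   then show ?thesis by (simp add: power_mult_distrib)
  qed
  ultimately show "1 + (s\<^sup>2 + pwC * s) <= exp ((pwC + 2) * s)" by linarith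
  show "1 + (s\<^sup>2 + pwC * s) > 0" using s0 pwC(1) by (intro add_pos_nonneg) auto
 qed simp
 also have "... = (pwC + 2) * pw x / ?r" by (simp add: s_def)
 finally show ?thesis .
qed

lemma GG_tendsto:
 assumes "y \<noteq> x" "r \<longlonglongrightarrow> 0" "x \<in> annulus" "y \<in> annulus"
 shows "(\<lambda>n. GG (r n) x y) \<longlonglongrightarrow> GG 0 x y"
proof -
 have p: "pw x * pw y > 0" using assms pw_collar(3) by simp
 then have "1 + pw x * pw y / ((norm (y - x))\<^sup>2 + 0) > 0" by (intro add_pos_nonneg) auto
 then show ?thesis unfolding GG_def using assms(1,2) by (intro tendsto_intros) auto
qed

definition GGx :: "real => real^2 => real^2 => real^2" where
 "GGx e x y = (1 / NN e x y) *\<^sub>R (2 *\<^sub>R (x - y) + pw y *\<^sub>R pwg x) - (2 / ((norm (y - x))\<^sup>2 + e)) *\<^sub>R (x - y)"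

lemma NN_gderiv: "GDERIV (\<lambda>x. NN e x y) x :> 2 *\<^sub>R (x - y) + pw y *\<^sub>R pwg x"
proof -
 have "GDERIV (\<lambda>x. (y - x) \<bullet> (y - x) + e) x :> 2 *\<^sub>R (x - y)"
  by (auto simp: gderiv_def inner_commute algebra_simps intro!: derivative_eq_intros)
 from GDERIV_add[OF this GDERIV_mult[OF pw_gderiv GDERIV_const[of "pw y"]]]
 show ?thesis by (simp add: NN_def)
qed

lemma GG_gderiv:
 assumes x: "x \<in> annulus" and y: "y \<in> annulus" and e: "e >= 0" "y \<noteq> x \<or> e > 0"
 shows "GDERIV (\<lambda>x. GG e x y) x :> GGx e x y"
proof -
 have d: "(norm (y - x))\<^sup>2 + e > 0" using e by (auto intro: add_pos_nonneg add_nonneg_pos)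
 have n: "NN e x y > 0" by (rule NN_facts(2)[OF x y e(1)])
 let ?D = "\<lambda>x. (norm (y - x))\<^sup>2 + e"
 have gD: "GDERIV ?D x :> 2 *\<^sub>R (x - y)"
  unfolding power2_norm_eq_inner
  by (auto simp: gderiv_def inner_commute algebra_simps intro!: derivative_eq_intros)
 have l: "GDERIV (\<lambda>x. ln (NN e x y)) x :> (1 / NN e x y) *\<^sub>R (2 *\<^sub>R (x - y) + pw y *\<^sub>R pwg x)"
  by (rule GDERIV_DERIV_compose[OF NN_gderiv]) (use n in \<open>auto intro!: derivative_eq_intros\<close>)
 have m: "GDERIV (\<lambda>x. ln (?D x)) x :> (1 / ?D x) *\<^sub>R (2 *\<^sub>R (x - y))"
  by (rule GDERIV_DERIV_compose[OF gD]) (use d in \<open>auto intro!: derivative_eq_intros\<close>)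
 have g: "GDERIV (\<lambda>x. ln (NN e x y) - ln (?D x)) x :> GGx e x y"
  using GDERIV_diff[OF l m] by (simp add: GGx_def)
 let ?S = "if e > 0 then annulus else annulus - {y}"
 have oS: "open ?S" using open_annulus by (auto intro: open_Diff)
 have xS: "x \<in> ?S" using x e by auto
 have eq: "ln (NN e z y) - ln (?D z) = GG e z y" if "z \<in> ?S" for z
 proof -
  have z: "z \<in> annulus" "y \<noteq> z \<or> e > 0" using that by (auto split: if_splits)
  have d: "?D z > 0" using z(2) e(1) by (auto intro: add_pos_nonneg add_nonneg_pos)
  have "1 + pw z * pw y / ?D z = NN e z y / ?D z"
   using d NN_facts(5)[OF z(1) y e(1)] by (simp add: field_simps)
  then show ?thesis using d NN_facts(2)[OF z(1) y e(1)] by (simp add: GG_def ln_div)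
 qed
 show ?thesis
  using g unfolding gderiv_def
  by (rule has_derivative_transform_within_open[OF _ oS xS]) (rule eq)
qed

text \<open>Collecting the coefficients of \<open>x - y\<close> brings out the factor
  \<open>pw x * pw y\<close>. The bounds below and the symmetrised virial kernel both start from
  this form.\<close>

lemma GGx_alt:
 assumes x: "x \<in> annulus" and y: "y \<in> annulus" and e: "e >= 0" "y \<noteq> x \<or> e > 0"
 shows "GGx e x y = (pw y / NN e x y) *\<^sub>R pwg x - (2 * (pw x * pw y) / (NN e x y * ((norm (y - x))\<^sup>2 + e))) *\<^sub>R (x - y)"
proof -
 have d: "(norm (y - x))\<^sup>2 + e > 0" using e by (auto intro: add_pos_nonneg add_nonneg_pos)
 have n: "NN e x y > 0" by (rule NN_facts(2)[OF x y e(1)])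
 have "2 / NN e x y - 2 / ((norm (y - x))\<^sup>2 + e) = - (2 * (pw x * pw y) / (NN e x y * ((norm (y - x))\<^sup>2 + e)))"
  using d n NN_facts(5)[OF x y e(1)] by (simp add: field_simps)
 moreover have "GGx e x y = (2 / NN e x y - 2 / ((norm (y - x))\<^sup>2 + e)) *\<^sub>R (x - y) + (pw y / NN e x y) *\<^sub>R pwg x"
  by (simp add: GGx_def scaleR_right_distrib scaleR_left_diff_distrib)
 ultimately show ?thesis by simp
qed

lemma GGx_bound:
 assumes x: "x \<in> annulus" and y: "y \<in> annulus" and e: "e >= 0" and ne: "y \<noteq> x"
 shows "norm (GGx e x y) <= (pwC * (1 + pwC) + 2) / norm (y - x)"
proof -
 let ?r = "norm (y - x)"
 have r: "?r > 0" using ne by simp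
 have px: "pw x > 0" "pw y > 0" using x y pw_collar(3) by auto
 have n: "NN e x y > 0" by (rule NN_facts(2)[OF x y e])
 have c1: "pwC >= 1" by (rule pwC)
 \<comment> \<open>When \<open>pw x\<close> exceeds the distance, \<open>NN\<close> is bounded below
   by its product term; otherwise \<open>pw y\<close> is itself of the order of the distance, and
   the squared distance serves as the lower bound.\<close>
 have a: "pw y / NN e x y <= (1 + pwC) / ?r"
 proof (cases "pw x >= ?r")
  case True
  have "pw y / NN e x y <= pw y / (pw x * pw y)"
   using NN_facts(1)[OF x y e] px n by (intro divide_left_mono mult_pos_pos) auto
  also have "... = 1 / pw x" using px by simp
  also have "... <= (1 + pwC) / ?r" using True r px c1 by (intro frac_le) auto
  finally show ?thesis .
 next
  case False
  have "pw y <= pw x + pwC * ?r" using pwC(4)[OF x y] by linarith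
  also have "... <= (1 + pwC) * ?r" using False by (simp add: algebra_simps)
  finally have "pw y / NN e x y <= (1 + pwC) * ?r / ?r\<^sup>2"
   using NN_facts(3)[OF x y e] px r c1 by (intro frac_le) auto
  then show ?thesis using r by (simp add: power2_eq_square)
 qed
 have b: "2 * (pw x * pw y) / (NN e x y * (?r\<^sup>2 + e)) <= 2 / ?r\<^sup>2"
 proof -
  have "2 * (pw x * pw y) / (NN e x y * (?r\<^sup>2 + e)) <= 2 * NN e x y / (NN e x y * (?r\<^sup>2 + e))"
   using NN_facts(1)[OF x y e] n e r by (intro divide_right_mono) auto
  also have "... = 2 / (?r\<^sup>2 + e)" using n by simp
  also have "... <= 2 / ?r\<^sup>2" using e r by (intro divide_left_mono mult_pos_pos add_pos_nonneg) auto
  finally show ?thesis .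
 qed
 have "norm (GGx e x y) <= norm ((pw y / NN e x y) *\<^sub>R pwg x) + norm ((2 * (pw x * pw y) / (NN e x y * (?r\<^sup>2 + e))) *\<^sub>R (x - y))"
  unfolding GGx_alt[OF x y e disjI1[OF ne]] by (rule norm_triangle_ineq4)
 also have "norm ((pw y / NN e x y) *\<^sub>R pwg x) <= (1 + pwC) / ?r * pwC"
  unfolding norm_scaleR using a px n pwC(2)[OF x] r c1 by (intro mult_mono) auto
 also have "norm ((2 * (pw x * pw y) / (NN e x y * (?r\<^sup>2 + e))) *\<^sub>R (x - y)) <= 2 / ?r\<^sup>2 * ?r"
  unfolding norm_scaleR norm_minus_commute[of x y] using b px n e by (intro mult_right_mono) auto
 also have "(1 + pwC) / ?r * pwC + 2 / ?r\<^sup>2 * ?r = (pwC * (1 + pwC) + 2) / ?r"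
  using r by (simp add: field_simps power2_eq_square)
 finally show ?thesis by simp
qed

lemma GGx_bound_eps:
 assumes x: "x \<in> annulus" and y: "y \<in> annulus" and e: "e > 0"
 shows "norm (GGx e x y) <= (8 * pwC + 8) / e"
proof -
 have n: "NN e x y > 0" "NN e x y >= e" using NN_facts[OF x y, of e] e by auto
 have xy: "norm (x - y) <= 2" using annulus_norm[OF x] annulus_norm[OF y] norm_triangle_ineq4[of x y] by linarith
 have "norm (GGx e x y) <= norm ((1 / NN e x y) *\<^sub>R (2 *\<^sub>R (x - y) + pw y *\<^sub>R pwg x)) + norm ((2 / ((norm (y - x))\<^sup>2 + e)) *\<^sub>R (x - y))"
  unfolding GGx_def by (rule norm_triangle_ineq4)
 also have "norm ((1 / NN e x y) *\<^sub>R (2 *\<^sub>R (x - y) + pw y *\<^sub>R pwg x)) <= (1 / e) * (2 * 2 + 8 * pwC)"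
 proof -
  have "norm (2 *\<^sub>R (x - y) + pw y *\<^sub>R pwg x) <= 2 * norm (x - y) + pw y * norm (pwg x)"
   using norm_triangle_ineq[of "2 *\<^sub>R (x - y)" "pw y *\<^sub>R pwg x"] pw_collar(3)[OF y] by simp
  also have "... <= 2 * 2 + 8 * pwC"
   using xy pw_collar[OF y] pwC(2)[OF x] by (intro add_mono mult_mono) auto
  finally have "norm (2 *\<^sub>R (x - y) + pw y *\<^sub>R pwg x) <= 2 * 2 + 8 * pwC" .
  moreover have "1 / NN e x y <= 1 / e" using n e by (intro divide_left_mono) auto
  ultimately show ?thesis unfolding norm_scaleR using n e by (intro mult_mono) auto
 qed
 also have "norm ((2 / ((norm (y - x))\<^sup>2 + e)) *\<^sub>R (x - y)) <= (2 / e) * 2"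
 proof -
  have "2 / ((norm (y - x))\<^sup>2 + e) <= 2 / e" using e by (intro divide_left_mono mult_pos_pos add_nonneg_pos) auto
  then show ?thesis unfolding norm_scaleR using xy e by (intro mult_mono) (auto simp: add_nonneg_nonneg)
 qed
 also have "(1 / e) * (2 * 2 + 8 * pwC) + (2 / e) * 2 = (8 * pwC + 8) / e" using e by (simp add: field_simps)
 finally show ?thesis by simp
qed

lemma GGx_tendsto:
 assumes "y \<noteq> x" "r \<longlonglongrightarrow> 0" "x \<in> annulus" "y \<in> annulus"
 shows "(\<lambda>n. GGx (r n) x y) \<longlonglongrightarrow> GGx 0 x y"
proof -
 have "NN 0 x y \<noteq> 0" using NN_facts(2)[OF assms(3,4), of 0] by simp
 then show ?thesis unfolding GGx_def NN_def using assms(1,2) by (intro tendsto_intros) auto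
qed

definition NNg :: "real^2 => real^2 => real^2" where
 "NNg x y = 2 *\<^sub>R (x - y) + pw y *\<^sub>R pwg x"

definition kng :: "real^2 => real^2 => real^2" where
 "kng x y = pwl y *\<^sub>R NNg x y + 4 *\<^sub>R pwg y - (pwg y \<bullet> pwg y) *\<^sub>R pwg x"

text \<open>The error kernel: \<open>pw x * kap x y\<close> is the Laplacian in \<open>y\<close> of
  \<open>ln (NN 0 x y)\<close>. The factor \<open>pw x\<close> is kept outside, so that the error
  potential visibly vanishes at the boundary.\<close>

definition kap :: "real^2 => real^2 => real" where
 "kap x y = kn 0 x y / (NN 0 x y)\<^sup>2"

definition kapg :: "real^2 => real^2 => real^2" where
 "kapg x y = (1 / (NN 0 x y)\<^sup>2) *\<^sub>R kng x y - (2 * kn 0 x y / (NN 0 x y) ^ 3) *\<^sub>R NNg x y"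

definition same_collar :: "real^2 => real^2 => bool" where
 "same_collar x y \<longleftrightarrow> (x \<bullet> x <= 1/2 \<and> y \<bullet> y <= 1/2) \<or> (x \<bullet> x >= 3/4 \<and> y \<bullet> y >= 3/4)"

text \<open>In a common collar \<open>NN 0 x y\<close> is the squared modulus of
  \<open>1 - x conj(y)\<close>, respectively of \<open>2 x conj(y) - 1/2\<close>. As a function of
  \<open>y\<close> it is the squared modulus of an antiholomorphic function, so its logarithm is
  harmonic wherever it does not vanish.\<close>

lemma kn_same_collar:
 assumes "same_collar x y"
 shows "kn 0 x y = 0" "kng x y = 0"
proof -
 consider "x \<bullet> x <= 1/2" "y \<bullet> y <= 1/2" | "x \<bullet> x >= 3/4" "y \<bullet> y >= 3/4"
  using assms by (auto simp: same_collar_def)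
 then have "kn 0 x y = 0 \<and> kng x y = 0"
 proof cases
  case 1
  have a: "pw x = 2 * (x \<bullet> x) - 1/2" "pw y = 2 * (y \<bullet> y) - 1/2" "pwg x = 4 *\<^sub>R x" "pwg y = 4 *\<^sub>R y" "pwl y = 8"
   using 1 by (simp_all add: pw_def pwg_def pwl_def prof_low)
  have n: "NN 0 x y = y \<bullet> y - 2 * (x \<bullet> y) + x \<bullet> x + (2 * (x \<bullet> x) - 1/2) * (2 * (y \<bullet> y) - 1/2)"
   by (simp add: NN_def a inner_diff inner_commute)
  have "kn 0 x y = 0" unfolding kn_def n a by (simp add: inner_diff_left inner_commute algebra_simps)
  moreover have "kng x y = (16 + 16 * (4 * (y \<bullet> y) - 1) - 64 * (y \<bullet> y)) *\<^sub>R x"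
   unfolding kng_def NNg_def a by (simp add: algebra_simps)
  ultimately show ?thesis by simp
 next
  case 2
  have a: "pw x = 1 - x \<bullet> x" "pw y = 1 - y \<bullet> y" "pwg x = (-2) *\<^sub>R x" "pwg y = (-2) *\<^sub>R y" "pwl y = -4"
   using 2 by (simp_all add: pw_def pwg_def pwl_def prof_high)
  have n: "NN 0 x y = y \<bullet> y - 2 * (x \<bullet> y) + x \<bullet> x + (1 - x \<bullet> x) * (1 - y \<bullet> y)"
   by (simp add: NN_def a inner_diff inner_commute)
  have "kn 0 x y = 0" unfolding kn_def n a by (simp add: inner_diff_left inner_commute algebra_simps)
  moreover have "kng x y = 0"
   unfolding kng_def NNg_def a by (simp add: algebra_simps)
  ultimately show ?thesis by simp
 qed
 then show "kn 0 x y = 0" "kng x y = 0" by auto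
qed

text \<open>Either the squared radii differ by at least 1/8, which separates the points by 1/16, or
  both lie between 3/8 and 7/8, where \<open>pw\<close> is at least 5/64. The bound 1/256 is the
  smaller outcome of the two cases.\<close>

lemma NN_not_same_collar:
 assumes x: "x \<in> annulus" and y: "y \<in> annulus" and far: "\<not> same_collar x y"
 shows "NN 0 x y >= 1/256"
proof (cases "\<bar>x \<bullet> x - y \<bullet> y\<bar> >= 1/8")
 case True
 have "\<bar>x \<bullet> x - y \<bullet> y\<bar> = \<bar>(y - x) \<bullet> (y + x)\<bar>"
  by (simp add: inner_diff_left inner_add_right inner_commute[of x y] abs_minus_commute)
 also have "... <= norm (y - x) * norm (y + x)" by (rule Cauchy_Schwarz_ineq2)
 also have "... <= norm (y - x) * 2"
  using annulus_norm[OF x] annulus_norm[OF y] norm_triangle_ineq[of y x] by (intro mult_left_mono) auto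
 finally have "1/16 <= norm (y - x)" using True by simp
 then have "(1/16)\<^sup>2 <= (norm (y - x))\<^sup>2" by (intro power_mono) auto
 then show ?thesis using NN_facts(3)[OF x y, of 0] by (simp add: power2_eq_square)
next
 case False
 then have t: "3/8 <= x \<bullet> x" "x \<bullet> x <= 7/8" "3/8 <= y \<bullet> y" "y \<bullet> y <= 7/8"
  using far unfolding same_collar_def by linarith+
 have p: "pw z >= 5/64" if "3/8 <= z \<bullet> z" "z \<bullet> z <= 7/8" for z
 proof -
  have "0 <= (z \<bullet> z - 3/8) * (7/8 - z \<bullet> z)" using that by simp
  moreover have "(1 - z \<bullet> z) * (z \<bullet> z - 1/4) = 5/64 + (z \<bullet> z - 3/8) * (7/8 - z \<bullet> z)"
   by (simp add: field_simps)
  ultimately have "5/64 <= (1 - z \<bullet> z) * (z \<bullet> z - 1/4)" by linarith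
  also have "... <= pw z" unfolding pw_def using that by (intro prof_ge) auto
  finally show ?thesis .
 qed
 have "5/64 * (5/64) <= pw x * pw y" using p[OF t(1,2)] p[OF t(3,4)] by (intro mult_mono) auto
 then show ?thesis using NN_facts(1)[OF x y, of 0] by simp
qed

lemma continuous_NN [continuous_intros]:
 "continuous_on A f ==> continuous_on A g ==> continuous_on A (\<lambda>z. NN e (f z) (g z))"
 "continuous_on A f ==> continuous_on A g ==> continuous_on A (\<lambda>z. NNg (f z) (g z))"
 unfolding NN_def NNg_def by (intro continuous_intros; assumption)+

lemma continuous_kn [continuous_intros]:
 "continuous_on A f ==> continuous_on A g ==> continuous_on A (\<lambda>z. kn e (f z) (g z))"
 "continuous_on A f ==> continuous_on A g ==> continuous_on A (\<lambda>z. kng (f z) (g z))"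
 unfolding kn_def kng_def by (intro continuous_intros; assumption)+

text \<open>Degeneration of \<open>NN\<close> at the boundary is harmless: in a common collar the
  numerator vanishes identically, and all other pairs lie in a compact set on which
  \<open>NN 0\<close> is bounded below.\<close>

lemma kap_bound_exists: "\<exists>C\<ge>0. \<forall>x\<in>annulus. \<forall>y\<in>annulus. \<bar>kap x y\<bar> <= C \<and> norm (kapg x y) <= C"
proof -
 let ?S = "closed_annulus \<times> closed_annulus \<inter> {z. 1/256 <= NN 0 (fst z) (snd z)}"
 have S: "compact ?S"
  by (intro compact_Int_closed compact_Times compact_closed_annulus closed_Collect_le continuous_intros)
 have c: "continuous_on ?S (\<lambda>z. kap (fst z) (snd z))" "continuous_on ?S (\<lambda>z. kapg (fst z) (snd z))"
  unfolding kap_def kapg_def by (auto intro!: continuous_intros)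
 have "bounded ((\<lambda>z. kap (fst z) (snd z)) ` ?S)" "bounded ((\<lambda>z. kapg (fst z) (snd z)) ` ?S)"
  by (intro compact_imp_bounded compact_continuous_image[OF _ S] c)+
 then obtain C1 C2 where C: "\<And>z. z \<in> ?S ==> norm (kap (fst z) (snd z)) <= C1" "\<And>z. z \<in> ?S ==> norm (kapg (fst z) (snd z)) <= C2"
  unfolding bounded_iff by (metis (no_types, lifting) imageI)
 have "\<bar>kap x y\<bar> <= max 0 (max C1 C2) \<and> norm (kapg x y) <= max 0 (max C1 C2)" if x: "x \<in> annulus" and y: "y \<in> annulus" for x y
 proof (cases "same_collar x y")
  case True
  then show ?thesis using kn_same_collar[OF True] by (simp add: kap_def kapg_def)
 next
  case False
  have "(x, y) \<in> ?S" using NN_not_same_collar[OF x y False] x y annulus_subset_closed by auto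
  from C(1)[OF this] C(2)[OF this] show ?thesis by auto
 qed
 then show ?thesis by (intro exI[of _ "max 0 (max C1 C2)"]) auto
qed

definition kapC :: real where
 "kapC = (SOME C. C >= 0 \<and> (\<forall>x\<in>annulus. \<forall>y\<in>annulus. \<bar>kap x y\<bar> <= C \<and> norm (kapg x y) <= C))"

lemma kapC: "kapC >= 0" "x \<in> annulus ==> y \<in> annulus ==> \<bar>kap x y\<bar> <= kapC"
 "x \<in> annulus ==> y \<in> annulus ==> norm (kapg x y) <= kapC"
 using someI_ex[OF kap_bound_exists, folded kapC_def] by blast+

lemma kap_gderiv:
 assumes x: "x \<in> annulus" and y: "y \<in> annulus"
 shows "GDERIV (\<lambda>x. kap x y) x :> kapg x y"
proof -
 have n: "NN 0 x y > 0" using NN_facts(2)[OF x y, of 0] by simp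
 have gN: "GDERIV (\<lambda>x. NN 0 x y) x :> NNg x y" using NN_gderiv by (simp add: NNg_def)
 have gk: "GDERIV (\<lambda>x. kn 0 x y) x :> kng x y"
 proof -
  have a: "GDERIV (\<lambda>x. 4 * ((y - x) \<bullet> pwg y)) x :> (- 4) *\<^sub>R pwg y"
   by (auto simp: gderiv_def intro!: derivative_eq_intros)
  have b: "GDERIV (\<lambda>x. pw x * (pwg y \<bullet> pwg y)) x :> (pwg y \<bullet> pwg y) *\<^sub>R pwg x"
   using GDERIV_mult[OF pw_gderiv GDERIV_const[of "pwg y \<bullet> pwg y"]] by simp
  have c: "GDERIV (\<lambda>x. 4 * pw y + pwl y * NN 0 x y) x :> pwl y *\<^sub>R NNg x y"
   using GDERIV_add[OF GDERIV_const[of "4 * pw y"] GDERIV_mult[OF GDERIV_const[of "pwl y"] gN]] by simp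
  show ?thesis using GDERIV_diff[OF GDERIV_diff[OF c a] b] by (simp add: kn_def kng_def)
 qed
 have gi: "GDERIV (\<lambda>x. inverse ((NN 0 x y)\<^sup>2)) x :> (- 2 / (NN 0 x y) ^ 3) *\<^sub>R NNg x y"
  by (rule GDERIV_DERIV_compose[OF gN])
   (use n in \<open>auto intro!: derivative_eq_intros simp: field_simps power2_eq_square power3_eq_cube\<close>)
 show ?thesis
  using GDERIV_mult[OF gk gi] by (simp add: kap_def kapg_def divide_inverse mult_ac)
qed

lemma continuous_kap:
 assumes "continuous_on A f" "continuous_on A g" "\<And>z. z \<in> A ==> f z \<in> annulus" "\<And>z. z \<in> A ==> g z \<in> annulus"
 shows "continuous_on A (\<lambda>z. kap (f z) (g z))" "continuous_on A (\<lambda>z. kapg (f z) (g z))"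
proof -
 have "NN 0 (f z) (g z) \<noteq> 0" if "z \<in> A" for z
  using NN_facts(2)[of "f z" "g z" 0] assms(3,4)[OF that] by auto
 then show "continuous_on A (\<lambda>z. kap (f z) (g z))" "continuous_on A (\<lambda>z. kapg (f z) (g z))"
  unfolding kap_def kapg_def by (intro continuous_intros assms; simp)+
qed

section \<open>Differentiation under the integral and singular potentials\<close>

lemma gderiv_integral_annM:
 fixes K :: "real^2 => real^2 => real"
 assumes F: "integrable annM F"
  and K: "\<And>x y. x \<in> annulus ==> y \<in> annulus ==> GDERIV (\<lambda>x. K x y) x :> K' x y"
   "\<And>x y. x \<in> annulus ==> y \<in> annulus ==> norm (K' x y) <= C"
   "\<And>x y. x \<in> annulus ==> y \<in> annulus ==> \<bar>K x y\<bar> <= C'"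
  and meas: "\<And>x. x \<in> annulus ==> K x \<in> borel_measurable annM" "\<And>x. x \<in> annulus ==> K' x \<in> borel_measurable annM"
  and x: "x \<in> annulus"
 shows "GDERIV (\<lambda>x. LINT y|annM. F y * K x y) x :> (LINT y|annM. F y *\<^sub>R K' x y)"
proof -
 have iK: "integrable annM (\<lambda>y. F y * K z y)" if "z \<in> annulus" for z
  by (rule integrable_annM_bounded_mult[OF F meas(1)[OF that] K(3)[OF that]])
 have iK': "integrable annM (\<lambda>y. F y *\<^sub>R K' z y)" if z: "z \<in> annulus" for z
 proof (rule Bochner_Integration.integrable_bound[OF integrable_mult_right[OF integrable_abs[OF F], of C]])
  show "(\<lambda>y. F y *\<^sub>R K' z y) \<in> borel_measurable annM" using F meas(2)[OF z] by measurable
  show "AE y in annM. norm (F y *\<^sub>R K' z y) <= norm (C * \<bar>F y\<bar>)"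
  proof (rule AE_I2)
   fix y assume "y \<in> space annM"
   then have "norm (K' z y) <= \<bar>C\<bar>" using K(2)[OF z, of y] by simp
   then show "norm (F y *\<^sub>R K' z y) <= norm (C * \<bar>F y\<bar>)"
    using mult_left_mono[of "norm (K' z y)" "\<bar>C\<bar>" "\<bar>F y\<bar>"] by (simp add: abs_mult mult.commute)
  qed
 qed
 let ?f = "\<lambda>x. LINT y|annM. F y * K x y" and ?D = "LINT y|annM. F y *\<^sub>R K' x y"
 obtain d where d: "d > 0" "ball x d \<subseteq> annulus" using open_annulus x open_contains_ball by blast
 have "(\<lambda>h. norm (?f (x + h) - ?f x - h \<bullet> ?D) / norm h) \<midarrow>0\<rightarrow> 0"
  unfolding tendsto_at_iff_sequentially
 proof (intro allI impI)
  fix h :: "nat => real^2"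
  assume hn: "\<forall>i. h i \<in> UNIV - {0}" and h0: "h \<longlonglongrightarrow> 0"
  then have hne: "h i \<noteq> 0" for i by auto
  obtain N where N: "\<And>n. n >= N ==> norm (h n) < d"
   using LIMSEQ_D[OF h0 d(1)] by auto
  have xh: "x + h (n + N) \<in> ball x d" for n using N[of "n + N"] by (simp add: dist_norm)
  then have xa: "x + h (n + N) \<in> annulus" for n using d(2) by auto
  define q where "q n y = (K (x + h (n + N)) y - K x y - h (n + N) \<bullet> K' x y) / norm (h (n + N))" for n y
  have q0: "(\<lambda>n. q n y) \<longlonglongrightarrow> 0" if y: "y \<in> annulus" for y
  proof -
   have "(\<lambda>h. norm (K (x + h) y - K x y - h \<bullet> K' x y) / norm h) \<midarrow>0\<rightarrow> 0"
    using K(1)[OF x y] unfolding gderiv_def has_derivative_at by simp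
   then have "(\<lambda>n. norm (K (x + h n) y - K x y - h n \<bullet> K' x y) / norm (h n)) \<longlonglongrightarrow> 0"
    using hn h0 unfolding tendsto_at_iff_sequentially o_def by blast
   then have "(\<lambda>n. norm (K (x + h (n + N)) y - K x y - h (n + N) \<bullet> K' x y) / norm (h (n + N))) \<longlonglongrightarrow> 0"
    by (rule LIMSEQ_ignore_initial_segment)
   then have "(\<lambda>n. norm (q n y)) \<longlonglongrightarrow> 0" by (simp add: q_def)
   then show ?thesis by (rule tendsto_norm_zero_cancel)
  qed
  have qb: "\<bar>q n y\<bar> <= 2 * C" if y: "y \<in> annulus" for n y
  proof -
   have "\<bar>K (x + h (n + N)) y - K x y\<bar> <= C * norm (x + h (n + N) - x)"
   proof (rule bounded_gderiv_lipschitz[of "ball x d"])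
    fix z assume "z \<in> ball x d"
    then have z: "z \<in> annulus" using d(2) by blast
    show "GDERIV (\<lambda>x. K x y) z :> K' z y" by (rule K(1)[OF z y])
    show "norm (K' z y) <= C" by (rule K(2)[OF z y])
   qed (use xh d(1) in simp_all)
   moreover have "\<bar>h (n + N) \<bullet> K' x y\<bar> <= norm (h (n + N)) * C"
    by (rule order_trans[OF Cauchy_Schwarz_ineq2]) (use K(2)[OF x y] in \<open>simp add: mult_left_mono\<close>)
   ultimately have "\<bar>K (x + h (n + N)) y - K x y - h (n + N) \<bullet> K' x y\<bar> <= 2 * C * norm (h (n + N))"
    by (simp add: mult.commute)
   then show ?thesis using hne[of "n + N"] by (simp add: q_def abs_divide pos_divide_le_eq)
  qed
  have qm: "q n \<in> borel_measurable annM" for n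
   unfolding q_def using meas(1)[OF xa, of n] meas(1)[OF x] meas(2)[OF x] by measurable
  have "(\<lambda>n. LINT y|annM. F y * q n y) \<longlonglongrightarrow> (LINT y|annM. F y * 0)"
  proof (rule integral_dominated_convergence[where w="\<lambda>y. 2 * C * \<bar>F y\<bar>"])
   show "(\<lambda>y. F y * q n y) \<in> borel_measurable annM" for n using F qm[of n] by measurable
   show "integrable annM (\<lambda>y. 2 * C * \<bar>F y\<bar>)" using F by auto
   show "AE y in annM. (\<lambda>n. F y * q n y) \<longlonglongrightarrow> F y * 0"
    using q0 by (intro AE_I2 tendsto_intros) auto
   show "AE y in annM. norm (F y * q n y) <= 2 * C * \<bar>F y\<bar>" for n
   proof (rule AE_I2)
    fix y assume "y \<in> space annM"
    then show "norm (F y * q n y) <= 2 * C * \<bar>F y\<bar>"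
     using mult_left_mono[OF qb[of y n] abs_ge_zero[of "F y"]] by (simp add: abs_mult mult.commute)
   qed
  qed simp
  then have 1: "(\<lambda>n. \<bar>LINT y|annM. F y * q n y\<bar>) \<longlonglongrightarrow> 0" by (simp add: tendsto_rabs_zero)
  have "norm (?f (x + h (n + N)) - ?f x - h (n + N) \<bullet> ?D) / norm (h (n + N)) = \<bar>LINT y|annM. F y * q n y\<bar>" for n
  proof -
   have "h (n + N) \<bullet> ?D = (LINT y|annM. h (n + N) \<bullet> (F y *\<^sub>R K' x y))"
    using iK'[OF x] by (intro integral_inner_right[symmetric])
   moreover have "integrable annM (\<lambda>y. h (n + N) \<bullet> (F y *\<^sub>R K' x y))" using iK'[OF x] by (rule integrable_inner_right)
   ultimately have "?f (x + h (n + N)) - ?f x - h (n + N) \<bullet> ?D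
     = (LINT y|annM. F y * K (x + h (n + N)) y - F y * K x y - h (n + N) \<bullet> (F y *\<^sub>R K' x y))"
    using iK[OF x] iK[OF xa] by simp
   also have "... = (LINT y|annM. norm (h (n + N)) * (F y * q n y))"
   proof (intro Bochner_Integration.integral_cong refl)
    fix y
    have "norm (h (n + N)) * q n y = K (x + h (n + N)) y - K x y - h (n + N) \<bullet> K' x y"
     using hne[of "n + N"] by (simp add: q_def)
    then show "F y * K (x + h (n + N)) y - F y * K x y - h (n + N) \<bullet> (F y *\<^sub>R K' x y) = norm (h (n + N)) * (F y * q n y)"
     by (simp add: mult.left_commute[of "norm (h (n + N))"] right_diff_distrib)
   qed
   also have "... = norm (h (n + N)) * (LINT y|annM. F y * q n y)" by simp
   finally show ?thesis using hne[of "n + N"] by (simp add: abs_mult)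
  qed
  then have "(\<lambda>n. norm (?f (x + h (n + N)) - ?f x - h (n + N) \<bullet> ?D) / norm (h (n + N))) \<longlonglongrightarrow> 0"
   using 1 by simp
  then show "((\<lambda>h. norm (?f (x + h) - ?f x - h \<bullet> ?D) / norm h) \<circ> h) \<longlonglongrightarrow> 0"
   unfolding o_def by (rule LIMSEQ_offset)
 qed
 then show ?thesis
  unfolding gderiv_def has_derivative_at by (simp add: bounded_linear_inner_left)
qed

lemma continuous_integral_annM:
 fixes K' :: "real^2 => real^2 => real^2"
 assumes F: "integrable annM F"
  and K: "\<And>y. y \<in> annulus ==> continuous_on annulus (\<lambda>x. K' x y)"
   "\<And>x y. x \<in> annulus ==> y \<in> annulus ==> norm (K' x y) <= C"
  and meas: "\<And>x. x \<in> annulus ==> K' x \<in> borel_measurable annM"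
 shows "continuous_on annulus (\<lambda>x. LINT y|annM. F y *\<^sub>R K' x y)"
 unfolding continuous_on_sequentially
proof (intro allI impI ballI, elim conjE)
 fix s :: "nat => real^2" and x assume x: "x \<in> annulus" and s: "\<forall>n. s n \<in> annulus" "s \<longlonglongrightarrow> x"
 have "(\<lambda>n. LINT y|annM. F y *\<^sub>R K' (s n) y) \<longlonglongrightarrow> (LINT y|annM. F y *\<^sub>R K' x y)"
 proof (rule integral_dominated_convergence[where w="\<lambda>y. C * \<bar>F y\<bar>"])
  show "(\<lambda>y. F y *\<^sub>R K' (s n) y) \<in> borel_measurable annM" for n using F meas[of "s n"] s by auto
  show "(\<lambda>y. F y *\<^sub>R K' x y) \<in> borel_measurable annM" using F meas[OF x] by auto
  show "integrable annM (\<lambda>y. C * \<bar>F y\<bar>)" using F by auto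
  show "AE y in annM. (\<lambda>n. F y *\<^sub>R K' (s n) y) \<longlonglongrightarrow> F y *\<^sub>R K' x y"
  proof (rule AE_I2)
   fix y assume "y \<in> space annM"
   then have "(\<lambda>n. K' (s n) y) \<longlonglongrightarrow> K' x y"
    using K(1)[of y] x s unfolding continuous_on_sequentially o_def by auto
   then show "(\<lambda>n. F y *\<^sub>R K' (s n) y) \<longlonglongrightarrow> F y *\<^sub>R K' x y" by (intro tendsto_intros)
  qed
  show "AE y in annM. norm (F y *\<^sub>R K' (s n) y) <= C * \<bar>F y\<bar>" for n
  proof (rule AE_I2)
   fix y assume "y \<in> space annM"
   then show "norm (F y *\<^sub>R K' (s n) y) <= C * \<bar>F y\<bar>"
    using s mult_right_mono[OF K(2)[of "s n" y] abs_ge_zero[of "F y"]] by (simp add: mult.commute)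
  qed
 qed
 then show "((\<lambda>x. LINT y|annM. F y *\<^sub>R K' x y) \<circ> s) \<longlonglongrightarrow> (LINT y|annM. F y *\<^sub>R K' x y)" by (simp add: o_def)
qed

interpretation annP: pair_sigma_finite annM annM
 using sigma_finite_annM by (rule pair_sigma_finite.intro) (rule sigma_finite_annM)

lemma AE_annM_neq: "AE y in annM. y \<noteq> x"
proof -
 have "AE y in lebesgue. y \<noteq> x" using AE_lborel_singleton by (rule AE_completion)
 then show ?thesis using annulus_lmeasurable by (subst AE_restrict_space_iff) auto
qed

lemma annM_pair_measurable: "k \<in> borel_measurable borel ==> k \<in> borel_measurable (annM \<Otimes>\<^sub>M annM)"
 for k :: "(real^2) \<times> (real^2) => 'a::euclidean_space"
proof -
 assume k: "k \<in> borel_measurable borel"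
 have "(\<lambda>z. (fst z, snd z)) \<in> annM \<Otimes>\<^sub>M annM \<rightarrow>\<^sub>M borel \<Otimes>\<^sub>M borel"
  using measurable_compose[OF measurable_fst id_measurable_lebesgue_on] measurable_compose[OF measurable_snd id_measurable_lebesgue_on]
  by (intro measurable_Pair) auto
 from measurable_compose[OF this, of k borel] k show ?thesis by (simp add: borel_prod)
qed

lemma norm_powr_measurable: "(\<lambda>z. norm (fst z - snd z) powr s) \<in> borel_measurable (annM \<Otimes>\<^sub>M annM)"
 for s :: real
 by (intro annM_pair_measurable powr_real_measurable borel_measurable_norm borel_measurable_const
   borel_measurable_continuous_onI continuous_intros)

lemma singular_potential:
 assumes F: "integrable annM F" and s: "0 <= s" "s < 2"
 shows "integrable (annM \<Otimes>\<^sub>M annM) (\<lambda>(y, x). F y * norm (y - x) powr (- s))"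
  "AE x in annM. integrable annM (\<lambda>y. F y * norm (y - x) powr (- s))"
  "integrable annM (\<lambda>x. LINT y|annM. F y * norm (y - x) powr (- s))"
proof -
 obtain C where C: "\<And>x. x \<in> annulus ==> integrable annM (\<lambda>y. norm (y - x) powr (- s))"
  "\<And>x. x \<in> annulus ==> (LINT y|annM. norm (y - x) powr (- s)) <= C"
  using singular_integral[OF s] by blast
 have "integrable (annM \<Otimes>\<^sub>M annM) (\<lambda>(y, x). F y * ((\<lambda>z. norm (fst z - snd z) powr (- s)) (y, x) * 1))"
  by (rule integrable_pair_kernel[where k="\<lambda>z. norm (fst z - snd z) powr (- s)" and b="\<lambda>_. 1" and C=C])
   (use C in \<open>auto simp: norm_minus_commute intro: sigma_finite_annM norm_powr_measurable F\<close>)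
 then show i: "integrable (annM \<Otimes>\<^sub>M annM) (\<lambda>(y, x). F y * norm (y - x) powr (- s))" by simp
 show "AE x in annM. integrable annM (\<lambda>y. F y * norm (y - x) powr (- s))"
  using annP.AE_integrable_snd[OF i] by simp
 show "integrable annM (\<lambda>x. LINT y|annM. F y * norm (y - x) powr (- s))"
  using annP.integrable_snd[OF i] by simp
qed

section \<open>Pointwise representation of solutions\<close>

definition delta_ker :: "real => real^2 => real^2 => real" where
 "delta_ker r x y = 4 * r\<^sup>2 / ((y - x) \<bullet> (y - x) + r\<^sup>2)\<^sup>2"

lemma delta_ker_bounds:
 assumes r: "r > 0"
 shows "0 <= delta_ker r x y" "delta_ker r x y <= 4 / r\<^sup>2"
proof -
 show "0 <= delta_ker r x y" by (simp add: delta_ker_def)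
 have "(r\<^sup>2)\<^sup>2 <= ((y - x) \<bullet> (y - x) + r\<^sup>2)\<^sup>2" by (intro power_mono) auto
 then have "delta_ker r x y <= 4 * r\<^sup>2 / (r\<^sup>2)\<^sup>2"
  unfolding delta_ker_def using r by (intro divide_left_mono mult_pos_pos zero_less_power add_nonneg_pos) auto
 also have "... = 4 / r\<^sup>2" using r by (simp add: power2_eq_square)
 finally show "delta_ker r x y <= 4 / r\<^sup>2" .
qed

lemma delta_ker_continuous:
 assumes "r > 0" "continuous_on A f" "continuous_on A g"
 shows "continuous_on A (\<lambda>z. delta_ker r (f z) (g z))"
proof -
 have "(g z - f z) \<bullet> (g z - f z) + r\<^sup>2 \<noteq> 0" for z
  using add_nonneg_pos[OF inner_ge_zero[of "g z - f z"] zero_less_power[OF assms(1), of 2]] by simp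
 then show ?thesis unfolding delta_ker_def by (intro continuous_intros assms) auto
qed

lemma delta_ker_integral:
 assumes r: "r > 0"
 shows "integrable annM (\<lambda>x. delta_ker r x y)" "(LINT x|annM. delta_ker r x y) <= delta_mass"
proof -
 have c: "continuous_on A (\<lambda>x. delta_ker r x y)" for A by (intro delta_ker_continuous r continuous_intros)
 show "integrable annM (\<lambda>x. delta_ker r x y)"
  by (rule integrable_annM_bounded[OF continuous_on_annM_measurable[OF c]]) (use delta_ker_bounds[OF r] in auto)
 have e: "(LINT x|lborel. delta_ker r x y) = delta_mass"
  using delta_kernel_scale[OF r, of "\<lambda>_. 1" y] by (simp add: delta_ker_def delta_mass_def)
 have i: "integrable lborel (\<lambda>x. delta_ker r x y)"
 proof (rule ccontr)
  assume "\<not> ?thesis"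
  then have "(LINT x|lborel. delta_ker r x y) = 0" by (rule not_integrable_integral_eq)
  then show False using e delta_mass_pos by simp
 qed
 have "(LINT x|annM. delta_ker r x y) = (LINT x|lborel. indicator annulus x * delta_ker r x y)"
  by (rule integrable_annM_lborel(2)[OF i])
 also have "... <= (LINT x|lborel. delta_ker r x y)"
  using i integrable_mult_indicator[OF _ i, of annulus] open_annulus delta_ker_bounds(1)[OF r]
  by (intro integral_mono) (auto simp: borel_open indicator_def)
 finally show "(LINT x|annM. delta_ker r x y) <= delta_mass" using e by simp
qed

lemma delta_ker_L1:
 assumes w: "integrable annM w" and r: "r > 0"
 shows "integrable annM (\<lambda>x. LINT y|annM. w y * delta_ker r x y)"
  "(LINT x|annM. \<bar>LINT y|annM. w y * delta_ker r x y\<bar>) <= delta_mass * (LINT y|annM. \<bar>w y\<bar>)"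
  "\<And>x. integrable annM (\<lambda>y. w y * delta_ker r x y)"
proof -
 have m: "(\<lambda>z. delta_ker r (snd z) (fst z)) \<in> borel_measurable (annM \<Otimes>\<^sub>M annM)"
  by (intro annM_pair_measurable borel_measurable_continuous_onI delta_ker_continuous r continuous_intros)
 have i: "integrable (annM \<Otimes>\<^sub>M annM) (\<lambda>(y, x). w y * delta_ker r x y)" if w: "integrable annM w" for w
  using integrable_pair_bounded_kernel[OF sigma_finite_annM sigma_finite_annM m w, of "\<lambda>_. 1" "4 / r\<^sup>2"]
   delta_ker_bounds[OF r] finite_annM by (simp add: finite_measure.integrable_const)
 have I: "integrable annM (\<lambda>x. LINT y|annM. w y * delta_ker r x y)" if "integrable annM w" for w
  using annP.integrable_snd[OF i[OF that]] by simp
 show "integrable annM (\<lambda>x. LINT y|annM. w y * delta_ker r x y)" by (rule I[OF w])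
 show "integrable annM (\<lambda>y. w y * delta_ker r x y)" for x
  by (rule integrable_annM_bounded_mult[OF w continuous_on_annM_measurable, of _ "4 / r\<^sup>2"])
   (use delta_ker_bounds[OF r] in \<open>auto intro!: delta_ker_continuous r continuous_intros\<close>)
 note wa = integrable_abs[OF w]
 have "(LINT x|annM. \<bar>LINT y|annM. w y * delta_ker r x y\<bar>) <= (LINT x|annM. (LINT y|annM. \<bar>w y\<bar> * delta_ker r x y))"
 proof (rule integral_mono)
  fix x
  have "\<bar>LINT y|annM. w y * delta_ker r x y\<bar> <= (LINT y|annM. \<bar>w y * delta_ker r x y\<bar>)" by (rule integral_abs_bound)
  then show "\<bar>LINT y|annM. w y * delta_ker r x y\<bar> <= (LINT y|annM. \<bar>w y\<bar> * delta_ker r x y)"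
   using delta_ker_bounds(1)[OF r] by (simp add: abs_mult)
 qed (use I[OF w] I[OF wa] in auto)
 also have "... = (LINT y|annM. (LINT x|annM. \<bar>w y\<bar> * delta_ker r x y))"
  by (rule annP.Fubini_integral[OF i[OF wa]])
 also have "... <= (LINT y|annM. \<bar>w y\<bar> * delta_mass)"
 proof (rule integral_mono)
  show "integrable annM (\<lambda>y. LINT x|annM. \<bar>w y\<bar> * delta_ker r x y)"
   by (rule annP.integrable_fst[OF i[OF wa]])
  show "integrable annM (\<lambda>y. \<bar>w y\<bar> * delta_mass)" using wa by (rule integrable_mult_left)
  show "(LINT x|annM. \<bar>w y\<bar> * delta_ker r x y) <= \<bar>w y\<bar> * delta_mass" for y
   using delta_ker_integral(2)[OF r, of y] by (simp add: mult_left_mono)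
 qed
 also have "... = delta_mass * (LINT y|annM. \<bar>w y\<bar>)" by simp
 finally show "(LINT x|annM. \<bar>LINT y|annM. w y * delta_ker r x y\<bar>) <= delta_mass * (LINT y|annM. \<bar>w y\<bar>)" .
qed

text \<open>For a test function the convergence is pointwise and bounded. The \<open>L^1\<close>
  bound of \<open>delta_ker_L1\<close>, uniform in the radius, carries it over to every function
  approximable in \<open>L^1\<close>.\<close>

lemma delta_ker_L1_tendsto:
 assumes u: "integrable annM u"
  and approx: "\<And>\<epsilon>. \<epsilon> > 0 ==> \<exists>\<phi>. test_function annulus \<phi> \<and> (LINT x|annM. \<bar>u x - \<phi> x\<bar>) < \<epsilon>"
  and r: "\<And>n. r n > 0" "r \<longlonglongrightarrow> 0"
 shows "(\<lambda>n. LINT x|annM. \<bar>(LINT y|annM. u y * delta_ker (r n) x y) - delta_mass * u x\<bar>) \<longlonglongrightarrow> 0"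
proof (rule LIMSEQ_I)
 fix e :: real assume e: "e > 0"
 note K0 = delta_mass_pos
 \<comment> \<open>This accuracy is spent twice, once on the smeared difference and once on the
   plain one; together with the error of the test function they take three quarters of
   \<open>e\<close>.\<close>
 obtain \<phi> where \<phi>: "test_function annulus \<phi>" "(LINT x|annM. \<bar>u x - \<phi> x\<bar>) < e / (4 * delta_mass)"
  using approx[of "e / (4 * delta_mass)"] e K0 by auto
 obtain C where C: "\<And>x. \<bar>\<phi> x\<bar> <= C" using test_function_bounded[OF \<phi>(1)] by blast
 have c\<phi>: "continuous_on A \<phi>" for A by (rule test_function_continuous(1)[OF \<phi>(1)])
 have i\<phi>: "integrable annM \<phi>"
  by (rule integrable_annM_bounded[OF continuous_on_annM_measurable[OF c\<phi>]]) (use C in auto)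
 have off: "\<phi> x = 0" if "x \<notin> annulus" for x
  using test_function_support(2,3)[OF \<phi>(1)] that by blast
 let ?I = "\<lambda>w n x. LINT y|annM. w y * delta_ker (r n) x y"
 have I\<phi>: "?I \<phi> n x = (LINT y|lborel. 4 * (r n)\<^sup>2 / ((x - y) \<bullet> (x - y) + (r n)\<^sup>2)\<^sup>2 * \<phi> y)" for n x
 proof -
  have eq: "\<phi> y * delta_ker (r n) x y = 4 * (r n)\<^sup>2 / ((x - y) \<bullet> (x - y) + (r n)\<^sup>2)\<^sup>2 * \<phi> y" for y
   by (simp add: delta_ker_def power2_norm_eq_inner[symmetric] norm_minus_commute)
  have "integrable lborel (\<lambda>y. \<phi> y * delta_ker (r n) x y)"
  proof (rule integrable_continuous_bounded_support[where R=1])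
   show "continuous_on UNIV (\<lambda>y. \<phi> y * delta_ker (r n) x y)"
    by (intro continuous_intros c\<phi> delta_ker_continuous r)
   show "\<phi> y * delta_ker (r n) x y = 0" if "1 < norm y" for y
    using off[of y] annulus_norm[of y] that by auto
  qed
  from integrable_annM_lborel(2)[OF this]
  have "?I \<phi> n x = (LINT y|lborel. indicator annulus y * (\<phi> y * delta_ker (r n) x y))" .
  also have "... = (LINT y|lborel. \<phi> y * delta_ker (r n) x y)"
   by (rule Bochner_Integration.integral_cong) (auto simp: indicator_def off)
  finally show ?thesis unfolding eq .
 qed
 have lim: "(\<lambda>n. ?I \<phi> n x) \<longlonglongrightarrow> delta_mass * \<phi> x" for x
  unfolding I\<phi> by (rule delta_kernel_tendsto(1)[OF r c\<phi> C])
 have bd: "\<bar>?I \<phi> n x\<bar> <= delta_mass * C" for n x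
  unfolding I\<phi> by (rule delta_kernel_tendsto(2)[OF r c\<phi> C])
 have "(\<lambda>n. LINT x|annM. \<bar>?I \<phi> n x - delta_mass * \<phi> x\<bar>) \<longlonglongrightarrow> (LINT x|annM. \<bar>delta_mass * \<phi> x - delta_mass * \<phi> x\<bar>)"
 proof (rule integral_dominated_convergence[where w="\<lambda>_. 2 * delta_mass * C"])
  show "(\<lambda>x. \<bar>?I \<phi> n x - delta_mass * \<phi> x\<bar>) \<in> borel_measurable annM" for n
   using delta_ker_L1(1)[OF i\<phi> r(1)] i\<phi> by (intro borel_measurable_abs borel_measurable_diff borel_measurable_times) auto
  show "integrable annM (\<lambda>_. 2 * delta_mass * C)" using finite_annM by (simp add: finite_measure.integrable_const)
  show "AE x in annM. (\<lambda>n. \<bar>?I \<phi> n x - delta_mass * \<phi> x\<bar>) \<longlonglongrightarrow> \<bar>delta_mass * \<phi> x - delta_mass * \<phi> x\<bar>"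
   using lim by (intro AE_I2 tendsto_intros)
  show "AE x in annM. norm \<bar>?I \<phi> n x - delta_mass * \<phi> x\<bar> <= 2 * delta_mass * C" for n
  proof (rule AE_I2)
   fix x
   have "\<bar>delta_mass * \<phi> x\<bar> <= delta_mass * C" unfolding abs_mult using C[of x] K0 by simp
   then show "norm \<bar>?I \<phi> n x - delta_mass * \<phi> x\<bar> <= 2 * delta_mass * C" using bd[of n x] by simp
  qed
 qed simp
 then have "(\<lambda>n. LINT x|annM. \<bar>?I \<phi> n x - delta_mass * \<phi> x\<bar>) \<longlonglongrightarrow> 0" by simp
 from LIMSEQ_D[OF this, of "e / 4"] e obtain N where N: "\<And>n. n >= N ==> \<bar>LINT x|annM. \<bar>?I \<phi> n x - delta_mass * \<phi> x\<bar>\<bar> < e / 4"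
  by auto
 show "\<exists>N. \<forall>n\<ge>N. norm ((LINT x|annM. \<bar>?I u n x - delta_mass * u x\<bar>) - 0) < e"
 proof (intro exI allI impI)
  fix n assume n: "n >= N"
  have iw: "integrable annM (\<lambda>x. u x - \<phi> x)" using u i\<phi> by simp
  have spl: "?I u n x = ?I (\<lambda>y. u y - \<phi> y) n x + ?I \<phi> n x" for x
   using delta_ker_L1(3)[OF u r(1)] delta_ker_L1(3)[OF i\<phi> r(1)] by (simp add: left_diff_distrib)
  note i1 = delta_ker_L1(1)[OF iw r(1), of n] delta_ker_L1(1)[OF i\<phi> r(1), of n] delta_ker_L1(1)[OF u r(1), of n]
  have "(LINT x|annM. \<bar>?I u n x - delta_mass * u x\<bar>)
    <= (LINT x|annM. \<bar>?I (\<lambda>y. u y - \<phi> y) n x\<bar> + \<bar>?I \<phi> n x - delta_mass * \<phi> x\<bar> + delta_mass * \<bar>u x - \<phi> x\<bar>)"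
  proof (rule integral_mono)
   show "integrable annM (\<lambda>x. \<bar>?I u n x - delta_mass * u x\<bar>)" using i1 u by auto
   show "integrable annM (\<lambda>x. \<bar>?I (\<lambda>y. u y - \<phi> y) n x\<bar> + \<bar>?I \<phi> n x - delta_mass * \<phi> x\<bar> + delta_mass * \<bar>u x - \<phi> x\<bar>)"
    using i1 i\<phi> iw by auto
   fix x
   have "\<bar>delta_mass * \<phi> x - delta_mass * u x\<bar> = delta_mass * \<bar>u x - \<phi> x\<bar>"
    using K0 by (simp add: abs_mult abs_minus_commute flip: right_diff_distrib)
   then show "\<bar>?I u n x - delta_mass * u x\<bar> <= \<bar>?I (\<lambda>y. u y - \<phi> y) n x\<bar> + \<bar>?I \<phi> n x - delta_mass * \<phi> x\<bar> + delta_mass * \<bar>u x - \<phi> x\<bar>"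
    unfolding spl by linarith
  qed
  also have "... = (LINT x|annM. \<bar>?I (\<lambda>y. u y - \<phi> y) n x\<bar>) + (LINT x|annM. \<bar>?I \<phi> n x - delta_mass * \<phi> x\<bar>) + delta_mass * (LINT x|annM. \<bar>u x - \<phi> x\<bar>)"
   using i1 i\<phi> iw by simp
  also have "(LINT x|annM. \<bar>?I (\<lambda>y. u y - \<phi> y) n x\<bar>) <= delta_mass * (LINT x|annM. \<bar>u x - \<phi> x\<bar>)"
   by (rule delta_ker_L1(2)[OF iw r(1)])
  also have "delta_mass * (LINT x|annM. \<bar>u x - \<phi> x\<bar>) + (LINT x|annM. \<bar>?I \<phi> n x - delta_mass * \<phi> x\<bar>) + delta_mass * (LINT x|annM. \<bar>u x - \<phi> x\<bar>) < e"
  proof -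
   have "delta_mass * (LINT x|annM. \<bar>u x - \<phi> x\<bar>) < delta_mass * (e / (4 * delta_mass))"
    using \<phi>(2) K0 by (rule mult_strict_left_mono)
   also have "... = e / 4" using K0 by simp
   finally show ?thesis using N[OF n] e by linarith
  qed
  finally show "norm ((LINT x|annM. \<bar>?I u n x - delta_mass * u x\<bar>) - 0) < e" by simp
 qed
qed

lemma W11_0_approx:
 assumes "u \<in> W11_0 annulus"
 shows "integrable annM u" "\<epsilon> > 0 ==> \<exists>\<phi>. test_function annulus \<phi> \<and> (LINT x|annM. \<bar>u x - \<phi> x\<bar>) < \<epsilon>"
proof -
 obtain G where G: "integrable annM u"
  and approx: "\<And>\<epsilon>. \<epsilon> > 0 ==> \<exists>\<phi>. test_function annulus \<phi> \<and>
     (LINT x|annM. \<bar>u x - \<phi> x\<bar>) + (LINT x|annM. norm (G x - grad \<phi> x)) < \<epsilon>"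
  using assms unfolding W11_0_def set_integral_annM absolutely_integrable_annM by blast
 show "integrable annM u" by (rule G)
 show "\<exists>\<phi>. test_function annulus \<phi> \<and> (LINT x|annM. \<bar>u x - \<phi> x\<bar>) < \<epsilon>" if e: "\<epsilon> > 0"
 proof -
  obtain \<phi> where \<phi>: "test_function annulus \<phi>"
   "(LINT x|annM. \<bar>u x - \<phi> x\<bar>) + (LINT x|annM. norm (G x - grad \<phi> x)) < \<epsilon>" using approx[OF e] by blast
  moreover have "(LINT x|annM. norm (G x - grad \<phi> x)) >= 0" by (intro integral_nonneg_AE) simp
  ultimately have "(LINT x|annM. \<bar>u x - \<phi> x\<bar>) < \<epsilon>" by linarith
  with \<phi>(1) show ?thesis by blast
 qed
qed

lemma kn_bound:
 assumes x: "x \<in> annulus" and y: "y \<in> annulus" and e: "0 <= e" "e <= 1"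
 shows "\<bar>kn e x y\<bar> <= 32 + pwC * 69 + 8 * pwC + 8 * pwC\<^sup>2"
proof -
 have n0: "NN e x y > 0" using NN_facts(2)[OF x y] e by simp
 have xy: "norm (y - x) <= 2"
  using annulus_norm[OF x] annulus_norm[OF y] norm_triangle_ineq4[of y x] by simp
 note p = pw_collar(3,4)[OF x] pw_collar(3,4)[OF y]
 have bN: "NN e x y <= 69"
 proof -
  have "(norm (y - x))\<^sup>2 <= 2\<^sup>2" using xy by (intro power_mono) auto
  moreover have "pw x * pw y <= 8 * 8" using p by (intro mult_mono) auto
  ultimately show ?thesis using NN_facts(5)[OF x y, of e] e by simp
 qed
 have g2: "pwg y \<bullet> pwg y <= pwC\<^sup>2"
  unfolding power2_norm_eq_inner[symmetric] using pwC(2)[OF y] by (intro power_mono) auto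
 have "\<bar>pwl y * NN e x y\<bar> <= pwC * 69" unfolding abs_mult using pwC(3)[OF y] bN n0 pwC(1) by (intro mult_mono) auto
 moreover have "\<bar>(y - x) \<bullet> pwg y\<bar> <= 2 * pwC"
  by (rule order_trans[OF Cauchy_Schwarz_ineq2]) (use xy pwC(2)[OF y] in \<open>intro mult_mono; auto\<close>)
 moreover have "\<bar>pw x * (pwg y \<bullet> pwg y)\<bar> <= 8 * pwC\<^sup>2" unfolding abs_mult using p g2 by (intro mult_mono) auto
 moreover have "\<bar>4 * pw y\<bar> <= 32" using p by simp
 ultimately show ?thesis unfolding kn_def by linarith
qed

lemma GG_measurable: "GG s x \<in> borel_measurable annM"
 unfolding GG_def[abs_def]
 by (intro borel_measurable_ln borel_measurable_add borel_measurable_divide borel_measurable_const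
   borel_measurable_times borel_measurable_power borel_measurable_norm)
  (auto intro!: continuous_on_annM_measurable continuous_intros)

lemma AE_annM_in: "AE y in annM. y \<in> annulus"
 using AE_space by eventually_elim simp

lemma GG_potential_tendsto:
 assumes F: "F \<in> borel_measurable annM" "integrable annM (\<lambda>y. F y * norm (y - x) powr (- 1))" and x: "x \<in> annulus"
  and s: "\<And>n. s n > 0" "s \<longlonglongrightarrow> 0"
 shows "(\<lambda>n. LINT y|annM. F y * GG (s n) x y) \<longlonglongrightarrow> (LINT y|annM. F y * GG 0 x y)"
proof (rule integral_dominated_convergence[where w="\<lambda>y. ((pwC + 2) * pw x) * \<bar>F y * norm (y - x) powr (- 1)\<bar>"])
 show "(\<lambda>y. F y * GG (s n) x y) \<in> borel_measurable annM" for n using F(1) GG_measurable[of "s n" x] by measurable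
 show "(\<lambda>y. F y * GG 0 x y) \<in> borel_measurable annM" using F(1) GG_measurable[of 0 x] by measurable
 show "integrable annM (\<lambda>y. ((pwC + 2) * pw x) * \<bar>F y * norm (y - x) powr (- 1)\<bar>)"
  by (intro integrable_mult_right integrable_abs F)
 have nn: "AE y in annM. y \<noteq> x \<and> y \<in> annulus" using AE_annM_neq AE_annM_in by eventually_elim auto
 show "AE y in annM. (\<lambda>n. F y * GG (s n) x y) \<longlonglongrightarrow> F y * GG 0 x y"
  using nn by eventually_elim (intro tendsto_intros GG_tendsto s x; simp)
 show "AE y in annM. norm (F y * GG (s n) x y) <= ((pwC + 2) * pw x) * \<bar>F y * norm (y - x) powr (- 1)\<bar>" for n
  using nn
 proof eventually_elim
  case (elim y)
  have "\<bar>GG (s n) x y\<bar> <= (pwC + 2) * pw x * norm (y - x) powr (- 1)"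
   using GG_bound[OF x, of y "s n"] GG_nonneg[OF x, of y "s n"] elim s(1)[of n] by (auto simp: powr_minus_divide)
  from mult_left_mono[OF this abs_ge_zero[of "F y"]]
  have "\<bar>F y\<bar> * \<bar>GG (s n) x y\<bar> <= (pwC + 2) * pw x * (\<bar>F y\<bar> * norm (y - x) powr (- 1))" by (simp only: mult_ac)
  then show ?case by (simp only: real_norm_def abs_mult abs_of_nonneg[OF powr_ge_zero])
 qed
qed

lemma bounded_kernel_tendsto:
 assumes u: "integrable annM u" and k: "\<And>n. k n \<in> borel_measurable annM" "\<And>n y. y \<in> annulus ==> \<bar>k n y\<bar> <= C"
  and l: "\<And>y. y \<in> annulus ==> (\<lambda>n. k n y) \<longlonglongrightarrow> (l y :: real)"
 shows "(\<lambda>n. LINT y|annM. u y * k n y) \<longlonglongrightarrow> (LINT y|annM. u y * l y)"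
proof (rule integral_dominated_convergence[where w="\<lambda>y. C * \<bar>u y\<bar>"])
 have "l \<in> borel_measurable annM" by (rule borel_measurable_LIMSEQ_metric[OF k(1)]) (use l in simp)
 then show "(\<lambda>y. u y * l y) \<in> borel_measurable annM" using u by measurable
 show "(\<lambda>y. u y * k n y) \<in> borel_measurable annM" for n using u k(1)[of n] by measurable
 show "integrable annM (\<lambda>y. C * \<bar>u y\<bar>)" using u by auto
 show "AE y in annM. (\<lambda>n. u y * k n y) \<longlonglongrightarrow> u y * l y" using l by (intro AE_I2 tendsto_mult tendsto_const) simp
 show "AE y in annM. norm (u y * k n y) <= C * \<bar>u y\<bar>" for n
 proof (rule AE_I2)
  fix y assume "y \<in> space annM"
  then show "norm (u y * k n y) <= C * \<bar>u y\<bar>"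
   using mult_right_mono[OF k(2)[of y n] abs_ge_zero[of "u y"]] by (simp add: abs_mult mult.commute)
 qed
qed

text \<open>Let the regularisation \<open>e = (r n)\<^sup>2\<close> tend to zero. For fixed
  \<open>x\<close> the kernels with \<open>NN\<close> in the denominator are bounded, since
  \<open>NN\<close> is at least a multiple of \<open>(pw x)\<^sup>2\<close>. The concentrating term
  converges in \<open>L^1\<close> only, which is why the result holds almost everywhere and is
  reached along a subsequence.\<close>

lemma representation:
 assumes u: "u \<in> W11_0 annulus" and eq: "neg_laplacian_distr annulus u F" and F: "integrable annM F"
 shows "AE x in annM. delta_mass * u x = (LINT y|annM. F y * GG 0 x y) + (LINT y|annM. u y * (pw x * kap x y))"
proof -
 define r where "r n = inverse (real (Suc n))" for n
 have r: "r n > 0" "r n <= 1" for n by (auto simp: r_def inverse_le_1_iff)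
 have r0: "r \<longlonglongrightarrow> 0" unfolding r_def by (rule LIMSEQ_inverse_real_of_nat)
 have rr: "(\<lambda>n. (r n)\<^sup>2) \<longlonglongrightarrow> 0" using tendsto_power[OF r0, of 2] by simp
 have e: "(r n)\<^sup>2 > 0" "(r n)\<^sup>2 <= 1" for n using r[of n] by (auto intro: power_le_one)
 note iu = W11_0_approx(1)[OF u]
 let ?I = "\<lambda>n x. LINT y|annM. u y * delta_ker (r n) x y"
 have L1: "(\<lambda>n. LINT x|annM. \<bar>?I n x - delta_mass * u x\<bar>) \<longlonglongrightarrow> 0"
  by (rule delta_ker_L1_tendsto[OF iu W11_0_approx(2)[OF u] r(1) r0])
 have "integrable annM (\<lambda>x. ?I n x - delta_mass * u x)" for n
  using delta_ker_L1(1)[OF iu r(1)] iu by auto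
 from tendsto_L1_AE_subseq[of annM "\<lambda>n x. ?I n x - delta_mass * u x", OF this] L1
 obtain k where k: "strict_mono k" "AE x in annM. (\<lambda>n. ?I (k n) x - delta_mass * u x) \<longlonglongrightarrow> 0"
  by auto
 have main: "(\<lambda>n. ?I n x) \<longlonglongrightarrow> (LINT y|annM. F y * GG 0 x y) + (LINT y|annM. u y * (pw x * kap x y))"
  if x: "x \<in> annulus" and i1: "integrable annM (\<lambda>y. F y * norm (y - x) powr (- 1))" for x
 proof -
  note px = pw_collar(3,4)[OF x]
  have inv: "1 / (NN s x y)\<^sup>2 <= (4 * pwC\<^sup>2 / (pw x)\<^sup>2)\<^sup>2" if "y \<in> annulus" "s >= 0" for y s
  proof -
   have n0: "NN s x y > 0" using NN_facts(2)[OF x that(1,2)] .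
   have "1 / NN s x y <= 1 / ((pw x)\<^sup>2 / (4 * pwC\<^sup>2))"
    using NN_ge_pw_sq[OF x that] px pwC(1) n0 by (intro divide_left_mono mult_pos_pos divide_pos_pos) auto
   then have "(1 / NN s x y)\<^sup>2 <= (4 * pwC\<^sup>2 / (pw x)\<^sup>2)\<^sup>2" using n0 by (intro power_mono) auto
   then show ?thesis by (simp add: power_divide)
  qed
  define Q where "Q = (4 * pwC\<^sup>2 / (pw x)\<^sup>2)\<^sup>2"
  define Kb where "Kb = 32 + pwC * 69 + 8 * pwC + 8 * pwC\<^sup>2"
  have Kb0: "Kb >= 0" using pwC(1) by (simp add: Kb_def)
  have Q0: "Q >= 0" by (simp add: Q_def)
  let ?T2 = "\<lambda>n y. 4 * (r n)\<^sup>2 / (NN ((r n)\<^sup>2) x y)\<^sup>2"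
  let ?T3 = "\<lambda>n y. pw x * kn ((r n)\<^sup>2) x y / (NN ((r n)\<^sup>2) x y)\<^sup>2"
  have n: "NN ((r n)\<^sup>2) x y \<noteq> 0" if "y \<in> annulus" for n y
   using NN_facts(2)[OF x that, of "(r n)\<^sup>2"] by simp
  have c: "continuous_on annulus (?T2 n)" "continuous_on annulus (?T3 n)" for n
   using n by (auto intro!: continuous_intros)
  have b2: "\<bar>?T2 n y\<bar> <= 4 * Q" if "y \<in> annulus" for n y
  proof -
   have "?T2 n y = (4 * (r n)\<^sup>2) * (1 / (NN ((r n)\<^sup>2) x y)\<^sup>2)" by simp
   also have "... <= (4 * 1) * Q" unfolding Q_def using e[of n] inv[OF that] by (intro mult_mono) auto
   finally show ?thesis by simp
  qed
  have b3: "\<bar>?T3 n y\<bar> <= 8 * Kb * Q" if "y \<in> annulus" for n y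
  proof -
   have "\<bar>?T3 n y\<bar> = pw x * \<bar>kn ((r n)\<^sup>2) x y\<bar> * (1 / (NN ((r n)\<^sup>2) x y)\<^sup>2)"
    using px by (simp add: abs_mult)
   also have "... <= 8 * Kb * Q" unfolding Q_def Kb_def
    using e[of n] inv[OF that] px kn_bound[OF x that] pwC(1) by (intro mult_mono) auto
   finally show ?thesis .
  qed
  have i2: "integrable annM (\<lambda>y. u y * ?T2 n y)" "integrable annM (\<lambda>y. u y * ?T3 n y)" for n
   by (rule integrable_annM_bounded_mult[OF iu continuous_on_annM_measurable[OF c(1)] b2], assumption)
     (rule integrable_annM_bounded_mult[OF iu continuous_on_annM_measurable[OF c(2)] b3], assumption)
  have idk: "integrable annM (\<lambda>y. u y * delta_ker (r n) x y)" for n by (rule delta_ker_L1(3)[OF iu r(1)])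
  have rep: "?I n x = (LINT y|annM. F y * GG ((r n)\<^sup>2) x y) + (LINT y|annM. u y * ?T2 n y) + (LINT y|annM. u y * ?T3 n y)" for n
  proof -
   have "(LINT y|annM. F y * GG ((r n)\<^sup>2) x y) = (LINT y|annM. u y * delta_ker (r n) x y - u y * ?T2 n y - u y * ?T3 n y)"
    unfolding representation_eps[OF u eq F x e(1), of n, symmetric] delta_ker_def
    by (intro Bochner_Integration.integral_cong) (auto simp: right_diff_distrib)
   also have "... = ?I n x - (LINT y|annM. u y * ?T2 n y) - (LINT y|annM. u y * ?T3 n y)"
    using i2[of n] idk[of n] by simp
   finally show ?thesis by simp
  qed
  have N0: "NN 0 x y \<noteq> 0" if "y \<in> annulus" for y using NN_facts(2)[OF x that, of 0] by simp
  have l2: "(\<lambda>n. LINT y|annM. u y * ?T2 n y) \<longlonglongrightarrow> (LINT y|annM. u y * (4 * 0 / (NN 0 x y)\<^sup>2))"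
   by (rule bounded_kernel_tendsto[OF iu continuous_on_annM_measurable[OF c(1)] b2], assumption)
    (use N0 in \<open>unfold NN_def, intro tendsto_intros rr, auto\<close>)
  have l3: "(\<lambda>n. LINT y|annM. u y * ?T3 n y) \<longlonglongrightarrow> (LINT y|annM. u y * (pw x * kn 0 x y / (NN 0 x y)\<^sup>2))"
   by (rule bounded_kernel_tendsto[OF iu continuous_on_annM_measurable[OF c(2)] b3], assumption)
    (use N0 in \<open>unfold NN_def kn_def, intro tendsto_intros rr, auto\<close>)
  note l1 = GG_potential_tendsto[OF borel_measurable_integrable[OF F] i1 x e(1) rr]
  show ?thesis
   unfolding rep using tendsto_add[OF tendsto_add[OF l1 l2] l3] by (simp add: kap_def)
 qed
 have 1: "AE x in annM. x \<in> annulus" using AE_space by eventually_elim simp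
 have 2: "AE x in annM. integrable annM (\<lambda>y. F y * norm (y - x) powr (- 1))"
  by (rule singular_potential(2)[OF F]) auto
 from 1 k(2) 2 show ?thesis
 proof eventually_elim
  case (elim x)
  have "(\<lambda>n. ?I (k n) x) \<longlonglongrightarrow> (LINT y|annM. F y * GG 0 x y) + (LINT y|annM. u y * (pw x * kap x y))"
   using LIMSEQ_subseq_LIMSEQ[OF main[OF elim(1)] k(1)] elim(3) by (simp add: o_def)
  moreover have "(\<lambda>n. ?I (k n) x) \<longlonglongrightarrow> delta_mass * u x"
   using tendsto_add[OF elim(2) tendsto_const[of "delta_mass * u x"]] by simp
  ultimately show ?case using LIMSEQ_unique by blast
 qed
qed

lemma GG_integrable_potential:
 assumes F: "F \<in> borel_measurable annM" and i: "integrable annM (\<lambda>y. F y * norm (y - x) powr (- 1))" and x: "x \<in> annulus"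
 shows "integrable annM (\<lambda>y. F y * GG 0 x y)"
  "\<bar>LINT y|annM. F y * GG 0 x y\<bar> <= (pwC + 2) * pw x * (LINT y|annM. \<bar>F y\<bar> * norm (y - x) powr (- 1))"
proof -
 let ?c = "(pwC + 2) * pw x"
 have j: "integrable annM (\<lambda>y. ?c * \<bar>F y * norm (y - x) powr (- 1)\<bar>)"
  by (intro integrable_mult_right integrable_abs i)
 have b: "AE y in annM. norm (F y * GG 0 x y) <= ?c * \<bar>F y * norm (y - x) powr (- 1)\<bar>"
  using AE_annM_neq[of x] AE_annM_in
 proof eventually_elim
  case (elim y)
  have "GG 0 x y <= ?c / norm (y - x)" "GG 0 x y >= 0"
   using GG_bound[OF x elim(2), of 0] GG_nonneg[OF x elim(2), of 0] elim(1) by auto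
  then have "\<bar>GG 0 x y\<bar> <= ?c * norm (y - x) powr (- 1)"
   using elim by (simp add: powr_minus_divide)
  from mult_left_mono[OF this abs_ge_zero[of "F y"]]
  show ?case by (simp add: abs_mult mult_ac)
 qed
 have b': "AE y in annM. norm (F y * GG 0 x y) <= norm (?c * \<bar>F y * norm (y - x) powr (- 1)\<bar>)"
  using b by eventually_elim (unfold real_norm_def, erule order_trans, rule abs_ge_self)
 have m: "(\<lambda>y. F y * GG 0 x y) \<in> borel_measurable annM" using F GG_measurable[of 0 x] by measurable
 show "integrable annM (\<lambda>y. F y * GG 0 x y)"
  by (rule Bochner_Integration.integrable_bound[OF j m b'])
 have "\<bar>LINT y|annM. F y * GG 0 x y\<bar> <= (LINT y|annM. ?c * \<bar>F y * norm (y - x) powr (- 1)\<bar>)"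
 proof (rule order_trans[OF integral_abs_bound], rule integral_mono_AE)
  show "AE y in annM. \<bar>F y * GG 0 x y\<bar> <= ?c * \<bar>F y * norm (y - x) powr (- 1)\<bar>" using b by simp
 qed (use j \<open>integrable annM (\<lambda>y. F y * GG 0 x y)\<close> in auto)
 then show "\<bar>LINT y|annM. F y * GG 0 x y\<bar> <= ?c * (LINT y|annM. \<bar>F y\<bar> * norm (y - x) powr (- 1))"
  unfolding integral_mult_right_zero by (simp only: abs_mult abs_of_nonneg[OF powr_ge_zero])
qed

lemma kap_potential:
 assumes u: "integrable annM u" and x: "x \<in> annulus"
 shows "integrable annM (\<lambda>y. u y * (pw x * kap x y))"
  "\<bar>LINT y|annM. u y * (pw x * kap x y)\<bar> <= pw x * kapC * (LINT y|annM. \<bar>u y\<bar>)"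
proof -
 have c: "continuous_on annulus (\<lambda>y. pw x * kap x y)"
  using x by (intro continuous_intros continuous_kap) auto
 have b: "\<bar>pw x * kap x y\<bar> <= pw x * kapC" if "y \<in> annulus" for y
  unfolding abs_mult using kapC(2)[OF x that] pw_collar(3)[OF x] by (intro mult_mono) auto
 show i: "integrable annM (\<lambda>y. u y * (pw x * kap x y))"
  by (rule integrable_annM_bounded_mult[OF u continuous_on_annM_measurable[OF c] b])
 have "\<bar>LINT y|annM. u y * (pw x * kap x y)\<bar> <= (LINT y|annM. \<bar>u y\<bar> * (pw x * kapC))"
 proof (rule order_trans[OF integral_abs_bound], rule integral_mono)
  fix y assume "y \<in> space annM"
  then show "\<bar>u y * (pw x * kap x y)\<bar> <= \<bar>u y\<bar> * (pw x * kapC)"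
   unfolding abs_mult[of "u y"] using b[of y] by (intro mult_left_mono) auto
 qed (use i u in auto)
 also have "... = pw x * kapC * (LINT y|annM. \<bar>u y\<bar>)" by simp
 finally show "\<bar>LINT y|annM. u y * (pw x * kap x y)\<bar> <= pw x * kapC * (LINT y|annM. \<bar>u y\<bar>)" .
qed

text \<open>Jensen's inequality for a sub-probability density, via the tangent line of \<open>exp\<close> at the mean.\<close>

lemma exp_integral_le:
 fixes f h :: "'a => real"
 assumes f: "integrable M f" "\<And>y. y \<in> space M ==> f y >= 0" "(LINT y|M. f y) <= 1"
  and h: "integrable M (\<lambda>y. f y * h y)" "integrable M (\<lambda>y. f y * exp (h y))"
 shows "exp (LINT y|M. f y * h y) <= (LINT y|M. f y * exp (h y)) + 1"
proof -
 define a where "a = (LINT y|M. f y * h y)"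
 define m where "m = (LINT y|M. f y)"
 have m: "0 <= m" "m <= 1" using f unfolding m_def by (auto intro!: integral_nonneg_AE)
 have t: "exp a * (1 + (t - a)) <= exp t" for t
 proof -
  have "exp a * (1 + (t - a)) <= exp a * exp (t - a)" by (intro mult_left_mono exp_ge_add_one_self) auto
  then show ?thesis by (simp add: exp_diff)
 qed
 have "(LINT y|M. exp a * (f y * (1 - a) + f y * h y)) <= (LINT y|M. f y * exp (h y))"
 proof (rule integral_mono)
  fix y assume "y \<in> space M"
  then have "f y * (exp a * (1 + (h y - a))) <= f y * exp (h y)" using t[of "h y"] f(2) by (intro mult_left_mono)
  then show "exp a * (f y * (1 - a) + f y * h y) <= f y * exp (h y)" by (simp add: algebra_simps)
 qed (use f h in auto)
 also have "(LINT y|M. exp a * (f y * (1 - a) + f y * h y)) = exp a * (m * (1 - a) + a)"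
  using f(1) h(1) by (simp add: m_def a_def)
 finally have 1: "exp a * (m * (1 - a) + a) <= (LINT y|M. f y * exp (h y))" .
 have "(1 - m) * (exp a * (1 - a)) <= (1 - m) * 1" using t[of 0] m by (intro mult_left_mono) auto
 then have 2: "exp a * ((1 - m) * (1 - a)) <= 1" using m by (simp add: mult_ac)
 have "exp a = exp a * (m * (1 - a) + a) + exp a * ((1 - m) * (1 - a))" by (simp add: algebra_simps)
 with 1 2 show ?thesis unfolding a_def by linarith
qed

section \<open>Exponential integrability and weighted potentials\<close>

lemma exp_half_GG:
 assumes x: "x \<in> annulus" and y: "y \<in> annulus" and ne: "y \<noteq> x"
 shows "exp (GG 0 x y / 2) <= 9 * norm (y - x) powr (- 1)"
proof -
 let ?r = "norm (y - x)"
 have r: "?r > 0" "?r <= 2" using ne annulus_norm[OF x] annulus_norm[OF y] norm_triangle_ineq4[of y x] by auto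
 have p: "pw x * pw y <= 8 * 8" "pw x * pw y > 0"
  using pw_collar(3,4)[OF x] pw_collar(3,4)[OF y] mult_mono[of "pw x" 8 "pw y" 8] by auto
 have r2: "?r\<^sup>2 <= 2\<^sup>2" using r by (intro power_mono) auto
 have "1 + pw x * pw y / ?r\<^sup>2 = (?r\<^sup>2 + pw x * pw y) / ?r\<^sup>2" using r by (simp add: field_simps)
 \<comment> \<open>The numerator is at most 4 + 64, rounded up to a square.\<close>
 also have "... <= 81 / ?r\<^sup>2" using p r2 by (intro divide_right_mono) auto
 also have "... = (9 / ?r)\<^sup>2" by (simp add: power_divide)
 finally have "1 + pw x * pw y / ?r\<^sup>2 <= (9 / ?r)\<^sup>2" .
 then have "GG 0 x y <= ln ((9 / ?r)\<^sup>2)" unfolding GG_def using p r by (intro ln_mono add_pos_nonneg) auto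
 also have "... = 2 * ln (9 / ?r)" using r by (simp add: ln_realpow)
 finally have "exp (GG 0 x y / 2) <= exp (ln (9 / ?r))" by simp
 also have "... = 9 * ?r powr (- 1)" using r by (simp add: powr_minus_divide)
 finally show ?thesis .
qed

text \<open>The Brezis-Merle argument. Truncation at a high level leaves a part \<open>F1\<close> of
  mass below \<open>d\<close>; the rest is bounded and contributes a bounded potential. Jensen with
  density \<open>F1 / d\<close> reduces the exponential of the potential of \<open>F1\<close> to an
  average of \<open>exp (GG 0 x y / 2)\<close>, whose singularity is only the inverse distance. As
  \<open>d\<close> may be taken small, every exponent \<open>k\<close> is reached.\<close>

lemma exp_solution_integrable:
 assumes u: "u \<in> W11_0 annulus" and eq: "neg_laplacian_distr annulus u F" and F: "integrable annM F"
  and pos: "\<And>x. x \<in> annulus ==> F x >= 0" and k: "k > 0"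
 shows "integrable annM (\<lambda>x. exp (k * u x))"
proof -
 note K0 = delta_mass_pos
 note iu = W11_0_approx(1)[OF u]
 define q where "q = k / delta_mass"
 have q: "q > 0" using k K0 by (simp add: q_def)
 \<comment> \<open>With this value \<open>q * F1 * GG\<close> equals
   \<open>(F1 / d) * (GG / 2)\<close>, so the exponential in Jensen's inequality carries exactly
   half of \<open>GG\<close>.\<close>
 define d where "d = 1 / (2 * q)"
 have d: "d > 0" using q by (simp add: d_def)
 have "(\<lambda>n. LINT x|annM. F x - min (F x) (real n)) \<longlonglongrightarrow> (LINT x|annM. 0)"
 proof (rule integral_dominated_convergence[where w="\<lambda>x. \<bar>F x\<bar>"])
  show "(\<lambda>x. F x - min (F x) (real n)) \<in> borel_measurable annM" for n using F by measurable
  show "integrable annM (\<lambda>x. \<bar>F x\<bar>)" using F by auto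
  show "AE x in annM. (\<lambda>n. F x - min (F x) (real n)) \<longlonglongrightarrow> 0"
  proof (rule AE_I2)
   fix x
   obtain N where N: "real N >= F x" using real_arch_simple by blast
   show "(\<lambda>n. F x - min (F x) (real n)) \<longlonglongrightarrow> 0"
   proof (rule tendsto_eventually, rule eventually_sequentiallyI[of N])
    fix n assume "N <= n"
    then have "F x <= real n" using N by (meson of_nat_mono order_trans)
    then show "F x - min (F x) (real n) = 0" by simp
   qed
  qed
  show "AE x in annM. norm (F x - min (F x) (real n)) <= \<bar>F x\<bar>" for n
   using pos by (intro AE_I2) (auto simp: min_def)
 qed simp
 then have "(\<lambda>n. LINT x|annM. F x - min (F x) (real n)) \<longlonglongrightarrow> 0" by simp
 from LIMSEQ_D[OF this d] obtain n where n: "\<bar>LINT x|annM. F x - min (F x) (real n)\<bar> < d" by auto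
 define F1 where "F1 x = F x - min (F x) (real n)" for x
 define F2 where "F2 x = min (F x) (real n)" for x
 have F12: "F x = F1 x + F2 x" for x by (simp add: F1_def F2_def)
 have b2: "0 <= F2 x" "F2 x <= real n" if "x \<in> annulus" for x using pos[OF that] by (auto simp: F2_def)
 have b1: "0 <= F1 x" for x by (simp add: F1_def)
 have m2: "F2 \<in> borel_measurable annM" using F by (auto simp: F2_def[abs_def])
 have i2: "integrable annM F2" by (rule integrable_annM_bounded[OF m2]) (use b2 in force)
 have "F1 = (\<lambda>x. F x - F2 x)" by (simp add: F1_def F2_def fun_eq_iff)
 then have i1: "integrable annM F1" using F i2 by simp
 obtain C1 where C1: "\<And>x. x \<in> annulus ==> integrable annM (\<lambda>y. norm (y - x) powr (- 1))"
  "\<And>x. x \<in> annulus ==> (LINT y|annM. norm (y - x) powr (- 1)) <= C1"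
  using singular_integral[of 1] by auto
 define a2 where "a2 = (pwC + 2) * 8 * (real n * C1)"
 define b where "b = 8 * kapC * (LINT y|annM. \<bar>u y\<bar>)"
 define J where "J x = (9 / d) * (LINT y|annM. F1 y * norm (y - x) powr (- 1)) + 1" for x
 have J: "integrable annM J"
  unfolding J_def using singular_potential(3)[OF i1, of 1] finite_annM by (auto simp: finite_measure.integrable_const)
 have s1: "AE x in annM. integrable annM (\<lambda>y. F1 y * norm (y - x) powr (- 1))"
  by (rule singular_potential(2)[OF i1]) auto
 have bound: "AE x in annM. exp (k * u x) <= exp (q * (a2 + b)) * J x"
  using representation[OF u eq F] s1 AE_annM_in
 proof eventually_elim
  case (elim x)
  note x = elim(3)
  have px: "pw x > 0" "pw x <= 8" using pw_collar[OF x] by auto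
  have s2: "integrable annM (\<lambda>y. F2 y * norm (y - x) powr (- 1))"
  proof (rule Bochner_Integration.integrable_bound[OF integrable_mult_right[OF C1(1)[OF x], of "real n"]])
   show "(\<lambda>y. F2 y * norm (y - x) powr (- 1)) \<in> borel_measurable annM" using m2 C1(1)[OF x] by measurable
   show "AE y in annM. norm (F2 y * norm (y - x) powr (- 1)) <= norm (real n * norm (y - x) powr (- 1))"
   proof (rule AE_I2)
    fix y assume "y \<in> space annM"
    then have "\<bar>F2 y\<bar> <= real n" using b2[of y] by simp
    then show "norm (F2 y * norm (y - x) powr (- 1)) <= norm (real n * norm (y - x) powr (- 1))"
     by (simp add: abs_mult divide_right_mono)
   qed
  qed
  note g1 = GG_integrable_potential[OF borel_measurable_integrable[OF i1] elim(2) x]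
  note g2 = GG_integrable_potential[OF m2 s2 x]
  have "(LINT y|annM. \<bar>F2 y\<bar> * norm (y - x) powr (- 1)) <= (LINT y|annM. real n * norm (y - x) powr (- 1))"
  proof (rule integral_mono)
   show "integrable annM (\<lambda>y. \<bar>F2 y\<bar> * norm (y - x) powr (- 1))" using integrable_abs[OF s2] by (simp add: abs_mult)
   show "integrable annM (\<lambda>y. real n * norm (y - x) powr (- 1))" using C1(1)[OF x] by (rule integrable_mult_right)
   fix y assume "y \<in> space annM"
   then show "\<bar>F2 y\<bar> * norm (y - x) powr (- 1) <= real n * norm (y - x) powr (- 1)"
    using b2[of y] by (intro mult_right_mono) auto
  qed
  also have "... = real n * (LINT y|annM. norm (y - x) powr (- 1))" by (rule integral_mult_right_zero)
  also have "... <= real n * C1" using C1(2)[OF x] by (intro mult_left_mono) auto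
  finally have I2: "(LINT y|annM. \<bar>F2 y\<bar> * norm (y - x) powr (- 1)) <= real n * C1" .
  have A2: "(LINT y|annM. F2 y * GG 0 x y) <= a2"
  proof -
   have "(LINT y|annM. F2 y * GG 0 x y) <= (pwC + 2) * pw x * (LINT y|annM. \<bar>F2 y\<bar> * norm (y - x) powr (- 1))"
    using g2(2) by linarith
   also have "... <= (pwC + 2) * 8 * (real n * C1)"
    using I2 px pwC(1) by (intro mult_mono) (auto intro!: integral_nonneg_AE)
   finally show ?thesis by (simp add: a2_def)
  qed
  have Bx: "(LINT y|annM. u y * (pw x * kap x y)) <= b"
  proof -
   have "(LINT y|annM. u y * (pw x * kap x y)) <= pw x * kapC * (LINT y|annM. \<bar>u y\<bar>)"
    using kap_potential(2)[OF iu x] by linarith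
   also have "... <= b" unfolding b_def using px kapC(1) by (intro mult_right_mono) (auto intro!: integral_nonneg_AE)
   finally show ?thesis .
  qed
  have split: "(LINT y|annM. F y * GG 0 x y) = (LINT y|annM. F1 y * GG 0 x y) + (LINT y|annM. F2 y * GG 0 x y)"
   unfolding F12 using g1(1) g2(1) by (simp add: distrib_right)
  have A1: "exp (q * (LINT y|annM. F1 y * GG 0 x y)) <= J x"
  proof -
   have e1: "integrable annM (\<lambda>y. F1 y / d * exp (GG 0 x y / 2))"
   proof (rule Bochner_Integration.integrable_bound[OF integrable_mult_right[OF elim(2), of "9 / d"]])
    show "(\<lambda>y. F1 y / d * exp (GG 0 x y / 2)) \<in> borel_measurable annM"
     using i1 GG_measurable[of 0 x] by measurable
    show "AE y in annM. norm (F1 y / d * exp (GG 0 x y / 2)) <= norm (9 / d * (F1 y * norm (y - x) powr (- 1)))"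
     using AE_annM_neq[of x] AE_annM_in
    proof eventually_elim
     case (elim y)
     have "F1 y / d * exp (GG 0 x y / 2) <= F1 y / d * (9 * norm (y - x) powr (- 1))"
      using exp_half_GG[OF x elim(2,1)] b1[of y] d by (intro mult_left_mono) auto
     moreover have "0 <= F1 y / d * exp (GG 0 x y / 2)" using b1[of y] d by simp
     moreover have "F1 y / d * (9 * norm (y - x) powr (- 1)) = 9 / d * (F1 y * norm (y - x) powr (- 1))"
      by (simp add: mult_ac)
     ultimately show ?case unfolding real_norm_def by linarith
    qed
   qed
   have "exp (LINT y|annM. F1 y / d * (GG 0 x y / 2)) <= (LINT y|annM. F1 y / d * exp (GG 0 x y / 2)) + 1"
   proof (rule exp_integral_le[OF _ _ _ _ e1])
    show "integrable annM (\<lambda>y. F1 y / d)" using i1 by simp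
    show "(LINT y|annM. F1 y / d) <= 1" using n d by (simp add: F1_def pos_divide_le_eq)
    show "integrable annM (\<lambda>y. F1 y / d * (GG 0 x y / 2))" using g1(1) by simp
   qed (use b1 d in auto)
   also have "(LINT y|annM. F1 y / d * exp (GG 0 x y / 2)) <= (LINT y|annM. (9 / d) * (F1 y * norm (y - x) powr (- 1)))"
   proof (rule integral_mono_AE[OF e1 integrable_mult_right[OF elim(2)]])
    show "AE y in annM. F1 y / d * exp (GG 0 x y / 2) <= (9 / d) * (F1 y * norm (y - x) powr (- 1))"
     using AE_annM_neq[of x] AE_annM_in
    proof eventually_elim
     case (elim y)
     have "F1 y / d * exp (GG 0 x y / 2) <= F1 y / d * (9 * norm (y - x) powr (- 1))"
      using exp_half_GG[OF x elim(2,1)] b1[of y] d by (intro mult_left_mono) auto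
     then show ?case by (simp add: mult_ac)
    qed
   qed
   also have "(LINT y|annM. F1 y / d * (GG 0 x y / 2)) = q * (LINT y|annM. F1 y * GG 0 x y)"
   proof -
    have "(\<lambda>y. F1 y / d * (GG 0 x y / 2)) = (\<lambda>y. q * (F1 y * GG 0 x y))"
     using q by (simp add: d_def fun_eq_iff)
    then show ?thesis by (simp only: integral_mult_right_zero)
   qed
   finally show ?thesis unfolding J_def integral_mult_right_zero by simp
  qed
  have "k * u x = q * (delta_mass * u x)" using K0 by (simp add: q_def)
  also have "... = q * (LINT y|annM. F1 y * GG 0 x y) + q * ((LINT y|annM. F2 y * GG 0 x y) + (LINT y|annM. u y * (pw x * kap x y)))"
   unfolding elim(1) split by (simp add: algebra_simps)
  also have "... <= q * (LINT y|annM. F1 y * GG 0 x y) + q * (a2 + b)"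
   using A2 Bx q by (intro add_left_mono mult_left_mono) auto
  finally have "exp (k * u x) <= exp (q * (LINT y|annM. F1 y * GG 0 x y)) * exp (q * (a2 + b))"
   by (simp flip: exp_add)
  also have "... <= J x * exp (q * (a2 + b))" using A1 by (intro mult_right_mono) auto
  finally show ?case by (simp add: mult.commute)
 qed
 show ?thesis
 proof (rule Bochner_Integration.integrable_bound[OF integrable_mult_right[OF J, of "exp (q * (a2 + b))"]])
  show "(\<lambda>x. exp (k * u x)) \<in> borel_measurable annM" using iu by measurable
  show "AE x in annM. norm (exp (k * u x)) <= norm (exp (q * (a2 + b)) * J x)"
   using bound by eventually_elim simp
 qed
qed

lemma young_three:
 fixes x y z q r t :: real
 assumes "x >= 0" "y >= 0" "z >= 0" "q > 0" "r > 0" "t > 0" "1 / q + 1 / r + 1 / t = 1"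
 shows "x * y * z <= x powr q + y powr r + z powr t"
proof -
 define M where "M = max (x powr q) (max (y powr r) (z powr t))"
 have M0: "M >= 0" using powr_ge_zero[of x q] unfolding M_def by (rule max.coboundedI1)
 have le: "a <= M powr (1 / p)" if "a >= 0" "p > 0" "a powr p <= M" for a p
 proof -
  have "a = (a powr p) powr (1 / p)" using that by (simp add: powr_powr)
  also have "... <= M powr (1 / p)" using that by (intro powr_mono2) auto
  finally show ?thesis .
 qed
 have "x * y * z <= M powr (1 / q) * M powr (1 / r) * M powr (1 / t)"
  using assms by (intro mult_mono le) (auto simp: M_def le_max_iff_disj)
 also have "... = M" using M0 assms(7) by (cases "M = 0") (simp_all flip: powr_add)
 also have "... <= x powr q + y powr r + z powr t"
  unfolding M_def using powr_ge_zero[of x q] powr_ge_zero[of y r] powr_ge_zero[of z t] by linarith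
 finally show ?thesis .
qed

lemma annulus_dist_less_2: "y \<in> annulus ==> norm x <= 1 ==> norm (y - x) < 2"
 using annulus_norm[of y] norm_triangle_ineq4[of y x] by simp

lemma annulus_neq_boundary: "y \<in> annulus ==> norm x0 = 1/2 ==> y \<noteq> x0"
 by (auto simp: annulus_def)

text \<open>Young's inequality separates the pole of the weight at \<open>x0\<close>, the pole of
  the kernel at \<open>x\<close>, and the exponential. The weight needs
  \<open>1/q > - \<beta>\<close> when \<open>\<beta>\<close> is negative and the kernel needs
  \<open>1/r > 1/2\<close>; room for a third exponent remains exactly when
  \<open>\<beta> > -1/2\<close>.\<close>

lemma weight_potential_bound:
 fixes x0 :: "real^2"
 assumes x0: "norm x0 = 1/2" and \<beta>: "\<beta> > -1/2"
  and w: "\<And>k. k > 0 ==> integrable annM (\<lambda>x. exp (k * w x))"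
  and F: "F \<in> borel_measurable annM" "\<And>y. y \<in> annulus ==> 0 <= F y"
   "\<And>y. y \<in> annulus ==> F y <= b * (norm (y - x0) powr (2 * \<beta>) * exp (w y))"
  and b: "b >= 0"
 shows "\<exists>C. \<forall>x\<in>annulus. integrable annM (\<lambda>y. F y * norm (y - x) powr (- 1)) \<and> (LINT y|annM. F y * norm (y - x) powr (- 1)) <= C"
proof -
 define g where "g = min \<beta> 0"
 define d where "d = 1/2 + g"
 have d: "0 < d" "d <= 1/2" using \<beta> by (auto simp: d_def g_def)
 \<comment> \<open>The surplus \<open>d = 1/2 + g\<close> is divided: one quarter goes to the
   weight, one half to the kernel, and one quarter is \<open>1 / t\<close>. Then the reciprocals sum
   to 1, and both singular powers remain below 2.\<close>
 define q r t where "q = 1 / (- g + d / 4)" and "r = 2 / (1 + d)" and "t = 4 / d"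
 have qrt: "q > 0" "r > 0" "t > 0" "1 / q + 1 / r + 1 / t = 1"
  using d by (auto simp: q_def r_def t_def d_def field_simps g_def)
 have gq: "- (2 * g * q) >= 0" "- (2 * g * q) < 2"
 proof -
  have g: "g <= 0" by (simp add: g_def)
  show "- (2 * g * q) >= 0" using g qrt by (simp add: mult_nonpos_nonneg)
  have "- g + d / 4 > 0" using g d by simp
  then show "- (2 * g * q) < 2" using d by (simp add: q_def field_simps)
 qed
 have r2: "r < 2" using d by (simp add: r_def field_simps)
 obtain C1 where C1: "integrable annM (\<lambda>y. norm (y - x0) powr (2 * g * q))"
  using singular_integral_ball[OF gq] x0 by auto
 obtain C2 where C2: "\<And>x. x \<in> annulus ==> integrable annM (\<lambda>y. norm (y - x) powr (- r))"
  "\<And>x. x \<in> annulus ==> (LINT y|annM. norm (y - x) powr (- r)) <= C2"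
  using singular_integral[of r] qrt(2) r2 by auto
 have w3: "integrable annM (\<lambda>y. exp (t * w y))" by (rule w[OF qrt(3)])
 define c where "c = 2 powr (2 * (\<beta> - g))"
 have c: "c >= 0" by (simp add: c_def)
 define H where "H x y = norm (y - x0) powr (2 * g * q) + norm (y - x) powr (- r) + exp (t * w y)" for x y
 have H: "integrable annM (H x)" if "x \<in> annulus" for x
  unfolding H_def[abs_def] using C1 C2(1)[OF that] w3 by simp
 have bd: "F y * norm (y - x) powr (- 1) <= b * c * H x y" if y: "y \<in> annulus" and x: "x \<in> annulus" for x y
 proof -
  let ?n = "norm (y - x0)"
  have n: "?n > 0" "?n < 2" using annulus_neq_boundary[OF y x0] annulus_dist_less_2[OF y, of x0] x0 by auto
  have "?n powr (2 * \<beta>) = ?n powr (2 * (\<beta> - g)) * ?n powr (2 * g)"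
   using n by (simp add: powr_add[symmetric] algebra_simps)
  also have "... <= c * ?n powr (2 * g)"
   unfolding c_def using n by (intro mult_right_mono powr_mono2) (auto simp: g_def)
  finally have 1: "?n powr (2 * \<beta>) <= c * ?n powr (2 * g)" .
  have "F y <= b * ((c * ?n powr (2 * g)) * exp (w y))"
   by (rule order_trans[OF F(3)[OF y]]) (intro mult_left_mono mult_right_mono 1 b; simp)
  then have "F y * norm (y - x) powr (- 1) <= (b * ((c * ?n powr (2 * g)) * exp (w y))) * norm (y - x) powr (- 1)"
   by (rule mult_right_mono) simp
  also have "... = b * c * (?n powr (2 * g) * norm (y - x) powr (- 1) * exp (w y))" by (simp add: mult_ac)
  also have "?n powr (2 * g) * norm (y - x) powr (- 1) * exp (w y)
    <= (?n powr (2 * g)) powr q + (norm (y - x) powr (- 1)) powr r + exp (w y) powr t"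
   by (rule young_three) (use qrt in auto)
  also have "... = H x y" unfolding H_def powr_powr exp_powr_real by (simp add: mult.commute)
  finally show ?thesis using b c by (simp add: mult_left_mono)
 qed
 have int: "integrable annM (\<lambda>y. F y * norm (y - x) powr (- 1))" if x: "x \<in> annulus" for x
 proof (rule Bochner_Integration.integrable_bound[OF integrable_mult_right[OF H[OF x], of "b * c"]])
  have "integrable annM (\<lambda>y. norm (y - x) powr (- 1))" using singular_integral[of 1] x by auto
  then show "(\<lambda>y. F y * norm (y - x) powr (- 1)) \<in> borel_measurable annM" using F(1) by measurable
  show "AE y in annM. norm (F y * norm (y - x) powr (- 1)) <= norm (b * c * H x y)"
  proof (rule AE_I2)
   fix y assume "y \<in> space annM"
   then have y: "y \<in> annulus" by simp
   have "0 <= F y * norm (y - x) powr (- 1)" using F(2)[OF y] by simp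
   then show "norm (F y * norm (y - x) powr (- 1)) <= norm (b * c * H x y)"
    using bd[OF y x] unfolding real_norm_def by linarith
  qed
 qed
 have "(LINT y|annM. F y * norm (y - x) powr (- 1))
   <= b * c * ((LINT y|annM. norm (y - x0) powr (2 * g * q)) + C2 + (LINT y|annM. exp (t * w y)))" if x: "x \<in> annulus" for x
 proof -
  have "(LINT y|annM. F y * norm (y - x) powr (- 1)) <= (LINT y|annM. b * c * H x y)"
   by (rule integral_mono[OF int[OF x] integrable_mult_right[OF H[OF x]]]) (use bd x in auto)
  also have "... = b * c * (LINT y|annM. H x y)" by (rule integral_mult_right_zero)
  also have "(LINT y|annM. H x y) = (LINT y|annM. norm (y - x0) powr (2 * g * q)) + (LINT y|annM. norm (y - x) powr (- r)) + (LINT y|annM. exp (t * w y))"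
   unfolding H_def using C1 C2(1)[OF x] w3 by simp
  finally have "(LINT y|annM. F y * norm (y - x) powr (- 1))
   <= b * c * ((LINT y|annM. norm (y - x0) powr (2 * g * q)) + (LINT y|annM. norm (y - x) powr (- r)) + (LINT y|annM. exp (t * w y)))" .
  also have "... <= b * c * ((LINT y|annM. norm (y - x0) powr (2 * g * q)) + C2 + (LINT y|annM. exp (t * w y)))"
   using C2(2)[OF x] b c by (intro mult_left_mono) auto
  finally show ?thesis .
 qed
 with int show ?thesis by blast
qed

section \<open>The regular representative of a solution\<close>

definition kkg :: "real^2 => real^2 => real^2" where
 "kkg x y = kap x y *\<^sub>R pwg x + pw x *\<^sub>R kapg x y"

text \<open>The right-hand side of the representation formula, solved for \<open>u\<close>. Unlike
  \<open>u\<close> it has meaningful values at every point of the annulus, with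
  \<open>sol_grad\<close> as its gradient.\<close>

definition sol_fun :: "(real^2 => real) => (real^2 => real) => real^2 => real" where
 "sol_fun u F x = ((LINT y|annM. F y * GG 0 x y) + (LINT y|annM. u y * (pw x * kap x y))) / delta_mass"

definition sol_grad :: "(real^2 => real) => (real^2 => real) => real^2 => real^2" where
 "sol_grad u F x = (1 / delta_mass) *\<^sub>R ((LINT y|annM. F y *\<^sub>R GGx 0 x y) + (LINT y|annM. u y *\<^sub>R kkg x y))"

lemma NN_measurable: "NN e x \<in> borel_measurable annM"
 by (intro continuous_on_annM_measurable continuous_intros)

lemma GGx_measurable: "GGx s x \<in> borel_measurable annM"
 unfolding GGx_def[abs_def]
 by (intro borel_measurable_diff borel_measurable_scaleR borel_measurable_divide borel_measurable_const NN_measurable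
   borel_measurable_add borel_measurable_power borel_measurable_norm)
  (auto intro!: continuous_on_annM_measurable continuous_intros)

lemma kkg_facts:
 assumes x: "x \<in> annulus"
 shows "y \<in> annulus ==> GDERIV (\<lambda>x. pw x * kap x y) x :> kkg x y"
  "y \<in> annulus ==> norm (kkg x y) <= kapC * (pwC + 8)"
  "y \<in> annulus ==> \<bar>pw x * kap x y\<bar> <= 8 * kapC"
  "(\<lambda>y. pw x * kap x y) \<in> borel_measurable annM" "kkg x \<in> borel_measurable annM"
  "y \<in> annulus ==> continuous_on annulus (\<lambda>x. kkg x y)"
proof -
 note p = pw_collar(3,4)[OF x]
 show "GDERIV (\<lambda>x. pw x * kap x y) x :> kkg x y" if "y \<in> annulus"
  using GDERIV_mult[OF pw_gderiv kap_gderiv[OF x that]] by (simp add: kkg_def add.commute)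
 show "norm (kkg x y) <= kapC * (pwC + 8)" if y: "y \<in> annulus"
 proof -
  have "norm (kkg x y) <= \<bar>kap x y\<bar> * norm (pwg x) + pw x * norm (kapg x y)"
   unfolding kkg_def using norm_triangle_ineq[of "kap x y *\<^sub>R pwg x" "pw x *\<^sub>R kapg x y"] p by simp
  also have "... <= kapC * pwC + 8 * kapC"
   using kapC(2,3)[OF x y] kapC(1) pwC(2)[OF x] p by (intro add_mono mult_mono) auto
  finally show ?thesis by (simp add: algebra_simps)
 qed
 show "\<bar>pw x * kap x y\<bar> <= 8 * kapC" if y: "y \<in> annulus"
  unfolding abs_mult using kapC(2)[OF x y] p by (intro mult_mono) auto
 show "(\<lambda>y. pw x * kap x y) \<in> borel_measurable annM" "kkg x \<in> borel_measurable annM"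
  unfolding kkg_def[abs_def] using x
  by (auto intro!: continuous_on_annM_measurable continuous_intros continuous_kap)
 show "continuous_on annulus (\<lambda>x. kkg x y)" if "y \<in> annulus"
  unfolding kkg_def using that by (auto intro!: continuous_intros continuous_kap)
qed

lemma integrable_scaleR_bounded:
 fixes K :: "real^2 => real^2"
 assumes f: "integrable annM f" and K: "K \<in> borel_measurable annM" "\<And>y. y \<in> annulus ==> norm (K y) <= C"
 shows "integrable annM (\<lambda>y. f y *\<^sub>R K y)" "norm (LINT y|annM. f y *\<^sub>R K y) <= C * (LINT y|annM. \<bar>f y\<bar>)"
proof -
 have b: "norm (f y *\<^sub>R K y) <= C * \<bar>f y\<bar>" if "y \<in> annulus" for y
  using mult_left_mono[OF K(2)[OF that] abs_ge_zero[of "f y"]] by (simp add: mult.commute)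
 show i: "integrable annM (\<lambda>y. f y *\<^sub>R K y)"
 proof (rule Bochner_Integration.integrable_bound[OF integrable_mult_right[OF integrable_abs[OF f], of C]])
  show "(\<lambda>y. f y *\<^sub>R K y) \<in> borel_measurable annM" using f K(1) by measurable
  show "AE y in annM. norm (f y *\<^sub>R K y) <= norm (C * \<bar>f y\<bar>)"
   by (rule AE_I2, unfold real_norm_def, rule order_trans[OF b abs_ge_self]) simp
 qed
 have "norm (LINT y|annM. f y *\<^sub>R K y) <= (LINT y|annM. norm (f y *\<^sub>R K y))" by (rule integral_norm_bound)
 also have "... <= (LINT y|annM. C * \<bar>f y\<bar>)"
  by (rule integral_mono[OF integrable_norm[OF i] integrable_mult_right[OF integrable_abs[OF f]] b]) simp
 finally show "norm (LINT y|annM. f y *\<^sub>R K y) <= C * (LINT y|annM. \<bar>f y\<bar>)" by simp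
qed

lemma GGx_potential:
 assumes F: "F \<in> borel_measurable annM" and i: "integrable annM (\<lambda>y. F y * norm (y - x) powr (- 1))"
  and x: "x \<in> annulus" and e: "e >= 0"
 shows "integrable annM (\<lambda>y. F y *\<^sub>R GGx e x y)"
  "AE y in annM. norm (F y *\<^sub>R GGx e x y) <= (pwC * (1 + pwC) + 2) * \<bar>F y * norm (y - x) powr (- 1)\<bar>"
  "norm (LINT y|annM. F y *\<^sub>R GGx e x y) <= (pwC * (1 + pwC) + 2) * (LINT y|annM. \<bar>F y * norm (y - x) powr (- 1)\<bar>)"
proof -
 let ?c = "pwC * (1 + pwC) + 2"
 have j: "integrable annM (\<lambda>y. ?c * \<bar>F y * norm (y - x) powr (- 1)\<bar>)"
  by (intro integrable_mult_right integrable_abs i)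
 show b: "AE y in annM. norm (F y *\<^sub>R GGx e x y) <= ?c * \<bar>F y * norm (y - x) powr (- 1)\<bar>"
  using AE_annM_neq[of x] AE_annM_in
 proof eventually_elim
  case (elim y)
  have "norm (GGx e x y) <= ?c * norm (y - x) powr (- 1)"
   using GGx_bound[OF x elim(2) e elim(1)] elim by (simp add: powr_minus_divide)
  from mult_left_mono[OF this abs_ge_zero[of "F y"]]
  have "\<bar>F y\<bar> * norm (GGx e x y) <= ?c * (\<bar>F y\<bar> * norm (y - x) powr (- 1))" by (simp only: mult_ac)
  then show ?case by (simp only: norm_scaleR abs_mult abs_of_nonneg[OF powr_ge_zero])
 qed
 have b': "AE y in annM. norm (F y *\<^sub>R GGx e x y) <= norm (?c * \<bar>F y * norm (y - x) powr (- 1)\<bar>)"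
  using b by eventually_elim (unfold real_norm_def, erule order_trans, rule abs_ge_self)
 have m: "(\<lambda>y. F y *\<^sub>R GGx e x y) \<in> borel_measurable annM" using F GGx_measurable[of e x] by measurable
 show I: "integrable annM (\<lambda>y. F y *\<^sub>R GGx e x y)"
  by (rule Bochner_Integration.integrable_bound[OF j m b'])
 have "norm (LINT y|annM. F y *\<^sub>R GGx e x y) <= (LINT y|annM. norm (F y *\<^sub>R GGx e x y))" by (rule integral_norm_bound)
 also have "... <= (LINT y|annM. ?c * \<bar>F y * norm (y - x) powr (- 1)\<bar>)"
  by (rule integral_mono_AE[OF integrable_norm[OF I] j b])
 finally show "norm (LINT y|annM. F y *\<^sub>R GGx e x y) <= ?c * (LINT y|annM. \<bar>F y * norm (y - x) powr (- 1)\<bar>)"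
  unfolding integral_mult_right_zero .
qed

text \<open>The potentials with kernel \<open>GG (s n)\<close> are continuously differentiable. The
  uniform bound on the potential of \<open>F\<close> makes their \<open>C1_collar\<close> constant
  independent of \<open>n\<close>, because \<open>GG_bound\<close> and \<open>GGx_bound\<close> do
  not see the regularisation.\<close>

lemma sol_fun_C1_limit:
 assumes u: "integrable annM u" and F: "integrable annM F" "\<And>y. y \<in> annulus ==> 0 <= F y"
  and pot: "\<And>x. x \<in> annulus ==> integrable annM (\<lambda>y. F y * norm (y - x) powr (- 1))"
   "\<And>x. x \<in> annulus ==> (LINT y|annM. F y * norm (y - x) powr (- 1)) <= C"
 shows "\<exists>C. C1_limit (sol_fun u F) (sol_grad u F) C"
proof -
 note K0 = delta_mass_pos
 define s where "s n = inverse (real (Suc n))" for n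
 have s: "s n > 0" for n by (auto simp: s_def)
 have s0: "s \<longlonglongrightarrow> 0" unfolding s_def by (rule LIMSEQ_inverse_real_of_nat)
 define A where "A n x = (LINT y|annM. F y * GG (s n) x y)" for n x
 define Ag where "Ag n x = (LINT y|annM. F y *\<^sub>R GGx (s n) x y)" for n x
 define B where "B x = (LINT y|annM. u y * (pw x * kap x y))" for x
 define Bg where "Bg x = (LINT y|annM. u y *\<^sub>R kkg x y)" for x
 let ?\<Phi> = "\<lambda>n x. (1 / delta_mass) * (A n x + B x)" and ?D = "\<lambda>n x. (1 / delta_mass) *\<^sub>R (Ag n x + Bg x)"
 define U where "U = (LINT y|annM. \<bar>u y\<bar>)"
 have U0: "U >= 0" unfolding U_def by (intro integral_nonneg_AE) simp
 have Fabs: "(LINT y|annM. \<bar>F y * norm (y - x) powr (- 1)\<bar>) = (LINT y|annM. F y * norm (y - x) powr (- 1))" for x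
  using F(2) by (intro Bochner_Integration.integral_cong) auto
 have C0: "C >= 0"
  by (rule order_trans[OF integral_nonneg_AE pot(2)[OF annulus_nonempty]]) (use F(2) in auto)
 have Bder: "GDERIV B x :> Bg x" if "x \<in> annulus" for x
  unfolding B_def[abs_def] Bg_def
  by (rule gderiv_integral_annM[OF u]) (use kkg_facts that in auto)
 have Bcont: "continuous_on annulus Bg"
  unfolding Bg_def[abs_def] by (rule continuous_integral_annM[OF u]) (use kkg_facts in auto)
 have GGb: "\<bar>GG (s n) x y\<bar> <= ln (1 + 64 / s n)" if "x \<in> annulus" "y \<in> annulus" for n x y
 proof -
  have p: "pw x * pw y <= 8 * 8" "pw x * pw y > 0"
   using pw_collar(3,4)[OF that(1)] pw_collar(3,4)[OF that(2)] mult_mono[of "pw x" 8 "pw y" 8] by auto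
  have "pw x * pw y / ((norm (y - x))\<^sup>2 + s n) <= 64 / s n"
   using p s[of n] by (intro frac_le) auto
  moreover have "pw x * pw y / ((norm (y - x))\<^sup>2 + s n) >= 0" using p s[of n] by (intro divide_nonneg_nonneg) auto
  ultimately have "GG (s n) x y <= ln (1 + 64 / s n)" unfolding GG_def by (intro ln_mono) auto
  then show ?thesis using GG_nonneg[OF that, of "s n"] s[of n] by simp
 qed
 have Ader: "GDERIV (A n) x :> Ag n x" if "x \<in> annulus" for n x
  unfolding A_def[abs_def] Ag_def
 proof (rule gderiv_integral_annM[OF F(1)])
  fix x y :: "real^2" assume xy: "x \<in> annulus" "y \<in> annulus"
  show "GDERIV (\<lambda>x. GG (s n) x y) x :> GGx (s n) x y" using GG_gderiv[OF xy] s[of n] by auto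
  show "norm (GGx (s n) x y) <= (8 * pwC + 8) / s n" by (rule GGx_bound_eps[OF xy s])
  show "\<bar>GG (s n) x y\<bar> <= ln (1 + 64 / s n)" by (rule GGb[OF xy])
 qed (use GG_measurable GGx_measurable that in auto)
 have GGxc: "continuous_on annulus (\<lambda>x. GGx (s n) x y)" if y: "y \<in> annulus" for n y
 proof -
  have "NN (s n) x y \<noteq> 0" if "x \<in> annulus" for x using NN_facts(2)[OF that y, of "s n"] s[of n] by auto
  moreover have "(norm (y - x))\<^sup>2 + s n \<noteq> 0" for x using add_nonneg_pos[OF zero_le_power2[of "norm (y - x)"] s[of n]] by simp
  ultimately show ?thesis unfolding GGx_def by (intro continuous_intros) auto
 qed
 have Acont: "continuous_on annulus (Ag n)" for n
  unfolding Ag_def[abs_def]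
  by (rule continuous_integral_annM[OF F(1) GGxc GGx_bound_eps[OF _ _ s] GGx_measurable])
 define C' where "C' = (1 / delta_mass) * (8 * (pwC + 2) * C + 8 * kapC * U + (pwC * (1 + pwC) + 2) * C + kapC * (pwC + 8) * U)"
 have pos: "8 * (pwC + 2) * C >= 0" "8 * kapC * U >= 0" "(pwC * (1 + pwC) + 2) * C >= 0" "kapC * (pwC + 8) * U >= 0"
  using pwC(1) C0 kapC(1) U0 by auto
 have coll: "C1_collar (?\<Phi> n) (?D n) C'" for n
  unfolding C1_collar_def
 proof (intro conjI ballI)
  show "continuous_on annulus (?D n)" by (intro continuous_intros Acont Bcont)
  fix x assume x: "x \<in> annulus"
  note p = pw_collar[OF x]
  have c0: "collar x > 0" using x annulus_collar by simp
  show "GDERIV (?\<Phi> n) x :> ?D n x"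
   using GDERIV_mult[OF GDERIV_const[of "1 / delta_mass"] GDERIV_add[OF Ader[OF x] Bder[OF x]]] by simp
  have A1: "\<bar>A n x\<bar> <= (8 * (pwC + 2) * C) * collar x"
  proof -
   have "\<bar>A n x\<bar> <= (LINT y|annM. \<bar>F y * GG (s n) x y\<bar>)" unfolding A_def by (rule integral_abs_bound)
   also have "... <= (LINT y|annM. ((pwC + 2) * pw x) * (F y * norm (y - x) powr (- 1)))"
   proof (rule integral_mono_AE)
    show "integrable annM (\<lambda>y. \<bar>F y * GG (s n) x y\<bar>)"
     by (intro integrable_abs integrable_annM_bounded_mult[OF F(1) GG_measurable GGb[OF x]])
    show "integrable annM (\<lambda>y. ((pwC + 2) * pw x) * (F y * norm (y - x) powr (- 1)))"
     by (intro integrable_mult_right pot x)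
    show "AE y in annM. \<bar>F y * GG (s n) x y\<bar> <= ((pwC + 2) * pw x) * (F y * norm (y - x) powr (- 1))"
     using AE_annM_neq[of x] AE_annM_in
    proof eventually_elim
     case (elim y)
     have h: "GG (s n) x y <= (pwC + 2) * pw x * norm (y - x) powr (- 1)" "GG (s n) x y >= 0"
      using GG_bound[OF x elim(2), of "s n"] GG_nonneg[OF x elim(2), of "s n"] elim(1) s[of n]
      by (auto simp: powr_minus_divide)
     note mult_left_mono[OF h(1) F(2)[OF elim(2)]] mult_nonneg_nonneg[OF F(2)[OF elim(2)] h(2)]
     then show ?case by (simp only: abs_of_nonneg mult_ac)
    qed
   qed
   also have "... = ((pwC + 2) * pw x) * (LINT y|annM. F y * norm (y - x) powr (- 1))" by (rule integral_mult_right_zero)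
   also have "... <= ((pwC + 2) * (8 * collar x)) * C"
    using pot(2)[OF x] p pwC(1) C0 c0 F(2)
    by (intro mult_mono) (auto intro!: integral_nonneg_AE)
   finally show ?thesis by (simp add: mult_ac)
  qed
  have B1: "\<bar>B x\<bar> <= (8 * kapC * U) * collar x"
  proof -
   have "\<bar>B x\<bar> <= pw x * kapC * U" unfolding B_def U_def by (rule kap_potential(2)[OF u x])
   also have "... <= (8 * collar x) * kapC * U" using p kapC(1) U0 by (intro mult_right_mono) auto
   finally show ?thesis by (simp add: mult_ac)
  qed
  have "\<bar>?\<Phi> n x\<bar> = (1 / delta_mass) * \<bar>A n x + B x\<bar>" using K0 by (simp add: abs_mult)
  also have "... <= (1 / delta_mass) * ((8 * (pwC + 2) * C + 8 * kapC * U) * collar x)"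
   using A1 B1 K0 by (intro mult_left_mono) (auto simp: distrib_right)
  also have "... <= C' * collar x"
   unfolding C'_def mult.assoc[symmetric] using pos K0 c0 by (intro mult_right_mono mult_left_mono) auto
  finally show "\<bar>?\<Phi> n x\<bar> <= C' * collar x" .
  have "norm (Ag n x) <= (pwC * (1 + pwC) + 2) * (LINT y|annM. \<bar>F y * norm (y - x) powr (- 1)\<bar>)"
   unfolding Ag_def using s[of n] by (intro GGx_potential(3)[OF borel_measurable_integrable[OF F(1)] pot(1)[OF x] x]) simp
  also have "... <= (pwC * (1 + pwC) + 2) * C" unfolding Fabs using pot(2)[OF x] pwC(1) by (intro mult_left_mono) auto
  finally have A2: "norm (Ag n x) <= (pwC * (1 + pwC) + 2) * C" .
  have B2: "norm (Bg x) <= kapC * (pwC + 8) * U"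
   unfolding Bg_def U_def by (rule integrable_scaleR_bounded(2)[OF u kkg_facts(5)[OF x] kkg_facts(2)[OF x]])
  have "norm (?D n x) = (1 / delta_mass) * norm (Ag n x + Bg x)" using K0 by simp
  also have "... <= (1 / delta_mass) * ((pwC * (1 + pwC) + 2) * C + kapC * (pwC + 8) * U)"
   using A2 B2 K0 norm_triangle_ineq[of "Ag n x" "Bg x"] by (intro mult_left_mono) auto
  also have "... <= C'" unfolding C'_def using pos K0 by (intro mult_left_mono) auto
  finally show "norm (?D n x) <= C'" .
 qed
 have lim: "(\<lambda>n. ?\<Phi> n x) \<longlonglongrightarrow> sol_fun u F x" "(\<lambda>n. ?D n x) \<longlonglongrightarrow> sol_grad u F x" if x: "x \<in> annulus" for x
 proof -
  let ?w = "\<lambda>y. \<bar>F y * norm (y - x) powr (- 1)\<bar>"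
  have iw: "integrable annM (\<lambda>y. c * ?w y)" for c by (intro integrable_mult_right integrable_abs pot x)
  have nn: "AE y in annM. y \<noteq> x \<and> y \<in> annulus" using AE_annM_neq AE_annM_in by eventually_elim auto
  have Fm: "F \<in> borel_measurable annM" using F(1) by simp
  have "(\<lambda>n. A n x) \<longlonglongrightarrow> (LINT y|annM. F y * GG 0 x y)"
   unfolding A_def by (rule GG_potential_tendsto[OF Fm pot(1)[OF x] x s s0])
  then show "(\<lambda>n. ?\<Phi> n x) \<longlonglongrightarrow> sol_fun u F x"
   unfolding sol_fun_def B_def[symmetric] using K0 by (auto intro!: tendsto_eq_intros)
  have "(\<lambda>n. Ag n x) \<longlonglongrightarrow> (LINT y|annM. F y *\<^sub>R GGx 0 x y)"
   unfolding Ag_def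
  proof (rule integral_dominated_convergence[where w="\<lambda>y. (pwC * (1 + pwC) + 2) * ?w y"])
   show "(\<lambda>y. F y *\<^sub>R GGx (s n) x y) \<in> borel_measurable annM" for n using Fm GGx_measurable[of "s n" x] by measurable
   show "(\<lambda>y. F y *\<^sub>R GGx 0 x y) \<in> borel_measurable annM" using Fm GGx_measurable[of 0 x] by measurable
   show "AE y in annM. (\<lambda>n. F y *\<^sub>R GGx (s n) x y) \<longlonglongrightarrow> F y *\<^sub>R GGx 0 x y"
    using nn by eventually_elim (intro tendsto_intros GGx_tendsto s0 x; simp)
   show "AE y in annM. norm (F y *\<^sub>R GGx (s n) x y) <= (pwC * (1 + pwC) + 2) * ?w y" for n
    using s[of n] by (intro GGx_potential(2)[OF Fm pot(1)[OF x] x]) simp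
  qed (rule iw)
  then show "(\<lambda>n. ?D n x) \<longlonglongrightarrow> sol_grad u F x"
   unfolding sol_grad_def Bg_def[symmetric] by (intro tendsto_intros)
 qed
 have "C1_limit (sol_fun u F) (sol_grad u F) C'"
  unfolding C1_limit_def
  by (intro exI[of _ "\<lambda>n x. (1 / delta_mass) * (A n x + B x)"] exI[of _ "\<lambda>n x. (1 / delta_mass) *\<^sub>R (Ag n x + Bg x)"]
    conjI allI ballI coll lim)
 then show ?thesis by blast
qed

section \<open>Maximum principle and interior estimates\<close>

text \<open>Two values of \<open>k\<close> matter: with -1 the function is strictly superharmonic,
  and with 3 it has minus Laplacian at most a multiple of itself, as a first eigenfunction would.
  \<open>cpsg\<close> is the gradient, \<open>cpsh\<close> holds the gradients of its components,
  and \<open>cpsl\<close> is the Laplacian.\<close>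

definition cps :: "real => real^2 => real" where "cps k x = collar x + k * (collar x)\<^sup>2"
definition cpsg :: "real => real^2 => real^2" where
 "cpsg k x = (2 * (5/4 - 2 * (x \<bullet> x)) * (1 + 2 * k * collar x)) *\<^sub>R x"
definition cpsh :: "real => real^2 => real^2 => real^2" where
 "cpsh k i x = ((x \<bullet> i) * (8 * k * (5/4 - 2 * (x \<bullet> x))\<^sup>2 - 8 * (1 + 2 * k * collar x))) *\<^sub>R x
   + (2 * (5/4 - 2 * (x \<bullet> x)) * (1 + 2 * k * collar x)) *\<^sub>R i"
definition cpsl :: "real => real^2 => real" where
 "cpsl k x = (5 - 16 * (x \<bullet> x)) * (1 + 2 * k * collar x) + 8 * k * (x \<bullet> x) * (5/4 - 2 * (x \<bullet> x))\<^sup>2"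

lemma cps_gderiv: "GDERIV (cps k) x :> cpsg k x"
proof -
 have "((\<lambda>t. (1 - t) * (t - 1/4) + k * ((1 - t) * (t - 1/4))\<^sup>2) has_real_derivative
   (5/4 - 2 * (x \<bullet> x)) * (1 + 2 * k * collar x)) (at (x \<bullet> x))"
  unfolding collar_def by (auto intro!: derivative_eq_intros simp: field_simps power2_eq_square)
 from GDERIV_radial[OF this] show ?thesis
  by (simp only: cpsg_def collar_def cps_def[abs_def] mult.assoc)
qed

lemma cpsg_gderiv: "GDERIV (\<lambda>x. cpsg k x \<bullet> i) x :> cpsh k i x"
proof -
 have d: "((\<lambda>t. 2 * (5/4 - 2 * t) * (1 + 2 * k * ((1 - t) * (t - 1/4)))) has_real_derivative
   4 * k * (5/4 - 2 * (x \<bullet> x))\<^sup>2 - 4 * (1 + 2 * k * collar x)) (at (x \<bullet> x))"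
  unfolding collar_def by (auto intro!: derivative_eq_intros simp: field_simps power2_eq_square)
 have "GDERIV (\<lambda>x. x \<bullet> i) x :> i" by (auto simp: gderiv_def inner_commute intro!: derivative_eq_intros)
 from GDERIV_mult[OF GDERIV_radial[OF d] this] show ?thesis
  unfolding cpsg_def[abs_def] cpsh_def collar_def by (simp add: algebra_simps)
qed

lemma cpsl_eq: "(\<Sum>i\<in>Basis. cpsh k i x \<bullet> i) = cpsl k x"
proof -
 let ?A = "8 * k * (5/4 - 2 * (x \<bullet> x))\<^sup>2 - 8 * (1 + 2 * k * collar x)" and ?B = "2 * (5/4 - 2 * (x \<bullet> x)) * (1 + 2 * k * collar x)"
 have "(\<Sum>i\<in>Basis. cpsh k i x \<bullet> i) = (\<Sum>i\<in>Basis. ?A * ((x \<bullet> i) * (x \<bullet> i)) + ?B)"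
  unfolding cpsh_def by (rule sum.cong[OF refl]) (simp add: inner_add_left algebra_simps)
 also have "... = ?A * (x \<bullet> x) + 2 * ?B"
  by (simp add: sum.distrib sum_distrib_left[symmetric] euclidean_inner[of x x, symmetric] del: inner_add_left)
 also have "... = cpsl k x" unfolding cpsl_def by (simp add: algebra_simps)
 finally show ?thesis .
qed

lemma continuous_collar [continuous_intros]: "continuous_on A f ==> continuous_on A (\<lambda>x. collar (f x))"
 unfolding collar_def by (intro continuous_intros)

lemma cps_continuous: "continuous_on A (cpsg k)" "continuous_on A (cpsh k i)" "continuous_on A (cpsl k)" "continuous_on A (cps k)"
 unfolding cpsg_def[abs_def] cpsh_def[abs_def] cpsl_def[abs_def] cps_def[abs_def] by (intro continuous_intros)+

lemma cps_bounded: "\<exists>B. B >= 1 + \<bar>k\<bar> \<and> (\<forall>x\<in>annulus. \<bar>cps k x\<bar> <= B \<and> norm (cpsg k x) <= B \<and> \<bar>cpsl k x\<bar> <= B \<and> (\<forall>i\<in>Basis. norm (cpsh k i x) <= B))"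
proof -
 have cpt: "compact (cball (0::real^2) 1)" by simp
 have ex: "\<exists>B. \<forall>x\<in>cball 0 1. norm (f x) <= B" if "continuous_on (cball (0::real^2) 1) f" for f :: "real^2 => 'a::euclidean_space"
  using compact_imp_bounded[OF compact_continuous_image[OF that cpt]] unfolding bounded_iff by blast
 obtain B1 B2 B3 where B: "\<And>x. x \<in> cball 0 1 ==> norm (cps k x) <= B1" "\<And>x. x \<in> cball 0 1 ==> norm (cpsg k x) <= B2"
  "\<And>x. x \<in> cball 0 1 ==> norm (cpsl k x) <= B3"
  using ex[OF cps_continuous(4)] ex[OF cps_continuous(1)] ex[OF cps_continuous(3)] by metis
 obtain B4 where B4: "\<And>x i. x \<in> cball 0 1 ==> norm (cpsh k i x) <= B4 i" using ex[OF cps_continuous(2)] by metis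
 define B where "B = max (1 + \<bar>k\<bar>) (max (max B1 B2) (max B3 (Max (B4 ` Basis))))"
 have m: "B4 i <= Max (B4 ` Basis)" if "i \<in> Basis" for i using that by (intro Max_ge) auto
 have "norm (cpsh k i x) <= Max (B4 ` Basis)" if "i \<in> Basis" "x \<in> cball 0 1" for i x
  using B4[OF that(2)] m[OF that(1)] by (rule order_trans)
 moreover have "x \<in> cball 0 1" if "x \<in> annulus" for x using annulus_norm[OF that] by simp
 ultimately show ?thesis using B by (intro exI[of _ B]) (auto simp: B_def le_max_iff_disj)
qed

lemma cps_C1_collar: "\<exists>C. C1_collar (cps k) (cpsg k) C"
proof -
 obtain B where B: "B >= 1 + \<bar>k\<bar>" "\<And>x. x \<in> annulus ==> norm (cpsg k x) <= B" using cps_bounded[of k] by auto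
 have "\<bar>cps k x\<bar> <= B * collar x" if x: "x \<in> annulus" for x
 proof -
  have c: "0 < collar x" "collar x <= 1" using x annulus_collar collar_le by auto
  have "\<bar>k * (collar x)\<^sup>2\<bar> <= \<bar>k\<bar> * collar x"
   unfolding abs_mult using c by (intro mult_left_mono) (auto simp: power2_eq_square mult_left_le)
  then have "\<bar>cps k x\<bar> <= (1 + \<bar>k\<bar>) * collar x" unfolding cps_def using c by (simp add: algebra_simps)
  also have "... <= B * collar x" using B(1) c by (intro mult_right_mono) auto
  finally show ?thesis .
 qed
 then show ?thesis unfolding C1_collar_def using cps_gderiv cps_continuous(1) B(2) by blast
qed

lemma divergence_cps:
 assumes "C1_limit \<Phi> D C"
 shows "integrable annM (\<lambda>x. cpsl k x * \<Phi> x)" "integrable annM (\<lambda>x. cpsg k x \<bullet> D x)"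
  "(LINT x|annM. cpsg k x \<bullet> D x) = - (LINT x|annM. cpsl k x * \<Phi> x)"
proof -
 obtain B where B: "\<And>x. x \<in> annulus ==> norm (cpsg k x) <= B"
  "\<And>i x. i \<in> Basis ==> x \<in> annulus ==> norm (cpsh k i x) <= B"
  using cps_bounded[of k] by auto
 have m: "cpsh k i \<in> borel_measurable annM" for i by (rule continuous_on_annM_measurable[OF cps_continuous(2)])
 have b: "\<bar>cpsg k x \<bullet> i\<bar> <= B" if "i \<in> Basis" "x \<in> annulus" for i x
  using Basis_le_norm[OF that(1)] B(1)[OF that(2)] by (rule order_trans)
 note z = zero_trace_divergence[OF C1_limit_zero_trace[OF assms] cpsg_gderiv m b B(2), unfolded cpsl_eq]
 show "integrable annM (\<lambda>x. cpsl k x * \<Phi> x)" "integrable annM (\<lambda>x. cpsg k x \<bullet> D x)"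
  "(LINT x|annM. cpsg k x \<bullet> D x) = - (LINT x|annM. cpsl k x * \<Phi> x)"
  using z by (simp_all add: mult.commute)
qed

lemma weak_sol_cps:
 assumes U: "C1_limit U D C" and w: "weak_sol D F"
 shows "(LINT x|annM. F x * cps k x) = - (LINT x|annM. cpsl k x * U x)"
proof -
 obtain C' where "C1_limit (cps k) (cpsg k) C'" using cps_C1_collar C1_collar_imp_limit by blast
 then have "(LINT x|annM. F x * cps k x) = (LINT x|annM. D x \<bullet> cpsg k x)" using w unfolding weak_sol_def by blast
 also have "... = (LINT x|annM. cpsg k x \<bullet> D x)" by (simp add: inner_commute)
 finally show ?thesis unfolding divergence_cps(3)[OF U] .
qed

lemma cps_minus_one: "x \<in> annulus ==> cpsl (-1) x <= - 1/8" "x \<in> annulus ==> 0 <= cps (-1) x" "x \<in> annulus ==> cps (-1) x <= collar x"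
proof -
 assume x: "x \<in> annulus"
 define s where "s = x \<bullet> x - 1/4"
 have t: "x \<bullet> x = s + 1/4" by (simp add: s_def)
 have s: "s > 0" using x by (simp add: s_def annulus_iff)
 \<comment> \<open>Measured from the inner circle, the value is 1/8 plus \<open>s\<close> times a
   quadratic without real zeros.\<close>
 have "- cpsl (-1) x = s * ((8 * s - 21/8)\<^sup>2 + 583/64) + 1/8"
  unfolding cpsl_def collar_def t by (simp add: power2_eq_square algebra_simps add_divide_distrib diff_divide_distrib)
 moreover have "s * ((8 * s - 21/8)\<^sup>2 + 583/64) >= 0" using s by (intro mult_nonneg_nonneg) auto
 ultimately show "cpsl (-1) x <= - 1/8" by linarith
 have c: "0 < collar x" "collar x <= 1" using x annulus_collar collar_le by auto
 show "0 <= cps (-1) x" "cps (-1) x <= collar x" using c by (auto simp: cps_def power2_eq_square mult_left_le)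
qed

text \<open>An estimate of this kind forces the Laplacian to be nonnegative on the boundary, where
  the function vanishes; with \<open>k = 3\<close> its boundary value is
  \<open>5 - 5/2 * t > 0\<close>. The constant 162 is \<open>192 * t - 30\<close> at
  \<open>t = 1\<close>.\<close>

lemma cps_three: "x \<in> annulus ==> - cpsl 3 x <= 162 * cps 3 x" "x \<in> annulus ==> collar x <= cps 3 x" "x \<in> annulus ==> cps 3 x <= 4"
proof -
 assume x: "x \<in> annulus"
 define t where "t = x \<bullet> x"
 have t: "1/4 < t" "t < 1" using x by (auto simp: t_def annulus_iff)
 have c: "0 < collar x" "collar x <= 1" using x annulus_collar collar_le by auto
 have c2: "0 <= (collar x)\<^sup>2" "(collar x)\<^sup>2 <= 1" using c by (auto simp: power_le_one)
 show "collar x <= cps 3 x" "cps 3 x <= 4" unfolding cps_def using c c2 by auto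
 have "- cpsl 3 x = (5/2 * t - 5) + (192 * t - 30) * collar x"
  unfolding cpsl_def collar_def t_def[symmetric] by (simp add: power2_eq_square algebra_simps add_divide_distrib diff_divide_distrib)
 also have "... <= 0 + 162 * collar x" using t c by (intro add_mono mult_right_mono) auto
 also have "... <= 162 * cps 3 x" using c2 by (simp add: cps_def)
 finally show "- cpsl 3 x <= 162 * cps 3 x" .
qed

text \<open>Test the equation with \<open>\<psi>((w - k)\<^sup>+)\<^sup>2\<close>, where \<open>\<psi> = cps (-1)\<close> is strictly superharmonic.\<close>

lemma max_principle:
 assumes w: "C1_limit w D C" "weak_sol D f" and k: "k >= 0"
  and f: "AE x in annM. w x > k \<longrightarrow> f x <= 0"
 shows "AE x in annM. w x <= k"
proof -
 \<comment> \<open>\<open>J\<close> is the antiderivative of \<open>T\<close>, so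
   \<open>T (w x)\<close> times the gradient of \<open>w\<close> is the gradient of
   \<open>J (w x)\<close> and the cross term can be integrated by parts onto \<open>\<psi>\<close>.
   As minus the Laplacian of \<open>\<psi>\<close> is at least 1/8, a nonpositive total forces
   \<open>J (w x) = 0\<close>.\<close>
 define T T' J where "T s = trunc_pow 2 (s - k)" and "T' s = 2 * trunc_pow 1 (s - k)" and "J s = trunc_pow 3 (s - k) / 3" for s
 have sh: "((\<lambda>t. trunc_pow (Suc (Suc n)) (t - k)) has_real_derivative real (n + 2) * trunc_pow (Suc n) (t - k)) (at t)" for n t
  using DERIV_shift[of "trunc_pow (Suc (Suc n))" "real (n + 2) * trunc_pow (Suc n) (t - k)" t "-k"] trunc_pow_deriv[of n "t - k"] by simp
 have dT: "(T has_real_derivative T' s) (at s)" for s using sh[of 0 s] unfolding T_def[abs_def] T'_def by (simp add: eval_nat_numeral)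
 have dJ: "(J has_real_derivative T s) (at s)" for s
  using DERIV_cdivide[OF sh[of 1 s], of 3] unfolding J_def[abs_def] T_def by (simp add: eval_nat_numeral)
 have z: "T 0 = 0" "J 0 = 0" using k by (auto simp: T_def J_def trunc_pow_def)
 have ct: "continuous_on UNIV T" "continuous_on UNIV T'" unfolding T_def T'_def by (intro continuous_intros)+
 have bd: "\<exists>B. \<forall>s. \<bar>s\<bar> <= C \<longrightarrow> \<bar>g s\<bar> <= B" if "continuous_on UNIV g" for g :: "real => real"
 proof -
  have "bounded (g ` {-C..C})" by (intro compact_imp_bounded compact_continuous_image continuous_on_subset[OF that]) auto
  then obtain B where "\<And>s. s \<in> {-C..C} ==> norm (g s) <= B" unfolding bounded_iff by blast
  then show ?thesis by (intro exI[of _ B]) (simp add: abs_le_iff)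
 qed
 obtain B1 B2 where B: "\<And>s. \<bar>s\<bar> <= C ==> \<bar>T' s\<bar> <= B1" "\<And>s. \<bar>s\<bar> <= C ==> \<bar>T s\<bar> <= B2"
  using bd[OF ct(2)] bd[OF ct(1)] by metis
 note Tl = C1_limit_compose[OF w(1) z(1) dT ct(2) B(1)] and Jl = C1_limit_compose[OF w(1) z(2) dJ ct(1) B(2)]
 let ?\<psi> = "cps (-1)" and ?Z = "cpsg (-1)"
 obtain B3 where B3: "\<And>x. x \<in> annulus ==> \<bar>?\<psi> x\<bar> <= B3" "\<And>x. x \<in> annulus ==> norm (?Z x) <= B3"
  using cps_bounded[of "-1"] by auto
 have B3': "collar x * norm (?Z x) <= B3" if x: "x \<in> annulus" for x
  using mult_right_mono[OF collar_le[OF x] norm_ge_zero[of "?Z x"]] B3(2)[OF x] by simp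
 note \<Phi> = C1_limit_mult[OF Tl cps_gderiv cps_continuous(1) B3(1) B3']
 have "(LINT x|annM. f x * (?\<psi> x * T (w x))) = (LINT x|annM. D x \<bullet> (?\<psi> x *\<^sub>R (T' (w x) *\<^sub>R D x) + T (w x) *\<^sub>R ?Z x))"
  using w(2) \<Phi> unfolding weak_sol_def by blast
 also have "... = (LINT x|annM. ?\<psi> x * T' (w x) * (D x \<bullet> D x) + ?Z x \<bullet> (T (w x) *\<^sub>R D x))"
  by (simp add: inner_add_right inner_commute algebra_simps)
 finally have 1: "(LINT x|annM. f x * (?\<psi> x * T (w x))) = ..." .
 note j = divergence_cps[OF Jl, of "-1"]
 have "integrable annM (\<lambda>x. D x \<bullet> (?\<psi> x *\<^sub>R (T' (w x) *\<^sub>R D x) + T (w x) *\<^sub>R ?Z x))"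
  by (rule C1_limit_inner_integrable[OF \<Phi> integrable_annM_bounded[OF C1_limit_facts(6,4)[OF w(1)]]])
 then have "integrable annM (\<lambda>x. ?\<psi> x * T' (w x) * (D x \<bullet> D x) + ?Z x \<bullet> (T (w x) *\<^sub>R D x))"
  by (simp add: inner_add_right inner_commute algebra_simps)
 from Bochner_Integration.integrable_diff[OF this j(2)] have i: "integrable annM (\<lambda>x. ?\<psi> x * T' (w x) * (D x \<bullet> D x))" by simp
 have "(LINT x|annM. f x * (?\<psi> x * T (w x))) = (LINT x|annM. ?\<psi> x * T' (w x) * (D x \<bullet> D x)) - (LINT x|annM. cpsl (-1) x * J (w x))"
  using 1 Bochner_Integration.integral_add[OF i j(2)] j(3) by linarith
 moreover have "0 <= (LINT x|annM. - (f x * (?\<psi> x * T (w x))))"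
 proof (rule integral_nonneg_AE)
  show "AE x in annM. 0 <= - (f x * (?\<psi> x * T (w x)))"
   using f AE_annM_in
  proof eventually_elim
   case (elim x)
   show ?case
   proof (cases "w x > k")
    case True
    then have "f x * (?\<psi> x * T (w x)) <= 0"
     using elim cps_minus_one(2)[of x] by (intro mult_nonpos_nonneg mult_nonneg_nonneg) (auto simp: T_def trunc_pow_def)
    then show ?thesis by linarith
   qed (simp add: T_def trunc_pow_def max_def)
  qed
 qed
 then have "(LINT x|annM. f x * (?\<psi> x * T (w x))) <= 0" by simp
 moreover have "(LINT x|annM. ?\<psi> x * T' (w x) * (D x \<bullet> D x)) >= 0"
  by (rule integral_nonneg_AE, rule AE_I2) (use cps_minus_one(2) in \<open>auto simp: T'_def trunc_pow_def\<close>)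
 ultimately have J0: "(LINT x|annM. - cpsl (-1) x * J (w x)) <= 0" by simp
 have Jn: "J s >= 0" for s by (simp add: J_def trunc_pow_def)
 have nn: "AE x in annM. 0 <= - cpsl (-1) x * J (w x)"
  using AE_annM_in
 proof eventually_elim
  case (elim x)
  then have "- cpsl (-1) x >= 0" using cps_minus_one(1)[of x] by linarith
  then show ?case using Jn by (rule mult_nonneg_nonneg)
 qed
 have ij: "integrable annM (\<lambda>x. - cpsl (-1) x * J (w x))" using j(1) by simp
 have "(LINT x|annM. - cpsl (-1) x * J (w x)) = 0"
  using J0 integral_nonneg_AE[OF nn] by linarith
 then have "AE x in annM. - cpsl (-1) x * J (w x) = 0"
  using integral_nonneg_eq_0_iff_AE[OF ij nn] by blast
 then show ?thesis using AE_annM_in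
 proof eventually_elim
  case (elim x)
  have "- cpsl (-1) x \<noteq> 0" using cps_minus_one(1)[OF elim(2)] by linarith
  then have "J (w x) = 0" using elim(1) mult_eq_0_iff by blast
  then show ?case by (simp add: J_def trunc_pow_def max_def split: if_splits)
 qed
qed

section \<open>The system and its a priori bounds\<close>

definition wt :: "real^2 => real => real^2 => real" where "wt x0 \<beta> y = norm (y - x0) powr (2 * \<beta>)"
definition rhs :: "real^2 => real => (real^2 => real) => (real^2 => real) => real^2 => real" where
 "rhs x0 \<beta> P v y = wt x0 \<beta> y * P y * exp (v y)"

text \<open>The data alone. Constants defined in this locale cannot depend on the potentials or the
  solution, as the order of quantifiers in the theorem demands.\<close>

locale le_params =
 fixes x0 :: "real^2" and \<beta> a b c d :: real
 assumes x0: "norm x0 = 1/2" and \<beta>: "\<beta> > -1/2" and pos: "a > 0" "b > 0" "c > 0" "d > 0"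
begin

lemma x0_dist: "y \<in> annulus ==> 0 < norm (y - x0)" "y \<in> annulus ==> norm (y - x0) < 2"
 using annulus_neq_boundary[OF _ x0] annulus_dist_less_2[of y x0] x0 by auto

lemma wt_pos: "y \<in> annulus ==> 0 < wt x0 \<beta> y"
 using x0_dist(1) by (auto simp: wt_def)

lemma dist_measurable: "(\<lambda>y. norm (y - x0)) \<in> borel_measurable annM"
 by (intro continuous_on_annM_measurable continuous_intros)

lemma wt_measurable: "wt x0 \<beta> \<in> borel_measurable annM"
 unfolding wt_def[abs_def] using dist_measurable by measurable

lemma wt_integrable: "integrable annM (wt x0 \<beta>)"
proof (cases "\<beta> >= 0")
 case True
 show ?thesis
 proof (rule integrable_annM_bounded[OF wt_measurable])
  show "norm (wt x0 \<beta> y) <= 2 powr (2 * \<beta>)" if "y \<in> annulus" for y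
   unfolding wt_def using True x0_dist[OF that] by (auto intro!: powr_mono2)
 qed
next
 case False
 then have "0 <= - (2 * \<beta>)" "- (2 * \<beta>) < 2" using \<beta> by auto
 from singular_integral_ball[OF this] x0 show ?thesis unfolding wt_def[abs_def] by auto
qed

lemma ln_wt_integrable: "integrable annM (\<lambda>y. \<bar>ln (wt x0 \<beta> y)\<bar>)"
proof -
 have "integrable annM (\<lambda>y. norm (y - x0) powr (- 1))" using singular_integral_ball[of 1] x0 by auto
 moreover have "integrable annM (\<lambda>y. 2::real)" by (rule integrable_annM_bounded) auto
 ultimately have i: "integrable annM (\<lambda>y. 2 * \<bar>\<beta>\<bar> * (norm (y - x0) powr (- 1) + 2))" by auto
 show ?thesis
 proof (rule Bochner_Integration.integrable_bound[OF i])
  show "(\<lambda>y. \<bar>ln (wt x0 \<beta> y)\<bar>) \<in> borel_measurable annM" using wt_measurable by measurable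
  show "AE y in annM. norm \<bar>ln (wt x0 \<beta> y)\<bar> <= norm (2 * \<bar>\<beta>\<bar> * (norm (y - x0) powr (- 1) + 2))"
   using AE_annM_in
  proof eventually_elim
   case (elim y)
   note r = x0_dist[OF elim]
   have "ln (norm (y - x0)) <= 2" using ln_le_minus_one[OF r(1)] r by linarith
   moreover have "- ln (norm (y - x0)) <= norm (y - x0) powr (- 1)"
    using ln_le_minus_one[of "inverse (norm (y - x0))"] r by (simp add: ln_inverse powr_minus)
   ultimately have l: "\<bar>ln (norm (y - x0))\<bar> <= norm (y - x0) powr (- 1) + 2" using powr_ge_zero[of "norm (y - x0)" "-1"] by linarith
   have "\<bar>ln (wt x0 \<beta> y)\<bar> = 2 * \<bar>\<beta>\<bar> * \<bar>ln (norm (y - x0))\<bar>" using r(1) by (simp add: wt_def ln_powr abs_mult)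
   also have "... <= 2 * \<bar>\<beta>\<bar> * (norm (y - x0) powr (- 1) + 2)" by (intro mult_left_mono l) simp
   finally have "\<bar>ln (wt x0 \<beta> y)\<bar> <= 2 * \<bar>\<beta>\<bar> * (norm (y - x0) powr (- 1) + 2)" .
   then show ?case unfolding real_norm_def abs_idempotent by (rule order_trans[OF _ abs_ge_self])
  qed
 qed
qed

text \<open>The factor 648 is \<open>4 * 162\<close>: the test function \<open>cps 3\<close> is at
  most 4, and 162 comes from its Laplacian.\<close>

definition log_bound :: "real^2 => real" where
 "log_bound y = 648 * (\<bar>ln (324 / a)\<bar> + \<bar>ln (324 / c)\<bar> + 2 * \<bar>ln (wt x0 \<beta> y)\<bar>)"

definition I1 :: real where "I1 = (LINT y|annM. log_bound y)"

lemma log_bound_integrable: "integrable annM log_bound"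
proof -
 have "integrable annM (\<lambda>y. k :: real)" for k by (rule integrable_annM_bounded) auto
 then show ?thesis unfolding log_bound_def[abs_def] using ln_wt_integrable by auto
qed

lemma I1_nonneg: "0 <= I1"
 unfolding I1_def by (rule integral_nonneg_AE, rule AE_I2) (simp add: log_bound_def)

end

text \<open>The system for regular representatives. Its assumptions are symmetric under exchange of
  the two equations, so each fact about \<open>u\<close> yields one about \<open>v\<close> through
  \<open>swapped\<close>. \<open>GP\<close> and \<open>GQ\<close> are the weak gradients of the
  coefficients.\<close>

locale le_system = le_params +
 fixes P Q :: "real^2 => real" and GP GQ :: "real^2 => real^2" and u v :: "real^2 => real" and Cu Cv Cp Cq :: real
 assumes P: "P \<in> borel_measurable annM" "\<And>y. y \<in> annulus ==> a <= P y" "\<And>y. y \<in> annulus ==> P y <= b"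
  and Q: "Q \<in> borel_measurable annM" "\<And>y. y \<in> annulus ==> c <= Q y" "\<And>y. y \<in> annulus ==> Q y <= d"
  and GP: "integrable annM GP" "AE y in annM. norm (GP y) <= (\<beta> + 1) * a / 2"
   "\<And>\<phi> i. test_function annulus \<phi> ==> i \<in> Basis ==> (LINT x|annM. P x * partial_deriv i \<phi> x) = - (LINT x|annM. (GP x \<bullet> i) * \<phi> x)"
  and GQ: "integrable annM GQ" "AE y in annM. norm (GQ y) <= (\<beta> + 1) * c / 2"
   "\<And>\<phi> i. test_function annulus \<phi> ==> i \<in> Basis ==> (LINT x|annM. Q x * partial_deriv i \<phi> x) = - (LINT x|annM. (GQ x \<bullet> i) * \<phi> x)"
  and u: "C1_limit u (sol_grad u (rhs x0 \<beta> P v)) Cu" "weak_sol (sol_grad u (rhs x0 \<beta> P v)) (rhs x0 \<beta> P v)"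
  and v: "C1_limit v (sol_grad v (rhs x0 \<beta> Q u)) Cv" "weak_sol (sol_grad v (rhs x0 \<beta> Q u)) (rhs x0 \<beta> Q u)"
  and pot: "\<And>x. x \<in> annulus ==> integrable annM (\<lambda>y. rhs x0 \<beta> P v y * norm (y - x) powr (- 1))"
   "\<And>x. x \<in> annulus ==> (LINT y|annM. rhs x0 \<beta> P v y * norm (y - x) powr (- 1)) <= Cp"
   "\<And>x. x \<in> annulus ==> integrable annM (\<lambda>y. rhs x0 \<beta> Q u y * norm (y - x) powr (- 1))"
   "\<And>x. x \<in> annulus ==> (LINT y|annM. rhs x0 \<beta> Q u y * norm (y - x) powr (- 1)) <= Cq"
begin

abbreviation "\<rho> \<equiv> wt x0 \<beta>"
abbreviation "F \<equiv> rhs x0 \<beta> P v"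
abbreviation "G \<equiv> rhs x0 \<beta> Q u"

lemma swapped: "le_system x0 \<beta> c d a b Q P GQ GP v u Cv Cu Cq Cp"
 using x0 \<beta> pos P Q GP GQ u v pot by unfold_locales

lemma expu_integrable: "integrable annM (\<lambda>y. \<rho> y * exp (u y))"
 by (rule integrable_annM_bounded_mult[OF wt_integrable, of _ "exp Cu"])
  (use C1_limit_facts(3,5)[OF u(1)] in \<open>auto simp: abs_le_iff\<close>)

lemma G_integrable: "integrable annM G"
proof -
 have "\<bar>Q y\<bar> <= d" if "y \<in> annulus" for y using Q(2,3)[OF that] pos by simp
 from integrable_annM_bounded_mult[OF expu_integrable Q(1) this] show ?thesis
  unfolding rhs_def[abs_def] by (simp add: mult_ac)
qed

lemma G_bounds:
 assumes y: "y \<in> annulus"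
 shows "0 <= G y" "c * (\<rho> y * exp (u y)) <= G y" "G y <= d * (\<rho> y * exp (u y))"
proof -
 have 0: "0 <= \<rho> y * exp (u y)" using wt_pos[OF y] by simp
 have e: "G y = Q y * (\<rho> y * exp (u y))" by (simp add: rhs_def)
 show "c * (\<rho> y * exp (u y)) <= G y" "G y <= d * (\<rho> y * exp (u y))"
  unfolding e using Q(2,3)[OF y] 0 by (auto intro!: mult_right_mono)
 then show "0 <= G y" using 0 pos(3) mult_nonneg_nonneg[of c] by (meson less_imp_le order_trans)
qed

lemmas F_integrable = le_system.G_integrable[OF swapped]
 and F_bounds = le_system.G_bounds[OF swapped]
 and expv_integrable = le_system.expu_integrable[OF swapped]

lemma weak_sol_neg: "weak_sol D f ==> weak_sol (\<lambda>x. - D x) (\<lambda>x. - f x)"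
 unfolding weak_sol_def by (intro allI impI) (simp, blast)

lemma u_nonneg: "AE x in annM. 0 <= u x"
proof -
 have "C1_limit (\<lambda>x. - u x) (\<lambda>x. (- 1) *\<^sub>R sol_grad u F x) (1 * Cu)"
  by (rule C1_limit_compose[OF u(1)]) (auto intro!: derivative_eq_intros)
 then have w: "C1_limit (\<lambda>x. - u x) (\<lambda>x. - sol_grad u F x) (1 * Cu)" by simp
 have "AE x in annM. - u x <= 0"
  by (rule max_principle[OF w weak_sol_neg[OF u(2)]]) (use F_bounds(1) in auto)
 then show ?thesis by simp
qed

definition (in le_params) k1 :: real where "k1 = max 0 (ln (b / c))"

text \<open>Where \<open>u - v\<close> exceeds \<open>k1\<close>, the inequality
  \<open>b * exp (v x) \<le> c * exp (u x)\<close> gives \<open>F \<le> G\<close>. The difference is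
  thus subharmonic above the level \<open>k1\<close>, and the maximum principle applies.\<close>

lemma u_le_v: "AE x in annM. u x - v x <= k1"
proof (rule max_principle[OF C1_limit_diff[OF u(1) v(1)]])
 show "weak_sol (\<lambda>x. sol_grad u F x - sol_grad v G x) (\<lambda>x. F x - G x)"
  unfolding weak_sol_def
 proof (intro allI impI)
  fix \<Phi> E C assume \<Phi>: "C1_limit \<Phi> E C"
  have "(LINT x|annM. F x * \<Phi> x) = (LINT x|annM. sol_grad u F x \<bullet> E x)" "(LINT x|annM. G x * \<Phi> x) = (LINT x|annM. sol_grad v G x \<bullet> E x)"
   using u(2) v(2) \<Phi> unfolding weak_sol_def by blast+
  then show "(LINT x|annM. (F x - G x) * \<Phi> x) = (LINT x|annM. (sol_grad u F x - sol_grad v G x) \<bullet> E x)"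
   using C1_limit_mult_integrable[OF \<Phi> F_integrable] C1_limit_mult_integrable[OF \<Phi> G_integrable]
    C1_limit_inner_integrable[OF \<Phi> integrable_annM_bounded[OF C1_limit_facts(6,4)[OF u(1)]]]
    C1_limit_inner_integrable[OF \<Phi> integrable_annM_bounded[OF C1_limit_facts(6,4)[OF v(1)]]]
   by (simp add: left_diff_distrib inner_diff_left)
 qed
 show "k1 >= 0" by (simp add: k1_def)
 show "AE x in annM. k1 < u x - v x \<longrightarrow> F x - G x <= 0"
 proof (rule AE_I2, rule impI)
  fix x assume "x \<in> space annM" and k: "k1 < u x - v x"
  then have x: "x \<in> annulus" by simp
  have "b / c <= exp k1" using pos by (simp add: k1_def max_def ln_ge_iff)
  also have "... <= exp (u x - v x)" using k by simp
  finally have "b * exp (v x) <= c * exp (u x)" using pos by (simp add: exp_diff field_simps)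
  then have "\<rho> x * (b * exp (v x)) <= \<rho> x * (c * exp (u x))" using wt_pos[OF x] by (intro mult_left_mono) auto
  then show "F x - G x <= 0" using F_bounds(3)[OF x] G_bounds(2)[OF x] by (simp add: mult_ac)
 qed
qed

text \<open>This comparison later turns the mixed form in \<open>G\<close> and \<open>F\<close> into
  a quadratic form in \<open>G\<close>.\<close>

lemma F_ge_G: "AE x in annM. (a * exp (- k1) / d) * G x <= F x"
 using u_le_v AE_annM_in
proof eventually_elim
 case (elim x)
 note x = elim(2)
 have "(a * exp (- k1) / d) * G x <= (a * exp (- k1) / d) * (d * (\<rho> x * exp (u x)))"
  using G_bounds(3)[OF x] pos by (intro mult_left_mono) auto
 also have "... = a * (\<rho> x * exp (u x - k1))" using pos by (simp add: exp_diff exp_minus field_simps)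
 also have "... <= a * (\<rho> x * exp (v x))" using elim wt_pos[OF x] pos by (intro mult_left_mono) auto
 also have "... <= F x" by (rule F_bounds(2)[OF x])
 finally show ?case .
qed

text \<open>The tangent of \<open>exp\<close> at \<open>ln (162 / l)\<close> with
  \<open>l = s * r / 2\<close>. The exponential term carries half the lower bound of the
  nonlinearity, so it can be absorbed; the remainder is only logarithmic in the weight, hence
  integrable.\<close>

lemma young_log: "r > 0 ==> s > 0 ==> 162 * t <= s * r / 2 * exp t + 162 * (\<bar>ln (324 / s)\<bar> + \<bar>ln r\<bar>)"
 for r s t :: real
proof -
 assume r: "r > 0" "s > 0"
 define l where "l = s * r / 2"
 have l: "l > 0" using r by (simp add: l_def)
 have "t - ln (162 / l) <= exp (t - ln (162 / l)) - 1" using exp_ge_add_one_self[of "t - ln (162 / l)"] by linarith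
 also have "exp (t - ln (162 / l)) = l / 162 * exp t" using l by (simp add: exp_diff)
 finally have "162 * t <= l * exp t + 162 * ln (162 / l)" by simp
 moreover have "ln (162 / l) = ln (324 / s) - ln r" using r by (simp add: l_def ln_div ln_mult)
 ultimately show ?thesis unfolding l_def by (simp add: abs_if split: if_splits)
qed

text \<open>Tested with \<open>cps 3\<close>, the equations bound the weighted mass by
  \<open>162 * cps 3 * (u + v)\<close>. The linear growth in \<open>u + v\<close> is beaten by half
  of the exponential mass, and the logarithmic remainder integrates to \<open>I1\<close>. The test
  function dominates \<open>collar\<close>.\<close>

lemma interior:
 shows "(LINT y|annM. \<rho> y * exp (u y) * collar y) <= 2 * I1 / c"
  "(LINT y|annM. \<rho> y * exp (v y) * collar y) <= 2 * I1 / a"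
proof -
 let ?\<psi> = "cps 3"
 have m: "?\<psi> \<in> borel_measurable annM" "collar \<in> borel_measurable annM"
  using cps_continuous(4) continuous_collar[OF continuous_on_id] by (auto intro: continuous_on_annM_measurable)
 have b: "\<bar>?\<psi> y\<bar> <= 4" "\<bar>collar y\<bar> <= 1" "0 < collar y" if "y \<in> annulus" for y
  using cps_three(2,3)[OF that] that collar_le[OF that] annulus_collar[of y] by auto
 note bm = integrable_annM_bounded_mult[OF _ m(1) b(1)] and bc = integrable_annM_bounded_mult[OF _ m(2) b(2)]
 note iU = bm[OF expu_integrable] and iV = bm[OF expv_integrable] and iF = bm[OF F_integrable] and iG = bm[OF G_integrable]
 note iu = divergence_cps(1)[OF u(1), of 3] and iv = divergence_cps(1)[OF v(1), of 3]
 let ?eu = "\<lambda>y. \<rho> y * exp (u y) * ?\<psi> y" and ?ev = "\<lambda>y. \<rho> y * exp (v y) * ?\<psi> y"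
 have "(LINT y|annM. F y * ?\<psi> y + G y * ?\<psi> y) = (LINT y|annM. - (cpsl 3 y * u y) - cpsl 3 y * v y)"
  using weak_sol_cps[OF u(1,2), of 3] weak_sol_cps[OF v(1,2), of 3] iF iG iu iv by simp
 moreover have "(LINT y|annM. a * ?ev y + c * ?eu y) <= (LINT y|annM. F y * ?\<psi> y + G y * ?\<psi> y)"
 proof (rule integral_mono)
  fix y assume "y \<in> space annM"
  then have y: "y \<in> annulus" by simp
  have p: "0 <= ?\<psi> y" using cps_three(2)[OF y] b(3)[OF y] by linarith
  show "a * ?ev y + c * ?eu y <= F y * ?\<psi> y + G y * ?\<psi> y"
   using mult_right_mono[OF F_bounds(2)[OF y] p] mult_right_mono[OF G_bounds(2)[OF y] p] by (simp add: mult_ac)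
 qed (use iU iV iF iG in auto)
 moreover have "(LINT y|annM. - (cpsl 3 y * u y) - cpsl 3 y * v y) <= (LINT y|annM. (a / 2 * ?ev y + c / 2 * ?eu y) + log_bound y)"
 proof (rule integral_mono_AE)
  show "AE y in annM. - (cpsl 3 y * u y) - cpsl 3 y * v y <= (a / 2 * ?ev y + c / 2 * ?eu y) + log_bound y"
   using u_nonneg le_system.u_nonneg[OF swapped] AE_annM_in
  proof eventually_elim
   case (elim y)
   note y = elim(3)
   have p: "0 <= ?\<psi> y" using cps_three(2)[OF y] b(3)[OF y] by linarith
   note r = wt_pos[OF y]
   have "- (cpsl 3 y * u y) - cpsl 3 y * v y = - cpsl 3 y * (u y + v y)" by (simp add: algebra_simps)
   also have "... <= (162 * ?\<psi> y) * (u y + v y)" using cps_three(1)[OF y] elim by (intro mult_right_mono) auto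
   also have "... = ?\<psi> y * (162 * v y + 162 * u y)" by (simp add: algebra_simps)
   also have "... <= ?\<psi> y * ((a * \<rho> y / 2 * exp (v y) + 162 * (\<bar>ln (324 / a)\<bar> + \<bar>ln (\<rho> y)\<bar>))
     + (c * \<rho> y / 2 * exp (u y) + 162 * (\<bar>ln (324 / c)\<bar> + \<bar>ln (\<rho> y)\<bar>)))"
    by (intro mult_left_mono add_mono young_log r pos p)
   also have "... = (a / 2 * ?ev y + c / 2 * ?eu y) + ?\<psi> y * (162 * (\<bar>ln (324 / a)\<bar> + \<bar>ln (324 / c)\<bar> + 2 * \<bar>ln (\<rho> y)\<bar>))"
    by (simp add: algebra_simps)
   also have "?\<psi> y * (162 * (\<bar>ln (324 / a)\<bar> + \<bar>ln (324 / c)\<bar> + 2 * \<bar>ln (\<rho> y)\<bar>))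
     <= 4 * (162 * (\<bar>ln (324 / a)\<bar> + \<bar>ln (324 / c)\<bar> + 2 * \<bar>ln (\<rho> y)\<bar>))"
    using cps_three(3)[OF y] by (intro mult_right_mono) auto
   also have "... = log_bound y" by (simp add: log_bound_def)
   finally show ?case by simp
  qed
 qed (use iu iv iU iV log_bound_integrable in auto)
 ultimately have "a * (LINT y|annM. ?ev y) + c * (LINT y|annM. ?eu y) <= a / 2 * (LINT y|annM. ?ev y) + c / 2 * (LINT y|annM. ?eu y) + I1"
  unfolding I1_def using iU iV log_bound_integrable by simp
 then have s: "a * (LINT y|annM. ?ev y) + c * (LINT y|annM. ?eu y) <= 2 * I1" by simp
 have le: "(LINT y|annM. \<rho> y * exp (w y) * collar y) <= (LINT y|annM. \<rho> y * exp (w y) * ?\<psi> y)"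
  "0 <= (LINT y|annM. \<rho> y * exp (w y) * ?\<psi> y)"
  if i: "integrable annM (\<lambda>y. \<rho> y * exp (w y))" for w
 proof -
  show "(LINT y|annM. \<rho> y * exp (w y) * collar y) <= (LINT y|annM. \<rho> y * exp (w y) * ?\<psi> y)"
   by (rule integral_mono[OF bc[OF i] bm[OF i]]) (use cps_three(2) wt_pos in \<open>auto intro!: mult_left_mono less_imp_le\<close>)
  show "0 <= (LINT y|annM. \<rho> y * exp (w y) * ?\<psi> y)"
   by (rule integral_nonneg_AE, rule AE_I2) (use cps_three(2) wt_pos b(3) in \<open>force intro!: mult_nonneg_nonneg intro: order_trans less_imp_le\<close>)
 qed
 note lu = le[OF expu_integrable] and lv = le[OF expv_integrable]
 have "c * (LINT y|annM. ?eu y) <= 2 * I1" "a * (LINT y|annM. ?ev y) <= 2 * I1"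
  using s mult_nonneg_nonneg[OF less_imp_le[OF pos(1)] lv(2)] mult_nonneg_nonneg[OF less_imp_le[OF pos(3)] lu(2)] by linarith+
 then have "(LINT y|annM. ?eu y) <= 2 * I1 / c" "(LINT y|annM. ?ev y) <= 2 * I1 / a"
  using pos by (simp_all add: field_simps)
 with lu(1) lv(1) show "(LINT y|annM. \<rho> y * exp (u y) * collar y) <= 2 * I1 / c"
  "(LINT y|annM. \<rho> y * exp (v y) * collar y) <= 2 * I1 / a" by (meson order_trans)+
qed

lemma collar_G: "integrable annM (\<lambda>y. G y * collar y)" "(LINT y|annM. G y * collar y) <= 2 * I1 * d / c"
 "integrable annM (\<lambda>y. F y * collar y)" "(LINT y|annM. F y * collar y) <= 2 * I1 * b / a"
proof -
 have m: "collar \<in> borel_measurable annM" by (intro continuous_on_annM_measurable continuous_intros)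
 have b: "\<bar>collar y\<bar> <= 1" "0 < collar y" if "y \<in> annulus" for y
  using that collar_le[OF that] annulus_collar[of y] by auto
 note bc = integrable_annM_bounded_mult[OF _ m b(1)]
 show iG: "integrable annM (\<lambda>y. G y * collar y)" by (rule bc[OF G_integrable])
 show iF: "integrable annM (\<lambda>y. F y * collar y)" by (rule bc[OF F_integrable])
 have "(LINT y|annM. G y * collar y) <= (LINT y|annM. d * (\<rho> y * exp (u y) * collar y))"
  by (rule integral_mono[OF iG integrable_mult_right[OF bc[OF expu_integrable]]])
   (use G_bounds(3) b(2) in \<open>auto simp: mult.assoc[symmetric] intro!: mult_right_mono less_imp_le\<close>)
 also have "... = d * (LINT y|annM. \<rho> y * exp (u y) * collar y)" by (rule integral_mult_right_zero)
 also have "... <= d * (2 * I1 / c)" using interior(1) pos by (intro mult_left_mono) auto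
 finally show "(LINT y|annM. G y * collar y) <= 2 * I1 * d / c" by (simp add: mult_ac)
 have "(LINT y|annM. F y * collar y) <= (LINT y|annM. b * (\<rho> y * exp (v y) * collar y))"
  by (rule integral_mono[OF iF integrable_mult_right[OF bc[OF expv_integrable]]])
   (use F_bounds(3) b(2) in \<open>auto simp: mult.assoc[symmetric] intro!: mult_right_mono less_imp_le\<close>)
 also have "... = b * (LINT y|annM. \<rho> y * exp (v y) * collar y)" by (rule integral_mult_right_zero)
 also have "... <= b * (2 * I1 / a)" using interior(2) pos by (intro mult_left_mono) auto
 finally show "(LINT y|annM. F y * collar y) <= 2 * I1 * b / a" by (simp add: mult_ac)
qed

text \<open>Testing with \<open>cps (-1)\<close>, whose Laplacian is at most -1/8, turns the
  interior mass of \<open>F\<close> into a bound for the integral of \<open>u\<close>; the factor 16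
  is 8 times 2.\<close>

lemma u_L1: "integrable annM u" "(LINT x|annM. \<bar>u x\<bar>) <= 16 * I1 * b / a"
proof -
 show iu: "integrable annM u" by (rule integrable_annM_bounded[OF C1_limit_facts(5)[OF u(1)]]) (use C1_limit_facts(3)[OF u(1)] in auto)
 let ?\<psi> = "cps (-1)"
 note i = divergence_cps(1)[OF u(1), of "-1"]
 have "(LINT x|annM. 1/8 * \<bar>u x\<bar>) <= (LINT x|annM. - (cpsl (-1) x * u x))"
 proof (rule integral_mono_AE)
  show "AE x in annM. 1/8 * \<bar>u x\<bar> <= - (cpsl (-1) x * u x)"
   using u_nonneg AE_annM_in
  proof eventually_elim
   case (elim x)
   then show ?case using mult_right_mono[OF cps_minus_one(1)[OF elim(2)] elim(1)] by simp
  qed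
 qed (use iu i in auto)
 also have "... = (LINT x|annM. F x * ?\<psi> x)" using weak_sol_cps[OF u(1,2), of "-1"] by simp
 also have "... <= (LINT x|annM. F x * collar x)"
 proof (rule integral_mono[OF _ collar_G(3)])
  obtain C where "C1_limit ?\<psi> (cpsg (-1)) C" using cps_C1_collar C1_collar_imp_limit by blast
  then show "integrable annM (\<lambda>x. F x * ?\<psi> x)" using F_integrable by (rule C1_limit_mult_integrable)
 qed (use cps_minus_one(3) F_bounds(1) in \<open>auto intro!: mult_left_mono\<close>)
 also have "... <= 2 * I1 * b / a" by (rule collar_G(4))
 finally show "(LINT x|annM. \<bar>u x\<bar>) <= 16 * I1 * b / a" by simp
qed

end

section \<open>The virial identity\<close>

context le_system
begin

text \<open>The weak gradient of \<open>Q\<close> is tested with each component of \<open>Y\<close>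
  times \<open>exp (u x) - 1\<close>. Subtracting 1 makes the exponential vanish on the boundary, so
  no boundary term arises although \<open>Y\<close> does not vanish there. Only
  \<open>collar\<close> times the derivatives of \<open>Y\<close> has to be bounded.\<close>

lemma virial_weak:
 assumes Y: "\<And>i x. i \<in> Basis ==> x \<in> annulus ==> GDERIV (\<lambda>x. Y x \<bullet> i) x :> Z i x"
   "\<And>i. i \<in> Basis ==> continuous_on annulus (Z i)"
   "\<And>i x. i \<in> Basis ==> x \<in> annulus ==> \<bar>Y x \<bullet> i\<bar> <= B"
   "\<And>i x. i \<in> Basis ==> x \<in> annulus ==> collar x * norm (Z i x) <= B"
 shows "integrable annM (\<lambda>x. Q x * exp (u x) * (Y x \<bullet> sol_grad u F x))"
  "integrable annM (\<lambda>x. (exp (u x) - 1) * (Q x * (\<Sum>i\<in>Basis. Z i x \<bullet> i) + GQ x \<bullet> Y x))"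
  "(LINT x|annM. Q x * exp (u x) * (Y x \<bullet> sol_grad u F x))
   = - (LINT x|annM. (exp (u x) - 1) * (Q x * (\<Sum>i\<in>Basis. Z i x \<bullet> i) + GQ x \<bullet> Y x))"
proof -
 let ?D = "sol_grad u F"
 let ?E = "\<lambda>i x. (Y x \<bullet> i) *\<^sub>R (exp (u x) *\<^sub>R ?D x) + (exp (u x) - 1) *\<^sub>R Z i x"
 let ?T = "\<lambda>i x. (GQ x \<bullet> i) * ((Y x \<bullet> i) * (exp (u x) - 1)) + (Q x *\<^sub>R i) \<bullet> ?E i x"
 have ex: "C1_limit (\<lambda>x. exp (u x) - 1) (\<lambda>x. exp (u x) *\<^sub>R ?D x) (exp Cu * Cu)"
  by (rule C1_limit_compose[OF u(1)]) (auto intro!: derivative_eq_intros continuous_intros)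
 have l: "C1_limit (\<lambda>x. (Y x \<bullet> i) * (exp (u x) - 1)) (?E i) (2 * B * (exp Cu * Cu))" if i: "i \<in> Basis" for i
  by (rule C1_limit_mult[OF ex Y(1)[OF i] Y(2)[OF i] Y(3)[OF i] Y(4)[OF i]])
 have Qb: "\<bar>Q x\<bar> <= d" if "x \<in> annulus" for x using Q(2,3)[OF that] pos by simp
 have int: "integrable annM (?T i)" and zero: "(LINT x|annM. ?T i x) = 0" if i: "i \<in> Basis" for i
 proof -
  have a: "integrable annM (\<lambda>x. GQ x \<bullet> i)" using GQ(1) by auto
  have "integrable annM Q" by (rule integrable_annM_bounded[OF Q(1)]) (use Qb in auto)
  then have b: "integrable annM (\<lambda>x. Q x *\<^sub>R i)" by auto
  show "(LINT x|annM. ?T i x) = 0"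
  proof (rule weak_identity_C1_limit[OF a b _ l[OF i]])
   fix \<phi> assume \<phi>: "test_function annulus \<phi>"
   have gi: "i \<bullet> grad \<phi> x = partial_deriv i \<phi> x" for x
    using gderiv_partial_deriv[OF test_function_gderiv[OF \<phi>]] by (simp add: inner_commute)
   obtain C where C: "\<And>x. \<bar>\<phi> x\<bar> <= C" "\<And>x. norm (grad \<phi> x) <= C" using test_function_bounded[OF \<phi>] by blast
   have i1: "integrable annM (\<lambda>x. (GQ x \<bullet> i) * \<phi> x)"
    by (rule integrable_annM_bounded_mult[OF a continuous_on_annM_measurable[OF test_function_continuous(1)[OF \<phi>]] C(1)])
   have pc: "partial_deriv i \<phi> \<in> borel_measurable annM"
    by (rule continuous_on_annM_measurable[OF test_function_continuous(1)[OF test_function_partial[OF \<phi> i]]])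
   have pb: "\<bar>partial_deriv i \<phi> x\<bar> <= C" for x
    using Basis_le_norm[OF i, of "grad \<phi> x"] C(2)[of x] gi[of x] by (simp add: inner_commute)
   have i2: "integrable annM (\<lambda>x. Q x * partial_deriv i \<phi> x)"
    by (rule integrable_annM_bounded_mult[OF integrable_annM_bounded[OF Q(1)] pc pb]) (use Qb in auto)
   show "(LINT x|annM. (GQ x \<bullet> i) * \<phi> x + (Q x *\<^sub>R i) \<bullet> grad \<phi> x) = 0"
    using GQ(3)[OF \<phi> i] i1 i2 by (simp add: gi)
  qed
  have "integrable annM (\<lambda>x. (GQ x \<bullet> i) * ((Y x \<bullet> i) * (exp (u x) - 1)))"
   by (rule integrable_annM_bounded_mult[OF a C1_limit_facts(5,3)[OF l[OF i]]])
  moreover have "integrable annM (\<lambda>x. (Q x *\<^sub>R i) \<bullet> ?E i x)"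
  proof -
   have mE: "?E i \<in> borel_measurable annM" by (rule C1_limit_facts(6)[OF l[OF i]])
   have mi: "(\<lambda>x. i \<bullet> ?E i x) \<in> borel_measurable annM" using borel_measurable_inner[OF borel_measurable_const mE] .
   have "\<bar>i \<bullet> ?E i x\<bar> <= 2 * B * (exp Cu * Cu)" if "x \<in> annulus" for x
    using Basis_le_norm[OF i, of "?E i x"] C1_limit_facts(4)[OF l[OF i] that] unfolding inner_commute[of i] by (rule order_trans)
   from integrable_annM_bounded_mult[OF integrable_annM_bounded[OF Q(1), of d] mi this] Qb
   show ?thesis by simp
  qed
  ultimately show "integrable annM (?T i)" by (rule Bochner_Integration.integrable_add)
 qed
 have exp: "Y x \<bullet> ?D x = (\<Sum>i\<in>Basis. (Y x \<bullet> i) * (?D x \<bullet> i))" "GQ x \<bullet> Y x = (\<Sum>i\<in>Basis. (GQ x \<bullet> i) * (Y x \<bullet> i))" for x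
  by (rule euclidean_inner)+
 let ?A = "\<lambda>x. Q x * exp (u x) * (Y x \<bullet> ?D x)" and ?R = "\<lambda>x. (exp (u x) - 1) * (Q x * (\<Sum>i\<in>Basis. Z i x \<bullet> i) + GQ x \<bullet> Y x)"
 have T: "(\<Sum>i\<in>Basis. ?T i x) = ?A x + ?R x" for x
  unfolding exp by (simp add: sum.distrib[symmetric] sum_distrib_left inner_add_right inner_commute algebra_simps)
 have i1: "integrable annM (\<lambda>x. ?A x + ?R x)" unfolding T[symmetric] by (rule Bochner_Integration.integrable_sum) (rule int)
 have z: "(LINT x|annM. ?A x + ?R x) = 0"
  unfolding T[symmetric] by (subst Bochner_Integration.integral_sum) (use int zero in auto)
 have "(\<lambda>x. Y x \<bullet> i) \<in> borel_measurable annM" if "i \<in> Basis" for i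
  using gderiv_continuous_on[OF Y(1)[OF that]] by (rule continuous_on_annM_measurable)
 note Ym = this
 have YD: "integrable annM (\<lambda>x. (Y x \<bullet> i) * (?D x \<bullet> i))" if i: "i \<in> Basis" for i
 proof (rule integrable_annM_bounded)
  show "(\<lambda>x. (Y x \<bullet> i) * (?D x \<bullet> i)) \<in> borel_measurable annM" using Ym[OF i] C1_limit_facts(6)[OF u(1)] by measurable
  fix x assume x: "x \<in> annulus"
  have "B >= 0" using Y(3)[OF i x] by linarith
  then show "norm ((Y x \<bullet> i) * (?D x \<bullet> i)) <= B * Cu"
   unfolding real_norm_def abs_mult
   by (intro mult_mono Y(3)[OF i x] order_trans[OF Basis_le_norm[OF i] C1_limit_facts(4)[OF u(1) x]]) auto
 qed
 have "\<bar>Q x * exp (u x)\<bar> <= d * exp Cu" if x: "x \<in> annulus" for x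
  unfolding abs_mult using Qb[OF x] C1_limit_facts(3)[OF u(1) x] pos by (intro mult_mono) auto
 then have "integrable annM (\<lambda>x. (Y x \<bullet> ?D x) * (Q x * exp (u x)))"
  using Q(1) C1_limit_facts(5)[OF u(1)] unfolding exp(1)
  by (intro integrable_annM_bounded_mult[where C="d * exp Cu"] Bochner_Integration.integrable_sum YD) auto
 then show iA: "integrable annM ?A" by (simp add: mult_ac)
 show iR: "integrable annM ?R" using Bochner_Integration.integrable_diff[OF i1 iA] by simp
 show "(LINT x|annM. ?A x) = - (LINT x|annM. ?R x)" using z unfolding Bochner_Integration.integral_add[OF iA iR] by linarith
qed

end

text \<open>One locale for both collars: centre \<open>x0\<close> and sign 1 at the inner circle,
  centre 0 and sign -1 at the outer one. The condition \<open>e_dist\<close> bounds the field by the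
  distance to \<open>x0\<close>; the weighted field is then of order
  \<open>norm (x - x0) powr (2 * \<beta> + 1)\<close>, which is bounded for
  \<open>\<beta> > -1/2\<close>.\<close>

locale le_field = le_params +
 fixes s :: real and x1 :: "real^2" and e e' :: "real => real"
 assumes e: "\<And>t. (e has_real_derivative e' t) (at t)" "continuous_on UNIV e'" "\<And>t. 0 <= e t" "\<And>t. e t <= 1" "\<And>t. \<bar>e' t\<bar> <= 32"
  and s: "\<bar>s\<bar> = 1" and x1: "norm x1 <= 1/2"
  and e_dist: "\<And>x. x \<in> annulus ==> e (x \<bullet> x) * norm (x - x1) <= 3 * norm (x - x0)"
begin

definition X :: "real^2 => real^2" where "X x = (s * e (x \<bullet> x)) *\<^sub>R (x - x1)"

text \<open>The divergence of the weighted field \<open>wt * X\<close>. For \<open>x1 = x0\<close>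
  the last summand reduces to \<open>2 * \<beta> * e\<close>, the Euler relation for the homogeneous
  weight.\<close>

definition divY :: "real^2 => real" where
 "divY x = wt x0 \<beta> x * s * (2 * e (x \<bullet> x) + 2 * e' (x \<bullet> x) * (x \<bullet> (x - x1))
   + 2 * \<beta> * e (x \<bullet> x) * ((x - x0) \<bullet> (x - x1)) / (norm (x - x0))\<^sup>2)"

definition gradY :: "real^2 => real^2 => real^2" where
 "gradY i x = (wt x0 \<beta> x * s) *\<^sub>R (e (x \<bullet> x) *\<^sub>R i + (2 * e' (x \<bullet> x) * ((x - x1) \<bullet> i)) *\<^sub>R x
   + (2 * \<beta> * e (x \<bullet> x) * ((x - x1) \<bullet> i) / (norm (x - x0))\<^sup>2) *\<^sub>R (x - x0))"

lemma x1_dist: "x \<in> annulus ==> norm (x - x1) <= 3/2"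
 using annulus_norm[of x] x1 norm_triangle_ineq4[of x x1] by simp

lemma X_norm: "x \<in> annulus ==> norm (X x) <= e (x \<bullet> x) * (3/2)"
 unfolding X_def norm_scaleR abs_mult s
 using mult_left_mono[OF x1_dist[of x] e(3)[of "x \<bullet> x"]] e(3)[of "x \<bullet> x"] by simp

lemma X_lipschitz:
 assumes x: "x \<in> annulus" and y: "y \<in> annulus"
 shows "norm (X x - X y) <= 97 * norm (x - y)"
proof -
 have "norm (e (x \<bullet> x) - e (y \<bullet> y)) <= 32 * norm (x \<bullet> x - y \<bullet> y)"
  by (rule field_differentiable_bound[of UNIV e e']) (use e in auto)
 also have "x \<bullet> x - y \<bullet> y = (x - y) \<bullet> (x + y)" by (simp add: inner_diff_left inner_diff_right inner_add_right inner_commute)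
 also have "norm ... <= norm (x - y) * 2"
 proof -
  have "norm (x + y) <= 2" using norm_triangle_ineq[of x y] annulus_norm[OF x] annulus_norm[OF y] by linarith
  then show ?thesis using Cauchy_Schwarz_ineq2[of "x - y" "x + y"] mult_left_mono[of "norm (x + y)" 2 "norm (x - y)"] by simp
 qed
 finally have d: "\<bar>e (x \<bullet> x) - e (y \<bullet> y)\<bar> <= 64 * norm (x - y)" by simp
 have "X x - X y = s *\<^sub>R (e (x \<bullet> x) *\<^sub>R (x - y) + (e (x \<bullet> x) - e (y \<bullet> y)) *\<^sub>R (y - x1))"
  unfolding X_def by (simp add: algebra_simps)
 then have "norm (X x - X y) = norm (e (x \<bullet> x) *\<^sub>R (x - y) + (e (x \<bullet> x) - e (y \<bullet> y)) *\<^sub>R (y - x1))"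
  using s by simp
 also have "... <= e (x \<bullet> x) * norm (x - y) + \<bar>e (x \<bullet> x) - e (y \<bullet> y)\<bar> * norm (y - x1)"
  by (rule norm_triangle_le) (use e(3) in simp)
 \<comment> \<open>Here 64 is the bound 32 for \<open>e'\<close> times
   \<open>norm (x + y) \<le> 2\<close>, and 3/2 bounds the distance to the centre; in total
   97.\<close>
 also have "... <= 1 * norm (x - y) + (64 * norm (x - y)) * (3/2)"
  by (intro add_mono mult_mono e d x1_dist y) auto
 finally show ?thesis by simp
qed

lemma continuous_e: "continuous_on A f ==> continuous_on A (\<lambda>x. e (f x))" "continuous_on A f ==> continuous_on A (\<lambda>x. e' (f x))"
proof -
 have "continuous_on UNIV e" by (rule DERIV_continuous_on[OF e(1)])
 then show "continuous_on A f ==> continuous_on A (\<lambda>x. e (f x))" by (rule continuous_on_compose2) auto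
 show "continuous_on A f ==> continuous_on A (\<lambda>x. e' (f x))" by (rule continuous_on_compose2[OF e(2)]) auto
qed

lemma wt_gderiv:
 assumes "x \<noteq> x0"
 shows "GDERIV (wt x0 \<beta>) x :> (2 * \<beta> * wt x0 \<beta> x / (norm (x - x0))\<^sup>2) *\<^sub>R (x - x0)"
proof -
 have n: "norm (x - x0) > 0" using assms by simp
 have d: "((\<lambda>t. t powr \<beta>) has_real_derivative \<beta> * ((x - x0) \<bullet> (x - x0)) powr (\<beta> - 1)) (at ((x - x0) \<bullet> (x - x0)))"
  using n by (intro has_real_derivative_powr) (simp add: power2_norm_eq_inner[symmetric])
 have "GDERIV (\<lambda>x. (x - x0) \<bullet> (x - x0)) x :> 2 *\<^sub>R (x - x0)"
  by (auto simp: gderiv_def inner_commute inner_diff algebra_simps intro!: derivative_eq_intros)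
 from GDERIV_DERIV_compose[OF this d]
 have g: "GDERIV (\<lambda>x. ((x - x0) \<bullet> (x - x0)) powr \<beta>) x :> (2 * \<beta> * ((x - x0) \<bullet> (x - x0)) powr (\<beta> - 1)) *\<^sub>R (x - x0)"
  by (simp add: mult_ac)
 have w: "((y - x0) \<bullet> (y - x0)) powr b = norm (y - x0) powr (2 * b)" for y b
 proof (cases "y = x0")
  case False
  then have "(norm (y - x0))\<^sup>2 = norm (y - x0) powr 2" by (simp add: powr_numeral)
  then show ?thesis unfolding power2_norm_eq_inner[symmetric] by (simp only: powr_powr)
 qed simp
 have "norm (x - x0) powr (2 * (\<beta> - 1)) = wt x0 \<beta> x / (norm (x - x0))\<^sup>2"
  unfolding wt_def right_diff_distrib powr_diff using n by simp
 then show ?thesis using g unfolding w wt_def[abs_def] by simp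
qed

lemma Y_gderiv:
 assumes x: "x \<in> annulus"
 shows "GDERIV (\<lambda>x. (wt x0 \<beta> x *\<^sub>R X x) \<bullet> i) x :> gradY i x"
proof -
 have "x \<noteq> x0" using x0_dist(1)[OF x] by auto
 note w = wt_gderiv[OF this]
 have l: "GDERIV (\<lambda>x. s * ((x - x1) \<bullet> i)) x :> s *\<^sub>R i"
  by (auto simp: gderiv_def inner_commute inner_diff algebra_simps intro!: derivative_eq_intros)
 have q: "(\<lambda>x. (wt x0 \<beta> x *\<^sub>R X x) \<bullet> i) = (\<lambda>x. wt x0 \<beta> x * (e (x \<bullet> x) * (s * ((x - x1) \<bullet> i))))"
  by (simp add: X_def mult_ac)
 show ?thesis
  using GDERIV_mult[OF w GDERIV_mult[OF GDERIV_radial[OF e(1)] l]]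
  unfolding q gradY_def by (simp add: algebra_simps add_divide_distrib diff_divide_distrib)
qed

lemma gradY_continuous: "continuous_on annulus (gradY i)"
proof -
 have "continuous_on annulus (wt x0 \<beta>)"
  by (rule gderiv_continuous_on[OF wt_gderiv]) (use x0_dist(1) in auto)
 then show ?thesis
  unfolding gradY_def[abs_def] using x0_dist(1) by (auto intro!: continuous_intros continuous_e)
qed

lemma sum_gradY: "(\<Sum>i\<in>Basis. gradY i x \<bullet> i) = divY x"
proof -
 have "(\<Sum>i\<in>Basis. gradY i x \<bullet> i) = wt x0 \<beta> x * s * ((\<Sum>i\<in>(Basis::(real^2) set). e (x \<bullet> x)) + 2 * e' (x \<bullet> x) * (\<Sum>i\<in>Basis. (x \<bullet> i) * ((x - x1) \<bullet> i))
   + 2 * \<beta> * e (x \<bullet> x) / (norm (x - x0))\<^sup>2 * (\<Sum>i\<in>Basis. ((x - x0) \<bullet> i) * ((x - x1) \<bullet> i)))"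
  unfolding gradY_def sum_distrib_left sum.distrib[symmetric]
  by (rule sum.cong[OF refl]) (simp add: inner_add_left inner_Basis algebra_simps add_divide_distrib diff_divide_distrib)
 then show ?thesis unfolding divY_def euclidean_inner[symmetric] by simp
qed

text \<open>The bracket \<open>97 + 6 * \<bar>\<beta>\<bar>\<close> bounds the three terms of
  \<open>gradY\<close>: 1 from the identity part, 96 from the cutoff, and the rest from the weight.
  The factor 2 is that of \<open>collar_dist\<close>.\<close>

definition YB :: real where "YB = 2 powr (2 * \<beta> + 1) * (2 * (97 + 6 * \<bar>\<beta>\<bar>))"

lemma wt_dist:
 assumes x: "x \<in> annulus"
 shows "wt x0 \<beta> x * norm (x - x0) <= 2 powr (2 * \<beta> + 1)"
proof -
 have "wt x0 \<beta> x * norm (x - x0) = norm (x - x0) powr (2 * \<beta> + 1)"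
  using x0_dist(1)[OF x] by (simp add: wt_def powr_add)
 also have "... <= 2 powr (2 * \<beta> + 1)" using x0_dist[OF x] \<beta> by (intro powr_mono2) auto
 finally show ?thesis .
qed

lemma collar_dist:
 assumes x: "x \<in> annulus"
 shows "collar x <= 2 * norm (x - x0)"
proof -
 have n: "1/2 < norm x" "norm x < 1" using x by (auto simp: annulus_def)
 have "collar x <= 1 * (x \<bullet> x - 1/4)" unfolding collar_def using x by (intro mult_right_mono) (auto simp: annulus_iff)
 also have "... = (norm x - 1/2) * (norm x + 1/2)" by (simp add: power2_norm_eq_inner[symmetric] power2_eq_square algebra_simps)
 also have "... <= norm (x - x0) * 2" using n norm_triangle_ineq2[of x x0] x0 by (intro mult_mono) auto
 finally show ?thesis by simp
qed

text \<open>Differentiating the weight loses one power of the distance to \<open>x0\<close>;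
  \<open>collar\<close>, at most twice this distance, gives it back.\<close>

lemma Y_bounds:
 assumes x: "x \<in> annulus" and i: "i \<in> Basis"
 shows "\<bar>(wt x0 \<beta> x *\<^sub>R X x) \<bullet> i\<bar> <= YB" "collar x * norm (gradY i x) <= YB"
proof -
 let ?r = "norm (x - x0)" and ?h = "norm (x - x1)" and ?e = "e (x \<bullet> x)" and ?w = "wt x0 \<beta> x"
 have r: "?r > 0" by (rule x0_dist(1)[OF x])
 have w: "?w > 0" by (rule wt_pos[OF x])
 have hi: "\<bar>(x - x1) \<bullet> i\<bar> <= ?h" by (rule Basis_le_norm[OF i])
 have "\<bar>(?w *\<^sub>R X x) \<bullet> i\<bar> <= norm (?w *\<^sub>R X x)" by (rule Basis_le_norm[OF i])
 also have "... = ?w * (?e * ?h)" using s w e(3) by (simp add: X_def abs_mult)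
 also have "... <= ?w * (3 * ?r)" using e_dist[OF x] w by (intro mult_left_mono) auto
 also have "... = 3 * (?w * ?r)" by simp
 also have "... <= (2 * (97 + 6 * \<bar>\<beta>\<bar>)) * 2 powr (2 * \<beta> + 1)" using wt_dist[OF x] w r by (intro mult_mono) auto
 finally show "\<bar>(?w *\<^sub>R X x) \<bullet> i\<bar> <= YB" unfolding YB_def by (simp add: mult.commute)
 let ?g = "?e *\<^sub>R i + (2 * e' (x \<bullet> x) * ((x - x1) \<bullet> i)) *\<^sub>R x + (2 * \<beta> * ?e * ((x - x1) \<bullet> i) / ?r\<^sup>2) *\<^sub>R (x - x0)"
 have "norm ?g <= norm (?e *\<^sub>R i) + norm ((2 * e' (x \<bullet> x) * ((x - x1) \<bullet> i)) *\<^sub>R x) + norm ((2 * \<beta> * ?e * ((x - x1) \<bullet> i) / ?r\<^sup>2) *\<^sub>R (x - x0))"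
  by (rule norm_triangle_le[OF add_right_mono[OF norm_triangle_ineq]])
 moreover have "norm (?e *\<^sub>R i) <= 1" using e(3,4) i by simp
 moreover have "norm ((2 * e' (x \<bullet> x) * ((x - x1) \<bullet> i)) *\<^sub>R x) <= (2 * 32 * (3/2)) * 1"
  unfolding norm_scaleR abs_mult using e(5)[of "x \<bullet> x"] hi x1_dist[OF x] annulus_norm[OF x] by (intro mult_mono) auto
 moreover have "norm ((2 * \<beta> * ?e * ((x - x1) \<bullet> i) / ?r\<^sup>2) *\<^sub>R (x - x0)) <= 6 * \<bar>\<beta>\<bar>"
 proof -
  have "norm ((2 * \<beta> * ?e * ((x - x1) \<bullet> i) / ?r\<^sup>2) *\<^sub>R (x - x0)) = 2 * \<bar>\<beta>\<bar> * (?e * \<bar>(x - x1) \<bullet> i\<bar>) / ?r"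
   using r e(3)[of "x \<bullet> x"] by (simp add: abs_mult power2_eq_square)
  also have "... <= 2 * \<bar>\<beta>\<bar> * (3 * ?r) / ?r"
   using r mult_left_mono[OF hi e(3)[of "x \<bullet> x"]] e_dist[OF x] by (intro divide_right_mono mult_left_mono) auto
  also have "... = 6 * \<bar>\<beta>\<bar>" using r by simp
  finally show ?thesis .
 qed
 ultimately have "norm ?g <= 97 + 6 * \<bar>\<beta>\<bar>" by simp
 then have "norm (gradY i x) <= ?w * (97 + 6 * \<bar>\<beta>\<bar>)"
  unfolding gradY_def using s w by (simp add: abs_mult mult_left_mono)
 then have "collar x * norm (gradY i x) <= (2 * ?r) * (?w * (97 + 6 * \<bar>\<beta>\<bar>))"
  using collar_dist[OF x] w by (intro mult_mono) auto
 also have "... = (?w * ?r) * (2 * (97 + 6 * \<bar>\<beta>\<bar>))" by simp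
 also have "... <= YB" unfolding YB_def using wt_dist[OF x] by (intro mult_right_mono) auto
 finally show "collar x * norm (gradY i x) <= YB" .
qed

end

locale le_virial = le_system x0 \<beta> a b c d + le_field x0 \<beta> a b c d
 for x0 \<beta> a b c d
begin

lemma virial_u:
 shows "integrable annM (\<lambda>x. G x * (X x \<bullet> sol_grad u F x))"
  "integrable annM (\<lambda>x. (exp (u x) - 1) * (Q x * divY x + \<rho> x * (GQ x \<bullet> X x)))"
  "(LINT x|annM. G x * (X x \<bullet> sol_grad u F x)) = - (LINT x|annM. (exp (u x) - 1) * (Q x * divY x + \<rho> x * (GQ x \<bullet> X x)))"
proof -
 have e: "Q x * exp (u x) * ((\<rho> x *\<^sub>R X x) \<bullet> sol_grad u F x) = G x * (X x \<bullet> sol_grad u F x)" for x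
  by (simp add: rhs_def)
 note * = virial_weak[OF Y_gderiv gradY_continuous Y_bounds(1) Y_bounds(2), unfolded sum_gradY e inner_scaleR_right]
 show "integrable annM (\<lambda>x. G x * (X x \<bullet> sol_grad u F x))"
  "integrable annM (\<lambda>x. (exp (u x) - 1) * (Q x * divY x + \<rho> x * (GQ x \<bullet> X x)))"
  "(LINT x|annM. G x * (X x \<bullet> sol_grad u F x)) = - (LINT x|annM. (exp (u x) - 1) * (Q x * divY x + \<rho> x * (GQ x \<bullet> X x)))"
  by (rule *; assumption)+
qed

end

section \<open>Positive definite kernels and the symmetrised interaction\<close>

lemma pair_product_integral:
 fixes f g :: "real^2 => real"
 assumes f: "integrable annM f" and g: "integrable annM g"
 shows "integrable (annM \<Otimes>\<^sub>M annM) (\<lambda>(x, y). f x * g y)"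
  "(LINT (x, y)|(annM \<Otimes>\<^sub>M annM). f x * g y) = (LINT x|annM. f x) * (LINT x|annM. g x)"
proof -
 have m: "(\<lambda>z. 1::real) \<in> borel_measurable (annM \<Otimes>\<^sub>M annM)" by simp
 show i: "integrable (annM \<Otimes>\<^sub>M annM) (\<lambda>(x, y). f x * g y)"
  using integrable_pair_bounded_kernel[OF sigma_finite_annM sigma_finite_annM m f g, of 1] by simp
 show "(LINT (x, y)|(annM \<Otimes>\<^sub>M annM). f x * g y) = (LINT x|annM. f x) * (LINT x|annM. g x)"
  using annP.integral_fst'[OF i] by simp
qed

text \<open>The geometric series for \<open>1 / (1 - q x * cnj (q y))\<close> writes the form as the
  sum over \<open>n\<close> of the squared moduli of the integrals of \<open>f * c * q ^ n\<close>.
  All are nonnegative, and keeping only the real part of the one with \<open>n = 0\<close> gives the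
  bound. The uniform \<open>r < 1\<close> dominates the partial sums.\<close>

lemma positive_kernel:
 fixes q c :: "real^2 => complex"
 assumes f: "integrable annM f" and m: "q \<in> borel_measurable annM" "c \<in> borel_measurable annM"
  and c: "\<And>x. x \<in> annulus ==> norm (c x) <= B" and q: "\<And>x. x \<in> annulus ==> norm (q x) <= r" and r: "r < 1"
 shows "(LINT x|annM. f x * Re (c x))\<^sup>2 <= (LINT (x, y)|(annM \<Otimes>\<^sub>M annM). f x * (Re (c x * cnj (c y) / (1 - q x * cnj (q y))) * f y))"
  "integrable (annM \<Otimes>\<^sub>M annM) (\<lambda>(x, y). f x * (Re (c x * cnj (c y) / (1 - q x * cnj (q y))) * f y))"
proof -
 have B0: "B >= 0" and r0: "r >= 0" using c[OF annulus_nonempty] q[OF annulus_nonempty] norm_ge_zero order_trans by blast+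
 define a b where "a n x = f x * Re (c x * q x ^ n)" and "b n x = f x * Im (c x * q x ^ n)" for n x
 have cq: "norm (c x * q x ^ n) <= B * r ^ n" if "x \<in> annulus" for n x
  unfolding norm_mult norm_power using c[OF that] q[OF that] B0 by (intro mult_mono power_mono) auto
 have cq': "\<bar>Re (c x * q x ^ n)\<bar> <= B * r ^ n" "\<bar>Im (c x * q x ^ n)\<bar> <= B * r ^ n" if "x \<in> annulus" for n x
  using abs_Re_le_cmod abs_Im_le_cmod cq[OF that] by (meson order_trans)+
 have "(\<lambda>x. c x * q x ^ n) \<in> borel_measurable annM" for n using m by measurable
 then have mm: "(\<lambda>x. Re (c x * q x ^ n)) \<in> borel_measurable annM" "(\<lambda>x. Im (c x * q x ^ n)) \<in> borel_measurable annM" for n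
  by measurable
 have ia: "integrable annM (a n)" and ib: "integrable annM (b n)" for n
  unfolding a_def[abs_def] b_def[abs_def]
  by (rule integrable_annM_bounded_mult[OF f mm(1) cq'(1)], assumption, rule integrable_annM_bounded_mult[OF f mm(2) cq'(2)], assumption)
 let ?P = "annM \<Otimes>\<^sub>M annM"
 define S where "S N z = (\<Sum>n<N. a n (fst z) * a n (snd z) + b n (fst z) * b n (snd z))" for N and z :: "(real^2) \<times> (real^2)"
 have iz: "integrable ?P (\<lambda>z. a n (fst z) * a n (snd z))" "integrable ?P (\<lambda>z. b n (fst z) * b n (snd z))" for n
  using pair_product_integral(1)[OF ia[of n] ia[of n]] pair_product_integral(1)[OF ib[of n] ib[of n]] unfolding case_prod_beta' by auto
 have iS: "integrable ?P (S N)" for N unfolding S_def[abs_def] using iz by auto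
 have vS: "(LINT z|?P. S N z) = (\<Sum>n<N. (LINT x|annM. a n x)\<^sup>2 + (LINT x|annM. b n x)\<^sup>2)" for N
  unfolding S_def using iz pair_product_integral(2)[OF ia ia] pair_product_integral(2)[OF ib ib]
  by (subst Bochner_Integration.integral_sum) (auto simp: case_prod_beta' power2_eq_square)
 let ?K = "\<lambda>x y. f x * (Re (c x * cnj (c y) / (1 - q x * cnj (q y))) * f y)"
 have ab: "a n x * a n y + b n x * b n y = f x * f y * Re (c x * cnj (c y) * (q x * cnj (q y)) ^ n)" for n x y
  unfolding a_def b_def by (simp add: power_mult_distrib algebra_simps flip: complex_cnj_power)
 have Sf: "S N (x, y) = f x * f y * Re (c x * cnj (c y) * (\<Sum>n<N. (q x * cnj (q y)) ^ n))" for N x y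
  unfolding S_def by (simp add: ab sum_distrib_left)
 have qq: "norm (q x * cnj (q y)) <= r" if "x \<in> annulus" "y \<in> annulus" for x y
  unfolding norm_mult complex_mod_cnj
  using mult_mono[OF q[OF that(1)] q[OF that(2)] r0 norm_ge_zero] mult_left_le[of r r] r r0 by linarith
 have lim: "(\<lambda>N. S N (x, y)) \<longlonglongrightarrow> ?K x y" if xy: "x \<in> annulus" "y \<in> annulus" for x y
 proof -
  have "norm (q x * cnj (q y)) < 1" using qq[OF xy] r by linarith
  then have "(\<lambda>N. \<Sum>n<N. (q x * cnj (q y)) ^ n) \<longlonglongrightarrow> 1 / (1 - q x * cnj (q y))"
   using geometric_sums unfolding sums_def by blast
  then have "(\<lambda>N. f x * f y * Re (c x * cnj (c y) * (\<Sum>n<N. (q x * cnj (q y)) ^ n)))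
    \<longlonglongrightarrow> f x * f y * Re (c x * cnj (c y) * (1 / (1 - q x * cnj (q y))))" by (intro tendsto_intros)
  then show ?thesis unfolding Sf by (simp add: mult_ac)
 qed
 have bound: "norm (S N (x, y)) <= \<bar>f x\<bar> * (B * B * (1 / (1 - r)) * \<bar>f y\<bar>)" if xy: "x \<in> annulus" "y \<in> annulus" for N x y
 proof -
  have "norm (\<Sum>n<N. (q x * cnj (q y)) ^ n) <= (\<Sum>n<N. r ^ n)"
   by (rule sum_norm_le) (use qq[OF xy] in \<open>auto simp: norm_power intro: power_mono\<close>)
  also have "... <= (\<Sum>n. r ^ n)" using r0 r by (intro sum_le_suminf summable_geometric) auto
  also have "... = 1 / (1 - r)" using r0 r by (intro suminf_geometric) auto
  finally have "norm (c x * cnj (c y) * (\<Sum>n<N. (q x * cnj (q y)) ^ n)) <= B * B * (1 / (1 - r))"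
   unfolding norm_mult complex_mod_cnj using c[OF xy(1)] c[OF xy(2)] B0 by (intro mult_mono) auto
  then have "\<bar>Re (c x * cnj (c y) * (\<Sum>n<N. (q x * cnj (q y)) ^ n))\<bar> <= B * B * (1 / (1 - r))"
   using abs_Re_le_cmod order_trans by blast
  from mult_left_mono[OF this, of "\<bar>f x\<bar> * \<bar>f y\<bar>"]
  show ?thesis unfolding Sf real_norm_def abs_mult by (simp only: mult_ac mult_nonneg_nonneg abs_ge_zero)
 qed
 have fi: "integrable annM (\<lambda>x. \<bar>f x\<bar>)" using f by auto
 have W: "integrable ?P (\<lambda>z. \<bar>f (fst z)\<bar> * (B * B * (1 / (1 - r)) * \<bar>f (snd z)\<bar>))"
  using pair_product_integral(1)[OF fi integrable_mult_right[OF fi, of "B * B * (1 / (1 - r))"]] by (simp add: case_prod_beta')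
 have sp: "fst z \<in> annulus" "snd z \<in> annulus" if "z \<in> space ?P" for z using that by (auto simp: space_pair_measure)
 have limz: "(\<lambda>N. S N z) \<longlonglongrightarrow> ?K (fst z) (snd z)" if "z \<in> space ?P" for z using lim[OF sp[OF that]] by simp
 have Km: "(\<lambda>z. ?K (fst z) (snd z)) \<in> borel_measurable ?P"
  by (rule borel_measurable_LIMSEQ_metric[OF borel_measurable_integrable[OF iS] limz])
 have bz: "AE z in ?P. norm (S N z) <= \<bar>f (fst z)\<bar> * (B * B * (1 / (1 - r)) * \<bar>f (snd z)\<bar>)" for N
  by (rule AE_I2) (use bound sp in \<open>metis prod.collapse\<close>)
 have L: "AE z in ?P. (\<lambda>N. S N z) \<longlonglongrightarrow> ?K (fst z) (snd z)" by (rule AE_I2, rule limz)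
 note dc = integral_dominated_convergence[OF Km borel_measurable_integrable[OF iS] W L bz]
  integrable_dominated_convergence[OF Km borel_measurable_integrable[OF iS] W L bz]
 have conv: "(\<lambda>N. LINT z|?P. S N z) \<longlonglongrightarrow> (LINT z|?P. ?K (fst z) (snd z))" by (rule dc(1))
 have "(LINT x|annM. a 0 x)\<^sup>2 <= (LINT z|?P. ?K (fst z) (snd z))"
 proof (rule LIMSEQ_le_const[OF conv], intro exI allI impI)
  fix N :: nat assume "1 <= N"
  have "(LINT x|annM. a 0 x)\<^sup>2 <= (LINT x|annM. a 0 x)\<^sup>2 + (LINT x|annM. b 0 x)\<^sup>2" by simp
  also have "... <= (\<Sum>n<N. (LINT x|annM. a n x)\<^sup>2 + (LINT x|annM. b n x)\<^sup>2)"
   using \<open>1 <= N\<close> by (intro member_le_sum[of 0 "{..<N}" "\<lambda>n. (LINT x|annM. a n x)\<^sup>2 + (LINT x|annM. b n x)\<^sup>2"]) auto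
  finally show "(LINT x|annM. a 0 x)\<^sup>2 <= (LINT z|?P. S N z)" unfolding vS .
 qed
 then show "(LINT x|annM. f x * Re (c x))\<^sup>2 <= (LINT (x, y)|?P. ?K x y)"
  unfolding a_def case_prod_beta' by simp
 show "integrable ?P (\<lambda>(x, y). ?K x y)" using dc(2) by (simp add: case_prod_beta')
qed

lemma GGx_pair_measurable: "(\<lambda>z. GGx 0 (fst z) (snd z)) \<in> borel_measurable (annM \<Otimes>\<^sub>M annM)"
 unfolding GGx_def NN_def
 by (intro annM_pair_measurable borel_measurable_diff borel_measurable_scaleR borel_measurable_divide
   borel_measurable_continuous_onI continuous_intros)

context le_virial
begin

text \<open>The interaction kernel: the derivative along \<open>X\<close> of the parametrix in its
  first argument. It has a diagonal singularity that weakens only after symmetrisation.\<close>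

definition A :: "(real^2) \<times> (real^2) => real" where "A z = X (fst z) \<bullet> GGx 0 (fst z) (snd z)"

lemma X_continuous: "continuous_on B X"
 unfolding X_def[abs_def] by (intro continuous_intros continuous_e)

lemma A_measurable: "A \<in> borel_measurable (annM \<Otimes>\<^sub>M annM)"
 unfolding A_def[abs_def]
 by (intro borel_measurable_inner GGx_pair_measurable annM_pair_measurable borel_measurable_continuous_onI)
  (auto intro!: continuous_on_compose2[OF X_continuous] continuous_intros)

text \<open>Inserts the representation of the gradient of \<open>u\<close> into the virial integral.
  The error potential contributes at most \<open>kapC\<close> times the \<open>L^1\<close> norm of
  \<open>u\<close> times \<open>M\<close>, where \<open>M\<close> dominates the two terms of the
  derivative of \<open>pw x * kap x y\<close> along \<open>X\<close>; 3/2 bounds the field.\<close>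

lemma kernel_u:
 assumes M: "M \<in> borel_measurable annM" "\<And>x. x \<in> annulus ==> \<bar>M x\<bar> <= BM"
  "\<And>x. x \<in> annulus ==> \<bar>X x \<bullet> pwg x\<bar> + 3/2 * pw x <= M x"
 shows "integrable (annM \<Otimes>\<^sub>M annM) (\<lambda>(x, y). G x * (A (x, y) * F y))"
  "(LINT (x, y)|(annM \<Otimes>\<^sub>M annM). G x * (A (x, y) * F y))
   <= delta_mass * (LINT x|annM. G x * (X x \<bullet> sol_grad u F x)) + kapC * (LINT y|annM. \<bar>u y\<bar>) * (LINT x|annM. G x * M x)"
proof -
 let ?c = "pwC * (1 + pwC) + 2"
 have c0: "?c >= 0" using pwC(1) by simp
 have Fm: "F \<in> borel_measurable annM" using F_integrable by simp
 have Xb: "norm (X x) <= 3/2" if "x \<in> annulus" for x using X_norm[OF that] e(4)[of "x \<bullet> x"] by linarith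
 have inner: "A (x, y) * F y = X x \<bullet> (F y *\<^sub>R GGx 0 x y)" for x y by (simp add: A_def)
 have int: "integrable annM (\<lambda>y. A (x, y) * F y)" if x: "x \<in> annulus" for x
  unfolding inner by (rule integrable_inner_right) (rule GGx_potential(1)[OF Fm pot(1)[OF x] x order_refl])
 have bd: "(LINT y|annM. \<bar>A (x, y) * F y\<bar>) <= 3/2 * (?c * Cp)" if x: "x \<in> annulus" for x
 proof -
  have "(LINT y|annM. \<bar>A (x, y) * F y\<bar>) <= (LINT y|annM. 3/2 * (?c * \<bar>F y * norm (y - x) powr (- 1)\<bar>))"
  proof (rule integral_mono_AE)
   show "AE y in annM. \<bar>A (x, y) * F y\<bar> <= 3/2 * (?c * \<bar>F y * norm (y - x) powr (- 1)\<bar>)"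
    using GGx_potential(2)[OF Fm pot(1)[OF x] x order_refl]
   proof eventually_elim
    case (elim y)
    show ?case unfolding inner
     by (rule order_trans[OF Cauchy_Schwarz_ineq2]) (rule mult_mono[OF Xb[OF x] elim], auto)
   qed
  qed (intro integrable_mult_right integrable_abs int[OF x] pot(1)[OF x])+
  also have "... = 3/2 * (?c * (LINT y|annM. \<bar>F y * norm (y - x) powr (- 1)\<bar>))"
   unfolding integral_mult_right_zero ..
  also have "(LINT y|annM. \<bar>F y * norm (y - x) powr (- 1)\<bar>) = (LINT y|annM. F y * norm (y - x) powr (- 1))"
   using F_bounds(1) by (intro Bochner_Integration.integral_cong) auto
  also have "3/2 * (?c * ...) <= 3/2 * (?c * Cp)" using pot(2)[OF x] c0 by (intro mult_left_mono) auto
  finally show ?thesis .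
 qed
 show I: "integrable (annM \<Otimes>\<^sub>M annM) (\<lambda>(x, y). G x * (A (x, y) * F y))"
  by (rule integrable_pair_kernel[OF sigma_finite_annM sigma_finite_annM A_measurable G_integrable Fm int bd]) simp_all
 define R where "R x = (LINT y|annM. u y * (X x \<bullet> kkg x y))" for x
 let ?U = "LINT y|annM. \<bar>u y\<bar>"
 note dm = delta_mass_pos
 have dec: "delta_mass * (X x \<bullet> sol_grad u F x) = (LINT y|annM. A (x, y) * F y) + R x" if x: "x \<in> annulus" for x
 proof -
  have iK: "integrable annM (\<lambda>y. u y *\<^sub>R kkg x y)"
   by (rule integrable_scaleR_bounded(1)[OF u_L1(1) kkg_facts(5)[OF x] kkg_facts(2)[OF x]])
  have "delta_mass * (X x \<bullet> sol_grad u F x) = X x \<bullet> (LINT y|annM. F y *\<^sub>R GGx 0 x y) + X x \<bullet> (LINT y|annM. u y *\<^sub>R kkg x y)"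
   unfolding sol_grad_def using dm by (simp add: inner_add_right)
  also have "X x \<bullet> (LINT y|annM. F y *\<^sub>R GGx 0 x y) = (LINT y|annM. A (x, y) * F y)"
   unfolding inner by (rule integral_inner_right[OF GGx_potential(1)[OF Fm pot(1)[OF x] x order_refl], symmetric])
  also have "X x \<bullet> (LINT y|annM. u y *\<^sub>R kkg x y) = R x"
   unfolding R_def using integral_inner_right[OF iK, of "X x"] by simp
  finally show ?thesis .
 qed
 have Rb: "\<bar>R x\<bar> <= kapC * ?U * M x" if x: "x \<in> annulus" for x
 proof -
  have k: "\<bar>X x \<bullet> kkg x y\<bar> <= kapC * M x" if y: "y \<in> annulus" for y
  proof -
   have "X x \<bullet> kkg x y = kap x y * (X x \<bullet> pwg x) + pw x * (X x \<bullet> kapg x y)" by (simp add: kkg_def inner_add_right)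
   moreover have "\<bar>kap x y * (X x \<bullet> pwg x)\<bar> <= kapC * \<bar>X x \<bullet> pwg x\<bar>"
    unfolding abs_mult using kapC(2)[OF x y] by (intro mult_right_mono) auto
   moreover have "\<bar>pw x * (X x \<bullet> kapg x y)\<bar> <= pw x * (3/2 * kapC)"
   proof -
    have "\<bar>X x \<bullet> kapg x y\<bar> <= 3/2 * kapC"
     by (rule order_trans[OF Cauchy_Schwarz_ineq2]) (intro mult_mono Xb[OF x] kapC(3)[OF x y]; simp)
    then show ?thesis using pw_collar(3)[OF x] by (simp add: abs_mult mult_left_mono)
   qed
   ultimately have "\<bar>X x \<bullet> kkg x y\<bar> <= kapC * (\<bar>X x \<bullet> pwg x\<bar> + 3/2 * pw x)" by (simp add: algebra_simps)
   also have "... <= kapC * M x" using M(3)[OF x] kapC(1) by (rule mult_left_mono)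
   finally show ?thesis .
  qed
  have km: "(\<lambda>y. X x \<bullet> kkg x y) \<in> borel_measurable annM" using kkg_facts(5)[OF x] by measurable
  have i: "integrable annM (\<lambda>y. u y * (X x \<bullet> kkg x y))" by (rule integrable_annM_bounded_mult[OF u_L1(1) km k])
  have "\<bar>R x\<bar> <= (LINT y|annM. \<bar>u y * (X x \<bullet> kkg x y)\<bar>)" unfolding R_def by (rule integral_abs_bound)
  also have "... <= (LINT y|annM. kapC * M x * \<bar>u y\<bar>)"
  proof (rule integral_mono)
   show "\<bar>u y * (X x \<bullet> kkg x y)\<bar> <= kapC * M x * \<bar>u y\<bar>" if "y \<in> space annM" for y
    using mult_left_mono[OF k[of y] abs_ge_zero[of "u y"]] that by (simp add: abs_mult mult_ac)
  qed (use i u_L1(1) in auto)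
  finally show ?thesis by (simp add: mult_ac)
 qed
 have f: "integrable annM (\<lambda>x. LINT y|annM. G x * (A (x, y) * F y))"
  using annP.integrable_fst'[OF I] by simp
 have v: "(LINT x|annM. (LINT y|annM. G x * (A (x, y) * F y))) = (LINT (x, y)|(annM \<Otimes>\<^sub>M annM). G x * (A (x, y) * F y))"
  using annP.integral_fst'[OF I] by simp
 have iM: "integrable annM (\<lambda>x. kapC * ?U * (G x * M x))" by (intro integrable_mult_right integrable_annM_bounded_mult[OF G_integrable M(1,2)])
 have iX: "integrable annM (\<lambda>x. delta_mass * (G x * (X x \<bullet> sol_grad u F x)))" by (intro integrable_mult_right virial_u(1))
 have "(LINT x|annM. (LINT y|annM. G x * (A (x, y) * F y)))
   <= (LINT x|annM. delta_mass * (G x * (X x \<bullet> sol_grad u F x)) + kapC * ?U * (G x * M x))"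
 proof (rule integral_mono[OF f Bochner_Integration.integrable_add[OF iX iM]])
  fix x assume "x \<in> space annM"
  then have x: "x \<in> annulus" by simp
  have "(LINT y|annM. G x * (A (x, y) * F y)) = G x * (delta_mass * (X x \<bullet> sol_grad u F x) - R x)"
   unfolding integral_mult_right_zero dec[OF x] by simp
  also have "... <= G x * (delta_mass * (X x \<bullet> sol_grad u F x) + kapC * ?U * M x)"
   using Rb[OF x] G_bounds(1)[OF x] by (intro mult_left_mono) auto
  finally show "(LINT y|annM. G x * (A (x, y) * F y)) <= delta_mass * (G x * (X x \<bullet> sol_grad u F x)) + kapC * ?U * (G x * M x)"
   by (simp add: algebra_simps)
 qed
 also have "... = delta_mass * (LINT x|annM. G x * (X x \<bullet> sol_grad u F x)) + kapC * ?U * (LINT x|annM. G x * M x)"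
  unfolding Bochner_Integration.integral_add[OF iX iM] integral_mult_right_zero ..
 finally show "(LINT (x, y)|(annM \<Otimes>\<^sub>M annM). G x * (A (x, y) * F y)) <= ..." unfolding v .
qed

end

context le_virial
begin

lemma swapped_virial: "le_virial Q P GQ GP v u Cv Cu Cq Cp s x1 e e' x0 \<beta> c d a b"
proof -
 interpret sw: le_system x0 \<beta> c d a b Q P GQ GP v u Cv Cu Cq Cp by (rule swapped)
 show ?thesis by unfold_locales (use e s x1 e_dist in auto)
qed

text \<open>Everything that must dominate the quadratic form: the virial integrals of both
  equations, the correction for pairs of points outside the core, and the errors of the
  parametrix.\<close>

definition vrhs :: "real => (real^2 => real) => real" where
 "vrhs Ch M = delta_mass * ((LINT x|annM. G x * (X x \<bullet> sol_grad u F x)) + (LINT x|annM. F x * (X x \<bullet> sol_grad v G x)))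
   + Ch * ((LINT x|annM. G x * collar x) * (LINT x|annM. F x * collar x))
   + kapC * ((LINT x|annM. \<bar>u x\<bar>) * (LINT x|annM. G x * M x) + (LINT x|annM. \<bar>v x\<bar>) * (LINT x|annM. F x * M x))"

text \<open>Exchanging the variables in the second interaction gives both the common factor
  \<open>G x * F y\<close>, and the kernels add up to \<open>A (x, y) + A (y, x)\<close>. As
  \<open>K\<close> is nonnegative, \<open>F y\<close> may first be replaced by its lower bound in
  terms of \<open>G y\<close>.\<close>

lemma virial_kernel:
 assumes M: "M \<in> borel_measurable annM" "\<And>x. x \<in> annulus ==> \<bar>M x\<bar> <= BM"
   "\<And>x. x \<in> annulus ==> \<bar>X x \<bullet> pwg x\<bar> + 3/2 * pw x <= M x"
  and K: "\<And>x y. x \<in> annulus ==> y \<in> annulus ==> 0 <= K x y"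
   "\<And>x y. x \<in> annulus ==> y \<in> annulus ==> x \<noteq> y ==> K x y <= A (x, y) + A (y, x) + Ch * (collar x * collar y)"
   "integrable (annM \<Otimes>\<^sub>M annM) (\<lambda>(x, y). G x * (K x y * G y))"
 shows "(a * exp (- k1) / d) * (LINT (x, y)|(annM \<Otimes>\<^sub>M annM). G x * (K x y * G y))
  <= vrhs Ch M"
proof -
 interpret sw: le_virial Q P GQ GP v u Cv Cu Cq Cp s x1 e e' x0 \<beta> c d a b by (rule swapped_virial)
 let ?P = "annM \<Otimes>\<^sub>M annM" and ?k = "a * exp (- k1) / d"
 note 1 = kernel_u[OF M, unfolded case_prod_beta'] and 2 = sw.kernel_u[OF M]
 have sw: "integrable ?P (\<lambda>z. F (snd z) * (A (snd z, fst z) * G (fst z)))"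
  "(LINT z|?P. F (snd z) * (A (snd z, fst z) * G (fst z))) = (LINT (x, y)|?P. F x * (A (x, y) * G y))"
  using annP.integrable_product_swap[OF 2(1)] annP.integral_product_swap[of "\<lambda>(x, y). F x * (A (x, y) * G y)"] 2(1)
  by (simp_all add: case_prod_beta' borel_measurable_integrable)
 note C = pair_product_integral[OF collar_G(1) collar_G(3), unfolded case_prod_beta']
 have iR: "integrable ?P (\<lambda>z. (G (fst z) * (A (fst z, snd z) * F (snd z)) + F (snd z) * (A (snd z, fst z) * G (fst z)))
   + Ch * ((G (fst z) * collar (fst z)) * (F (snd z) * collar (snd z))))"
  using 1(1) sw(1) C(1) by (intro Bochner_Integration.integrable_add integrable_mult_right) auto
 have ae: "AE z in ?P. fst z \<noteq> snd z \<and> ?k * G (snd z) <= F (snd z)"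
 proof (rule annP.AE_pair_measure)
  have "(\<lambda>z::(real^2) \<times> (real^2). norm (fst z - snd z)) \<in> borel_measurable ?P"
   by (intro annM_pair_measurable borel_measurable_continuous_onI continuous_intros)
  moreover have "(\<lambda>z. G (snd z)) \<in> borel_measurable ?P" "(\<lambda>z. F (snd z)) \<in> borel_measurable ?P"
   using borel_measurable_integrable[OF G_integrable] borel_measurable_integrable[OF F_integrable]
   by (auto intro: measurable_compose[OF measurable_snd])
  ultimately have "{z \<in> space ?P. norm (fst z - snd z) \<noteq> 0 \<and> ?k * G (snd z) <= F (snd z)} \<in> sets ?P" by measurable
  then show "{z \<in> space ?P. fst z \<noteq> snd z \<and> ?k * G (snd z) <= F (snd z)} \<in> sets ?P" by simp
  show "AE x in annM. AE y in annM. fst (x, y) \<noteq> snd (x, y) \<and> ?k * G (snd (x, y)) <= F (snd (x, y))"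
   by (rule AE_I2) (use AE_annM_neq F_ge_G in \<open>auto simp: eq_commute\<close>)
 qed
 have "?k * (LINT (x, y)|?P. G x * (K x y * G y)) = (LINT z|?P. ?k * (G (fst z) * (K (fst z) (snd z) * G (snd z))))"
  by (simp add: case_prod_beta')
 also have "... <= (LINT z|?P. (G (fst z) * (A (fst z, snd z) * F (snd z)) + F (snd z) * (A (snd z, fst z) * G (fst z)))
   + Ch * ((G (fst z) * collar (fst z)) * (F (snd z) * collar (snd z))))"
 proof (rule integral_mono_AE[OF _ iR])
  show "integrable ?P (\<lambda>z. ?k * (G (fst z) * (K (fst z) (snd z) * G (snd z))))"
   using K(3) by (simp add: case_prod_beta')
  show "AE z in ?P. ?k * (G (fst z) * (K (fst z) (snd z) * G (snd z)))
    <= (G (fst z) * (A (fst z, snd z) * F (snd z)) + F (snd z) * (A (snd z, fst z) * G (fst z)))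
   + Ch * ((G (fst z) * collar (fst z)) * (F (snd z) * collar (snd z)))"
   using ae AE_space[of ?P]
  proof eventually_elim
   case (elim z)
   obtain x y where z: "z = (x, y)" by (cases z)
   have x: "x \<in> annulus" and y: "y \<in> annulus" using elim(2) by (auto simp: z space_pair_measure)
   have "?k * (G x * (K x y * G y)) = (G x * K x y) * (?k * G y)" by simp
   also have "... <= (G x * K x y) * F y" using elim(1) G_bounds(1)[OF x] K(1)[OF x y] by (intro mult_left_mono) (auto simp: z)
   also have "... = (G x * F y) * K x y" by simp
   also have "... <= (G x * F y) * (A (x, y) + A (y, x) + Ch * (collar x * collar y))"
    using elim(1) G_bounds(1)[OF x] F_bounds(1)[OF y] K(2)[OF x y] by (intro mult_left_mono) (auto simp: z)
   finally show ?case by (simp add: z algebra_simps)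
  qed
 qed
 also have "... = (LINT z|?P. G (fst z) * (A (fst z, snd z) * F (snd z))) + (LINT (x, y)|?P. F x * (A (x, y) * G y))
   + Ch * ((LINT x|annM. G x * collar x) * (LINT x|annM. F x * collar x))"
  unfolding C(2)[symmetric] sw(2)[symmetric]
  using 1(1) sw(1) C(1) by simp
 also have "... <= (delta_mass * (LINT x|annM. G x * (X x \<bullet> sol_grad u F x)) + kapC * (LINT y|annM. \<bar>u y\<bar>) * (LINT x|annM. G x * M x))
   + (delta_mass * (LINT x|annM. F x * (X x \<bullet> sol_grad v G x)) + kapC * (LINT y|annM. \<bar>v y\<bar>) * (LINT x|annM. F x * M x))
   + Ch * ((LINT x|annM. G x * collar x) * (LINT x|annM. F x * collar x))"
  using 1(2) 2(2) by (intro add_mono) auto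
 finally show ?thesis by (simp add: vrhs_def algebra_simps)
qed

end

context le_virial
begin

text \<open>The parameter \<open>kb\<close> allows a symmetrised kernel equal to a multiple of the
  positive kernel minus a rank-one form. The first term of the series dominates
  \<open>2 + kb\<close> copies of the rank-one form, so two copies remain after the
  subtraction.\<close>

lemma core_estimate:
 fixes q cc :: "real^2 => complex"
 assumes M: "M \<in> borel_measurable annM" "\<And>x. x \<in> annulus ==> \<bar>M x\<bar> <= BM"
   "\<And>x. x \<in> annulus ==> \<bar>X x \<bullet> pwg x\<bar> + 3/2 * pw x <= M x"
  and m: "q \<in> borel_measurable annM" "cc \<in> borel_measurable annM" "T \<in> sets borel"
  and q: "\<And>x. x \<in> annulus ==> norm (q x) < 1" and cc: "\<And>x. x \<in> annulus ==> norm (cc x) <= B"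
  and kb: "kb >= 0"
  and T: "\<And>x y. x \<in> annulus ==> y \<in> annulus ==> x \<in> T ==> y \<in> T ==> x \<noteq> y ==>
    (2 + kb) * Re (cc x * cnj (cc y) / (1 - q x * cnj (q y))) - kb * (Re (cc x) * Re (cc y)) <= A (x, y) + A (y, x)"
   "\<And>x y. x \<in> annulus ==> y \<in> annulus ==> x \<in> T ==> y \<in> T ==>
    0 <= (2 + kb) * Re (cc x * cnj (cc y) / (1 - q x * cnj (q y))) - kb * (Re (cc x) * Re (cc y))"
   "\<And>x y. x \<in> annulus ==> y \<in> annulus ==> \<not> (x \<in> T \<and> y \<in> T) ==> x \<noteq> y ==> 0 <= A (x, y) + A (y, x) + Ch * (collar x * collar y)"
  and Ch: "Ch >= 0"
 shows "(a * exp (- k1) / d) * (2 * (LINT x|annM. indicator T x * (G x * Re (cc x)))\<^sup>2)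
  <= vrhs Ch M"
  (is "?k * _ <= ?RHS")
proof -
 let ?P = "annM \<Otimes>\<^sub>M annM"
 define r where "r n = 1 - inverse (real (Suc n))" for n
 have r: "r n < 1" for n by (simp add: r_def)
 have r1: "r \<longlonglongrightarrow> 1"
  using tendsto_diff[OF tendsto_const[of 1] LIMSEQ_inverse_real_of_nat] by (simp add: r_def[abs_def])
 \<comment> \<open>On the annulus \<open>q\<close> only satisfies \<open>norm (q x) < 1\<close>,
   with no uniform gap at the boundary; the truncation provides one, and the limit in
   \<open>n\<close> removes it.\<close>
 define S where "S n = {x \<in> annulus. x \<in> T \<and> norm (q x) <= r n}" for n
 have Tm: "T \<inter> annulus \<in> sets annM" using measurable_sets[OF id_measurable_lebesgue_on m(3), of annulus] by simp
 have Sm: "S n \<in> sets annM" for n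
 proof -
  have "{x \<in> space annM. norm (q x) <= r n} \<in> sets annM" using m(1) by measurable
  then have "T \<inter> annulus \<inter> {x \<in> space annM. norm (q x) <= r n} \<in> sets annM" by (intro sets.Int Tm)
  moreover have "T \<inter> annulus \<inter> {x \<in> space annM. norm (q x) <= r n} = S n" by (auto simp: S_def)
  ultimately show ?thesis by simp
 qed
 define f where "f n x = indicator (S n) x * G x" for n x
 define qn where "qn n x = indicator (S n) x *\<^sub>R q x" for n x
 have rn: "r n >= 0" for n by (simp add: r_def inverse_le_1_iff)
 have step: "?k * (2 * (LINT x|annM. f n x * Re (cc x))\<^sup>2) <= ?RHS" for n
 proof -
  have If: "integrable annM (f n)"
   unfolding f_def[abs_def] using integrable_mult_indicator[OF Sm G_integrable] by simp
  have qm: "qn n \<in> borel_measurable annM" unfolding qn_def[abs_def] using m(1) Sm by measurable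
  have qr: "norm (qn n x) <= r n" if "x \<in> annulus" for x using rn[of n] by (auto simp: qn_def S_def indicator_def)
  note pk = positive_kernel[OF If qm m(2) cc qr r]
  have "\<bar>Re (cc x)\<bar> <= B" if "x \<in> annulus" for x using abs_Re_le_cmod[of "cc x"] cc[OF that] by linarith
  then have Ifc: "integrable annM (\<lambda>x. f n x * Re (cc x))"
   using m(2) by (intro integrable_annM_bounded_mult[OF If]) auto
  note pp = pair_product_integral[OF Ifc Ifc]
  define K where "K x y = indicator (S n) x * indicator (S n) y *
   ((2 + kb) * Re (cc x * cnj (cc y) / (1 - q x * cnj (q y))) - kb * (Re (cc x) * Re (cc y)))" for x y
  \<comment> \<open>The indicators carried by \<open>f n\<close> make it immaterial that
    \<open>q\<close> was truncated as well.\<close>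
  have e: "G x * (K x y * G y) = (2 + kb) * (f n x * (Re (cc x * cnj (cc y) / (1 - qn n x * cnj (qn n y))) * f n y))
    - kb * ((f n x * Re (cc x)) * (f n y * Re (cc y)))" for x y
   unfolding K_def f_def qn_def by (simp add: indicator_def algebra_simps)
  have K3: "integrable ?P (\<lambda>(x, y). G x * (K x y * G y))"
   unfolding e using pk(2) pp(1) by (simp add: case_prod_beta')
  have "2 * (LINT x|annM. f n x * Re (cc x))\<^sup>2 = (2 + kb) * (LINT x|annM. f n x * Re (cc x))\<^sup>2 - kb * (LINT x|annM. f n x * Re (cc x))\<^sup>2"
   by (simp add: algebra_simps)
  also have "... <= (2 + kb) * (LINT (x, y)|?P. f n x * (Re (cc x * cnj (cc y) / (1 - qn n x * cnj (qn n y))) * f n y))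
    - kb * (LINT (x, y)|?P. (f n x * Re (cc x)) * (f n y * Re (cc y)))"
   unfolding pp(2) power2_eq_square[of "LINT x|annM. f n x * Re (cc x)"]
   using mult_left_mono[OF pk(1), of "2 + kb"] kb unfolding power2_eq_square by simp
  also have "... = (LINT (x, y)|?P. G x * (K x y * G y))"
   unfolding e using pk(2) pp(1) by (simp add: case_prod_beta')
  finally have "?k * (2 * (LINT x|annM. f n x * Re (cc x))\<^sup>2) <= ?k * (LINT (x, y)|?P. G x * (K x y * G y))"
   using pos by (intro mult_left_mono) auto
  also have "... <= ?RHS"
  proof (rule virial_kernel[OF M _ _ K3])
   fix x y assume x: "x \<in> annulus" and y: "y \<in> annulus"
   show K0: "0 <= K x y" using T(2)[OF x y] by (auto simp: K_def S_def indicator_def)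
   have cp: "0 <= Ch * (collar x * collar y)" using Ch x y annulus_collar by (auto intro!: mult_nonneg_nonneg less_imp_le)
   show "K x y <= A (x, y) + A (y, x) + Ch * (collar x * collar y)" if ne: "x \<noteq> y"
   proof (cases "x \<in> T \<and> y \<in> T")
    case True
    then show ?thesis using T(1,2)[OF x y] ne cp by (fastforce simp: K_def indicator_def)
   next
    case False
    then have "K x y = 0" by (auto simp: K_def S_def)
    then show ?thesis using T(3)[OF x y False ne] by simp
   qed
  qed
  finally show ?thesis .
 qed
 have "(\<lambda>n. LINT x|annM. f n x * Re (cc x)) \<longlonglongrightarrow> (LINT x|annM. indicator T x * (G x * Re (cc x)))"
 proof (rule integral_dominated_convergence[where w="\<lambda>x. B * \<bar>G x\<bar>"])
  have "G \<in> borel_measurable annM" using G_integrable by simp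
  note mm = this m(2)
  show "(\<lambda>x. f n x * Re (cc x)) \<in> borel_measurable annM" for n unfolding f_def using mm Sm by measurable
  have "(\<lambda>x. indicator (T \<inter> annulus) x * (G x * Re (cc x))) \<in> borel_measurable annM" using mm Tm by measurable
  then show "(\<lambda>x. indicator T x * (G x * Re (cc x))) \<in> borel_measurable annM"
   by (rule measurable_cong[THEN iffD1, rotated]) (simp add: indicator_def)
  show "integrable annM (\<lambda>x. B * \<bar>G x\<bar>)" using G_integrable by auto
  show "AE x in annM. (\<lambda>n. f n x * Re (cc x)) \<longlonglongrightarrow> indicator T x * (G x * Re (cc x))"
  proof (rule AE_I2)
   fix x assume "x \<in> space annM"
   then have x: "x \<in> annulus" by simp
   have "\<forall>\<^sub>F n in sequentially. norm (q x) < r n" by (rule order_tendstoD(1)[OF r1 q[OF x]])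
   then have "\<forall>\<^sub>F n in sequentially. f n x * Re (cc x) = indicator T x * (G x * Re (cc x))"
    by eventually_elim (use x in \<open>auto simp: f_def S_def indicator_def\<close>)
   then show "(\<lambda>n. f n x * Re (cc x)) \<longlonglongrightarrow> indicator T x * (G x * Re (cc x))" by (rule tendsto_eventually)
  qed
  show "AE x in annM. norm (f n x * Re (cc x)) <= B * \<bar>G x\<bar>" for n
  proof (rule AE_I2)
   fix x assume "x \<in> space annM"
   then have "\<bar>Re (cc x)\<bar> <= B" using abs_Re_le_cmod[of "cc x"] cc[of x] by auto
   then show "norm (f n x * Re (cc x)) <= B * \<bar>G x\<bar>"
    using mult_mono[of "\<bar>Re (cc x)\<bar>" B "\<bar>f n x\<bar>" "\<bar>G x\<bar>"] by (auto simp: f_def indicator_def abs_mult mult.commute)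
  qed
 qed
 then have "(\<lambda>n. ?k * (2 * (LINT x|annM. f n x * Re (cc x))\<^sup>2)) \<longlonglongrightarrow> ?k * (2 * (LINT x|annM. indicator T x * (G x * Re (cc x)))\<^sup>2)"
  by (intro tendsto_intros)
 then show ?thesis by (rule LIMSEQ_le_const2) (use step in auto)
qed

text \<open>\<open>NN 0\<close> and the distance are symmetric, so the terms along
  \<open>x - y\<close> combine into the difference of the field at the two points. A Lipschitz field
  cancels the inverse squared distance.\<close>

lemma A_sum:
 assumes x: "x \<in> annulus" and y: "y \<in> annulus" and ne: "x \<noteq> y"
 shows "A (x, y) + A (y, x) = (pw y * (X x \<bullet> pwg x) + pw x * (X y \<bullet> pwg y)) / NN 0 x y
  - 2 * (pw x * pw y) / (NN 0 x y * (norm (y - x))\<^sup>2) * ((X x - X y) \<bullet> (x - y))"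
proof -
 have N: "NN 0 y x = NN 0 x y" by (simp add: NN_def inner_diff_left inner_diff_right inner_commute)
 have "A (x, y) = pw y / NN 0 x y * (X x \<bullet> pwg x) - 2 * (pw x * pw y) / (NN 0 x y * (norm (y - x))\<^sup>2) * (X x \<bullet> (x - y))"
  "A (y, x) = pw x / NN 0 x y * (X y \<bullet> pwg y) - 2 * (pw x * pw y) / (NN 0 x y * (norm (y - x))\<^sup>2) * (X y \<bullet> (y - x))"
  unfolding A_def fst_conv snd_conv
  using GGx_alt[OF x y order_refl] GGx_alt[OF y x order_refl] ne by (simp_all add: inner_diff_right N norm_minus_commute mult.commute)
 then show ?thesis by (simp add: inner_diff_left inner_diff_right algebra_simps add_divide_distrib diff_divide_distrib)
qed

text \<open>On the core the field is exactly \<open>s\<close> times the displacement from its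
  centre, so its difference paired with \<open>x - y\<close> is \<open>s\<close> times the squared
  distance and the diagonal singularity drops out.\<close>

lemma A_sum_core:
 assumes x: "x \<in> annulus" "e (x \<bullet> x) = 1" and y: "y \<in> annulus" "e (y \<bullet> y) = 1" and ne: "x \<noteq> y"
 shows "A (x, y) + A (y, x) = (pw y * (X x \<bullet> pwg x) + pw x * (X y \<bullet> pwg y) - 2 * s * (pw x * pw y)) / NN 0 x y"
proof -
 have "(X x - X y) \<bullet> (x - y) = s * (norm (y - x))\<^sup>2"
  unfolding X_def x y by (simp add: power2_norm_eq_inner inner_diff_left inner_diff_right inner_commute algebra_simps)
 moreover have "norm (y - x) \<noteq> 0" using ne by simp
 ultimately show ?thesis unfolding A_sum[OF x(1) y(1) ne] by (simp add: diff_divide_distrib)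
qed

text \<open>The first part of the symmetrised kernel has a good sign because \<open>X\<close> points
  to increasing \<open>pw\<close>. In the second part, 194 is twice the Lipschitz constant 97 and 64
  comes from \<open>pw \<le> 8 * collar\<close> at both points.\<close>

lemma A_sum_off_core:
 assumes x: "x \<in> annulus" and y: "y \<in> annulus" and ne: "x \<noteq> y"
  and a: "X x \<bullet> pwg x >= 0" "X y \<bullet> pwg y >= 0" and n0: "n0 > 0" "n0 <= NN 0 x y \<or> X x = X y"
 shows "0 <= A (x, y) + A (y, x) + 194 * 64 / n0 * (collar x * collar y)"
proof -
 note p = pw_collar[OF x] pw_collar[OF y]
 have c: "collar x > 0" "collar y > 0" using x y annulus_collar by auto
 have N: "NN 0 x y > 0" by (rule NN_facts(2)[OF x y order_refl])
 let ?D = "(norm (y - x))\<^sup>2"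
 have D: "?D > 0" using ne by simp
 have h: "(pw y * (X x \<bullet> pwg x) + pw x * (X y \<bullet> pwg y)) / NN 0 x y >= 0" using p a N by (intro divide_nonneg_pos add_nonneg_nonneg mult_nonneg_nonneg) auto
 have "2 * (pw x * pw y) / (NN 0 x y * ?D) * ((X x - X y) \<bullet> (x - y)) <= 194 * 64 / n0 * (collar x * collar y)"
 proof (cases "X x = X y")
  case False
  then have n: "n0 <= NN 0 x y" using n0 by simp
  have "(X x - X y) \<bullet> (x - y) <= norm (X x - X y) * norm (x - y)" by (rule norm_cauchy_schwarz)
  also have "... <= (97 * norm (x - y)) * norm (x - y)" by (intro mult_right_mono X_lipschitz x y) simp
  finally have l: "(X x - X y) \<bullet> (x - y) <= 97 * ?D" by (simp add: power2_eq_square norm_minus_commute)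
  have "2 * (pw x * pw y) / (NN 0 x y * ?D) * ((X x - X y) \<bullet> (x - y)) <= 2 * (pw x * pw y) / (NN 0 x y * ?D) * (97 * ?D)"
   using p N D by (intro mult_left_mono l divide_nonneg_pos) auto
  also have "... = 194 * (pw x * pw y) / NN 0 x y" using D by simp
  also have "... <= 194 * ((8 * collar x) * (8 * collar y)) / n0"
   using p n n0 c by (intro frac_le mult_left_mono mult_mono) auto
  finally show ?thesis by (simp add: mult_ac)
 qed (use n0 c in simp)
 then show ?thesis using h unfolding A_sum[OF x y ne] by linarith
qed

end

section \<open>Mass near the boundary\<close>

text \<open>Both transition zones, 3/8 to 7/16 and 13/16 to 7/8 in the squared radius, lie where
  \<open>prof\<close> is affine, so the explicit formulas hold on the whole support of the cutoffs.
  They also stay away from the boundary, where the interior estimate controls the mass.\<close>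

definition e_in :: "real => real" where "e_in t = sstep (7 - 16 * t)"
definition e_in' :: "real => real" where "e_in' t = - 16 * sstep' (7 - 16 * t)"
definition e_out :: "real => real" where "e_out t = sstep (16 * t - 13)"
definition e_out' :: "real => real" where "e_out' t = 16 * sstep' (16 * t - 13)"

lemma e_in_values: "t <= 3/8 ==> e_in t = 1" "t >= 7/16 ==> e_in t = 0" "t <= 3/8 \<or> t >= 7/16 ==> e_in' t = 0"
 by (auto simp: e_in_def e_in'_def sstep_low sstep_high)

lemma e_out_values: "t >= 7/8 ==> e_out t = 1" "t <= 13/16 ==> e_out t = 0" "t >= 7/8 \<or> t <= 13/16 ==> e_out' t = 0"
 by (auto simp: e_out_def e_out'_def sstep_low sstep_high)

lemma e_facts:
 "(e_in has_real_derivative e_in' t) (at t)" "continuous_on UNIV e_in'" "0 <= e_in t" "e_in t <= 1" "\<bar>e_in' t\<bar> <= 32"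
 "(e_out has_real_derivative e_out' t) (at t)" "continuous_on UNIV e_out'" "0 <= e_out t" "e_out t <= 1" "\<bar>e_out' t\<bar> <= 32"
proof -
 have "((\<lambda>t. 7 - 16 * t) has_real_derivative - 16) (at t)" "((\<lambda>t. 16 * t - 13) has_real_derivative 16) (at t)"
  by (auto intro!: derivative_eq_intros)
 from this[THEN DERIV_chain2[OF sstep_deriv]]
 show "(e_in has_real_derivative e_in' t) (at t)" "(e_out has_real_derivative e_out' t) (at t)"
  unfolding e_in_def[abs_def] e_in'_def e_out_def[abs_def] e_out'_def by (simp_all add: mult.commute)
 show "continuous_on UNIV e_in'" "continuous_on UNIV e_out'"
  unfolding e_in'_def[abs_def] e_out'_def[abs_def] by (intro continuous_intros)+
 show "0 <= e_in t" "e_in t <= 1" "\<bar>e_in' t\<bar> <= 32" "0 <= e_out t" "e_out t <= 1" "\<bar>e_out' t\<bar> <= 32"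
  using sstep_range sstep'_range by (auto simp: e_in_def e_in'_def e_out_def e_out'_def abs_mult)
qed

lemma norm_sq_bounds:
 fixes x :: "'a::real_inner"
 assumes "k >= 0"
 shows "x \<bullet> x <= k\<^sup>2 ==> norm x <= k" "k\<^sup>2 <= x \<bullet> x ==> k <= norm x"
 using assms power2_le_imp_le[of "norm x" k] power2_le_imp_le[of k "norm x"] by (simp_all add: power2_norm_eq_inner)

lemma shell_collar: "3/8 <= x \<bullet> x ==> x \<bullet> x <= 7/8 ==> 1 <= 16 * collar x"
proof -
 assume t: "3/8 <= x \<bullet> x" "x \<bullet> x <= 7/8"
 have "0 <= (x \<bullet> x - 3/8) * (7/8 - x \<bullet> x)" using t by (intro mult_nonneg_nonneg) auto
 then show ?thesis unfolding collar_def by (simp add: algebra_simps add_divide_distrib diff_divide_distrib)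
qed

lemma NN_sym: "NN e x y = NN e y x"
 by (simp add: NN_def inner_diff_left inner_diff_right inner_commute)

lemma NN_shell:
 assumes x: "x \<in> annulus" and y: "y \<in> annulus" and t: "3/8 <= x \<bullet> x" "x \<bullet> x <= 7/8"
 shows "1 / (1024 * pwC\<^sup>2) <= NN 0 x y"
proof -
 have "1/16 <= pw x" using shell_collar[OF t] pw_collar(1)[OF x] by linarith
 then have "(1/16)\<^sup>2 <= (pw x)\<^sup>2" by (intro power_mono) auto
 then have "(1/16)\<^sup>2 / (4 * pwC\<^sup>2) <= (pw x)\<^sup>2 / (4 * pwC\<^sup>2)" by (intro divide_right_mono) auto
 also have "... <= NN 0 x y" by (rule NN_ge_pw_sq[OF x y order_refl])
 finally show ?thesis by (simp add: power2_eq_square)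
qed

lemma NN_far:
 assumes x: "x \<in> annulus" and y: "y \<in> annulus" and t: "x \<bullet> x <= 7/16" "13/16 <= y \<bullet> y"
 shows "1 / (1024 * pwC\<^sup>2) <= NN 0 x y"
proof -
 have "norm x <= 7/10" "9/10 <= norm y"
  using t norm_sq_bounds(1)[of "7/10" x] norm_sq_bounds(2)[of "9/10" y] by (simp_all add: power2_eq_square)
 then have "1/5 <= norm (y - x)" using norm_triangle_ineq2[of y x] by linarith
 then have "(1/5)\<^sup>2 <= (norm (y - x))\<^sup>2" by (intro power_mono) auto
 also have "... <= NN 0 x y" by (rule NN_facts(3)[OF x y order_refl])
 finally have "1/25 <= NN 0 x y" by (simp add: power2_eq_square)
 moreover have "1 / (1024 * pwC\<^sup>2) <= 1 / 1024" using one_le_power[OF pwC(1), of 2] by (intro frac_le) auto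
 ultimately show ?thesis by linarith
qed

lemma pw_low: "x \<bullet> x <= 1/2 ==> pw x = 2 * (x \<bullet> x) - 1/2" "x \<bullet> x <= 1/2 ==> pwg x = 4 *\<^sub>R x"
 by (simp_all add: pw_def pwg_def prof_low)

lemma pw_high: "x \<bullet> x >= 3/4 ==> pw x = 1 - x \<bullet> x" "x \<bullet> x >= 3/4 ==> pwg x = - 2 *\<^sub>R x"
 by (simp_all add: pw_def pwg_def prof_high)

section \<open>The symmetrised kernels in complex notation\<close>

definition zc :: "real^2 => complex" where "zc x = Complex (x $ 1) (x $ 2)"

lemma inner_real2: "x \<bullet> y = x $ 1 * y $ 1 + x $ 2 * y $ 2" for x y :: "real^2"
 by (simp add: inner_vec_def sum_2)

lemma zc_simps [simp]: "Re (zc x) = x $ 1" "Im (zc x) = x $ 2"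
 by (simp_all add: zc_def)

lemma norm_zc: "norm (zc x) = norm x"
 by (simp add: cmod_def norm_eq_sqrt_inner inner_real2 power2_eq_square)

lemma zc_measurable: "zc \<in> borel_measurable annM"
proof -
 have "continuous_on annulus zc" unfolding zc_def[abs_def] Complex_eq by (intro continuous_intros)
 then show ?thesis by (rule continuous_on_annM_measurable)
qed

lemma Re_div: "Re (A / B) = (Re A * Re B + Im A * Im B) / ((Re B)\<^sup>2 + (Im B)\<^sup>2)"
 by (simp add: Re_divide)

text \<open>Near the outer circle \<open>NN 0 x y\<close> is the squared modulus of the denominator
  \<open>1 - zc x * cnj (zc y)\<close>.\<close>

lemma outer_kernel:
 assumes x: "3/4 <= x \<bullet> x" and y: "3/4 <= y \<bullet> y"
 shows "Re (1 / (1 - zc x * cnj (zc y))) = (1 - x \<bullet> y) / NN 0 x y"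
proof -
 have "(Re (1 - zc x * cnj (zc y)))\<^sup>2 + (Im (1 - zc x * cnj (zc y)))\<^sup>2 = NN 0 x y"
  unfolding NN_def pw_high(1)[OF x] pw_high(1)[OF y] by (simp add: inner_real2 power2_eq_square algebra_simps)
 moreover have "Re (1 - zc x * cnj (zc y)) = 1 - x \<bullet> y" by (simp add: inner_real2)
 ultimately show ?thesis unfolding Re_div by simp
qed

text \<open>Clearing denominators leaves \<open>(zc x - p) * cnj (zc y - p)\<close> over
  \<open>zc x * cnj (zc y) - p * cnj p\<close>. As the modulus of \<open>p\<close> is 1/2, the
  denominator has squared modulus \<open>NN 0 x y / 4\<close>. The factors
  \<open>1 - p / zc x\<close> vanish at \<open>x0\<close>, in accordance with the choice of the
  field.\<close>

lemma inner_kernel: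
 assumes x0: "norm x0 = 1/2" and x: "x \<bullet> x <= 1/2" "x \<noteq> 0" and y: "y \<bullet> y <= 1/2" "y \<noteq> 0"
 shows "2 * Re ((1 - zc x0 / zc x) * cnj (1 - zc x0 / zc y) / (1 - (zc x0 / zc x) * cnj (zc x0 / zc y)))
  = (2 * (norm (x - x0))\<^sup>2 * pw y + 2 * (norm (y - x0))\<^sup>2 * pw x) / NN 0 x y"
proof -
 define p where "p = zc x0"
 have scale: "4 * t = n ==> t = n / 4" "8 * t = n ==> t = n / 8" "2 * (n / 8 / (t / 4)) = n / t" for t n :: real by simp_all
 have r: "x0 $ 1 * x0 $ 1 + x0 $ 2 * x0 $ 2 = 1/4"
  using power2_norm_eq_inner[of x0] unfolding x0 inner_real2 by (simp add: power2_eq_square)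
 have z: "zc x \<noteq> 0" "zc y \<noteq> 0" using x(2) y(2) norm_zc[of x] norm_zc[of y] by auto
 let ?A = "(zc x - p) * cnj (zc y - p)" and ?B = "zc x * cnj (zc y) - p * cnj p"
 have eq: "(1 - p / zc x) * cnj (1 - p / zc y) / (1 - (p / zc x) * cnj (p / zc y)) = ?A / ?B"
 proof -
  have cz: "cnj (zc y) \<noteq> 0" using z by simp
  have "(1 - p / zc x) * cnj (1 - p / zc y) = ?A / (zc x * cnj (zc y))" using z cz by (simp add: field_simps)
  moreover have "1 - (p / zc x) * cnj (p / zc y) = ?B / (zc x * cnj (zc y))" using z cz by (simp add: field_simps)
  ultimately show ?thesis using z cz by simp
 qed
 have "4 * ((Re ?B)\<^sup>2 + (Im ?B)\<^sup>2) = NN 0 x y"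
 proof -
  have B: "Re ?B = x \<bullet> y - 1/4" "Im ?B = x $ 2 * y $ 1 - x $ 1 * y $ 2"
   using r by (simp_all add: p_def inner_real2 mult.commute)
  show ?thesis unfolding B NN_def pw_low(1)[OF x(1)] pw_low(1)[OF y(1)]
   by (simp add: inner_real2 power2_eq_square algebra_simps add_divide_distrib diff_divide_distrib)
 qed
 then have den: "(Re ?B)\<^sup>2 + (Im ?B)\<^sup>2 = NN 0 x y / 4" by (rule scale(1))
 have "8 * (Re ?A * Re ?B + Im ?A * Im ?B) = 2 * (norm (x - x0))\<^sup>2 * pw y + 2 * (norm (y - x0))\<^sup>2 * pw x"
 proof -
  \<comment> \<open>Expressing the constant through the coordinates of \<open>x0\<close> makes the
    claim a polynomial identity.\<close>
  have half: "(1::real)/2 = 2 * (x0 $ 1 * x0 $ 1 + x0 $ 2 * x0 $ 2)" using r by simp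
  show ?thesis unfolding pw_low(1)[OF x(1)] pw_low(1)[OF y(1)] power2_norm_eq_inner half
   by (simp add: p_def inner_real2 algebra_simps)
 qed
 then have num: "Re ?A * Re ?B + Im ?A * Im ?B = (2 * (norm (x - x0))\<^sup>2 * pw y + 2 * (norm (y - x0))\<^sup>2 * pw x) / 8" by (rule scale(2))
 show ?thesis unfolding p_def[symmetric] eq Re_div num den by (rule scale(3))
qed

context le_params
begin

lemma inner_field: "le_field x0 \<beta> a b c d 1 x0 e_in e_in'"
proof unfold_locales
 fix x :: "real^2" assume "x \<in> annulus"
 show "e_in (x \<bullet> x) * norm (x - x0) <= 3 * norm (x - x0)"
  using e_facts(4)[of "x \<bullet> x"] by (intro mult_right_mono) auto
qed (use e_facts x0 in auto)

lemma outer_dist: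
 assumes "13/16 <= x \<bullet> x"
 shows "2/5 <= norm (x - x0)"
proof -
 have "9/10 <= norm x" using assms norm_sq_bounds(2)[of "9/10" x] by (simp add: power2_eq_square)
 then show ?thesis using norm_triangle_ineq2[of x x0] x0 by linarith
qed

lemma outer_field: "le_field x0 \<beta> a b c d (- 1) 0 e_out e_out'"
proof unfold_locales
 fix x :: "real^2" assume x: "x \<in> annulus"
 show "e_out (x \<bullet> x) * norm (x - 0) <= 3 * norm (x - x0)"
 proof (cases "x \<bullet> x <= 13/16")
  case False
  have "e_out (x \<bullet> x) * norm (x - 0) <= 1 * 1" using e_facts(8,9)[of "x \<bullet> x"] annulus_norm[OF x] by (intro mult_mono) auto
  then show ?thesis using outer_dist[of x] False by simp
 qed (simp add: e_out_values)
qed (use e_facts in auto)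

text \<open>The left side is the derivative of \<open>pw\<close> along \<open>x - x0\<close>.
  Splitting off \<open>pw x\<close> is what cancels the diagonal contribution in the symmetrised
  kernel and leaves the squared distances to \<open>x0\<close>.\<close>

lemma inner_half: "x \<bullet> x <= 1/2 ==> 4 * (x \<bullet> x - x \<bullet> x0) = pw x + 2 * (norm (x - x0))\<^sup>2"
proof -
 assume "x \<bullet> x <= 1/2"
 moreover have "x0 \<bullet> x0 = 1/4" using power2_norm_eq_inner[of x0] unfolding x0 by (simp add: power2_eq_square)
 ultimately show ?thesis unfolding power2_norm_eq_inner
  by (simp add: pw_low inner_diff_left inner_diff_right inner_commute)
qed

end

context le_system
begin

lemma inner_virial: "le_virial P Q GP GQ u v Cu Cv Cp Cq 1 x0 e_in e_in' x0 \<beta> a b c d"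
 by (intro le_virial.intro le_system_axioms inner_field)

lemma outer_virial: "le_virial P Q GP GQ u v Cu Cv Cp Cq (- 1) 0 e_out e_out' x0 \<beta> a b c d"
 by (intro le_virial.intro le_system_axioms outer_field)

lemma collar_expu: "integrable annM (\<lambda>x. \<rho> x * exp (u x) * collar x)"
proof -
 have m: "collar \<in> borel_measurable annM" by (intro continuous_on_annM_measurable continuous_intros)
 show ?thesis by (rule integrable_annM_bounded_mult[OF expu_integrable m, of 1]) (use collar_le annulus_collar in force)
qed

lemma bounded_expu:
 assumes "continuous_on UNIV g" "\<And>t. 0 <= g t" "\<And>t. g t <= 1"
 shows "integrable annM (\<lambda>x. \<rho> x * exp (u x) * g (x \<bullet> x))"
proof -
 have m: "(\<lambda>x. g (x \<bullet> x)) \<in> borel_measurable annM"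
  by (intro continuous_on_annM_measurable continuous_on_compose2[OF assms(1)] continuous_intros) auto
 show ?thesis by (rule integrable_annM_bounded_mult[OF expu_integrable m, of 1]) (use assms in force)
qed

lemma e_in_continuous: "continuous_on UNIV e_in"
 by (rule DERIV_continuous_on[OF e_facts(1)])

text \<open>Homogeneity of the weight about \<open>x0\<close> gives the divergence
  \<open>2 * (\<beta> + 1)\<close> on the core. The gradient bound
  \<open>(\<beta> + 1) * c / 2\<close>, with distance at most 6/5 to \<open>x0\<close>, takes away
  3/5 of \<open>(\<beta> + 1) * c\<close>; the difference is 7/5. The derivative of the cutoff is
  supported in a shell, where the interior estimate applies.\<close>

lemma inner_upper:
 "(LINT x|annM. G x * (le_field.X 1 x0 e_in x \<bullet> sol_grad u F x))
  <= - (7/5 * (\<beta> + 1) * c) * (LINT x|annM. \<rho> x * exp (u x) * e_in (x \<bullet> x)) + 7/5 * (\<beta> + 1) * c * (LINT x|annM. \<rho> x) + 3072 * (I1 * d / c)"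
proof -
 interpret vi: le_virial P Q GP GQ u v Cu Cv Cp Cq 1 x0 e_in e_in' x0 \<beta> a b c d by (rule inner_virial)
 define \<kappa> where "\<kappa> = 7/5 * (\<beta> + 1) * c"
 have \<kappa>: "\<kappa> >= 0" using \<beta> pos by (simp add: \<kappa>_def)
 let ?R = "\<lambda>x. (exp (u x) - 1) * (Q x * vi.divY x + \<rho> x * (GQ x \<bullet> vi.X x))"
 note ie = bounded_expu[OF e_in_continuous e_facts(3,4)]
 have "(LINT x|annM. - ?R x) <= (LINT x|annM. - \<kappa> * (\<rho> x * exp (u x) * e_in (x \<bullet> x)) + \<kappa> * \<rho> x + 1536 * d * (\<rho> x * exp (u x) * collar x))"
 proof (rule integral_mono_AE)
  show "AE x in annM. - ?R x <= - \<kappa> * (\<rho> x * exp (u x) * e_in (x \<bullet> x)) + \<kappa> * \<rho> x + 1536 * d * (\<rho> x * exp (u x) * collar x)"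
   using u_nonneg GQ(2) AE_annM_in
  proof eventually_elim
   case (elim x)
   note x = elim(3)
   let ?e = "e_in (x \<bullet> x)" and ?h = "x - x0"
   have r: "norm ?h > 0" by (rule x0_dist(1)[OF x])
   have w: "\<rho> x > 0" by (rule wt_pos[OF x])
   have c0: "collar x > 0" using x annulus_collar by simp
   have E: "exp (u x) >= 1" using elim(1) by simp
   have div: "vi.divY x = \<rho> x * ((2 + 2 * \<beta>) * ?e + 2 * e_in' (x \<bullet> x) * (x \<bullet> ?h))"
    unfolding vi.divY_def using r by (simp add: power2_norm_eq_inner[symmetric] algebra_simps)
   have 1: "- (3/5 * (\<beta> + 1) * c * ?e) <= GQ x \<bullet> vi.X x"
   proof (cases "x \<bullet> x >= 7/16")
    case True
    then show ?thesis by (simp add: vi.X_def e_in_values)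
   next
    case False
    have "norm x <= 7/10" using False norm_sq_bounds(1)[of "7/10" x] by (simp add: power2_eq_square)
    \<comment> \<open>On the support of the cutoff the radius is at most 7/10, and \<open>x0\<close>
      has norm 1/2.\<close>
    then have h: "norm ?h <= 6/5" using norm_triangle_ineq4[of x x0] x0 by linarith
    have "\<bar>GQ x \<bullet> vi.X x\<bar> <= norm (GQ x) * norm (vi.X x)" by (rule Cauchy_Schwarz_ineq2)
    also have "norm (vi.X x) = ?e * norm ?h" using e_facts(3) by (simp add: vi.X_def)
    also have "norm (GQ x) * (?e * norm ?h) <= ((\<beta> + 1) * c / 2) * (?e * (6/5))"
     using elim(2) h e_facts(3)[of "x \<bullet> x"] \<beta> pos by (intro mult_mono) auto
    finally show ?thesis by (simp add: field_simps)
   qed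
   \<comment> \<open>The product is at most \<open>2 * 32 * 3/2 = 96\<close>, and on the transition
     shell \<open>16 * collar\<close> is at least 1.\<close>
   have 2: "- (1536 * collar x) <= 2 * e_in' (x \<bullet> x) * (x \<bullet> ?h)"
   proof (cases "x \<bullet> x <= 3/8 \<or> x \<bullet> x >= 7/16")
    case True
    then show ?thesis using c0 by (simp add: e_in_values)
   next
    case False
    have "\<bar>x \<bullet> ?h\<bar> <= 1 * (3/2)"
     by (rule order_trans[OF Cauchy_Schwarz_ineq2]) (use annulus_norm[OF x] vi.x1_dist[OF x] in \<open>intro mult_mono, auto\<close>)
    then have "\<bar>2 * e_in' (x \<bullet> x) * (x \<bullet> ?h)\<bar> <= (2 * 32) * (3/2)"
     unfolding abs_mult using e_facts(5)[of "x \<bullet> x"] by (intro mult_mono) auto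
    then show ?thesis using shell_collar[of x] False by (simp add: abs_le_iff)
   qed
   have q: "c <= Q x" "Q x <= d" using Q x by auto
   define J where "J = (\<beta> + 1) * c * ?e"
   have J: "c * ((2 + 2 * \<beta>) * ?e) = 2 * J" "\<kappa> * ?e = 7/5 * J" "3/5 * (\<beta> + 1) * c * ?e = 3/5 * J"
    by (simp_all add: J_def \<kappa>_def algebra_simps)
   have "Q x * ((2 + 2 * \<beta>) * ?e) >= c * ((2 + 2 * \<beta>) * ?e)" using q \<beta> e_facts(3) by (intro mult_right_mono mult_nonneg_nonneg) auto
   then have "Q x * ((2 + 2 * \<beta>) * ?e) >= 2 * J" unfolding J .
   moreover have "Q x * (2 * e_in' (x \<bullet> x) * (x \<bullet> ?h)) >= - (d * (1536 * collar x))"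
   proof -
    have "Q x * (2 * e_in' (x \<bullet> x) * (x \<bullet> ?h)) >= Q x * (- (1536 * collar x))" using 2 q pos by (intro mult_left_mono) auto
    moreover have "Q x * (1536 * collar x) <= d * (1536 * collar x)" using q c0 by (intro mult_right_mono) auto
    ultimately show ?thesis by (simp add: algebra_simps)
   qed
   ultimately have "\<kappa> * ?e - 1536 * d * collar x <= Q x * ((2 + 2 * \<beta>) * ?e + 2 * e_in' (x \<bullet> x) * (x \<bullet> ?h)) + GQ x \<bullet> vi.X x"
    using 1 unfolding J distrib_left[of "Q x"] by simp
   then have "((exp (u x) - 1) * \<rho> x) * (\<kappa> * ?e - 1536 * d * collar x)
     <= ((exp (u x) - 1) * \<rho> x) * (Q x * ((2 + 2 * \<beta>) * ?e + 2 * e_in' (x \<bullet> x) * (x \<bullet> ?h)) + GQ x \<bullet> vi.X x)"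
    using E w by (intro mult_left_mono) auto
   also have "... = ?R x" unfolding div by (simp add: algebra_simps)
   finally have "- ?R x <= - ((exp (u x) - 1) * \<rho> x) * (\<kappa> * ?e - 1536 * d * collar x)" by simp
   also have "... = - \<kappa> * (\<rho> x * exp (u x) * ?e) + \<kappa> * (\<rho> x * ?e) + 1536 * d * (\<rho> x * exp (u x) * collar x) - 1536 * d * (\<rho> x * collar x)"
    by (simp add: algebra_simps)
   also have "... <= - \<kappa> * (\<rho> x * exp (u x) * ?e) + \<kappa> * \<rho> x + 1536 * d * (\<rho> x * exp (u x) * collar x)"
   proof -
    have "\<kappa> * (\<rho> x * ?e) <= \<kappa> * (\<rho> x * 1)" using \<kappa> w e_facts(4) by (intro mult_left_mono) auto
    moreover have "1536 * d * (\<rho> x * collar x) >= 0" using pos w c0 by simp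
    ultimately show ?thesis by linarith
   qed
   finally show ?case .
  qed
  show "integrable annM (\<lambda>x. - ?R x)" using vi.virial_u(2) by simp
  show "integrable annM (\<lambda>x. - \<kappa> * (\<rho> x * exp (u x) * e_in (x \<bullet> x)) + \<kappa> * \<rho> x + 1536 * d * (\<rho> x * exp (u x) * collar x))"
   by (intro Bochner_Integration.integrable_add integrable_mult_right ie wt_integrable collar_expu)
 qed
 also have "... = - \<kappa> * (LINT x|annM. \<rho> x * exp (u x) * e_in (x \<bullet> x)) + \<kappa> * (LINT x|annM. \<rho> x)
   + 1536 * d * (LINT x|annM. \<rho> x * exp (u x) * collar x)"
  using ie wt_integrable collar_expu by simp
 also have "1536 * d * (LINT x|annM. \<rho> x * exp (u x) * collar x) <= 1536 * d * (2 * I1 / c)"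
  using interior(1) pos by (intro mult_left_mono) auto
 finally show ?thesis unfolding vi.virial_u(3) \<kappa>_def by (simp add: mult_ac)
qed

end

definition Tin :: "(real^2) set" where "Tin = {x. x \<bullet> x <= 3/8}"
definition Tout :: "(real^2) set" where "Tout = {x. 7/8 <= x \<bullet> x}"
text \<open>The constant of \<open>A_sum_off_core\<close> divided by the lower bound
  \<open>1 / (1024 * pwC\<^sup>2)\<close> of \<open>NN 0\<close>, which holds for the pairs outside
  the core at which the two field values differ.\<close>

definition chC :: real where "chC = 194 * 64 * (1024 * pwC\<^sup>2)"

lemma T_borel: "Tin \<in> sets borel" "Tout \<in> sets borel"
 unfolding Tin_def Tout_def by (intro borel_closed closed_Collect_le continuous_intros)+

lemma T_measurable: "T \<in> sets borel ==> f \<in> borel_measurable annM ==> (\<lambda>x. indicator T x * f x) \<in> borel_measurable annM"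
 for f :: "real^2 => real"
proof -
 assume T: "T \<in> sets borel" and f: "f \<in> borel_measurable annM"
 have "T \<inter> annulus \<in> sets annM" using measurable_sets[OF id_measurable_lebesgue_on T, of annulus] by simp
 then have "(\<lambda>x. indicator (T \<inter> annulus) x * f x) \<in> borel_measurable annM" using f by measurable
 then show ?thesis by (rule measurable_cong[THEN iffD1, rotated]) (simp add: indicator_def)
qed

lemma T_integrable: "T \<in> sets borel ==> integrable annM f ==> integrable annM (\<lambda>x. indicator T x * f x)"
 for f :: "real^2 => real"
 by (rule Bochner_Integration.integrable_bound[of _ f], assumption, rule T_measurable) (auto simp: indicator_def)

lemma chC: "chC >= 0" "194 * 64 / (1 / (1024 * pwC\<^sup>2)) = chC" "1 / (1024 * pwC\<^sup>2) > 0"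
 using pwC(1) by (simp_all add: chC_def)

text \<open>Either \<open>J \<le> 1\<close>, or \<open>E1\<close> may be multiplied by
  \<open>J\<close> and one factor \<open>J\<close> cancels. The term \<open>Z\<close> is carried
  along because near the inner circle the mass sits in it and not in \<open>J\<close>.\<close>

lemma quadratic_bound:
 fixes k :: real
 assumes "k > 0" "E1 >= 0" "E2 >= 0" "Z >= 0" "k * (2 * J\<^sup>2) + Z <= E1 + E2 * J"
 shows "J <= 1 + (E1 + E2) / (2 * k)" "Z <= E1 + E2 * (1 + (E1 + E2) / (2 * k))"
proof -
 show J: "J <= 1 + (E1 + E2) / (2 * k)"
 proof (cases "J <= 1")
  case True
  then show ?thesis using assms by (simp add: add_increasing2)
 next
  case False
  have "(2 * k * J) * J <= E1 + E2 * J" using assms(4,5) by (simp add: power2_eq_square algebra_simps)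
  also have "... <= (E1 + E2) * J" using mult_left_mono[of 1 J E1] False assms(2) by (simp add: algebra_simps)
  finally have "2 * k * J <= E1 + E2" using False by (simp add: mult_le_cancel_right)
  then have "J <= (E1 + E2) / (2 * k)" using assms(1) by (simp add: field_simps)
  then show ?thesis by simp
 qed
 have "Z <= E1 + E2 * J" using assms by (smt (verit) mult_nonneg_nonneg zero_le_power2)
 also have "... <= E1 + E2 * (1 + (E1 + E2) / (2 * k))" using J assms(3) by (simp add: mult_left_mono)
 finally show "Z <= E1 + E2 * (1 + (E1 + E2) / (2 * k))" .
qed

section \<open>Explicit constants and the two collar estimates\<close>

context le_params
begin

definition k2 :: real where "k2 = max 0 (ln (d / a))"
definition K0 :: real where "K0 = a * exp (- k1) / d"
definition K1 :: real where "K1 = b * exp k2 / c"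
definition gI :: real where "gI = I1 * d / c"
definition fI :: real where "fI = I1 * b / a"
text \<open>Bounds the virial density near the outer circle relative to \<open>G\<close>: 66 is 2
  for the cutoff plus 64 for its derivative, \<open>6 * \<bar>\<beta>\<bar>\<close> comes from the
  weight, and the last term from the gradient of \<open>Q\<close>.\<close>

definition Bu :: real where "Bu = (d * (66 + 6 * \<bar>\<beta>\<bar>) + (\<beta> + 1) * c / 2) / c"
definition Bv :: real where "Bv = (b * (66 + 6 * \<bar>\<beta>\<bar>) + (\<beta> + 1) * a / 2) / a"

lemma const_pos: "K0 > 0" "K1 >= 0" "gI >= 0" "fI >= 0" "Bu >= 0" "Bv >= 0"
 using pos I1_nonneg \<beta> by (auto simp: K0_def K1_def gI_def fI_def Bu_def Bv_def intro!: divide_nonneg_pos add_nonneg_nonneg mult_nonneg_nonneg)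

text \<open>These four constants gather, for each collar, the terms free of \<open>J\<close> and the
  coefficient of \<open>J\<close> in the final quadratic inequality. The numbers 120 and 44 are the
  coefficients of \<open>collar\<close> in the majorants \<open>M\<close>.\<close>

definition inE1 :: real where
 "inE1 = delta_mass * ((7/5 * (\<beta> + 1) * c * (LINT x|annM. wt x0 \<beta> x) + 3072 * gI) + (7/5 * (\<beta> + 1) * a * (LINT x|annM. wt x0 \<beta> x) + 3072 * fI))
  + chC * ((2 * gI) * (2 * fI)) + kapC * ((16 * fI) * (2 * 120 * gI) + (16 * gI) * (2 * 120 * fI))"
definition inE2 :: real where "inE2 = kapC * ((16 * fI) * 4 + (16 * gI) * (4 * K1))"
definition outE1 :: real where
 "outE1 = delta_mass * (Bu * (32 * gI) + Bv * (32 * fI)) + chC * ((2 * gI) * (2 * fI)) + kapC * ((16 * fI) * (2 * 44 * gI) + (16 * gI) * (2 * 44 * fI))"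
definition outE2 :: real where "outE2 = delta_mass * (Bu + Bv * K1) + kapC * ((16 * fI) * 2 + (16 * gI) * (2 * K1))"

lemma E_nonneg: "inE1 >= 0" "inE2 >= 0" "outE1 >= 0" "outE2 >= 0"
proof -
 have "(LINT x|annM. wt x0 \<beta> x) >= 0" by (rule integral_nonneg_AE, rule AE_I2) (simp add: wt_def)
 then show "inE1 >= 0" "inE2 >= 0" "outE1 >= 0" "outE2 >= 0"
  unfolding inE1_def inE2_def outE1_def outE2_def
  using const_pos delta_mass_pos kapC(1) chC(1) \<beta> pos by (auto intro!: add_nonneg_nonneg mult_nonneg_nonneg)
qed

end

context le_system
begin

lemma F_le_G: "AE x in annM. F x <= K1 * G x"
proof -
 interpret sw: le_system x0 \<beta> c d a b Q P GQ GP v u Cv Cu Cq Cp by (rule swapped)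
 show ?thesis using sw.F_ge_G
 proof eventually_elim
  case (elim x)
  have "sw.k1 = k2" by (simp add: sw.k1_def k2_def)
  then have "c * exp (- k2) / b * F x <= G x" using elim by simp
  from mult_left_mono[OF this, of "b * exp k2 / c"] pos
  have *: "b * exp k2 / c * (c * exp (- k2) / b * F x) <= b * exp k2 / c * G x" by simp
  have e: "b * exp k2 / c * (c * exp (- k2) / b * F x) = F x" using pos by (simp add: exp_minus field_simps)
  show ?case using *[unfolded e] unfolding K1_def .
 qed
qed

text \<open>The weight is not homogeneous about the centre 0 of this field, and no sign is claimed.
  A bound linear in the mass of \<open>G\<close> suffices, since the quadratic interaction absorbs
  it.\<close>

lemma outer_upper:
 "(LINT x|annM. G x * (le_field.X (- 1) 0 e_out x \<bullet> sol_grad u F x)) <= Bu * ((LINT x|annM. indicator Tout x * G x) + 32 * gI)"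
proof -
 interpret vo: le_virial P Q GP GQ u v Cu Cv Cp Cq "- 1" 0 e_out e_out' x0 \<beta> a b c d by (rule outer_virial)
 let ?R = "\<lambda>x. (exp (u x) - 1) * (Q x * vo.divY x + \<rho> x * (GQ x \<bullet> vo.X x))"
 note iT = T_integrable[OF T_borel(2) G_integrable]
 have "(LINT x|annM. - ?R x) <= (LINT x|annM. Bu * (indicator Tout x * G x + 16 * (G x * collar x)))"
 proof (rule integral_mono_AE)
  show "AE x in annM. - ?R x <= Bu * (indicator Tout x * G x + 16 * (G x * collar x))"
   using u_nonneg GQ(2) AE_annM_in
  proof eventually_elim
   case (elim x)
   note x = elim(3)
   have c0: "collar x > 0" using x annulus_collar by simp
   have w: "\<rho> x > 0" by (rule wt_pos[OF x])
   have rhs0: "Bu * (indicator Tout x * G x + 16 * (G x * collar x)) >= 0"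
    using const_pos G_bounds(1)[OF x] c0 by (auto intro!: mult_nonneg_nonneg add_nonneg_nonneg)
   show ?case
   proof (cases "x \<bullet> x <= 13/16")
    case True
    then have z: "?R x = 0" by (simp add: vo.divY_def vo.X_def e_out_values)
    show ?thesis using rhs0 unfolding z by simp
   next
    case False
    let ?e = "e_out (x \<bullet> x)"
    have r: "norm (x - x0) > 0" by (rule x0_dist(1)[OF x])
    have t: "\<bar>x \<bullet> x\<bar> <= 1" using x by (simp add: annulus_iff)
    have "\<bar>2 * \<beta> * ?e * ((x - x0) \<bullet> (x - 0)) / (norm (x - x0))\<^sup>2\<bar> <= 6 * \<bar>\<beta>\<bar>"
    proof -
     have "?e * \<bar>(x - x0) \<bullet> x\<bar> <= ?e * (norm (x - x0) * norm x)"
      using e_facts(8) by (intro mult_left_mono Cauchy_Schwarz_ineq2) auto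
     also have "... = norm (x - x0) * (?e * norm (x - 0))" by simp
     also have "... <= norm (x - x0) * (3 * norm (x - x0))" by (intro mult_left_mono vo.e_dist x) auto
     finally have "?e * \<bar>(x - x0) \<bullet> x\<bar> / (norm (x - x0))\<^sup>2 <= 3" using r by (simp add: field_simps power2_eq_square)
     from mult_left_mono[OF this, of "2 * \<bar>\<beta>\<bar>"] show ?thesis using e_facts(8)[of "x \<bullet> x"] by (simp add: abs_mult mult_ac)
    qed
    moreover have "\<bar>2 * e_out' (x \<bullet> x) * (x \<bullet> (x - 0))\<bar> <= 2 * 32 * 1"
     unfolding abs_mult using e_facts(10)[of "x \<bullet> x"] t by (intro mult_mono) auto
    ultimately have s: "\<bar>2 * ?e + 2 * e_out' (x \<bullet> x) * (x \<bullet> (x - 0)) + 2 * \<beta> * ?e * ((x - x0) \<bullet> (x - 0)) / (norm (x - x0))\<^sup>2\<bar> <= 66 + 6 * \<bar>\<beta>\<bar>"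
     using e_facts(8,9)[of "x \<bullet> x"] by linarith
    have "\<bar>vo.divY x\<bar> <= \<rho> x * (66 + 6 * \<bar>\<beta>\<bar>)"
     unfolding vo.divY_def abs_mult using w mult_left_mono[OF s, of "\<rho> x"] by simp
    then have "\<bar>Q x * vo.divY x\<bar> <= d * (\<rho> x * (66 + 6 * \<bar>\<beta>\<bar>))"
     unfolding abs_mult using Q(2,3)[OF x] pos by (intro mult_mono) auto
    moreover have "\<bar>\<rho> x * (GQ x \<bullet> vo.X x)\<bar> <= \<rho> x * (((\<beta> + 1) * c / 2) * 1)"
    proof -
     have "norm (vo.X x) <= 1 * 1" unfolding vo.X_def norm_scaleR abs_mult
      using e_facts(8,9)[of "x \<bullet> x"] annulus_norm[OF x] by (intro mult_mono) auto
     then have "\<bar>GQ x \<bullet> vo.X x\<bar> <= ((\<beta> + 1) * c / 2) * 1"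
      by (intro order_trans[OF Cauchy_Schwarz_ineq2] mult_mono elim(2)) (use \<beta> pos in auto)
     then show ?thesis using w by (simp add: abs_mult mult_left_mono)
    qed
    ultimately have h: "\<bar>Q x * vo.divY x\<bar> <= d * (\<rho> x * (66 + 6 * \<bar>\<beta>\<bar>))" "\<bar>\<rho> x * (GQ x \<bullet> vo.X x)\<bar> <= \<rho> x * (((\<beta> + 1) * c / 2) * 1)" by blast+
    have "\<bar>Q x * vo.divY x + \<rho> x * (GQ x \<bullet> vo.X x)\<bar> <= \<rho> x * (Bu * c)"
    proof -
     have "\<rho> x * (Bu * c) = d * (\<rho> x * (66 + 6 * \<bar>\<beta>\<bar>)) + \<rho> x * (((\<beta> + 1) * c / 2) * 1)"
      unfolding Bu_def using pos by (simp add: field_simps)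
     then show ?thesis using h abs_triangle_ineq[of "Q x * vo.divY x" "\<rho> x * (GQ x \<bullet> vo.X x)"] by linarith
    qed
    then have "(exp (u x) - 1) * \<bar>Q x * vo.divY x + \<rho> x * (GQ x \<bullet> vo.X x)\<bar> <= exp (u x) * (\<rho> x * (Bu * c))"
     using elim(1) by (intro mult_mono) auto
    moreover have "m * \<bar>z\<bar> <= k ==> 0 <= m ==> - (m * z) <= k" for m z k :: real
     using abs_ge_minus_self[of "m * z"] by (simp add: abs_mult)
    ultimately have "- ?R x <= exp (u x) * (\<rho> x * (Bu * c))" using elim(1) by simp
    also have "... = Bu * (c * (\<rho> x * exp (u x)))" by simp
    also have "... <= Bu * G x" using G_bounds(2)[OF x] const_pos by (intro mult_left_mono) auto
    also have "... <= Bu * (G x * (indicator Tout x + 16 * collar x))"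
    proof -
     have "1 <= indicator Tout x + 16 * collar x"
      using shell_collar[of x] False c0 by (cases "x \<in> Tout") (auto simp: Tout_def indicator_def)
     from mult_left_mono[OF this G_bounds(1)[OF x]] show ?thesis using const_pos by (intro mult_left_mono) auto
    qed
    finally show ?thesis by (simp add: algebra_simps)
   qed
  qed
  show "integrable annM (\<lambda>x. - ?R x)" using vo.virial_u(2) by simp
  show "integrable annM (\<lambda>x. Bu * (indicator Tout x * G x + 16 * (G x * collar x)))"
   by (intro Bochner_Integration.integrable_add integrable_mult_right iT collar_G)
 qed
 also have "... = Bu * ((LINT x|annM. indicator Tout x * G x) + 16 * (LINT x|annM. G x * collar x))"
  using iT collar_G(1) by simp
 also have "... <= Bu * ((LINT x|annM. indicator Tout x * G x) + 32 * gI)"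
  using collar_G(2) const_pos by (intro mult_left_mono) (auto simp: gI_def)
 finally show ?thesis unfolding vo.virial_u(3) by simp
qed

end

context le_system
begin

lemma T_rhs_F:
 assumes T: "T \<in> sets borel" and g: "g \<in> borel_measurable annM" "\<forall>x\<in>annulus. 0 <= g x \<and> g x <= B"
 shows "integrable annM (\<lambda>x. indicator T x * (G x * g x))" "integrable annM (\<lambda>x. indicator T x * (F x * g x))"
  "(LINT x|annM. indicator T x * (F x * g x)) <= K1 * (LINT x|annM. indicator T x * (G x * g x))"
proof -
 have "\<bar>g x\<bar> <= B" if "x \<in> annulus" for x using g(2) that by simp
 note b = integrable_annM_bounded_mult[OF _ g(1) this]
 show iG: "integrable annM (\<lambda>x. indicator T x * (G x * g x))" by (rule T_integrable[OF T b[OF G_integrable]])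
 show iF: "integrable annM (\<lambda>x. indicator T x * (F x * g x))" by (rule T_integrable[OF T b[OF F_integrable]])
 have "(LINT x|annM. indicator T x * (F x * g x)) <= (LINT x|annM. K1 * (indicator T x * (G x * g x)))"
 proof (rule integral_mono_AE[OF iF integrable_mult_right[OF iG]])
  show "AE x in annM. indicator T x * (F x * g x) <= K1 * (indicator T x * (G x * g x))"
   using F_le_G AE_annM_in
  proof eventually_elim
   case (elim x)
   have "F x * g x <= K1 * G x * g x" using g(2) elim by (intro mult_right_mono) auto
   then show ?case by (simp add: indicator_def mult.assoc)
  qed
 qed
 then show "(LINT x|annM. indicator T x * (F x * g x)) <= K1 * (LINT x|annM. indicator T x * (G x * g x))"
  unfolding integral_mult_right_zero .
qed

lemma v_L1: "(LINT x|annM. \<bar>v x\<bar>) <= 16 * gI"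
proof -
 interpret sw: le_system x0 \<beta> c d a b Q P GQ GP v u Cv Cu Cq Cp by (rule swapped)
 have "sw.I1 = I1" unfolding sw.I1_def I1_def sw.log_bound_def log_bound_def by (simp add: add.commute)
 then show ?thesis using sw.u_L1(2) by (simp add: gI_def mult_ac)
qed

text \<open>The part of \<open>M\<close> proportional to \<open>collar\<close> is paid for by the
  interior estimate; the part on the core costs \<open>J\<close> for \<open>G\<close>, and
  \<open>K1 * J\<close> for \<open>F\<close> by comparison.\<close>

lemma weighted_terms:
 assumes T: "T \<in> sets borel" and g: "g \<in> borel_measurable annM" "\<forall>x\<in>annulus. 0 <= g x \<and> g x <= B"
  and m: "m >= 0" and J: "(LINT x|annM. indicator T x * (G x * g x)) <= J"
 defines "M \<equiv> \<lambda>x. indicator T x * g x + m * collar x"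
 shows "M \<in> borel_measurable annM" "\<And>x. x \<in> annulus ==> \<bar>M x\<bar> <= B + m"
  "chC * ((LINT x|annM. G x * collar x) * (LINT x|annM. F x * collar x))
   + kapC * ((LINT x|annM. \<bar>u x\<bar>) * (LINT x|annM. G x * M x) + (LINT x|annM. \<bar>v x\<bar>) * (LINT x|annM. F x * M x))
  <= chC * ((2 * gI) * (2 * fI)) + kapC * ((16 * fI) * (J + 2 * m * gI) + (16 * gI) * (K1 * J + 2 * m * fI))"
proof -
 have c: "0 < collar x" "collar x <= 1" if "x \<in> annulus" for x using that annulus_collar collar_le by auto
 have "collar \<in> borel_measurable annM" by (intro continuous_on_annM_measurable continuous_intros)
 then show "M \<in> borel_measurable annM" unfolding M_def using T_measurable[OF T g(1)] by measurable
 have "0 <= B" using g(2) annulus_nonempty by (meson order_trans)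
 then have M: "0 <= M x" "\<bar>M x\<bar> <= B + m" if "x \<in> annulus" for x
  using g(2) that c[OF that] m mult_left_le[of "collar x" m] by (auto simp: M_def indicator_def)
 then show "\<And>x. x \<in> annulus ==> \<bar>M x\<bar> <= B + m" by blast
 note iT = T_rhs_F[OF T g]
 have GM: "(LINT x|annM. H x * M x) = (LINT x|annM. indicator T x * (H x * g x)) + m * (LINT x|annM. H x * collar x)"
  if "integrable annM (\<lambda>x. indicator T x * (H x * g x))" "integrable annM (\<lambda>x. H x * collar x)" for H
 proof -
  have *: "H x * M x = indicator T x * (H x * g x) + m * (H x * collar x)" for x by (simp add: M_def algebra_simps)
  show ?thesis unfolding * using that by (subst Bochner_Integration.integral_add; simp)
 qed
 have "m * (LINT x|annM. G x * collar x) <= m * (2 * gI)" "m * (LINT x|annM. F x * collar x) <= m * (2 * fI)"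
  using collar_G(2,4) by (intro mult_left_mono m; simp add: gI_def fI_def)+
 then have b: "(LINT x|annM. G x * M x) <= J + 2 * m * gI" "(LINT x|annM. F x * M x) <= K1 * J + 2 * m * fI"
  unfolding GM[OF iT(1) collar_G(1)] GM[OF iT(2) collar_G(3)]
  using J iT(3) mult_left_mono[OF J const_pos(2)] by linarith+
 have nn: "0 <= (LINT x|annM. G x * M x)" "0 <= (LINT x|annM. F x * M x)" "0 <= (LINT x|annM. F x * collar x)"
  by (rule integral_nonneg_AE, rule AE_I2, use M(1) G_bounds(1) F_bounds(1) c(1) in \<open>simp add: less_imp_le\<close>)+
 show "chC * ((LINT x|annM. G x * collar x) * (LINT x|annM. F x * collar x))
   + kapC * ((LINT x|annM. \<bar>u x\<bar>) * (LINT x|annM. G x * M x) + (LINT x|annM. \<bar>v x\<bar>) * (LINT x|annM. F x * M x))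
  <= chC * ((2 * gI) * (2 * fI)) + kapC * ((16 * fI) * (J + 2 * m * gI) + (16 * gI) * (K1 * J + 2 * m * fI))"
  using collar_G(2,4) const_pos chC(1) kapC(1) b nn v_L1 u_L1(2)
  by (intro add_mono mult_left_mono mult_mono) (auto simp: gI_def fI_def)
qed

text \<open>The density of \<open>J\<close> vanishes at \<open>x0\<close>, so a bound on
  \<open>J\<close> misses mass that concentrates there. Instead \<open>J\<close> is only used to
  absorb the linear error terms, and the mass is recovered from the weight term \<open>Z\<close>
  with its coefficient 7/5.\<close>

lemma inner_core:
 "delta_mass * (7/5 * (\<beta> + 1) * c) * (LINT x|annM. \<rho> x * exp (u x) * e_in (x \<bullet> x)) <= inE1 + inE2 * (1 + (inE1 + inE2) / (2 * K0))"
proof -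
 interpret vi: le_virial P Q GP GQ u v Cu Cv Cp Cq 1 x0 e_in e_in' x0 \<beta> a b c d by (rule inner_virial)
 let ?q = "\<lambda>x. zc x0 / zc x" and ?cc = "\<lambda>x. 1 - zc x0 / zc x" and ?m = "\<lambda>x. 2 * (norm (x - x0))\<^sup>2"
 let ?M = "\<lambda>x. indicator Tin x * ?m x + 120 * collar x"
 have c0: "0 < collar x" "collar x <= 1" if "x \<in> annulus" for x using that annulus_collar collar_le by auto
 have mm: "?m \<in> borel_measurable annM" by (intro continuous_on_annM_measurable continuous_intros)
 have mb: "0 <= ?m x" "?m x <= 8" if "x \<in> annulus" for x
  using power_mono[OF less_imp_le[OF x0_dist(2)[OF that]] norm_ge_zero, of 2] by auto
 then have mb': "\<forall>x\<in>annulus. 0 <= ?m x \<and> ?m x <= 8" by blast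
 have qb: "norm (?q x) < 1" if "x \<in> annulus" for x
  using that x0 by (auto simp: norm_divide norm_zc annulus_def divide_less_eq)
 have Xp: "vi.X x \<bullet> pwg x = (if x \<bullet> x <= 7/16 then e_in (x \<bullet> x) * (pw x + ?m x) else 0)" for x
 proof (cases "x \<bullet> x <= 7/16")
  case True
  then have "vi.X x \<bullet> pwg x = e_in (x \<bullet> x) * (4 * (x \<bullet> x - x \<bullet> x0))"
   by (simp add: vi.X_def pw_low inner_diff_left inner_diff_right inner_commute)
  then show ?thesis using True inner_half[of x] by simp
 qed (simp add: vi.X_def e_in_values)
 have Xp0: "0 <= vi.X x \<bullet> pwg x" if "x \<in> annulus" for x
  unfolding Xp using e_facts(3) pw_collar(3)[OF that] by (auto intro!: mult_nonneg_nonneg)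
 have M3: "\<bar>vi.X x \<bullet> pwg x\<bar> + 3/2 * pw x <= ?M x" if x: "x \<in> annulus" for x
 proof -
  \<comment> \<open>Here 108 is 8 from \<open>pw \<le> 8 * collar\<close> plus 100 for the
    transition shell, where \<open>2 * (6/5)\<^sup>2\<close> is below 100/16. Adding 12 for
    \<open>3/2 * pw\<close> gives the 120 in \<open>?M\<close>.\<close>
  have "vi.X x \<bullet> pwg x <= indicator Tin x * ?m x + 108 * collar x"
  proof (cases "x \<bullet> x <= 7/16")
   case True
   have "e_in (x \<bullet> x) * (pw x + ?m x) <= 1 * (pw x + ?m x)"
    using e_facts(4) pw_collar(3)[OF x] by (intro mult_right_mono) auto
   moreover have "?m x <= indicator Tin x * ?m x + 100 * collar x"
   proof (cases "x \<in> Tin")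
    case False
    then have t: "3/8 <= x \<bullet> x" by (simp add: Tin_def)
    have "norm x <= 7/10" using True norm_sq_bounds(1)[of "7/10" x] by (simp add: power2_eq_square)
    then have "norm (x - x0) <= 6/5" using norm_triangle_ineq4[of x x0] x0 by linarith
    then have "(norm (x - x0))\<^sup>2 <= (6/5)\<^sup>2" by (intro power_mono) auto
    then show ?thesis using shell_collar[OF t] True False by (simp add: power2_eq_square)
   qed (use c0[OF x] in simp)
   ultimately show ?thesis unfolding Xp using True pw_collar(2)[OF x] by simp
  next
   case False
   then show ?thesis unfolding Xp using mb[OF x] c0[OF x] by (simp add: indicator_def)
  qed
  then show ?thesis using Xp0[OF x] pw_collar(2)[OF x] by simp
 qed
 have Rc: "Re (?cc x) = (x \<bullet> x - x \<bullet> x0) / (x \<bullet> x)" if "x \<in> annulus" for x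
 proof -
  have n: "x \<bullet> x \<noteq> 0" using that by (auto simp: annulus_iff)
  have "Re (?cc x) = 1 - x \<bullet> x0 / (x \<bullet> x)" by (simp add: Re_div inner_real2 power2_eq_square mult.commute)
  then show ?thesis using n by (simp add: diff_divide_distrib)
 qed
 have nz: "x \<noteq> 0" if "x \<in> annulus" for x using that by (auto simp: annulus_def)
 have ccb: "norm (?cc x) <= 2" if "x \<in> annulus" for x using norm_triangle_ineq4[of 1 "?q x"] qb[OF that] by simp
 have qm: "?q \<in> borel_measurable annM" "?cc \<in> borel_measurable annM" using zc_measurable by measurable
 let ?J = "LINT x|annM. indicator Tin x * (G x * Re (?cc x))"
 have ker: "(2 + 0) * Re (?cc x * cnj (?cc y) / (1 - ?q x * cnj (?q y))) - 0 * (Re (?cc x) * Re (?cc y)) = (?m x * pw y + ?m y * pw x) / NN 0 x y"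
  if "x \<in> annulus" "y \<in> annulus" "x \<in> Tin" "y \<in> Tin" for x y
  using inner_kernel[OF x0, of x y] nz that by (simp add: Tin_def)
 \<comment> \<open>Allows the error terms to be measured by \<open>J\<close>: by
   \<open>inner_half\<close> the weight is at most
   \<open>4 * (x \<bullet> x - x \<bullet> x0)\<close>, and dividing the nonnegative bracket by
   \<open>x \<bullet> x \<le> 1\<close> only increases it.\<close>
 have w: "?m x <= 4 * Re (?cc x)" if x: "x \<in> annulus" "x \<in> Tin" for x
 proof -
  have t: "0 < x \<bullet> x" "x \<bullet> x <= 1" using x(1) by (auto simp: annulus_iff)
  have p: "?m x <= 4 * (x \<bullet> x - x \<bullet> x0)" using inner_half[of x] x(2) pw_collar(3)[OF x(1)] by (simp add: Tin_def)
  have "(x \<bullet> x - x \<bullet> x0) >= 0" using order_trans[OF mb(1)[OF x(1)] p] by simp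
  then have q: "(x \<bullet> x - x \<bullet> x0) <= (x \<bullet> x - x \<bullet> x0) / (x \<bullet> x)" using t by (simp add: le_divide_eq mult_left_le)
  show ?thesis unfolding Rc[OF x(1)] by (rule order_trans[OF p mult_left_mono[OF q]]) simp
 qed
 note iT = T_rhs_F[OF T_borel(1) mm mb']
 have Rb: "\<bar>Re (?cc x)\<bar> <= 2" if "x \<in> annulus" for x using abs_Re_le_cmod[of "?cc x"] ccb[OF that] by linarith
 have Rm: "(\<lambda>x. Re (?cc x)) \<in> borel_measurable annM" by (rule measurable_compose[OF qm(2) borel_measurable_Re])
 have iJ: "integrable annM (\<lambda>x. indicator Tin x * (G x * Re (?cc x)))"
  by (rule T_integrable[OF T_borel(1) integrable_annM_bounded_mult[OF G_integrable Rm Rb]])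
 have mJ: "(LINT x|annM. indicator Tin x * (G x * ?m x)) <= 4 * ?J"
 proof -
  have "(LINT x|annM. indicator Tin x * (G x * ?m x)) <= (LINT x|annM. 4 * (indicator Tin x * (G x * Re (?cc x))))"
  proof (rule integral_mono[OF iT(1) integrable_mult_right[OF iJ]])
   fix x assume "x \<in> space annM"
   then have x: "x \<in> annulus" by simp
   show "indicator Tin x * (G x * ?m x) <= 4 * (indicator Tin x * (G x * Re (?cc x)))"
   proof (cases "x \<in> Tin")
    case True
    have "G x * ?m x <= 4 * (G x * Re (?cc x))"
     using mult_left_mono[OF w[OF x True] G_bounds(1)[OF x]] by (simp only: mult.left_commute)
    then show ?thesis using True by (simp only: indicator_simps mult_1_left)
   qed simp
  qed
  then show ?thesis unfolding integral_mult_right_zero .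
 qed
 have m120: "0 <= (120::real)" by simp
 note wt_terms = weighted_terms[OF T_borel(1) mm mb' m120 mJ]
 have core: "K0 * (2 * ?J\<^sup>2) <= vi.vrhs chC ?M"
  unfolding K0_def
 proof (rule vi.core_estimate[OF wt_terms(1,2) M3 qm T_borel(1) qb ccb order_refl])
  fix x y assume x: "x \<in> annulus" and y: "y \<in> annulus"
  show "0 <= (2 + 0) * Re (?cc x * cnj (?cc y) / (1 - ?q x * cnj (?q y))) - 0 * (Re (?cc x) * Re (?cc y))" if T: "x \<in> Tin" "y \<in> Tin"
   unfolding ker[OF x y T] using NN_facts(2)[OF x y order_refl] pw_collar(3)[OF x] pw_collar(3)[OF y] by (intro divide_nonneg_pos) auto
  show "(2 + 0) * Re (?cc x * cnj (?cc y) / (1 - ?q x * cnj (?q y))) - 0 * (Re (?cc x) * Re (?cc y)) <= vi.A (x, y) + vi.A (y, x)"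
   if T: "x \<in> Tin" "y \<in> Tin" and ne: "x \<noteq> y"
  proof -
   have t: "e_in (x \<bullet> x) = 1" "e_in (y \<bullet> y) = 1" "x \<bullet> x <= 7/16" "y \<bullet> y <= 7/16" using T by (auto simp: Tin_def e_in_values)
   show ?thesis unfolding ker[OF x y T] vi.A_sum_core[OF x t(1) y t(2) ne] Xp using t by (simp add: algebra_simps)
  qed
  show "0 <= vi.A (x, y) + vi.A (y, x) + chC * (collar x * collar y)" if T: "\<not> (x \<in> Tin \<and> y \<in> Tin)" and ne: "x \<noteq> y"
  proof -
   \<comment> \<open>A point off the core with squared radius at most 7/8 lies in the middle shell.
     Otherwise it is near the outer circle, and the other point is either far away from it or also
     outside the support of the field.\<close>
   have *: "1 / (1024 * pwC\<^sup>2) <= NN 0 x y \<or> vi.X x = vi.X y" if x: "x \<in> annulus" and y: "y \<in> annulus" and T: "x \<notin> Tin" for x y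
   proof (cases "x \<bullet> x <= 7/8")
    case True
    then show ?thesis using NN_shell[OF x y] T by (simp add: Tin_def)
   next
    case False
    then show ?thesis using NN_far[OF y x] NN_sym[of 0 x y] by (cases "y \<bullet> y <= 7/16") (auto simp: vi.X_def e_in_values)
   qed
   have "1 / (1024 * pwC\<^sup>2) <= NN 0 x y \<or> vi.X x = vi.X y"
    using T *[OF x y] *[OF y x] NN_sym[of 0 x y] by auto
   from vi.A_sum_off_core[OF x y ne Xp0[OF x] Xp0[OF y] chC(3) this]
   show ?thesis unfolding chC(2) .
  qed
 qed (assumption | rule chC(1))+
 interpret sw: le_system x0 \<beta> c d a b Q P GQ GP v u Cv Cu Cq Cp by (rule swapped)
 let ?eu = "LINT x|annM. \<rho> x * exp (u x) * e_in (x \<bullet> x)" and ?ev = "LINT x|annM. \<rho> x * exp (v x) * e_in (x \<bullet> x)" and ?R = "LINT x|annM. \<rho> x"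
 have I: "sw.I1 = I1" unfolding sw.I1_def I1_def sw.log_bound_def log_bound_def by (simp add: add.commute)
 have vir: "delta_mass * ((LINT x|annM. G x * (vi.X x \<bullet> sol_grad u F x)) + (LINT x|annM. F x * (vi.X x \<bullet> sol_grad v G x)))
  <= delta_mass * ((- (7/5 * (\<beta> + 1) * c) * ?eu + 7/5 * (\<beta> + 1) * c * ?R + 3072 * gI) + (- (7/5 * (\<beta> + 1) * a) * ?ev + 7/5 * (\<beta> + 1) * a * ?R + 3072 * fI))"
  unfolding gI_def fI_def using delta_mass_pos inner_upper sw.inner_upper[unfolded I] by (intro mult_left_mono add_mono) auto
 \<comment> \<open>The mass terms enter the virial bound with a negative sign; moved to the left
   they join the square of \<open>J\<close>.\<close>
 define Z where "Z = delta_mass * (7/5 * (\<beta> + 1) * c) * ?eu + delta_mass * (7/5 * (\<beta> + 1) * a) * ?ev"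
 have e0: "0 <= (LINT x|annM. \<rho> x * exp (f x) * e_in (x \<bullet> x))" for f
  by (rule integral_nonneg_AE, rule AE_I2) (auto simp: wt_def e_facts(3))
 have v0: "0 <= delta_mass * (7/5 * (\<beta> + 1) * a) * ?ev" "0 <= delta_mass * (7/5 * (\<beta> + 1) * c) * ?eu"
  using e0 delta_mass_pos \<beta> pos by (auto intro!: mult_nonneg_nonneg)
 have "K0 * (2 * ?J\<^sup>2) + Z <= inE1 + inE2 * ?J"
 proof -
  have "K0 * (2 * ?J\<^sup>2) <= delta_mass * ((- (7/5 * (\<beta> + 1) * c) * ?eu + 7/5 * (\<beta> + 1) * c * ?R + 3072 * gI) + (- (7/5 * (\<beta> + 1) * a) * ?ev + 7/5 * (\<beta> + 1) * a * ?R + 3072 * fI))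
   + (chC * ((2 * gI) * (2 * fI)) + kapC * ((16 * fI) * (4 * ?J + 2 * 120 * gI) + (16 * gI) * (K1 * (4 * ?J) + 2 * 120 * fI)))"
   using core vir wt_terms(3) unfolding vi.vrhs_def by linarith
  also have "... = inE1 + inE2 * ?J - Z" unfolding inE1_def inE2_def Z_def by (simp only: distrib_left distrib_right mult_minus_left mult_minus_right mult_ac)
  finally show ?thesis by simp
 qed
 from quadratic_bound(2)[OF const_pos(1) E_nonneg(1,2) _ this]
 have "Z <= inE1 + inE2 * (1 + (inE1 + inE2) / (2 * K0))" using v0 by (simp add: Z_def)
 then show ?thesis using v0(1) unfolding Z_def by linarith
qed

end

context le_system
begin

text \<open>On the core the symmetrised kernel is twice the Poisson kernel at
  \<open>zc x * cnj (zc y)\<close>. With the factor \<open>cc\<close> equal to 1, \<open>J\<close>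
  is the mass of \<open>G\<close> itself, so the quadratic inequality bounds it directly.\<close>

lemma outer_core:
 "(LINT x|annM. indicator Tout x * G x) <= 1 + (outE1 + outE2) / (2 * K0)"
proof -
 interpret vo: le_virial P Q GP GQ u v Cu Cv Cp Cq "- 1" 0 e_out e_out' x0 \<beta> a b c d by (rule outer_virial)
 let ?J = "LINT x|annM. indicator Tout x * G x" and ?M = "\<lambda>x. indicator Tout x * 2 + 44 * collar x"
 have "indicator Tout x * (G x * 2) = 2 * (indicator Tout x * G x)" for x by simp
 then have J2: "(LINT x|annM. indicator Tout x * (G x * 2)) <= 2 * ?J"
  by (simp only: integral_mult_right_zero order_refl)
 have m44: "0 <= (44::real)" "\<forall>x\<in>annulus. 0 <= (2::real) \<and> (2::real) <= 2" by simp_all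
 note wt_terms = weighted_terms[OF T_borel(2) borel_measurable_const m44(2,1) J2]
 have c0: "0 < collar x" "collar x <= 1" if "x \<in> annulus" for x using that annulus_collar collar_le by auto
 have qb: "norm (zc x) < 1" if "x \<in> annulus" for x using that by (simp add: norm_zc annulus_def)
 have Xp: "vo.X x \<bullet> pwg x = (if 13/16 <= x \<bullet> x then 2 * (e_out (x \<bullet> x) * (x \<bullet> x)) else 0)" for x
  by (simp add: vo.X_def e_out_values pw_high)
 have Xp0: "0 <= vo.X x \<bullet> pwg x" for x unfolding Xp using e_facts(8) by simp
 have M3: "\<bar>vo.X x \<bullet> pwg x\<bar> + 3/2 * pw x <= ?M x" if x: "x \<in> annulus" for x
 proof -
  have "vo.X x \<bullet> pwg x <= indicator Tout x * 2 + 32 * collar x"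
  proof (cases "13/16 <= x \<bullet> x")
   case True
   have "e_out (x \<bullet> x) * (x \<bullet> x) <= 1 * 1" using e_facts(8,9) x by (intro mult_mono) (auto simp: annulus_iff)
   then have "vo.X x \<bullet> pwg x <= 2" unfolding Xp by simp
   then show ?thesis using True shell_collar[of x] c0[OF x] by (cases "x \<in> Tout") (auto simp: Tout_def)
  qed (unfold Xp, use c0[OF x] in \<open>simp add: indicator_def\<close>)
  then show ?thesis using Xp0[of x] pw_collar(2)[OF x] by simp
 qed
 \<comment> \<open>Twice the real part of \<open>(1 + w) / (1 - w)\<close> is
   \<open>4 * Re (1 / (1 - w)) - 2\<close>, whence \<open>kb = 2\<close> with constant factor
   1.\<close>
 have ker: "(2 + 2) * Re (1 * cnj 1 / (1 - zc x * cnj (zc y))) - 2 * (Re 1 * Re 1) = 2 * (1 - (x \<bullet> x) * (y \<bullet> y)) / NN 0 x y"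
  if "x \<in> annulus" "y \<in> annulus" "x \<in> Tout" "y \<in> Tout" for x y
 proof -
  have t: "3/4 <= x \<bullet> x" "3/4 <= y \<bullet> y" using that by (auto simp: Tout_def)
  have N: "NN 0 x y > 0" by (rule NN_facts(2)[OF that(1,2) order_refl])
  have "4 * (1 - x \<bullet> y) - 2 * NN 0 x y = 2 * (1 - (x \<bullet> x) * (y \<bullet> y))"
   unfolding NN_def pw_high(1)[OF t(1)] pw_high(1)[OF t(2)] by (simp add: inner_diff_left inner_diff_right inner_commute algebra_simps)
  moreover have "(2 + 2) * Re (1 * cnj 1 / (1 - zc x * cnj (zc y))) - 2 * (Re 1 * Re 1) = (4 * (1 - x \<bullet> y) - 2 * NN 0 x y) / NN 0 x y"
   using outer_kernel[OF t] N by (simp add: diff_divide_distrib)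
  ultimately show ?thesis by simp
 qed
 have core: "K0 * (2 * (LINT x|annM. indicator Tout x * (G x * Re 1))\<^sup>2) <= vo.vrhs chC ?M"
  unfolding K0_def
 proof (rule vo.core_estimate[OF wt_terms(1,2) M3 zc_measurable borel_measurable_const T_borel(2) qb, where B=1 and kb=2])
  fix x y assume x: "x \<in> annulus" and y: "y \<in> annulus"
  show "0 <= (2 + 2) * Re (1 * cnj 1 / (1 - zc x * cnj (zc y))) - 2 * (Re 1 * Re 1)" if T: "x \<in> Tout" "y \<in> Tout"
  proof -
   have "(x \<bullet> x) * (y \<bullet> y) <= 1 * 1" using x y by (intro mult_mono) (auto simp: annulus_iff)
   then show ?thesis unfolding ker[OF x y T] using NN_facts(2)[OF x y order_refl] by (intro divide_nonneg_pos) auto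
  qed
  show "(2 + 2) * Re (1 * cnj 1 / (1 - zc x * cnj (zc y))) - 2 * (Re 1 * Re 1) <= vo.A (x, y) + vo.A (y, x)"
   if T: "x \<in> Tout" "y \<in> Tout" and ne: "x \<noteq> y"
  proof -
   have t: "e_out (x \<bullet> x) = 1" "e_out (y \<bullet> y) = 1" "13/16 <= x \<bullet> x" "13/16 <= y \<bullet> y" "3/4 <= x \<bullet> x" "3/4 <= y \<bullet> y"
    using T by (auto simp: Tout_def e_out_values)
   show ?thesis unfolding ker[OF x y T] vo.A_sum_core[OF x t(1) y t(2) ne] Xp using t by (simp add: pw_high algebra_simps)
  qed
  show "0 <= vo.A (x, y) + vo.A (y, x) + chC * (collar x * collar y)" if T: "\<not> (x \<in> Tout \<and> y \<in> Tout)" and ne: "x \<noteq> y"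
  proof -
   have *: "1 / (1024 * pwC\<^sup>2) <= NN 0 x y \<or> vo.X x = vo.X y" if x: "x \<in> annulus" and y: "y \<in> annulus" and T: "x \<notin> Tout" for x y
   proof (cases "3/8 <= x \<bullet> x")
    case True
    then show ?thesis using NN_shell[OF x y] T by (simp add: Tout_def)
   next
    case False
    then show ?thesis using NN_far[OF x y] by (cases "13/16 <= y \<bullet> y") (auto simp: vo.X_def e_out_values)
   qed
   have "1 / (1024 * pwC\<^sup>2) <= NN 0 x y \<or> vo.X x = vo.X y"
    using T *[OF x y] *[OF y x] NN_sym[of 0 x y] by auto
   from vo.A_sum_off_core[OF x y ne Xp0 Xp0 chC(3) this]
   show ?thesis unfolding chC(2) .
  qed
 qed (assumption | rule chC(1) | simp)+
 have one: "(\<lambda>x. 1::real) \<in> borel_measurable annM" by simp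
 note iT = T_rhs_F[OF T_borel(2) one, of 1, simplified]
 interpret sw: le_system x0 \<beta> c d a b Q P GQ GP v u Cv Cu Cq Cp by (rule swapped)
 have I: "sw.Bu = Bv" "sw.gI = fI"
  unfolding sw.gI_def fI_def sw.I1_def I1_def sw.log_bound_def log_bound_def sw.Bu_def Bv_def by (simp_all add: add.commute)
 have "(LINT x|annM. F x * (vo.X x \<bullet> sol_grad v G x)) <= Bv * (K1 * ?J + 32 * fI)"
  by (rule order_trans[OF sw.outer_upper, unfolded I], intro mult_left_mono add_right_mono iT(3) const_pos)
 then have vir: "delta_mass * ((LINT x|annM. G x * (vo.X x \<bullet> sol_grad u F x)) + (LINT x|annM. F x * (vo.X x \<bullet> sol_grad v G x)))
  <= delta_mass * (Bu * (?J + 32 * gI) + Bv * (K1 * ?J + 32 * fI))"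
  using delta_mass_pos outer_upper by (intro mult_left_mono add_mono) auto
 have "K0 * (2 * ?J\<^sup>2) + 0 <= outE1 + outE2 * ?J"
 proof -
  have "K0 * (2 * ?J\<^sup>2) <= delta_mass * (Bu * (?J + 32 * gI) + Bv * (K1 * ?J + 32 * fI))
   + (chC * ((2 * gI) * (2 * fI)) + kapC * ((16 * fI) * (2 * ?J + 2 * 44 * gI) + (16 * gI) * (K1 * (2 * ?J) + 2 * 44 * fI)))"
   using core vir wt_terms(3) unfolding vo.vrhs_def by simp
  also have "... = outE1 + outE2 * ?J" unfolding outE1_def outE2_def by (simp add: algebra_simps)
  finally show ?thesis by simp
 qed
 from quadratic_bound(1)[OF const_pos(1) E_nonneg(3,4) order_refl this] show ?thesis .
qed

definition (in le_params) mass_bound :: real where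
 "mass_bound = (inE1 + inE2 * (1 + (inE1 + inE2) / (2 * K0))) / (delta_mass * (7/5 * (\<beta> + 1) * c)) + 32 * I1 / c
  + (1 + (outE1 + outE2) / (2 * K0)) / c"

text \<open>The inner core, the outer core and the region between them cover the annulus, and on the
  latter \<open>16 * collar\<close> is at least 1. Only on the outer core is the mass of
  \<open>G\<close> used in place of that of the exponential, at the cost of
  \<open>1 / c\<close>.\<close>

lemma mass_le: "(LINT x|annM. \<rho> x * exp (u x)) <= mass_bound"
proof -
 note ie = bounded_expu[OF e_in_continuous e_facts(3,4)]
 note iT = T_integrable[OF T_borel(2) G_integrable]
 have k: "delta_mass * (7/5 * (\<beta> + 1) * c) > 0" using delta_mass_pos \<beta> pos by simp
 have "(LINT x|annM. \<rho> x * exp (u x))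
   <= (LINT x|annM. \<rho> x * exp (u x) * e_in (x \<bullet> x) + 16 * (\<rho> x * exp (u x) * collar x) + 1 / c * (indicator Tout x * G x))"
 proof (rule integral_mono[OF expu_integrable])
  show "integrable annM (\<lambda>x. \<rho> x * exp (u x) * e_in (x \<bullet> x) + 16 * (\<rho> x * exp (u x) * collar x) + 1 / c * (indicator Tout x * G x))"
   by (intro Bochner_Integration.integrable_add integrable_mult_right ie collar_expu iT)
  fix x assume "x \<in> space annM"
  then have x: "x \<in> annulus" by simp
  have w: "\<rho> x * exp (u x) >= 0" using wt_pos[OF x] by simp
  have "collar x > 0" using x annulus_collar by simp
  then have "1 <= e_in (x \<bullet> x) + 16 * collar x + indicator Tout x"
   using shell_collar[of x] e_facts(3)[of "x \<bullet> x"] e_in_values(1)[of "x \<bullet> x"]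
   by (cases "x \<bullet> x <= 3/8"; cases "x \<in> Tout") (auto simp: Tout_def)
  from mult_left_mono[OF this w]
  have "\<rho> x * exp (u x) <= \<rho> x * exp (u x) * e_in (x \<bullet> x) + 16 * (\<rho> x * exp (u x) * collar x) + indicator Tout x * (\<rho> x * exp (u x))"
   by (simp add: algebra_simps)
  moreover have "\<rho> x * exp (u x) <= 1 / c * G x" using G_bounds(2)[OF x] pos by (simp add: field_simps)
  ultimately show "\<rho> x * exp (u x) <= \<rho> x * exp (u x) * e_in (x \<bullet> x) + 16 * (\<rho> x * exp (u x) * collar x) + 1 / c * (indicator Tout x * G x)"
   by (cases "x \<in> Tout") auto
 qed
 also have "... = (LINT x|annM. \<rho> x * exp (u x) * e_in (x \<bullet> x)) + 16 * (LINT x|annM. \<rho> x * exp (u x) * collar x)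
   + 1 / c * (LINT x|annM. indicator Tout x * G x)"
  using ie collar_expu iT by simp
 also have "... <= (inE1 + inE2 * (1 + (inE1 + inE2) / (2 * K0))) / (delta_mass * (7/5 * (\<beta> + 1) * c)) + 16 * (2 * I1 / c)
   + 1 / c * (1 + (outE1 + outE2) / (2 * K0))"
  using inner_core k interior(1) outer_core pos by (intro add_mono mult_left_mono) (auto simp: pos_le_divide_eq mult.commute)
 finally show ?thesis by (simp add: mass_bound_def)
qed

end

section \<open>From distributional solutions to the regularised system\<close>

lemma grad_Linf_le_facts:
 assumes "grad_Linf_le annulus f B"
 shows "\<exists>H. integrable annM H \<and> (AE y in annM. norm (H y) <= B) \<and>
  (\<forall>\<phi> i. test_function annulus \<phi> \<longrightarrow> i \<in> Basis \<longrightarrow> (LINT x|annM. f x * partial_deriv i \<phi> x) = - (LINT x|annM. (H x \<bullet> i) * \<phi> x))"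
proof -
 obtain H where H: "has_weak_gradient annulus f H" and es: "esssup annM (\<lambda>x. ereal (norm (H x))) <= ereal B"
  using assms unfolding grad_Linf_le_def by blast
 have b: "AE y in annM. norm (H y) <= B"
  using esssup_AE[of "\<lambda>x. ereal (norm (H x))" annM]
 proof eventually_elim
  case (elim y)
  from order_trans[OF elim es] show ?case by simp
 qed
 \<comment> \<open>A compact exhaustion turns local integrability of the weak gradient into
   measurability on the whole annulus; the essential bound and finite measure then give
   integrability.\<close>
 define K where "K n = {x::real^2. inverse (real (Suc n)) <= collar x}" for n
 have "closed (K n)" for n unfolding K_def by (intro closed_Collect_le continuous_intros)
 moreover have sub: "K n \<subseteq> annulus" for n
 proof
  fix x assume "x \<in> K n"
  then have "inverse (real (Suc n)) <= collar x" by (simp add: K_def)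
  then show "x \<in> annulus" unfolding annulus_collar by (rule less_le_trans[rotated]) simp
 qed
 moreover have "bounded (K n)" for n
  by (rule bounded_subset[OF _ sub], rule bounded_subset[OF bounded_ball[of 0 1]]) (auto simp: annulus_def)
 ultimately have cK: "compact (K n)" for n by (simp add: compact_eq_bounded_closed)
 have "loc_integrable annulus H" using H by (simp only: has_weak_gradient_def)
 then have "H absolutely_integrable_on K n" for n
  unfolding loc_integrable_def by - (erule allE[of _ "K n"], erule impE, intro conjI cK sub, assumption)
 then have "(\<lambda>x. indicator (K n) x *\<^sub>R H x) \<in> borel_measurable lebesgue" for n
  unfolding set_integrable_def by (rule borel_measurable_integrable)
 then have m: "(\<lambda>x. indicator (K n) x *\<^sub>R H x) \<in> borel_measurable annM" for n
  by (rule measurable_restrict_space1)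
 have "H \<in> borel_measurable annM"
 proof (rule borel_measurable_LIMSEQ_metric[OF m])
  fix x assume "x \<in> space annM"
  then have "collar x > 0" using annulus_collar by simp
  then have "\<forall>\<^sub>F n in sequentially. inverse (real (Suc n)) < collar x" by (rule order_tendstoD(2)[OF LIMSEQ_inverse_real_of_nat])
  then have "\<forall>\<^sub>F n in sequentially. indicator (K n) x *\<^sub>R H x = H x"
   by eventually_elim (simp add: K_def)
  then show "(\<lambda>n. indicator (K n) x *\<^sub>R H x) \<longlonglongrightarrow> H x" by (rule tendsto_eventually)
 qed
 then have "integrable annM H" by (rule finite_measure.integrable_const_bound[OF finite_annM b])
 moreover have "\<forall>\<phi> i. test_function annulus \<phi> \<longrightarrow> i \<in> Basis \<longrightarrow> (LINT x|annM. f x * partial_deriv i \<phi> x) = - (LINT x|annM. (H x \<bullet> i) * \<phi> x)"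
  using H by (simp add: has_weak_gradient_def set_integral_annM)
 ultimately show ?thesis using b by (intro exI[of _ H] conjI)
qed

lemma AE_integral_cong:
 fixes f g :: "real^2 => real" and h :: "real^2 => 'a::euclidean_space"
 assumes "f \<in> borel_measurable annM" "g \<in> borel_measurable annM" "AE y in annM. f y = g y" "h \<in> borel_measurable annM"
 shows "(LINT y|annM. f y *\<^sub>R h y) = (LINT y|annM. g y *\<^sub>R h y)"
proof (rule integral_cong_AE)
 show "(\<lambda>y. f y *\<^sub>R h y) \<in> borel_measurable annM" "(\<lambda>y. g y *\<^sub>R h y) \<in> borel_measurable annM"
  using assms by measurable
 show "AE y in annM. f y *\<^sub>R h y = g y *\<^sub>R h y" using assms(3) by eventually_elim simp
qed

lemma sol_cong:
 assumes m: "u \<in> borel_measurable annM" "U \<in> borel_measurable annM" "F \<in> borel_measurable annM" "F' \<in> borel_measurable annM"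
  and ae: "AE y in annM. u y = U y" "AE y in annM. F y = F' y" and x: "x \<in> annulus"
 shows "sol_fun u F x = sol_fun U F' x" "sol_grad u F x = sol_grad U F' x"
proof -
 note k = kkg_facts(4,5)[OF x]
 show "sol_fun u F x = sol_fun U F' x"
  using AE_integral_cong[OF m(1,2) ae(1) k(1)] AE_integral_cong[OF m(3,4) ae(2) GG_measurable[of 0 x]] by (simp add: sol_fun_def)
 show "sol_grad u F x = sol_grad U F' x"
  using AE_integral_cong[OF m(1,2) ae(1) k(2)] AE_integral_cong[OF m(3,4) ae(2) GGx_measurable[of 0 x]] by (simp add: sol_grad_def)
qed

lemma C1_limit_cong:
 assumes "C1_limit \<Phi> D C" "\<And>x. x \<in> annulus ==> \<Phi> x = \<Psi> x" "\<And>x. x \<in> annulus ==> D x = E x"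
 shows "C1_limit \<Psi> E C"
 using assms unfolding C1_limit_def by force

context le_params
begin

lemma rhs_integrable:
 assumes P: "P \<in> borel_measurable annM" "\<And>y. y \<in> annulus ==> 0 <= P y" "\<And>y. y \<in> annulus ==> P y <= k"
  and i: "integrable annM (\<lambda>x. wt x0 \<beta> x * exp (v x))"
 shows "integrable annM (rhs x0 \<beta> P v)"
proof -
 have "\<bar>P y\<bar> <= k" if "y \<in> annulus" for y using P(2,3)[OF that] by simp
 from integrable_annM_bounded_mult[OF i P(1) this] show ?thesis
  unfolding rhs_def[abs_def] by (simp add: mult_ac)
qed

lemma regular_solution:
 assumes P: "P \<in> borel_measurable annM" "\<And>y. y \<in> annulus ==> 0 <= P y" "\<And>y. y \<in> annulus ==> P y <= k"
  and i: "integrable annM (\<lambda>x. wt x0 \<beta> x * exp (v x))"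
  and u: "u \<in> W11_0 annulus" and eq: "neg_laplacian_distr annulus u (rhs x0 \<beta> P v)"
  and v: "\<And>k. k > 0 ==> integrable annM (\<lambda>x. exp (k * v x))"
 defines "F \<equiv> rhs x0 \<beta> P v"
 shows "AE x in annM. u x = sol_fun u F x" "\<exists>C. C1_limit (sol_fun u F) (sol_grad u F) C"
  "\<exists>C. \<forall>x\<in>annulus. integrable annM (\<lambda>y. F y * norm (y - x) powr (- 1)) \<and> (LINT y|annM. F y * norm (y - x) powr (- 1)) <= C"
proof -
 have F: "integrable annM F" unfolding F_def by (rule rhs_integrable[OF P i])
 have F0: "0 <= F y" "F y <= k * (norm (y - x0) powr (2 * \<beta>) * exp (v y))" if y: "y \<in> annulus" for y
 proof -
  have e: "F y = P y * (wt x0 \<beta> y * exp (v y))" by (simp add: F_def rhs_def)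
  show "0 <= F y" "F y <= k * (norm (y - x0) powr (2 * \<beta>) * exp (v y))"
   unfolding e wt_def using P(2,3)[OF y] by (auto intro!: mult_nonneg_nonneg mult_right_mono)
 qed
 have k: "k >= 0" using P(2,3)[OF annulus_nonempty] by linarith
 show "AE x in annM. u x = sol_fun u F x"
  using representation[OF u eq[folded F_def] F]
  by eventually_elim (use delta_mass_pos in \<open>simp add: sol_fun_def field_simps\<close>)
 show pot: "\<exists>C. \<forall>x\<in>annulus. integrable annM (\<lambda>y. F y * norm (y - x) powr (- 1)) \<and> (LINT y|annM. F y * norm (y - x) powr (- 1)) <= C"
  by (rule weight_potential_bound[OF x0 \<beta> v borel_measurable_integrable[OF F] F0 k])
 then obtain C where "\<And>x. x \<in> annulus ==> integrable annM (\<lambda>y. F y * norm (y - x) powr (- 1))"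
  "\<And>x. x \<in> annulus ==> (LINT y|annM. F y * norm (y - x) powr (- 1)) <= C" by blast
 from sol_fun_C1_limit[OF W11_0_approx(1)[OF u] F F0(1) this]
 show "\<exists>C. C1_limit (sol_fun u F) (sol_grad u F) C" .
qed

lemma regular_weak_sol:
 assumes u: "u \<in> borel_measurable annM" "AE x in annM. u x = U x" and eq: "neg_laplacian_distr annulus u F"
  and F: "F \<in> borel_measurable annM" "AE x in annM. F x = F' x" "integrable annM F'" and U: "C1_limit U D C"
 shows "weak_sol D F'"
proof (rule zero_trace_weak_sol[OF C1_limit_zero_trace[OF U] F(3)])
 fix \<phi> :: "real^2 => real" assume \<phi>: "test_function annulus \<phi>"
 have "laplacian \<phi> = (\<lambda>x. \<Sum>i\<in>Basis. partial_deriv i (partial_deriv i \<phi>) x)" by (simp add: laplacian_def fun_eq_iff)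
 moreover have "continuous_on annulus (partial_deriv i (partial_deriv i \<phi>))" if "i \<in> Basis" for i
  by (rule test_function_continuous(1)[OF test_function_partial[OF test_function_partial[OF \<phi> that] that]])
 ultimately have "continuous_on annulus (laplacian \<phi>)" by (simp add: continuous_on_sum)
 then have lm: "laplacian \<phi> \<in> borel_measurable annM" by (rule continuous_on_annM_measurable)
 have pm: "\<phi> \<in> borel_measurable annM" by (rule continuous_on_annM_measurable[OF test_function_continuous(1)[OF \<phi>]])
 have "- (LINT x|annM. u x * laplacian \<phi> x) = (LINT x|annM. F x * \<phi> x)"
  using eq \<phi> unfolding neg_laplacian_distr_def set_integral_annM by blast
 then show "- (LINT x|annM. U x * laplacian \<phi> x) = (LINT x|annM. F' x * \<phi> x)"
  using AE_integral_cong[OF u(1) C1_limit_facts(5)[OF U] u(2) lm] AE_integral_cong[OF F(1) borel_measurable_integrable[OF F(3)] F(2) pm] by simp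
qed

text \<open>The solution is replaced by its regular representatives \<open>U\<close> and
  \<open>V\<close>. Their right-hand sides then contain \<open>V\<close> and \<open>U\<close>
  instead of \<open>v\<close> and \<open>u\<close>; as \<open>sol_grad\<close> and all integrals
  ignore null sets, each assumption of \<open>le_system\<close> carries over.\<close>

lemma system_mass_bound:
 assumes PL: "L-lipschitz_on annulus P" and QL: "L'-lipschitz_on annulus Q"
  and P: "\<And>x. x \<in> annulus ==> a <= P x" "\<And>x. x \<in> annulus ==> P x <= b" "grad_Linf_le annulus P ((\<beta> + 1) * a / 2)"
  and Q: "\<And>x. x \<in> annulus ==> c <= Q x" "\<And>x. x \<in> annulus ==> Q x <= d" "grad_Linf_le annulus Q ((\<beta> + 1) * c / 2)"
  and u: "u \<in> W11_0 annulus" and v: "v \<in> W11_0 annulus"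
  and eu: "integrable annM (\<lambda>x. wt x0 \<beta> x * exp (u x))" and ev: "integrable annM (\<lambda>x. wt x0 \<beta> x * exp (v x))"
  and equ: "neg_laplacian_distr annulus u (rhs x0 \<beta> P v)" and eqv: "neg_laplacian_distr annulus v (rhs x0 \<beta> Q u)"
 shows "(LINT x|annM. wt x0 \<beta> x * exp (u x)) <= mass_bound"
  "(LINT x|annM. wt x0 \<beta> x * exp (v x)) <= le_params.mass_bound x0 \<beta> c d a b"
proof -
 have Pm: "P \<in> borel_measurable annM" "Q \<in> borel_measurable annM"
  using lipschitz_on_continuous_on[OF PL] lipschitz_on_continuous_on[OF QL] by (auto intro: continuous_on_annM_measurable)
 have P0: "0 <= P x" "0 <= Q x" if "x \<in> annulus" for x using P(1)[OF that] Q(1)[OF that] pos by auto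
 let ?F = "rhs x0 \<beta> P v" and ?G = "rhs x0 \<beta> Q u"
 have iF: "integrable annM ?F" and iG: "integrable annM ?G"
  by (rule rhs_integrable[OF Pm(1) P0(1) P(2) ev], assumption+, rule rhs_integrable[OF Pm(2) P0(2) Q(2) eu])
 have F0: "0 <= ?F x" "0 <= ?G x" if "x \<in> annulus" for x using P0[OF that] by (auto simp: rhs_def wt_def)
 note ex = exp_solution_integrable[OF u equ iF F0(1)] exp_solution_integrable[OF v eqv iG F0(2)]
 note ru = regular_solution[OF Pm(1) P0(1) P(2) ev u equ ex(2)] and rv = regular_solution[OF Pm(2) P0(2) Q(2) eu v eqv ex(1)]
 define U V where "U = sol_fun u ?F" and "V = sol_fun v ?G"
 obtain Cu Cv where C: "C1_limit U (sol_grad u ?F) Cu" "C1_limit V (sol_grad v ?G) Cv"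
  using ru(2) rv(2) unfolding U_def V_def by blast
 have aeu: "AE x in annM. u x = U x" and aev: "AE x in annM. v x = V x" using ru(1) rv(1) unfolding U_def V_def by auto
 have um: "u \<in> borel_measurable annM" "v \<in> borel_measurable annM" using W11_0_approx(1)[OF u] W11_0_approx(1)[OF v] by auto
 note UVm = C1_limit_facts(5)[OF C(1)] C1_limit_facts(5)[OF C(2)]
 have aF: "AE x in annM. ?F x = rhs x0 \<beta> P V x" using aev by eventually_elim (simp add: rhs_def)
 have aG: "AE x in annM. ?G x = rhs x0 \<beta> Q U x" using aeu by eventually_elim (simp add: rhs_def)
 have bd: "integrable annM (\<lambda>x. wt x0 \<beta> x * exp (w x))" if "C1_limit w D k" for w D k
  by (rule integrable_annM_bounded_mult[OF wt_integrable, of _ "exp k"])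
   (use C1_limit_facts(3,5)[OF that] in \<open>auto simp: abs_le_iff\<close>)
 have iF': "integrable annM (rhs x0 \<beta> P V)" and iG': "integrable annM (rhs x0 \<beta> Q U)"
  by (rule rhs_integrable[OF Pm(1) P0(1) P(2) bd[OF C(2)]], assumption+, rule rhs_integrable[OF Pm(2) P0(2) Q(2) bd[OF C(1)]])
 note mF = borel_measurable_integrable[OF iF] borel_measurable_integrable[OF iF'] and mG = borel_measurable_integrable[OF iG] borel_measurable_integrable[OF iG']
 have CU: "C1_limit U (sol_grad U (rhs x0 \<beta> P V)) Cu"
  by (rule C1_limit_cong[OF C(1) refl sol_cong(2)[OF um(1) UVm(1) mF aeu aF]])
 have CV: "C1_limit V (sol_grad V (rhs x0 \<beta> Q U)) Cv"
  by (rule C1_limit_cong[OF C(2) refl sol_cong(2)[OF um(2) UVm(2) mG aev aG]])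
 \<comment> \<open>The essential bounds on the gradients are used through weak gradients only, so
   the Lipschitz property serves merely to make the coefficients continuous.\<close>
 obtain HP HQ where HP: "integrable annM HP" "AE y in annM. norm (HP y) <= (\<beta> + 1) * a / 2"
   "\<And>\<phi> i. test_function annulus \<phi> ==> i \<in> Basis ==> (LINT x|annM. P x * partial_deriv i \<phi> x) = - (LINT x|annM. (HP x \<bullet> i) * \<phi> x)"
  and HQ: "integrable annM HQ" "AE y in annM. norm (HQ y) <= (\<beta> + 1) * c / 2"
   "\<And>\<phi> i. test_function annulus \<phi> ==> i \<in> Basis ==> (LINT x|annM. Q x * partial_deriv i \<phi> x) = - (LINT x|annM. (HQ x \<bullet> i) * \<phi> x)"
  using grad_Linf_le_facts[OF P(3)] grad_Linf_le_facts[OF Q(3)] by blast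
 obtain Cp Cq where Cp: "\<And>x. x \<in> annulus ==> integrable annM (\<lambda>y. ?F y * norm (y - x) powr (- 1)) \<and> (LINT y|annM. ?F y * norm (y - x) powr (- 1)) <= Cp"
  and Cq: "\<And>x. x \<in> annulus ==> integrable annM (\<lambda>y. ?G y * norm (y - x) powr (- 1)) \<and> (LINT y|annM. ?G y * norm (y - x) powr (- 1)) <= Cq"
  using ru(3) rv(3) by blast
 have nm: "(\<lambda>y. norm (y - x) powr (- 1)) \<in> borel_measurable annM" for x :: "real^2"
  by (intro powr_real_measurable borel_measurable_const continuous_on_annM_measurable continuous_intros)
 have pot: "integrable annM (\<lambda>y. H' y * norm (y - x) powr (- 1)) \<and> (LINT y|annM. H' y * norm (y - x) powr (- 1)) <= k"
  if H: "H \<in> borel_measurable annM" "H' \<in> borel_measurable annM" "AE y in annM. H y = H' y"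
   and k: "integrable annM (\<lambda>y. H y * norm (y - x) powr (- 1)) \<and> (LINT y|annM. H y * norm (y - x) powr (- 1)) <= k" for H H' k x
 proof
  have "AE y in annM. H y * norm (y - x) powr (- 1) = H' y * norm (y - x) powr (- 1)" using H(3) by eventually_elim simp
  then show "integrable annM (\<lambda>y. H' y * norm (y - x) powr (- 1))"
   by (rule iffD1[OF integrable_cong_AE[OF borel_measurable_times[OF H(1) nm] borel_measurable_times[OF H(2) nm]] conjunct1[OF k]])
  show "(LINT y|annM. H' y * norm (y - x) powr (- 1)) <= k"
   using conjunct2[OF k] AE_integral_cong[OF H nm[of x]] unfolding real_scaleR_def by simp
 qed
 note pF = pot[OF mF aF Cp] and pG = pot[OF mG aG Cq]
 interpret S: le_system x0 \<beta> a b c d P Q HP HQ U V Cu Cv Cp Cq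
  by unfold_locales (rule Pm P Q HP HQ CU CV regular_weak_sol[OF um(1) aeu equ mF(1) aF iF' CU] regular_weak_sol[OF um(2) aev eqv mG(1) aG iG' CV]
   pF[THEN conjunct1] pF[THEN conjunct2] pG[THEN conjunct1] pG[THEN conjunct2] | assumption)+
 have em: "(\<lambda>x. exp (w x)) \<in> borel_measurable annM" if "w \<in> borel_measurable annM" for w :: "real^2 => real" using that by measurable
 have eq: "(LINT x|annM. wt x0 \<beta> x * exp (w x)) = (LINT x|annM. wt x0 \<beta> x * exp (w' x))"
  if "w \<in> borel_measurable annM" "w' \<in> borel_measurable annM" "AE x in annM. w x = w' x" for w w'
 proof (rule integral_cong_AE)
  show "(\<lambda>x. wt x0 \<beta> x * exp (w x)) \<in> borel_measurable annM" "(\<lambda>x. wt x0 \<beta> x * exp (w' x)) \<in> borel_measurable annM"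
   using that wt_measurable by measurable
  show "AE x in annM. wt x0 \<beta> x * exp (w x) = wt x0 \<beta> x * exp (w' x)" using that(3) by eventually_elim simp
 qed
 show "(LINT x|annM. wt x0 \<beta> x * exp (u x)) <= mass_bound"
  unfolding eq[OF um(1) UVm(1) aeu] by (rule S.mass_le)
 show "(LINT x|annM. wt x0 \<beta> x * exp (v x)) <= le_params.mass_bound x0 \<beta> c d a b"
  unfolding eq[OF um(2) UVm(2) aev] by (rule le_system.mass_le[OF S.swapped])
qed

end

theorem theorem1p2:
  fixes x0 :: "real^2" and \<beta> a b c d :: real
  assumes "norm x0 = 1/2" and "\<beta> > -1/2"
    and "a > 0" and "b > 0" and "c > 0" and "d > 0"
  shows "\<exists>C C'. \<forall>(V :: real^2 \<Rightarrow> real) (W :: real^2 \<Rightarrow> real) (u :: real^2 \<Rightarrow> real) (v :: real^2 \<Rightarrow> real).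
      (\<exists>L. L-lipschitz_on annulus V) \<and> (\<exists>L. L-lipschitz_on annulus W) \<and>
      (\<forall>x\<in>annulus. a \<le> V x \<and> V x \<le> b) \<and> grad_Linf_le annulus V ((\<beta> + 1) * a / 2) \<and>
      (\<forall>x\<in>annulus. c \<le> W x \<and> W x \<le> d) \<and> grad_Linf_le annulus W ((\<beta> + 1) * c / 2) \<and>
      u \<in> W11_0 annulus \<and> v \<in> W11_0 annulus \<and>
      (\<lambda>x. norm (x - x0) powr (2 * \<beta>) * exp (u x)) absolutely_integrable_on annulus \<and>
      (\<lambda>x. norm (x - x0) powr (2 * \<beta>) * exp (v x)) absolutely_integrable_on annulus \<and>
      neg_laplacian_distr annulus u (\<lambda>x. norm (x - x0) powr (2 * \<beta>) * V x * exp (v x)) \<and>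
      neg_laplacian_distr annulus v (\<lambda>x. norm (x - x0) powr (2 * \<beta>) * W x * exp (u x))
      \<longrightarrow> (LINT x:annulus|lebesgue. norm (x - x0) powr (2 * \<beta>) * exp (u x)) \<le> C \<and>
          (LINT x:annulus|lebesgue. norm (x - x0) powr (2 * \<beta>) * exp (v x)) \<le> C'"
proof -
 interpret le_params x0 \<beta> a b c d by unfold_locales (use assms in auto)
 note * = system_mass_bound[unfolded wt_def[abs_def] rhs_def[abs_def]]
 show ?thesis
  unfolding set_integral_annM absolutely_integrable_annM
 \<comment> \<open>The second constant is the first one for the system with its two equations
   interchanged.\<close>
 proof (rule exI[of _ mass_bound], rule exI[of _ "le_params.mass_bound x0 \<beta> c d a b"], intro allI impI, elim conjE exE, goal_cases)
  case (1 V W u v L L')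
  have "a <= V x" "V x <= b" "c <= W x" "W x <= d" if "x \<in> annulus" for x using 1 that by auto
  note b = this
  show ?case by (rule conjI; rule *[where P=V and Q=W and u=u and v=v and L=L and L'=L']) (rule 1 b | assumption)+
 qed
qed

end
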